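(* Let $n\ge 4$ be even, let $Q$ be the quiver of type $\tilde D_n$ with vertices $0,\dots,n$ and arrows $n\to n-2$, $n-1\to n-2$, $k+1\to k$ for $2\le k\le n-3$, $2\to 1$ and $2\to 0$, and let $i\in\{0,1,n-1,n\}$ be an extending vertex of $Q$. Then the frieze sequence $(X^i_j)_{j\in\mathbb Z}$ satisfies the linear recurrence relation $$X_\delta X^i_j = X^i_{j-n+2}+X^i_{j+n-2}\qquad\text{for all } j\ge n-2 .$$
   Context: Let $\mathcal F=\mathbb Q(x_0,\dots,x_n)$. The frieze sequences $(X^i_j)_{j\in\mathbb Z}$ in $\mathcal F$, $i$ a vertex of $Q$, are determined by $X^i_0=x_i$ and $X^i_{j+1}X^i_j=1+\prod_{s\to i}X^s_{j+1}\prod_{i\to d}X^d_j$ for all $j\in\mathbb Z$ (products over arrows of $Q$ into, respectively out of, $i$). Let $k$ be an algebraically closed field of characteristic $0$ and consider finite-dimensional right $kQ$-modules. For a vertex $i$ let $P_i$ be the indecomposable projective with top the simple $S_i$; with the right module convention, an arrow $i\to l$ gives an irreducible map $P_i\to P_l$ and $\dim\operatorname{Ext}^1(S_l,S_i)$ is the number of arrows $i\to l$. Dimension vectors are $\underline{\dim}\,M=(\dim\operatorname{Hom}(P_i,M))_i$; $\alpha_i=\underline{\dim}\,S_i$. The Euler form is the bilinear form with $\langle\underline{\dim}\,L,\underline{\dim}\,M\rangle=\dim\operatorname{Hom}(L,M)-\dim\operatorname{Ext}^1(L,M)$. The vector $\delta\in\mathbb Z^{n+1}$ is the unique vector with strictly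 positive entries generating the radical of the symmetrized Euler form; here $\delta_0=\delta_1=\delta_{n-1}=\delta_n=1$ and the other entries are $2$. A vertex $i$ is extending if $\delta_i=1$. The Caldero–Chapoton map on modules is $X_M=\sum_e\chi(\mathrm{Gr}_e(M))\prod_i x_i^{-\langle e,\alpha_i\rangle-\langle\alpha_i,\underline{\dim}\,M-e\rangle}\in\mathcal F$, where $\mathrm{Gr}_e(M)$ is the projective variety of submodules of $M$ of dimension vector $e$ and $\chi$ is the Euler characteristic. A regular simple module is a simple object in the abelian category of regular $kQ$-modules (modules all of whose indecomposable summands are neither preprojective nor preinjective). $X_\delta:=X_M$ for any regular simple module $M$ with $\underline{\dim}\,M=\delta$; this is known not to depend on $M$. *)

theory Defs
  imports
    "HOL-Homology.Homology"
    "HOL-Computational_Algebra.Computational_Algebra"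
    "HOL-Library.Poly_Mapping"
    "Jordan_Normal_Form.Matrix"
begin

section \<open>Quivers\<close>

text \<open>Quivers without multiple arrows; \<open>(i, l) \<in> arrows Q\<close> is an arrow \<open>i \<rightarrow> l\<close>.\<close>

record quiver =
  verts :: "nat set"
  arrows :: "(nat \<times> nat) set"

definition Dtilde :: "nat \<Rightarrow> quiver" where
  "Dtilde n = \<lparr> verts = {0..n},
     arrows = {(n, n - 2), (n - 1, n - 2)} \<union> {(k + 1, k) | k. 2 \<le> k \<and> k \<le> n - 3}
       \<union> {(2, 1), (2, 0)} \<rparr>"

text \<open>
  The bilinear form on \<open>\<int>\<^bsup>verts Q\<^esup>\<close> whose value on the basis of simples is
  \<open>\<langle>\<alpha>\<^sub>l, \<alpha>\<^sub>i\<rangle> = dim Hom(S\<^sub>l, S\<^sub>i) - dim Ext\<^sup>1(S\<^sub>l, S\<^sub>i)\<close>. For right modules the last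
  term is the number of arrows from \<open>i\<close> to \<open>l\<close>, in this order.
\<close>

definition euler_form :: "quiver \<Rightarrow> (nat \<Rightarrow> int) \<Rightarrow> (nat \<Rightarrow> int) \<Rightarrow> int" where
  "euler_form Q x y = (\<Sum>l\<in>verts Q. \<Sum>i\<in>verts Q. x l * y i *
     ((if l = i then 1 else 0) - (if (i, l) \<in> arrows Q then 1 else 0)))"

definition simple_root :: "nat \<Rightarrow> nat \<Rightarrow> int" where
  "simple_root i = (\<lambda>v. if v = i then 1 else 0)"

definition sym_radical :: "quiver \<Rightarrow> (nat \<Rightarrow> int) set" where
  "sym_radical Q = {d. (\<forall>v. v \<notin> verts Q \<longrightarrow> d v = 0) \<and>
     (\<forall>y. euler_form Q d y + euler_form Q y d = 0)}"

text \<open>The positive generator of the radical of the symmetrized Euler form of \<open>Dtilde n\<close>;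
  see \<open>delta_pos\<close> and \<open>sym_radical_Dtilde\<close> below.\<close>

definition delta :: "nat \<Rightarrow> nat \<Rightarrow> nat" where
  "delta n v = (if v \<in> {0, 1, n - 1, n} then 1 else if v \<le> n then 2 else 0)"

lemma delta_pos: "v \<le> n \<Longrightarrow> 0 < delta n v"
  by (simp add: delta_def)

lemma sym_radical_Dtilde:
  assumes n: "n \<ge> 4"
  shows "sym_radical (Dtilde n) = {\<lambda>v. c * int (delta n v) | c. True}"
proof -
  let ?Q = "Dtilde n" and ?V = "{0..n}"
  define A where "A = arrows ?Q"
  define w where "w l i = (if l = i then 1 else 0) - (if (i, l) \<in> A then 1 else (0::int))" for l i
  define g where "g d i = (\<Sum>l\<in>?V. d l * (w l i + w i l))" for d :: "nat \<Rightarrow> int" and i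
  have V: "verts ?Q = ?V" by (simp add: Dtilde_def)
  have form: "euler_form ?Q d y + euler_form ?Q y d = (\<Sum>i\<in>?V. y i * g d i)" for d y
  proof -
    have "euler_form ?Q d y = (\<Sum>i\<in>?V. \<Sum>l\<in>?V. d l * y i * w l i)"
      unfolding euler_form_def V w_def A_def by (rule sum.swap)
    moreover have "euler_form ?Q y d = (\<Sum>i\<in>?V. \<Sum>l\<in>?V. y i * d l * w i l)"
      unfolding euler_form_def V w_def A_def by simp
    ultimately show ?thesis
      by (simp add: g_def sum_distrib_left sum.distrib[symmetric] algebra_simps)
  qed
  have rad: "(\<forall>y. euler_form ?Q d y + euler_form ?Q y d = 0) \<longleftrightarrow> (\<forall>i\<le>n. g d i = 0)" for d
  proof
    assume a: "\<forall>y. euler_form ?Q d y + euler_form ?Q y d = 0"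
    show "\<forall>i\<le>n. g d i = 0"
    proof (intro allI impI)
      fix i assume i: "i \<le> n"
      have "0 = (\<Sum>k\<in>?V. simple_root i k * g d k)" using a form by metis
      also have "\<dots> = (\<Sum>k\<in>?V. if k = i then g d k else 0)"
        by (rule sum.cong) (auto simp: simple_root_def)
      also have "\<dots> = g d i" using i by simp
      finally show "g d i = 0" by simp
    qed
  qed (simp add: form)
  have g: "g d i = 2 * d i - sum d {l. (i, l) \<in> A} - sum d {l. (l, i) \<in> A}" if "i \<le> n" for d i
  proof -
    have AV: "(a, b) \<in> A \<Longrightarrow> a \<le> n \<and> b \<le> n" for a b
      using n by (auto simp: A_def Dtilde_def)
    have e: "{l. (i, l) \<in> A} = {l\<in>?V. (i, l) \<in> A}" "{l. (l, i) \<in> A} = {l\<in>?V. (l, i) \<in> A}"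
      using AV by auto
    have "g d i = (\<Sum>l\<in>?V. 2 * (if l = i then d l else 0) - (if (i, l) \<in> A then d l else 0)
                   - (if (l, i) \<in> A then d l else 0))"
      unfolding g_def w_def by (rule sum.cong) auto
    also have "\<dots> = 2 * d i - (\<Sum>l\<in>?V. if (i, l) \<in> A then d l else 0)
                   - (\<Sum>l\<in>?V. if (l, i) \<in> A then d l else 0)"
      using that by (simp add: sum_subtractf sum_distrib_left[symmetric])
    also have "\<dots> = 2 * d i - sum d {l. (i, l) \<in> A} - sum d {l. (l, i) \<in> A}"
      unfolding e sum.inter_filter[OF finite_atLeastAtMost] by (rule refl)
    finally show ?thesis .
  qed
  obtain m where m: "n = m + 4" using n le_Suc_ex by (metis add.commute)
  have mem: "(i, l) \<in> A \<longleftrightarrow> (i = m + 4 \<or> i = m + 3) \<and> l = m + 2 \<or>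
      i = l + 1 \<and> 2 \<le> l \<and> l \<le> m + 1 \<or> i = 2 \<and> (l = 0 \<or> l = 1)" for i l
    unfolding A_def Dtilde_def m by (simp add: numeral_eq_Suc) blast
  have outs: "{l. (i, l) \<in> A} = (if i \<le> 1 then {} else if i = 2 then {0, 1}
      else if i \<le> n - 2 then {i - 1} else {n - 2})" if i: "i \<le> n" for i
  proof -
    consider "i \<le> 1" | "i = 2" | "2 < i" "i \<le> m + 2" | "i = m + 3" | "i = m + 4"
      using i m by linarith
    then show ?thesis by cases (auto simp: mem m)
  qed
  have ins: "{l. (l, i) \<in> A} = (if i \<le> 1 then {2} else if i = n - 2 then {n - 1, n}
      else if i \<le> n - 3 then {i + 1} else {})" if i: "i \<le> n" for i
  proof -
    consider "i = 0" | "i = 1" | "i = m + 2" | "2 \<le> i" "i \<le> m + 1" | "i = m + 3" | "i = m + 4"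
      using i m by linarith
    then show ?thesis by cases (auto simp: mem m)
  qed
  have top: "{l. (i, l) \<in> A} = {n - 2}" "{l. (l, i) \<in> A} = {}" if "i = n - 1 \<or> i = n" for i
    using that by (auto simp: mem m)
  have s2: "sum d {0, 1} = d 0 + d 1" "sum d {n - 1, n} = d (n - 1) + d n" for d :: "nat \<Rightarrow> int"
    using n by auto
  show ?thesis
  proof (intro equalityI subsetI)
    fix d assume "d \<in> sym_radical ?Q"
    then have z: "\<And>v. v > n \<Longrightarrow> d v = 0" and g0: "\<And>i. i \<le> n \<Longrightarrow> g d i = 0"
      by (auto simp: sym_radical_def V rad)
    define c where "c = d 0"
    have d2: "d 2 = 2 * c" using g0[of 0] g[of 0 d] outs[of 0] ins[of 0] n by (simp add: c_def)
    have d1: "d 1 = c" using g0[of 1] g[of 1 d] outs[of 1] ins[of 1] n d2 by simp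
    have mid: "d k = 2 * c \<and> sum d {l. (k, l) \<in> A} = 2 * c" if "2 \<le> k" "k \<le> n - 2" for k
      using that
    proof (induction k rule: dec_induct)
      case base
      show ?case using outs[of 2] n d1 d2 s2(1)[of d] by (simp add: c_def)
    next
      case (step k)
      then have k: "k \<le> n" "\<not> k \<le> 1" "k \<noteq> n - 2" "k \<le> n - 3" by auto
      have ih: "d k = 2 * c" "sum d {l. (k, l) \<in> A} = 2 * c" using step by auto
      have "sum d {l. (l, k) \<in> A} = d (k + 1)" using ins[of k] k by simp
      then have "d (k + 1) = 2 * c" using ih g0[OF k(1)] g[OF k(1), of d] by simp
      moreover have "sum d {l. (Suc k, l) \<in> A} = d k" using outs[of "Suc k"] step by simp
      ultimately show ?case using ih by simp
    qed
    have e1: "d (n - 1) = c"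
      using g0[of "n - 1"] g[of "n - 1" d] mid[of "n - 2"] top[of "n - 1"] n by simp
    have e2: "d n = c"
      using g0[of n] g[of n d] mid[of "n - 2"] top[of n] n by simp
    have "d = (\<lambda>v. c * int (delta n v))"
    proof
      fix v
      consider "v = 0" | "v = 1" | "v = n - 1" | "v = n" | "2 \<le> v" "v \<le> n - 2" | "v > n"
        by linarith
      then show "d v = c * int (delta n v)"
      proof cases
        case 5
        then have "delta n v = 2" using n by (auto simp: delta_def)
        then show ?thesis using mid[of v] 5 by simp
      qed (use z[of v] d1 e1 e2 n in \<open>auto simp: delta_def c_def\<close>)
    qed
    then show "d \<in> {\<lambda>v. c * int (delta n v) | c. True}" by blast
  next
    fix d assume "d \<in> {\<lambda>v. c * int (delta n v) | c. True}"
    then obtain c where d: "d = (\<lambda>v. c * int (delta n v))" by blast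
    have ends: "d 0 = c" "d 1 = c" "d (n - 1) = c" "d n = c" by (simp_all add: d delta_def)
    have mid: "d v = 2 * c" if "2 \<le> v" "v \<le> n - 2" for v
    proof -
      have "delta n v = 2" using that n by (auto simp: delta_def)
      then show ?thesis by (simp add: d)
    qed
    have "g d i = 0" if i: "i \<le> n" for i
    proof -
      consider "i \<le> 1" | "2 \<le> i" "i \<le> n - 2" | "n - 2 < i" by linarith
      then show ?thesis
      proof cases
        case 1
        then have "d i = c" using ends by (cases "i = 0") (simp_all add: le_Suc_eq)
        then show ?thesis using g[OF i, of d] outs[OF i] ins[OF i] mid[of 2] n 1 by simp
      next
        case 2
        have "sum d {l. (i, l) \<in> A} = 2 * c"
        proof (cases "i = 2")
          case False
          then show ?thesis using outs[OF i] mid[of "i - 1"] 2 by simp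
        qed (use outs[OF i] s2(1)[of d] ends n in simp)
        moreover have "sum d {l. (l, i) \<in> A} = 2 * c"
        proof (cases "i = n - 2")
          case True
          then have "{l. (l, i) \<in> A} = {n - 1, n}" using ins[OF i] 2 by simp
          then show ?thesis using s2(2)[of d] ends by simp
        next
          case False
          then have "i \<le> n - 3" using 2 by linarith
          then show ?thesis using ins[OF i] mid[of "i + 1"] 2 False by simp
        qed
        ultimately show ?thesis using g[OF i, of d] mid[OF 2] by simp
      next
        case 3
        then have "i = n - 1 \<or> i = n" using i by linarith
        then have "d i = c" using ends by blast
        then show ?thesis using g[OF i, of d] mid[of "n - 2"] top[of i] n
            \<open>i = n - 1 \<or> i = n\<close> by simp
      qed
    qed
    then show "d \<in> sym_radical ?Q" using n by (auto simp: sym_radical_def V rad d delta_def)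
  qed
qed

section \<open>Frieze sequences\<close>

text \<open>
  Rational functions over \<open>\<rat>\<close> in variables \<open>x\<^sub>0, x\<^sub>1, \<dots>\<close>. For a quiver with vertices
  \<open>0, \<dots>, n\<close> everything below takes place in the subfield \<open>\<rat>(x\<^sub>0, \<dots>, x\<^sub>n)\<close>.
\<close>

type_synonym ratfun = "((nat \<Rightarrow>\<^sub>0 nat) \<Rightarrow>\<^sub>0 rat) fract"

definition var :: "nat \<Rightarrow> ratfun" where
  "var i = Fract (Poly_Mapping.single (Poly_Mapping.single i 1) 1) 1"

definition frieze_sequences :: "quiver \<Rightarrow> (nat \<Rightarrow> int \<Rightarrow> ratfun) \<Rightarrow> bool" where
  "frieze_sequences Q X \<longleftrightarrow>
     (\<forall>i\<in>verts Q. X i 0 = var i) \<and>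
     (\<forall>i\<in>verts Q. \<forall>j. X i (j + 1) * X i j =
        1 + (\<Prod>s | (s, i) \<in> arrows Q. X s (j + 1)) * (\<Prod>d | (i, d) \<in> arrows Q. X d j))"

section \<open>Right modules over the path algebra\<close>

text \<open>
  A finite-dimensional right \<open>kQ\<close>-module \<open>M\<close> is given, after a choice of bases, by the spaces
  \<open>M\<^sub>v = M e\<^sub>v = Hom(P\<^sub>v, M)\<close> of dimension \<open>dimv M v\<close> and, for each arrow \<open>a : i \<rightarrow> l\<close>, by the
  matrix \<open>act M (i, l)\<close> of right multiplication by \<open>a\<close>. As \<open>a\<close> gives a map \<open>P\<^sub>i \<rightarrow> P\<^sub>l\<close>, this
  is a map \<open>M\<^sub>l \<rightarrow> M\<^sub>i\<close>, against the direction of the arrow.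
\<close>

record 'k qmod =
  dimv :: "nat \<Rightarrow> nat"
  act :: "nat \<times> nat \<Rightarrow> 'k mat"

definition is_qmod :: "quiver \<Rightarrow> 'k qmod \<Rightarrow> bool" where
  "is_qmod Q M \<longleftrightarrow>
     (\<forall>(i, l)\<in>arrows Q. act M (i, l) \<in> carrier_mat (dimv M i) (dimv M l))"

definition qhom :: "quiver \<Rightarrow> 'k::field qmod \<Rightarrow> 'k qmod \<Rightarrow> (nat \<Rightarrow> 'k mat) set" where
  "qhom Q L M = {f. (\<forall>v\<in>verts Q. f v \<in> carrier_mat (dimv M v) (dimv L v)) \<and>
     (\<forall>(i, l)\<in>arrows Q. f i * act L (i, l) = act M (i, l) * f l)}"

definition qzero :: "quiver \<Rightarrow> 'k qmod \<Rightarrow> bool" where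
  "qzero Q M \<longleftrightarrow> (\<forall>v\<in>verts Q. dimv M v = 0)"

definition qmono :: "quiver \<Rightarrow> 'k::field qmod \<Rightarrow> (nat \<Rightarrow> 'k mat) \<Rightarrow> bool" where
  "qmono Q L f \<longleftrightarrow>
     (\<forall>v\<in>verts Q. inj_on (\<lambda>x. f v *\<^sub>v x) (carrier_vec (dimv L v)))"

definition qepi ::
    "quiver \<Rightarrow> 'k::field qmod \<Rightarrow> 'k qmod \<Rightarrow> (nat \<Rightarrow> 'k mat) \<Rightarrow> bool" where
  "qepi Q L M f \<longleftrightarrow>
     (\<forall>v\<in>verts Q. (\<lambda>x. f v *\<^sub>v x) ` carrier_vec (dimv L v) = carrier_vec (dimv M v))"

definition split_mono ::
    "quiver \<Rightarrow> 'k::field qmod \<Rightarrow> 'k qmod \<Rightarrow> (nat \<Rightarrow> 'k mat) \<Rightarrow> bool" where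
  "split_mono Q L M f \<longleftrightarrow> (\<exists>r\<in>qhom Q M L. \<forall>v\<in>verts Q. r v * f v = 1\<^sub>m (dimv L v))"

definition split_epi ::
    "quiver \<Rightarrow> 'k::field qmod \<Rightarrow> 'k qmod \<Rightarrow> (nat \<Rightarrow> 'k mat) \<Rightarrow> bool" where
  "split_epi Q L M f \<longleftrightarrow> (\<exists>s\<in>qhom Q M L. \<forall>v\<in>verts Q. f v * s v = 1\<^sub>m (dimv M v))"

text \<open>\<open>M \<cong> N \<oplus> L\<close>, expressed by the biproduct equations.\<close>

definition direct_sum :: "quiver \<Rightarrow> 'k::field qmod \<Rightarrow> 'k qmod \<Rightarrow> 'k qmod \<Rightarrow> bool" where
  "direct_sum Q M N L \<longleftrightarrow>
     (\<exists>a\<in>qhom Q N M. \<exists>b\<in>qhom Q L M. \<exists>p\<in>qhom Q M N. \<exists>q\<in>qhom Q M L. \<forall>v\<in>verts Q.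
        p v * a v = 1\<^sub>m (dimv N v) \<and> q v * b v = 1\<^sub>m (dimv L v) \<and>
        p v * b v = 0\<^sub>m (dimv N v) (dimv L v) \<and> q v * a v = 0\<^sub>m (dimv L v) (dimv N v) \<and>
        a v * p v + b v * q v = 1\<^sub>m (dimv M v))"

definition indecomposable :: "quiver \<Rightarrow> 'k::field qmod \<Rightarrow> bool" where
  "indecomposable Q M \<longleftrightarrow> is_qmod Q M \<and> \<not> qzero Q M \<and>
     (\<forall>N L. is_qmod Q N \<and> is_qmod Q L \<and> direct_sum Q M N L \<longrightarrow> qzero Q N \<or> qzero Q L)"

definition projective :: "quiver \<Rightarrow> 'k::field qmod \<Rightarrow> bool" where
  "projective Q P \<longleftrightarrow> is_qmod Q P \<and>
     (\<forall>X Y. is_qmod Q X \<and> is_qmod Q Y \<longrightarrow>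
       (\<forall>g\<in>qhom Q X Y. qepi Q X Y g \<longrightarrow>
         (\<forall>h\<in>qhom Q P Y. \<exists>h'\<in>qhom Q P X. \<forall>v\<in>verts Q. g v * h' v = h v)))"

definition injective :: "quiver \<Rightarrow> 'k::field qmod \<Rightarrow> bool" where
  "injective Q I \<longleftrightarrow> is_qmod Q I \<and>
     (\<forall>X Y. is_qmod Q X \<and> is_qmod Q Y \<longrightarrow>
       (\<forall>g\<in>qhom Q X Y. qmono Q X g \<longrightarrow>
         (\<forall>h\<in>qhom Q X I. \<exists>h'\<in>qhom Q Y I. \<forall>v\<in>verts Q. h' v * g v = h v)))"

definition short_exact :: "quiver \<Rightarrow> 'k::field qmod \<Rightarrow> (nat \<Rightarrow> 'k mat) \<Rightarrow>
    'k qmod \<Rightarrow> (nat \<Rightarrow> 'k mat) \<Rightarrow> 'k qmod \<Rightarrow> bool" where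
  "short_exact Q N f E g M \<longleftrightarrow>
     f \<in> qhom Q N E \<and> g \<in> qhom Q E M \<and> qmono Q N f \<and> qepi Q E M g \<and>
     (\<forall>v\<in>verts Q. (\<lambda>x. f v *\<^sub>v x) ` carrier_vec (dimv N v) =
        {y \<in> carrier_vec (dimv E v). g v *\<^sub>v y = 0\<^sub>v (dimv M v)})"

definition left_almost_split ::
    "quiver \<Rightarrow> 'k::field qmod \<Rightarrow> 'k qmod \<Rightarrow> (nat \<Rightarrow> 'k mat) \<Rightarrow> bool" where
  "left_almost_split Q N E f \<longleftrightarrow> \<not> split_mono Q N E f \<and>
     (\<forall>X. is_qmod Q X \<longrightarrow> (\<forall>h\<in>qhom Q N X. \<not> split_mono Q N X h \<longrightarrow>
        (\<exists>h'\<in>qhom Q E X. \<forall>v\<in>verts Q. h' v * f v = h v)))"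

definition right_almost_split ::
    "quiver \<Rightarrow> 'k::field qmod \<Rightarrow> 'k qmod \<Rightarrow> (nat \<Rightarrow> 'k mat) \<Rightarrow> bool" where
  "right_almost_split Q E M g \<longleftrightarrow> \<not> split_epi Q E M g \<and>
     (\<forall>X. is_qmod Q X \<longrightarrow> (\<forall>h\<in>qhom Q X M. \<not> split_epi Q X M h \<longrightarrow>
        (\<exists>h'\<in>qhom Q X E. \<forall>v\<in>verts Q. g v * h' v = h v)))"

text \<open>
  There is an almost split sequence \<open>0 \<rightarrow> N \<rightarrow> E \<rightarrow> M \<rightarrow> 0\<close>; by Auslander--Reiten theory, this
  means that \<open>M\<close> is indecomposable and not projective and that \<open>N \<cong> \<tau> M\<close>, equivalently that
  \<open>N\<close> is indecomposable and not injective and that \<open>M \<cong> \<tau>\<^sup>-\<^sup>1 N\<close>.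
\<close>

definition AR_translate :: "quiver \<Rightarrow> 'k::field qmod \<Rightarrow> 'k qmod \<Rightarrow> bool" where
  "AR_translate Q M N \<longleftrightarrow> is_qmod Q M \<and> is_qmod Q N \<and>
     (\<exists>E f g. is_qmod Q E \<and> short_exact Q N f E g M \<and>
        left_almost_split Q N E f \<and> right_almost_split Q E M g)"

text \<open>The indecomposable preprojective modules \<open>\<tau>\<^sup>-\<^sup>m P\<close> and preinjective modules \<open>\<tau>\<^sup>m I\<close>.\<close>

inductive preprojective :: "quiver \<Rightarrow> 'k::field qmod \<Rightarrow> bool" for Q where
  "indecomposable Q P \<Longrightarrow> projective Q P \<Longrightarrow> preprojective Q P"
| "preprojective Q N \<Longrightarrow> AR_translate Q M N \<Longrightarrow> preprojective Q M"

inductive preinjective :: "quiver \<Rightarrow> 'k::field qmod \<Rightarrow> bool" for Q where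
  "indecomposable Q I \<Longrightarrow> injective Q I \<Longrightarrow> preinjective Q I"
| "preinjective Q M \<Longrightarrow> AR_translate Q M N \<Longrightarrow> preinjective Q N"

definition regular :: "quiver \<Rightarrow> 'k::field qmod \<Rightarrow> bool" where
  "regular Q M \<longleftrightarrow> is_qmod Q M \<and>
     (\<forall>N L. indecomposable Q N \<and> is_qmod Q L \<and> direct_sum Q M N L \<longrightarrow>
        \<not> preprojective Q N \<and> \<not> preinjective Q N)"

text \<open>
  Simple objects of the category of regular modules: every subobject is zero or an isomorphism.
  Monomorphisms of regular modules are injective, since regular modules are closed under kernels.
\<close>

definition regular_simple :: "quiver \<Rightarrow> 'k::field qmod \<Rightarrow> bool" where
  "regular_simple Q M \<longleftrightarrow> regular Q M \<and> \<not> qzero Q M \<and>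
     (\<forall>N. regular Q N \<longrightarrow> (\<forall>f\<in>qhom Q N M. qmono Q N f \<longrightarrow> qzero Q N \<or> qepi Q N M f))"

section \<open>Euler characteristics of quiver Grassmannians\<close>

definition free_rank :: "('a, 'b) monoid_scheme \<Rightarrow> nat" where
  "free_rank G = Sup {card S | S. finite S \<and> S \<subseteq> carrier G \<and>
     (\<forall>c :: 'a \<Rightarrow> int. finprod G (\<lambda>s. s [^]\<^bsub>G\<^esub> c s) S = \<one>\<^bsub>G\<^esub> \<longrightarrow> (\<forall>s\<in>S. c s = 0))}"

text \<open>For spaces with finitely generated total integral singular homology.\<close>

definition euler_characteristic :: "'a topology \<Rightarrow> int" where
  "euler_characteristic X = (\<Sum>p | free_rank (homology_group (int p) X) \<noteq> 0.
     (-1) ^ p * int (free_rank (homology_group (int p) X)))"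

text \<open>
  \<open>F (v, r, c)\<close> is the entry in row \<open>r\<close> and column \<open>c\<close> of a matrix whose columns are to
  form a basis of a subspace of \<open>M\<^sub>v\<close> of dimension \<open>e v\<close>.
\<close>

definition frame_index :: "quiver \<Rightarrow> 'k qmod \<Rightarrow> (nat \<Rightarrow> nat) \<Rightarrow> (nat \<times> nat \<times> nat) set" where
  "frame_index Q M e = {(v, r, c). v \<in> verts Q \<and> r < dimv M v \<and> c < e v}"

definition frame_mat ::
    "'k qmod \<Rightarrow> (nat \<Rightarrow> nat) \<Rightarrow> (nat \<times> nat \<times> nat \<Rightarrow> 'k) \<Rightarrow> nat \<Rightarrow> 'k mat" where
  "frame_mat M e F v = mat (dimv M v) (e v) (\<lambda>(r, c). F (v, r, c))"

definition frame_span :: "quiver \<Rightarrow> 'k::field qmod \<Rightarrow> (nat \<Rightarrow> nat) \<Rightarrow>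
    (nat \<times> nat \<times> nat \<Rightarrow> 'k) \<Rightarrow> nat \<Rightarrow> 'k vec set" where
  "frame_span Q M e F =
     (\<lambda>v. if v \<in> verts Q then (\<lambda>x. frame_mat M e F v *\<^sub>v x) ` carrier_vec (e v) else {})"

definition submodule :: "quiver \<Rightarrow> 'k::field qmod \<Rightarrow> (nat \<Rightarrow> 'k vec set) \<Rightarrow> bool" where
  "submodule Q M U \<longleftrightarrow>
     (\<forall>v\<in>verts Q. U v \<subseteq> carrier_vec (dimv M v) \<and> 0\<^sub>v (dimv M v) \<in> U v \<and>
        (\<forall>x\<in>U v. \<forall>y\<in>U v. x + y \<in> U v) \<and> (\<forall>c. \<forall>x\<in>U v. c \<cdot>\<^sub>v x \<in> U v)) \<and>
     (\<forall>(i, l)\<in>arrows Q. \<forall>x\<in>U l. act M (i, l) *\<^sub>v x \<in> U i)"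

definition submodule_frames ::
    "quiver \<Rightarrow> 'k::field qmod \<Rightarrow> (nat \<Rightarrow> nat) \<Rightarrow> (nat \<times> nat \<times> nat \<Rightarrow> 'k) set" where
  "submodule_frames Q M e = {F \<in> frame_index Q M e \<rightarrow>\<^sub>E UNIV.
     (\<forall>v\<in>verts Q. inj_on (\<lambda>x. frame_mat M e F v *\<^sub>v x) (carrier_vec (e v))) \<and>
     submodule Q M (frame_span Q M e F)}"

text \<open>The submodules of \<open>M\<close> of dimension vector \<open>e\<close>.\<close>

definition Gr :: "quiver \<Rightarrow> 'k::field qmod \<Rightarrow> (nat \<Rightarrow> nat) \<Rightarrow> (nat \<Rightarrow> 'k vec set) set" where
  "Gr Q M e = frame_span Q M e ` submodule_frames Q M e"

text \<open>
  The analytic topology of a complex quiver Grassmannian: a product of Grassmannians is the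
  quotient of the space of frames by a product of general linear groups. Since quotients by group
  actions are open, the quotient topology on the closed subset of submodules is also the topology
  induced from that product.
\<close>

definition Gr_topology ::
    "quiver \<Rightarrow> complex qmod \<Rightarrow> (nat \<Rightarrow> nat) \<Rightarrow> (nat \<Rightarrow> complex vec set) topology" where
  "Gr_topology Q M e = topology (\<lambda>U. U \<subseteq> Gr Q M e \<and>
     openin (subtopology (product_topology (\<lambda>_. euclidean) (frame_index Q M e))
               (submodule_frames Q M e))
       {F \<in> submodule_frames Q M e. frame_span Q M e F \<in> U})"

text \<open>\<open>K\<close> is a subfield and \<open>\<sigma>\<close> restricts to a field embedding of \<open>K\<close> into the complex numbers.\<close>

definition complex_embedding :: "'k::field set \<Rightarrow> ('k \<Rightarrow> complex) \<Rightarrow> bool" where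
  "complex_embedding K \<sigma> \<longleftrightarrow>
     1 \<in> K \<and> (\<forall>a\<in>K. \<forall>b\<in>K. a - b \<in> K \<and> a * b \<in> K \<and> inverse a \<in> K) \<and>
     \<sigma> 1 = 1 \<and> (\<forall>a\<in>K. \<forall>b\<in>K. \<sigma> (a + b) = \<sigma> a + \<sigma> b \<and> \<sigma> (a * b) = \<sigma> a * \<sigma> b)"

definition map_qmod :: "('k \<Rightarrow> 'l) \<Rightarrow> 'k qmod \<Rightarrow> 'l qmod" where
  "map_qmod \<sigma> M = \<lparr> dimv = dimv M, act = (\<lambda>a. map_mat \<sigma> (act M a)) \<rparr>"

text \<open>
  The Euler characteristic of \<open>Gr\<^sub>e(M)\<close> over an algebraically closed field of characteristic 0:
  \<open>M\<close>, and with it the projective variety \<open>Gr\<^sub>e(M)\<close>, is defined over a subfield \<open>K\<close> that embeds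
  into the complex numbers (e.g. the finitely generated subfield of all matrix entries), and one
  takes the topological Euler characteristic of the complex points. By the comparison theorem this
  is the Euler characteristic of l-adic cohomology of \<open>Gr\<^sub>e(M)\<close>; hence it depends neither on \<open>K\<close>
  nor on the embedding, and for the complex numbers themselves it is the usual one.
\<close>

definition chi_Gr :: "quiver \<Rightarrow> 'k::field qmod \<Rightarrow> (nat \<Rightarrow> nat) \<Rightarrow> int" where
  "chi_Gr Q M e = (SOME c. \<exists>K \<sigma>. complex_embedding K \<sigma> \<and>
     (\<forall>a\<in>arrows Q. elements_mat (act M a) \<subseteq> K) \<and>
     c = euler_characteristic (Gr_topology Q (map_qmod \<sigma> M) e))"

text \<open>Only vectors \<open>e\<close> with \<open>e \<le> dimv M\<close> contribute; for all others \<open>Gr\<^sub>e(M)\<close> is empty.\<close>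

definition CC :: "quiver \<Rightarrow> 'k::field qmod \<Rightarrow> ratfun" where
  "CC Q M = (\<Sum>e \<in> (\<Pi>\<^sub>E v\<in>verts Q. {0..dimv M v}). of_int (chi_Gr Q M e) *
     (\<Prod>i\<in>verts Q. var i powi
        (- euler_form Q (\<lambda>v. int (e v)) (simple_root i)
         - euler_form Q (simple_root i) (\<lambda>v. int (dimv M v) - int (e v)))))"

end

theory Submission
  imports Defs
begin

text \<open>
  Along the frieze, the alternating sequence \<open>y\<close> of the two vertices of a fork satisfies
  \<open>y\<^bsub>j+1\<^esub> = c\<^sub>j y\<^sub>j - y\<^bsub>j-1\<^esub>\<close>, and reading the frieze from either fork shows that \<open>c\<close> has period
  \<open>n - 2\<close>. Hence Wronskians of \<open>y\<close> and its shift by \<open>n - 2\<close> are constant, and so is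
  \<open>(y\<^bsub>j+n-2\<^esub> + y\<^bsub>j-n+2\<^esub>) / y\<^sub>j\<close>, which is the trace of the monodromy and is computed at the initial
  variables. Since \<open>n\<close> is even, the shift preserves the vertex.

  The same Laurent polynomial is obtained as \<open>CC M\<close> for a generic representation \<open>M\<close> of dimension
  \<open>\<delta>\<close>: its subrepresentations are governed by the line they cut out in the common two-dimensional
  space and four pairwise distinct marked lines, so the quiver Grassmannians are empty, points or
  projective lines. Finally, a regular simple module of dimension \<open>\<delta>\<close> is generic: otherwise one of
  the thin modules at the mouths of the exceptional tubes embeds in it. These thin modules are regular, since a
  map to a preprojective module (or from a preinjective one) would produce by almost split sequences
  a splitting of a non-split extension.
\<close>

section \<open>Friezes on a strip\<close>

text \<open>Both sides are brought to one closed form. With p and q the products of the initial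
  variables at the two forks and \<Sigma> the sum of the reciprocals of neighbouring products along
  the strip, it is (p + q + p q \<Sigma>)^2 / (p q) - 2. On the module side the square comes from
  splitting \<delta> into the dimension vectors of two thin string modules, one along 0, 2, ..., n -
  2, n and one along 1, 2, ..., n - 2, n - 1: the Laurent monomials multiply when dimension vectors
  add, and each string contributes the factor p + q + p q \<Sigma> up to a monomial. Pairs of
  submodules of the two strings then count the Euler characteristics of the Grassmannians of a
  generic module, except at the dimension vectors of the two strings themselves, where there is one
  pair but no submodule. These two exceptions are the - 2. The obstacle on the module side is that
  regularity excludes all iterated translates of projectives and injectives. The vanishing of maps
  between them and a thin module can be carried along the translation only for a whole tube at once,
  because the extension used in one step involves a neighbour of the thin module in its
  tube.\<close>

lemma const_of_step:
  fixes f :: "int \<Rightarrow> 'b"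
  assumes "\<And>j. f (j + 1) = f j"
  shows "f j = f 0"
proof (induction j rule: int_induct[of _ 0])
  case (step2 i)
  then show ?case using assms[of "i - 1"] by simp
qed (simp_all add: assms)

text \<open>A frieze of type \<open>\<tilde>D\<close>, with the two pairs of end rows replaced by their products \<open>W 1\<close> and
  \<open>W (m + 1)\<close>, and with each such pair encoded by one sequence and a constant.\<close>

locale strip_frieze =
  fixes m :: nat and \<kappa> \<mu> :: "'a::field" and y \<eta> :: "int \<Rightarrow> 'a" and W :: "nat \<Rightarrow> int \<Rightarrow> 'a"
  assumes m: "m \<ge> 2"
    and const_nz: "\<kappa> \<noteq> 0" "\<mu> \<noteq> 0"
    and y_nz: "y j \<noteq> 0" and eta_nz: "\<eta> j \<noteq> 0"
    and W_nz: "1 \<le> k \<Longrightarrow> k \<le> m + 1 \<Longrightarrow> W k j \<noteq> 0"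
    and W_first: "W 1 j = \<kappa> * y j * y j"
    and W_last: "W (m + 1) j = \<mu> * \<eta> j * \<eta> j"
    and y_step: "\<kappa> * y j * y (j + 1) = 1 + W 2 (j + 1)"
    and eta_step: "\<mu> * \<eta> j * \<eta> (j + 1) = 1 + W m j"
    and W_step: "2 \<le> k \<Longrightarrow> k \<le> m \<Longrightarrow> W k (j + 1) * W k j = 1 + W (k + 1) (j + 1) * W (k - 1) j"
begin

text \<open>Turning the strip upside down exchanges the rows 1 and m + 1, but the mesh relation
  distinguishes the row above, taken at time j + 1, from the row below, taken at time j. Reversing
  time as well restores it. Whatever is proved from the first row thus holds from the last one, with
  \<open>\<eta>\<close> in place of \<open>y\<close>.\<close>

lemma reflected: "strip_frieze m \<mu> \<kappa> (\<lambda>j. \<eta> (- j)) (\<lambda>j. y (- j)) (\<lambda>k j. W (m + 2 - k) (- j))"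
proof
  fix j :: int and k :: nat
  show "W (m + 2 - 1) (- j) = \<mu> * \<eta> (- j) * \<eta> (- j)" using W_last[of "-j"] by simp
  show "W (m + 2 - (m + 1)) (- j) = \<kappa> * y (- j) * y (- j)" using W_first[of "-j"] by simp
  show "\<mu> * \<eta> (- j) * \<eta> (- (j + 1)) = 1 + W (m + 2 - 2) (- (j + 1))"
    using eta_step[of "- j - 1"] by (simp add: mult.assoc mult.commute mult.left_commute)
  have e: "m + 2 - m = 2" by simp
  show "\<kappa> * y (- j) * y (- (j + 1)) = 1 + W (m + 2 - m) (- j)"
    unfolding e using y_step[of "- j - 1"] by (simp add: mult.assoc mult.commute mult.left_commute)
  show "W (m + 2 - k) (- (j + 1)) * W (m + 2 - k) (- j) =
      1 + W (m + 2 - (k + 1)) (- (j + 1)) * W (m + 2 - (k - 1)) (- j)" if k: "2 \<le> k" "k \<le> m"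
  proof -
    have e: "m + 2 - (k + 1) = m + 2 - k - 1" "m + 2 - (k - 1) = m + 2 - k + 1"
      using k by linarith+
    show ?thesis
      unfolding e using W_step[of "m + 2 - k" "- j - 1"] k
      by (simp add: mult.commute)
  qed
qed (use m const_nz y_nz eta_nz W_nz in auto)

text \<open>Reduction of order: as a function of k, \<open>y (a + int k) * Q a k\<close> is a second
  solution of the linear recurrence satisfied by \<open>y\<close>, namely the one that vanishes at k
  = 0.\<close>

definition Q :: "int \<Rightarrow> nat \<Rightarrow> 'a" where
  "Q a k = (\<Sum>i<k. 1 / (\<kappa> * y (a + int i) * y (a + int i + 1)))"

lemma Q_0 [simp]: "Q a 0 = 0" and Q_1: "Q a (Suc 0) = 1 / (\<kappa> * y a * y (a + 1))"
  by (simp_all add: Q_def)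

lemma Q_Suc: "Q a (Suc k) = Q a k + 1 / (\<kappa> * y (a + int k) * y (a + int k + 1))"
  by (simp add: Q_def)

lemma Q_Suc': "Q a (Suc k) = Q (a + 1) k + 1 / (\<kappa> * y a * y (a + 1))"
  unfolding Q_def by (subst sum.lessThan_Suc_shift) (simp add: algebra_simps)

text \<open>The first two rows are given by \<open>y\<close>, and the mesh relation determines each
  further row from the two rows before it. The formula says that on a diagonal, where j - k is
  constant, the entries are the combination y - y Q of two basic solutions, up to a constant
  factor.\<close>

lemma W_eq: "k \<le> m \<Longrightarrow> W (Suc k) j = \<kappa> * y (j - int k) * y j * (1 - Q (j - int k) k)"
proof (induction k arbitrary: j rule: less_induct)
  case (less k)
  consider "k = 0" | "k = 1" | l where "k = Suc (Suc l)"
    by (metis One_nat_def not0_implies_Suc)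
  then show ?case
  proof cases
    case 1
    then show ?thesis using W_first by simp
  next
    case 2
    have "W 2 j = \<kappa> * y (j - 1) * y j - 1" using y_step[of "j - 1"] by simp
    with 2 show ?thesis
      using y_nz const_nz by (simp add: Q_1 right_diff_distrib numeral_2_eq_2)
  next
    case 3
    define a where "a = j - int k"
    have j: "j = a + int l + 2" by (simp add: a_def 3)
    define q where "q = 1 - Q (a + 1) l"
    define x z where "x = 1 / (\<kappa> * y a * y (a + 1))" and "z = 1 / (\<kappa> * y (j - 1) * y j)"
    have Q1: "Q a (Suc l) = Q (a + 1) l + x" "Q (a + 1) (Suc l) = Q (a + 1) l + z"
      "Q a k = Q (a + 1) l + z + x"
      using Q_Suc'[of a l] Q_Suc[of "a + 1" l] Q_Suc'[of a "Suc l"]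
      by (simp_all add: x_def z_def j 3 algebra_simps)
    have idx: "j - 1 - int (Suc l) = a" "j - int (Suc l) = a + 1" "j - 1 - int l = a + 1"
      by (simp_all add: j)
    have w1: "W (Suc (Suc l)) (j - 1) = \<kappa> * y a * y (j - 1) * (q - x)"
      and w2: "W (Suc (Suc l)) j = \<kappa> * y (a + 1) * y j * (q - z)"
      and w3: "W (Suc l) (j - 1) = \<kappa> * y (a + 1) * y (j - 1) * q"
      using less.IH[of "Suc l" "j - 1"] less.IH[of "Suc l" j] less.IH[of l "j - 1"] less.prems 3
      unfolding idx Q1 q_def by (simp_all add: diff_diff_add)
    have "W (Suc k) j * W (Suc l) (j - 1) = W (Suc (Suc l)) j * W (Suc (Suc l)) (j - 1) - 1"
      using W_step[of k "j - 1"] less.prems by (simp add: 3)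
    \<comment> \<open>The 1 of the mesh relation is rewritten with x z, because (q - x) (q - z) - x
      z = q (q - z - x); the factor q belongs to \<open>W (Suc l) (j - 1)\<close>, which
      cancels.\<close>
    also have "1 = \<kappa> * y a * (\<kappa> * y (a + 1)) * y j * y (j - 1) * (x * z)"
      using y_nz const_nz by (simp add: x_def z_def)
    also have "W (Suc (Suc l)) j * W (Suc (Suc l)) (j - 1) - \<dots> =
        \<kappa> * y a * y j * (q - z - x) * W (Suc l) (j - 1)"
      unfolding w1 w2 w3 by (simp add: algebra_simps)
    finally have "W (Suc k) j = \<kappa> * y a * y j * (q - z - x)"
      using W_nz[of "Suc l" "j - 1"] less.prems 3 by simp
    then show ?thesis
      unfolding Q1(3)[unfolded a_def] a_def[symmetric] using Q1(3) by (simp add: q_def algebra_simps)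
  qed
qed

definition c :: "int \<Rightarrow> 'a" where "c j = (y (j + 1) + y (j - 1)) / y j"

lemma y_rec: "y (j + 1) = c j * y j - y (j - 1)"
  using y_nz by (simp add: c_def)

text \<open>Along the direction (1, 1) the base point j - k + 1 of \<open>W_eq\<close> stays fixed,
  so the entries are a fixed solution of the recurrence of \<open>y\<close> evaluated at j, and the
  coefficient is \<open>c j\<close>.\<close>

lemma W_rec_right:
  assumes "2 \<le> k" "k \<le> m"
  shows "W (k + 1) (j + 1) + W (k - 1) (j - 1) = c j * W k j"
proof -
  obtain l where k: "k = Suc (Suc l)" using assms(1) by (metis add_2_eq_Suc le_Suc_ex)
  define a where "a = j - int l - 1"
  define z z' where "z = 1 / (\<kappa> * y (j - 1) * y j)" and "z' = 1 / (\<kappa> * y j * y (j + 1))"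
  have Qs: "Q a (Suc l) = Q a l + z" "Q a (Suc (Suc l)) = Q a l + z + z'"
    using Q_Suc[of a l] Q_Suc[of a "Suc l"] by (simp_all add: a_def z_def z'_def algebra_simps)
  have w1: "W (k + 1) (j + 1) = \<kappa> * y a * y (j + 1) * (1 - Q a l - z - z')"
    using W_eq[of "Suc (Suc l)" "j + 1"] assms(2) Qs by (simp add: a_def k algebra_simps)
  have w2: "W (k - 1) (j - 1) = \<kappa> * y a * y (j - 1) * (1 - Q a l)"
    using W_eq[of l "j - 1"] assms(2) by (simp add: a_def k algebra_simps)
  have w3: "W k j = \<kappa> * y a * y j * (1 - Q a l - z)"
    using W_eq[of "Suc l" j] assms(2) Qs by (simp add: a_def k algebra_simps)
  have "y (j + 1) * z' = y (j - 1) * z" using y_nz const_nz by (simp add: z_def z'_def)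
  moreover have "c j * y j = y (j + 1) + y (j - 1)" using y_nz by (simp add: c_def)
  moreover have "W (k + 1) (j + 1) + W (k - 1) (j - 1) - c j * W k j =
      \<kappa> * y a * ((1 - Q a l - z) * (y (j + 1) + y (j - 1) - c j * y j) + y (j - 1) * z - y (j + 1) * z')"
    unfolding w1 w2 w3 by (simp add: algebra_simps)
  ultimately show ?thesis by simp
qed

text \<open>With time fixed it is the other factor in \<open>W_eq\<close> that moves: the base point
  a = j - k + 1 runs backwards as k grows, and the entries solve the recurrence in a. Hence the
  coefficient belongs to a and not to j.\<close>

lemma W_rec_left:
  assumes "2 \<le> k" "k \<le> m"
  shows "W (k + 1) j + W (k - 1) j = c (j - int k + 1) * W k j"
proof -
  obtain l where k: "k = Suc (Suc l)" using assms(1) by (metis add_2_eq_Suc le_Suc_ex)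
  define a where "a = j - int l - 1"
  define z z' where "z = 1 / (\<kappa> * y a * y (a + 1))" and "z' = 1 / (\<kappa> * y (a - 1) * y a)"
  have Qs: "Q a (Suc l) = Q (a + 1) l + z" "Q (a - 1) (Suc (Suc l)) = Q (a + 1) l + z + z'"
    using Q_Suc'[of a l] Q_Suc'[of "a - 1" "Suc l"] by (simp_all add: z_def z'_def algebra_simps)
  have w1: "W (k + 1) j = \<kappa> * y (a - 1) * y j * (1 - Q (a + 1) l - z - z')"
    using W_eq[of "Suc (Suc l)" j] assms(2) Qs by (simp add: a_def k algebra_simps)
  have w2: "W (k - 1) j = \<kappa> * y (a + 1) * y j * (1 - Q (a + 1) l)"
    using W_eq[of l j] assms(2) by (simp add: a_def k algebra_simps)
  have w3: "W k j = \<kappa> * y a * y j * (1 - Q (a + 1) l - z)"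
    using W_eq[of "Suc l" j] assms(2) Qs by (simp add: a_def k algebra_simps)
  have "y (a + 1) * z = y (a - 1) * z'" using y_nz const_nz by (simp add: z_def z'_def)
  moreover have "c a * y a = y (a + 1) + y (a - 1)" using y_nz by (simp add: c_def)
  moreover have "W (k + 1) j + W (k - 1) j - c a * W k j =
      \<kappa> * y j * ((1 - Q (a + 1) l - z) * (y (a + 1) + y (a - 1) - c a * y a) + y (a + 1) * z - y (a - 1) * z')"
    unfolding w1 w2 w3 by (simp add: algebra_simps)
  ultimately have "W (k + 1) j + W (k - 1) j = c a * W k j" by simp
  moreover have "j - int k + 1 = a" by (simp add: a_def k)
  ultimately show ?thesis by simp
qed

text \<open>Both ends of the strip give the coefficients of the recurrences along its two diagonal
  directions; comparing them yields periodicity.\<close>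

lemma c_periodic: "c (j + int m) = c j"
proof -
  interpret r: strip_frieze m \<mu> \<kappa> "\<lambda>j. \<eta> (- j)" "\<lambda>j. y (- j)" "\<lambda>k j. W (m + 2 - k) (- j)"
    by (rule reflected)
  \<comment> \<open>The recurrence in direction (1, 1) at row m is read from both ends of the strip;
    both coefficients multiply the same nonzero entry.\<close>
  have c: "c i = r.c (- i)" for i
  proof -
    have "W (m + 1) (i + 1) + W (m - 1) (i - 1) = c i * W m i" using W_rec_right[of m i] m by simp
    moreover have "W (m - 1) (i - 1) + W (m + 1) (i + 1) = r.c (- i) * W m i"
      using r.W_rec_right[of 2 "- i"] m by (simp add: numeral_eq_Suc algebra_simps)
    ultimately have "c i * W m i = r.c (- i) * W m i" by (simp add: add.commute)
    then show ?thesis using W_nz[of m i] m by simp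
  qed
  \<comment> \<open>At fixed time the two ends see coefficients whose positions differ by m.
    Together with the comparison just made this is the period.\<close>
  have "W (m + 1) (j + int m - 1) + W (m - 1) (j + int m - 1) = c j * W m (j + int m - 1)"
    using W_rec_left[of m "j + int m - 1"] m by (simp add: algebra_simps)
  moreover have "W (m - 1) (j + int m - 1) + W (m + 1) (j + int m - 1) =
      r.c (- (j + int m)) * W m (j + int m - 1)"
    using r.W_rec_left[of 2 "- (j + int m - 1)"] m by (simp add: numeral_eq_Suc algebra_simps)
  ultimately have "c j * W m (j + int m - 1) = r.c (- (j + int m)) * W m (j + int m - 1)"
    by (simp add: add.commute)
  then show ?thesis using W_nz[of m "j + int m - 1"] m c by simp
qed

text \<open>\<open>V\<close> is the Casoratian of \<open>y\<close> and its translate by m. The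
  translate solves the same recurrence because \<open>c\<close> has period m, so \<open>V\<close> is
  constant. Equating the values of \<open>V\<close> at j and j - m and collecting terms is the
  constancy of the quotient.\<close>

lemma trace_const: "(y (j + int m) + y (j - int m)) / y j = (y (int m) + y (- int m)) / y 0"
proof -
  define V where "V j = y (j + 1 + int m) * y j - y (j + int m) * y (j + 1)" for j
  have rec: "y (j + 1 + int m) = c j * y (j + int m) - y (j - 1 + int m)" for j
    using y_rec[of "j + int m"] c_periodic[of j] by (simp add: algebra_simps)
  have "V (j + 1) = V j" for j
  proof -
    have A: "y (j + 1 + 1 + int m) = c (j + 1) * y (j + 1 + int m) - y (j + int m)"
      using rec[of "j + 1"] by simp
    have B: "y (j + 1 + 1) = c (j + 1) * y (j + 1) - y j" using y_rec[of "j + 1"] by simp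
    show ?thesis unfolding V_def A B by (simp add: algebra_simps)
  qed
  then have V: "V j = V 0" for j by (rule const_of_step)
  define f where "f j = (y (j + int m) + y (j - int m)) / y j" for j
  have "f (j + 1) = f j" for j
  proof -
    have "V j = V (j - int m)" using V by metis
    then have "(y (j + 1 + int m) + y (j + 1 - int m)) * y j = (y (j + int m) + y (j - int m)) * y (j + 1)"
      by (simp add: V_def algebra_simps)
    then show ?thesis using y_nz by (simp add: f_def frac_eq_eq)
  qed
  then have "f j = f 0" by (rule const_of_step)
  then show ?thesis by (simp add: f_def)
qed

text \<open>As functions of k, y (- k) and W (k + 1) 0 solve the same recurrence, so their quotient
  has differences governed by a constant Casoratian: passing from k to k + 1 adds y 0 / (W (k + 1) 0
  * W (k + 2) 0). Summation expresses y (- m) through the entries at time 0 alone.\<close>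

lemma y_minus_m:
  "\<kappa> * y (- int m) * y 0 = W (m + 1) 0 * (1 + W 1 0 * (\<Sum>i=1..m. 1 / (W i 0 * W (i + 1) 0)))"
proof -
  have "\<kappa> * y (- int k) * y 0 = W (Suc k) 0 * (1 + W 1 0 * (\<Sum>i=1..k. 1 / (W i 0 * W (i + 1) 0)))"
    if "k \<le> m" for k
    using that
  proof (induction k)
    case 0
    then show ?case using W_first[of 0] by simp
  next
    case (Suc k)
    define S where "S = (\<Sum>i=1..k. 1 / (W i 0 * W (i + 1) 0))"
    define q where "q = Q (- int k) k"
    define w w' where "w = W (Suc k) 0" and "w' = W (Suc (Suc k)) 0"
    define a b where "a = y (- int k)" and "b = y (- int k - 1)"
    have nz: "w \<noteq> 0" "w' \<noteq> 0" "a \<noteq> 0" "b \<noteq> 0" using W_nz y_nz Suc.prems by (auto simp: w_def w'_def a_def b_def)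
    have w: "w = \<kappa> * a * y 0 * (1 - q)" using W_eq[of k 0] Suc.prems by (simp add: w_def a_def q_def)
    have "Q (- int k - 1) (Suc k) = q + 1 / (\<kappa> * b * a)"
      using Q_Suc'[of "- int k - 1" k] by (simp add: q_def a_def b_def)
    moreover have shift: "0 - int (Suc k) = - int k - 1" by simp
    ultimately have w': "w' = \<kappa> * b * y 0 * (1 - q - 1 / (\<kappa> * b * a))"
      using W_eq[of "Suc k" 0] Suc.prems shift unfolding w'_def b_def by (simp only: diff_diff_eq)
    have IH: "\<kappa> * a * y 0 = w * (1 + W 1 0 * S)" using Suc by (simp add: w_def a_def S_def)
    have "a * w' = b * w - y 0"
      unfolding w w' using nz const_nz by (simp add: field_simps)
    have "w * (\<kappa> * b * y 0) = \<kappa> * y 0 * (b * w)" by simp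
    also have "b * w = a * w' + y 0" using \<open>a * w' = b * w - y 0\<close> by simp
    also have "\<kappa> * y 0 * (a * w' + y 0) = w' * (\<kappa> * a * y 0) + \<kappa> * y 0 * y 0" by (simp add: algebra_simps)
    also have "\<dots> = w * (w' * (1 + W 1 0 * (S + 1 / (w * w'))))"
      unfolding IH W_first[symmetric] using nz by (simp add: field_simps)
    finally have "\<kappa> * b * y 0 = w' * (1 + W 1 0 * (S + 1 / (w * w')))" using nz by simp
    moreover have e: "- int (Suc k) = - int k - 1" by simp
    ultimately show ?case unfolding e b_def[symmetric] by (simp add: S_def w_def w'_def)
  qed
  from this[of m] show ?thesis by simp
qed

text \<open>In k the product is the solution of the recurrence with initial values 0 and 1 /
  \<kappa>. Neither these values nor the coefficients change when the base point moves by m.\<close>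

lemma K_periodic:
  "y (a + int m) * y (a + int m + int k) * Q (a + int m) k = y a * y (a + int k) * Q a k"
proof -
  define K where "K a k = y a * y (a + int k) * Q a k" for a k
  have rec: "K a (Suc (Suc k)) = c (a + int k + 1) * K a (Suc k) - K a k" for a k
  proof -
    define u v w where "u = y (a + int k)" and "v = y (a + int k + 1)" and "w = y (a + int k + 1 + 1)"
    define z z' where "z = 1 / (\<kappa> * u * v)" and "z' = 1 / (\<kappa> * v * w)"
    have "Q a (Suc k) = Q a k + z" "Q a (Suc (Suc k)) = Q a k + z + z'"
      using Q_Suc[of a k] Q_Suc[of a "Suc k"] by (simp_all add: z_def z'_def u_def v_def w_def algebra_simps)
    then have Ks: "K a k = y a * u * Q a k" "K a (Suc k) = y a * v * (Q a k + z)"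
      "K a (Suc (Suc k)) = y a * w * (Q a k + z + z')"
      by (simp_all add: K_def u_def v_def w_def algebra_simps)
    have "w * z' = u * z" using y_nz const_nz by (simp add: z_def z'_def u_def v_def w_def)
    moreover have "c (a + int k + 1) * v = w + u" using y_rec[of "a + int k + 1"] by (simp add: u_def v_def w_def)
    moreover have "K a (Suc (Suc k)) - (c (a + int k + 1) * K a (Suc k) - K a k) =
        y a * ((w + u - c (a + int k + 1) * v) * (Q a k + z) + (w * z' - u * z))"
      unfolding Ks by (simp add: algebra_simps)
    ultimately show ?thesis by simp
  qed
  have "K (a + int m) k = K a k \<and> K (a + int m) (Suc k) = K a (Suc k)"
  proof (induction k)
    case 0
    have "K b (Suc 0) = 1 / \<kappa>" for b using y_nz by (simp add: K_def Q_1 add.commute)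
    then show ?case by (simp add: K_def)
  next
    case (Suc k)
    have "c (a + int m + int k + 1) = c (a + int k + 1)"
      using c_periodic[of "a + int k + 1"] by (simp add: algebra_simps)
    then show ?case using Suc rec by simp
  qed
  then show ?thesis by (simp add: K_def)
qed

definition p where "p = W 1 0"
definition q where "q = W (m + 1) 0"
definition \<Sigma> where "\<Sigma> = (\<Sum>i=1..m. 1 / (W i 0 * W (i + 1) 0))"

text \<open>From the entries at time 0, \<open>y_minus_m\<close> reaches the past of
  \<open>y\<close>. The future value y m is found by way of the other end: reflection gives \<eta> m
  and with it the entry W (m + 1) m, which \<open>W_eq\<close> ties to y m and Q 0 m, and
  \<open>K_periodic\<close> moves Q 0 m back to the past.\<close>

lemma trace_eq: "(y (int m) + y (- int m)) / y 0 = (p + q + p * q * \<Sigma>)\<^sup>2 / (p * q) - 2"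
proof -
  interpret r: strip_frieze m \<mu> \<kappa> "\<lambda>j. \<eta> (- j)" "\<lambda>j. y (- j)" "\<lambda>k j. W (m + 2 - k) (- j)"
    by (rule reflected)
  have nz: "p \<noteq> 0" "q \<noteq> 0" using W_nz by (simp_all add: p_def q_def)
  have y1: "\<kappa> * y (- int m) * y 0 = q * (1 + p * \<Sigma>)"
    using y_minus_m by (simp add: p_def q_def \<Sigma>_def)
  have S: "(\<Sum>i=1..m. 1 / (W (m + 2 - i) 0 * W (m + 2 - (i + 1)) 0)) = \<Sigma>"
    unfolding \<Sigma>_def
    by (rule sum.reindex_bij_witness[of _ "\<lambda>i. m + 1 - i" "\<lambda>i. m + 1 - i"])
      (auto simp: Suc_diff_le mult.commute)
  have e1: "\<mu> * \<eta> (int m) * \<eta> 0 = p * (1 + q * \<Sigma>)"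
    using r.y_minus_m S by (simp add: p_def q_def)
  have e0: "\<mu> * \<eta> 0 * \<eta> 0 = q" using W_last[of 0] by (simp add: q_def)
  have y0: "\<kappa> * y 0 * y 0 = p" using W_first[of 0] by (simp add: p_def)
  have w1: "\<mu> * \<eta> (int m) * \<eta> (int m) = \<kappa> * y 0 * y (int m) * (1 - Q 0 m)"
    using W_eq[of m "int m"] W_last[of "int m"] by simp
  have w2: "q = \<kappa> * y (- int m) * y 0 * (1 - Q (- int m) m)"
    using W_eq[of m 0] by (simp add: q_def)
  have k: "y 0 * y (int m) * Q 0 m = y (- int m) * y 0 * Q (- int m) m"
    using K_periodic[of "- int m" m] by simp
  have "(\<mu> * \<eta> (int m) * \<eta> (int m)) * q = (\<mu> * \<eta> (int m) * \<eta> 0)\<^sup>2"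
    unfolding e0[symmetric] by (simp add: power2_eq_square)
  then have top: "(\<mu> * \<eta> (int m) * \<eta> (int m)) * q = (p * (1 + q * \<Sigma>))\<^sup>2" by (simp only: e1)
  have "\<kappa> * y 0 * y (int m) * q = (p * (1 + q * \<Sigma>))\<^sup>2 + p * q * \<Sigma> * q"
  proof -
    have "\<kappa> * y 0 * y (int m) * q = (\<kappa> * y 0 * y (int m) * (1 - Q 0 m)) * q + \<kappa> * (y 0 * y (int m) * Q 0 m) * q"
      by (simp add: algebra_simps)
    also have "\<kappa> * (y 0 * y (int m) * Q 0 m) = p * q * \<Sigma>"
      unfolding k using w2 y1 by (simp add: algebra_simps)
    finally show ?thesis using top w1 by simp
  qed
  then have y2: "\<kappa> * y (int m) * y 0 = ((p * (1 + q * \<Sigma>))\<^sup>2 + p * q * \<Sigma> * q) / q"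
    using nz by (simp add: field_simps)
  have "(y (int m) + y (- int m)) / y 0 = (\<kappa> * y (int m) * y 0 + \<kappa> * y (- int m) * y 0) / (\<kappa> * y 0 * y 0)"
    using y_nz const_nz by (simp add: field_simps)
  also have "\<dots> = (p + q + p * q * \<Sigma>)\<^sup>2 / (p * q) - 2"
    unfolding y0 y1 y2 using nz by (simp add: field_simps power2_eq_square)
  finally show ?thesis .
qed

lemma y_recurrence: "y (j + int m) + y (j - int m) = ((p + q + p * q * \<Sigma>)\<^sup>2 / (p * q) - 2) * y j"
  using trace_const[of j] trace_eq y_nz[of j] by (simp add: divide_eq_eq)

lemma eta_recurrence: "\<eta> (j + int m) + \<eta> (j - int m) = ((p + q + p * q * \<Sigma>)\<^sup>2 / (p * q) - 2) * \<eta> j"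
proof -
  interpret r: strip_frieze m \<mu> \<kappa> "\<lambda>j. \<eta> (- j)" "\<lambda>j. y (- j)" "\<lambda>k j. W (m + 2 - k) (- j)"
    by (rule reflected)
  have S: "r.\<Sigma> = \<Sigma>"
    unfolding \<Sigma>_def r.\<Sigma>_def minus_zero
    by (rule sum.reindex_bij_witness[of _ "\<lambda>i. m + 1 - i" "\<lambda>i. m + 1 - i"])
      (auto simp: Suc_diff_le mult.commute)
  have "r.p = q" "r.q = p" unfolding r.p_def r.q_def p_def q_def by simp_all
  then show ?thesis using r.y_recurrence[of "- j"] S by (simp add: algebra_simps)
qed

end

section \<open>Subtraction-free rational functions and the nonvanishing of the frieze\<close>

definition pos_mpoly :: "((nat \<Rightarrow>\<^sub>0 nat) \<Rightarrow>\<^sub>0 rat) \<Rightarrow> bool" where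
  "pos_mpoly p \<longleftrightarrow> p \<noteq> 0 \<and> (\<forall>u. Poly_Mapping.lookup p u \<ge> 0)"

lemma pos_mpoly_add: "pos_mpoly p \<Longrightarrow> pos_mpoly q \<Longrightarrow> pos_mpoly (p + q)"
proof -
  assume a: "pos_mpoly p" "pos_mpoly q"
  then obtain u where "Poly_Mapping.lookup p u \<noteq> 0"
    unfolding pos_mpoly_def by (auto simp: poly_mapping_eq_iff fun_eq_iff)
  then have "Poly_Mapping.lookup p u > 0" using a unfolding pos_mpoly_def by (simp add: order_less_le)
  moreover have "Poly_Mapping.lookup q u \<ge> 0" using a unfolding pos_mpoly_def by simp
  ultimately have "Poly_Mapping.lookup (p + q) u > 0" unfolding lookup_add by (rule add_pos_nonneg)
  then have "p + q \<noteq> 0" by auto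
  then show ?thesis using a by (simp add: pos_mpoly_def lookup_add)
qed

lemma pos_mpoly_mult: "pos_mpoly p \<Longrightarrow> pos_mpoly q \<Longrightarrow> pos_mpoly (p * q)"
  unfolding pos_mpoly_def lookup_mult
  by (auto simp: Sum_any.expand_set when_def intro!: sum_nonneg mult_nonneg_nonneg)

lemma pos_mpoly_single: "pos_mpoly (Poly_Mapping.single u 1)"
proof -
  have "Poly_Mapping.lookup (Poly_Mapping.single u (1::rat)) u \<noteq> 0" by simp
  then have "Poly_Mapping.single u (1::rat) \<noteq> 0" by (metis lookup_zero)
  then show ?thesis by (simp add: pos_mpoly_def lookup_single when_def)
qed

text \<open>These functions contain the variables and are closed under sums, products and inverses,
  and none of them is 0. The frieze is generated from the variables by exactly these operations,
  which is what permits the divisions on the strip.\<close>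

definition pos_rat :: "ratfun \<Rightarrow> bool" where
  "pos_rat x \<longleftrightarrow> (\<exists>p q. pos_mpoly p \<and> pos_mpoly q \<and> x = Fract p q)"

lemma pos_rat_nz: "pos_rat x \<Longrightarrow> x \<noteq> 0"
  by (auto simp: pos_rat_def pos_mpoly_def Zero_fract_def eq_fract)

lemma pos_mpoly_one: "pos_mpoly 1"
  using pos_mpoly_single[of 0] by simp

lemma pos_rat_one: "pos_rat 1"
  unfolding pos_rat_def One_fract_def using pos_mpoly_one by blast

lemma pos_rat_var: "pos_rat (var i)"
  unfolding pos_rat_def var_def using pos_mpoly_one pos_mpoly_single by blast

lemma pos_rat_Fract: "pos_mpoly p \<Longrightarrow> pos_mpoly q \<Longrightarrow> pos_rat (Fract p q)"
  unfolding pos_rat_def by (intro exI conjI) (assumption | rule refl)+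

lemma pos_rat_add:
  assumes "pos_rat x" "pos_rat y"
  shows "pos_rat (x + y)"
proof -
  obtain p q r s where h: "pos_mpoly p" "pos_mpoly q" "pos_mpoly r" "pos_mpoly s"
    and xy: "x = Fract p q" "y = Fract r s"
    using assms by (auto simp: pos_rat_def)
  have e: "x + y = Fract (p * s + r * q) (q * s)"
    unfolding xy by (rule add_fract) (use h in \<open>simp_all add: pos_mpoly_def\<close>)
  show ?thesis
    unfolding e by (intro pos_rat_Fract pos_mpoly_add pos_mpoly_mult h)
qed

lemma pos_rat_mult:
  assumes "pos_rat x" "pos_rat y"
  shows "pos_rat (x * y)"
proof -
  obtain p q r s where h: "pos_mpoly p" "pos_mpoly q" "pos_mpoly r" "pos_mpoly s"
    and xy: "x = Fract p q" "y = Fract r s"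
    using assms by (auto simp: pos_rat_def)
  show ?thesis
    unfolding xy mult_fract by (intro pos_rat_Fract pos_mpoly_mult h)
qed

lemma pos_rat_inverse:
  assumes "pos_rat x"
  shows "pos_rat (inverse x)"
proof -
  obtain p q where h: "pos_mpoly p" "pos_mpoly q" and x: "x = Fract p q"
    using assms by (auto simp: pos_rat_def)
  show ?thesis
    unfolding x inverse_fract by (intro pos_rat_Fract h)
qed

lemma pos_rat_prod: "(\<And>x. x \<in> A \<Longrightarrow> pos_rat (f x)) \<Longrightarrow> pos_rat (\<Prod>x\<in>A. f x)"
  by (induction A rule: infinite_finite_induct) (auto intro: pos_rat_one pos_rat_mult)

lemma pos_rat_factor: "pos_rat (x * y) \<Longrightarrow> pos_rat y \<Longrightarrow> pos_rat x"
proof -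
  assume a: "pos_rat (x * y)" "pos_rat y"
  then have "x = (x * y) * inverse y" using pos_rat_nz[OF a(2)] by simp
  then show ?thesis using pos_rat_mult[OF a(1) pos_rat_inverse[OF a(2)]] by argo
qed

lemma Dtilde_arrow_cases:
  assumes "n \<ge> 4" "(i, l) \<in> arrows (Dtilde n)"
  shows "l < i \<and> i \<le> n"
  using assms by (auto simp: Dtilde_def)

text \<open>Positivity spreads from time 0 in both directions of time. All arrows go from larger to
  smaller vertices, so a step forward treats the vertices from n downwards and a step backward
  treats them from 0 upwards.\<close>

lemma frieze_nz:
  assumes n: "n \<ge> 4" and X: "frieze_sequences (Dtilde n) X" and i: "i \<le> n"
  shows "X i j \<noteq> 0"
proof -
  let ?A = "arrows (Dtilde n)"
  have X0: "X i 0 = var i" if "i \<le> n" for i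
    using X that by (simp add: frieze_sequences_def Dtilde_def)
  have step: "X i (j + 1) * X i j = 1 + (\<Prod>s | (s, i) \<in> ?A. X s (j + 1)) * (\<Prod>d | (i, d) \<in> ?A. X d j)"
    if "i \<le> n" for i j
    using X that by (simp add: frieze_sequences_def Dtilde_def)
  have up: "pos_rat (X i (j + 1))" if pos: "\<And>i. i \<le> n \<Longrightarrow> pos_rat (X i j)" and "i \<le> n" for i j
    using that(2)
  proof (induction "n - i" arbitrary: i rule: less_induct)
    case less
    have "pos_rat (X s (j + 1))" if "(s, i) \<in> ?A" for s
      using Dtilde_arrow_cases[OF n that] less.hyps[of s] by (meson diff_less_mono2 less_le_trans)
    moreover have "pos_rat (X d j)" if "(i, d) \<in> ?A" for d
      using Dtilde_arrow_cases[OF n that] pos by simp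
    ultimately have "pos_rat (X i (j + 1) * X i j)"
      unfolding step[OF less.prems]
      by (intro pos_rat_add pos_rat_one pos_rat_mult pos_rat_prod) auto
    then show ?case using pos_rat_factor pos less.prems by blast
  qed
  have down: "pos_rat (X i j)" if pos: "\<And>i. i \<le> n \<Longrightarrow> pos_rat (X i (j + 1))" and "i \<le> n" for i j
    using that(2)
  proof (induction i rule: less_induct)
    case (less i)
    have "pos_rat (X s (j + 1))" if "(s, i) \<in> ?A" for s
      using Dtilde_arrow_cases[OF n that] pos by simp
    moreover have "pos_rat (X d j)" if "(i, d) \<in> ?A" for d
      using Dtilde_arrow_cases[OF n that] less by simp
    ultimately have "pos_rat (X i j * X i (j + 1))"
      unfolding mult.commute[of "X i j"] step[OF less.prems]
      by (intro pos_rat_add pos_rat_one pos_rat_mult pos_rat_prod) auto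
    then show ?case using pos_rat_factor pos less.prems by blast
  qed
  have "\<forall>i\<le>n. pos_rat (X i j)"
  proof (induction j rule: int_induct[of _ 0])
    case base
    then show ?case using X0 pos_rat_var by simp
  next
    case (step1 j)
    then show ?case using up by blast
  next
    case (step2 j)
    then show ?case using down[of "j - 1"] by simp
  qed
  then show ?thesis using i pos_rat_nz by blast
qed

section \<open>The frieze of the quiver as a frieze on a strip\<close>

lemma Dtilde_in:
  assumes "n \<ge> 4"
  shows "{s. (s, 0) \<in> arrows (Dtilde n)} = {2}" "{s. (s, Suc 0) \<in> arrows (Dtilde n)} = {2}"
    "{s. (s, n) \<in> arrows (Dtilde n)} = {}" "{s. (s, n - 1) \<in> arrows (Dtilde n)} = {}"
    "{s. (s, n - 2) \<in> arrows (Dtilde n)} = {n - 1, n}"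
    "2 \<le> k \<Longrightarrow> k \<le> n - 3 \<Longrightarrow> {s. (s, k) \<in> arrows (Dtilde n)} = {k + 1}"
  using assms by (auto simp: Dtilde_def)

lemma Dtilde_out:
  assumes "n \<ge> 4"
  shows "{d. (0, d) \<in> arrows (Dtilde n)} = {}" "{d. (Suc 0, d) \<in> arrows (Dtilde n)} = {}"
    "{d. (n, d) \<in> arrows (Dtilde n)} = {n - 2}" "{d. (n - 1, d) \<in> arrows (Dtilde n)} = {n - 2}"
    "{d. (2, d) \<in> arrows (Dtilde n)} = {0, 1}"
    "3 \<le> k \<Longrightarrow> k \<le> n - 2 \<Longrightarrow> {d. (k, d) \<in> arrows (Dtilde n)} = {k - 1}"
proof -
  obtain r where n: "n = r + 4" using assms by (metis add.commute le_Suc_ex)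
  show "{d. (k, d) \<in> arrows (Dtilde n)} = {k - 1}" if k: "3 \<le> k" "k \<le> n - 2"
  proof -
    obtain l where "k = Suc l" using k(1) by (cases k) auto
    then show ?thesis using k by (auto simp: Dtilde_def n)
  qed
qed (use assms in \<open>auto simp: Dtilde_def\<close>)

definition strip_var :: "nat \<Rightarrow> nat \<Rightarrow> ratfun" where
  "strip_var n k = (if k = 1 then var 0 * var 1 else if k = n - 1 then var (n - 1) * var n else var k)"

text \<open>The trace of the monodromy found in \<open>trace_eq\<close>, at the initial variables;
  \<open>strip_var n k\<close> is the initial value of row k, with a product over the fork at either
  end.\<close>

definition trace_ratfun :: "nat \<Rightarrow> ratfun" where
  "trace_ratfun n = (let p = strip_var n 1; q = strip_var n (n - 1);
       S = (\<Sum>k = 1..n - 2. 1 / (strip_var n k * strip_var n (k + 1)))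
     in (p + q + p * q * S)\<^sup>2 / (p * q) - 2)"

lemma frieze_recurrence:
  fixes j :: int
  assumes n: "n \<ge> 4" and "even n" and X: "frieze_sequences (Dtilde n) X" and i: "i \<in> {0, 1, n - 1, n}"
  shows "trace_ratfun n * X i j = X i (j - int n + 2) + X i (j + int n - 2)"
proof -
  define m where "m = n - 2"
  have m: "m \<ge> 2" "even m" "n = m + 2" using n \<open>even n\<close> by (auto simp: m_def)
  have nz: "i \<le> n \<Longrightarrow> X i j \<noteq> 0" for i j using frieze_nz[OF n X] .
  have step: "X i (j + 1) * X i j = 1 + (\<Prod>s | (s, i) \<in> arrows (Dtilde n). X s (j + 1)) *
      (\<Prod>d | (i, d) \<in> arrows (Dtilde n). X d j)"
    if "i \<le> n" for i j
    using X that by (simp add: frieze_sequences_def Dtilde_def)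
  have s0: "X 0 (j + 1) * X 0 j = 1 + X 2 (j + 1)" and s1: "X 1 (j + 1) * X 1 j = 1 + X 2 (j + 1)" for j
    using step[of 0 j] step[of 1 j] Dtilde_in[OF n] Dtilde_out[OF n] n by simp_all
  have sn: "X n (j + 1) * X n j = 1 + X m j" and sn1: "X (n - 1) (j + 1) * X (n - 1) j = 1 + X m j" for j
    unfolding m_def using step[of n j] step[of "n - 1" j] Dtilde_in[OF n] Dtilde_out[OF n] n by simp_all
  define W where "W k j = (if k = 1 then X 0 j * X 1 j else if k = n - 1 then X (n - 1) j * X n j else X k j)"
    for k j
  have W_step: "W k (j + 1) * W k j = 1 + W (k + 1) (j + 1) * W (k - 1) j" if k: "2 \<le> k" "k \<le> m" for k j
  proof -
    have a: "(\<Prod>s | (s, k) \<in> arrows (Dtilde n). X s (j + 1)) = W (k + 1) (j + 1)"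
    proof (cases "k = n - 2")
      case True
      have "n - 2 + 1 = n - 1" "n - 1 \<noteq> n" "n - 1 \<noteq> 1" using n by auto
      then show ?thesis unfolding True Dtilde_in(5)[OF n] using n by (simp add: W_def)
    next
      case False
      then show ?thesis using Dtilde_in(6)[OF n, of k] k n by (simp add: W_def m_def)
    qed
    have b: "(\<Prod>d | (k, d) \<in> arrows (Dtilde n). X d j) = W (k - 1) j"
    proof (cases "k = 2")
      case True
      then show ?thesis using Dtilde_out(5)[OF n] by (simp add: W_def)
    next
      case False
      then show ?thesis using Dtilde_out(6)[OF n, of k] k n by (auto simp: W_def m_def)
    qed
    show ?thesis using step[of k j] k m unfolding a b by (simp add: W_def)
  qed
  \<comment> \<open>The two vertices of a fork satisfy the same relation, so the ratio X 1 / X 0 is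
    inverted at each time step. Alternating between the two vertices makes the ratio z / y
    constant.\<close>
  define y z where "y j = (if even j then X 0 j else X 1 j)" and "z j = (if even j then X 1 j else X 0 j)" for j :: int
  define \<eta> \<zeta> where "\<eta> j = (if even j then X n j else X (n - 1) j)"
    and "\<zeta> j = (if even j then X (n - 1) j else X n j)" for j :: int
  define \<kappa> \<mu> where "\<kappa> = z 0 / y 0" and "\<mu> = \<zeta> 0 / \<eta> 0"
  have nzs: "y j \<noteq> 0" "z j \<noteq> 0" "\<eta> j \<noteq> 0" "\<zeta> j \<noteq> 0" for j
    using nz n by (auto simp: y_def z_def \<eta>_def \<zeta>_def)
  have zy: "z j * y (j + 1) = 1 + X 2 (j + 1)" "y j * z (j + 1) = 1 + X 2 (j + 1)" for j
    using s0[of j] s1[of j] by (auto simp: y_def z_def mult.commute)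
  have ze: "\<zeta> j * \<eta> (j + 1) = 1 + X m j" "\<eta> j * \<zeta> (j + 1) = 1 + X m j" for j
    using sn[of j] sn1[of j] by (auto simp: \<eta>_def \<zeta>_def mult.commute)
  have "z (j + 1) / y (j + 1) = z j / y j" for j
    using zy[of j] nzs by (simp add: frac_eq_eq mult.commute)
  then have "z j / y j = z 0 / y 0" for j by (rule const_of_step)
  then have z: "z j = \<kappa> * y j" for j using nzs by (metis \<kappa>_def nonzero_eq_divide_eq)
  have "\<zeta> (j + 1) / \<eta> (j + 1) = \<zeta> j / \<eta> j" for j
    using ze[of j] nzs by (simp add: frac_eq_eq mult.commute)
  then have "\<zeta> j / \<eta> j = \<zeta> 0 / \<eta> 0" for j by (rule const_of_step)
  then have \<zeta>: "\<zeta> j = \<mu> * \<eta> j" for j using nzs by (metis \<mu>_def nonzero_eq_divide_eq)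
  interpret s: strip_frieze m \<kappa> \<mu> y \<eta> W
  proof
    fix k j
    show "\<kappa> \<noteq> 0" "\<mu> \<noteq> 0" using nzs by (simp_all add: \<kappa>_def \<mu>_def)
    show "W k j \<noteq> 0" if "1 \<le> k" "k \<le> m + 1" using nz that m by (simp add: W_def)
    show "W 1 j = \<kappa> * y j * y j"
      unfolding z[symmetric] by (simp add: W_def y_def z_def mult.commute)
    show "W (m + 1) j = \<mu> * \<eta> j * \<eta> j"
      unfolding \<zeta>[symmetric] using m by (simp add: W_def \<eta>_def \<zeta>_def mult.commute)
    show "\<kappa> * y j * y (j + 1) = 1 + W 2 (j + 1)"
      unfolding z[symmetric] zy using m by (simp add: W_def)
    show "\<mu> * \<eta> j * \<eta> (j + 1) = 1 + W m j"
      unfolding \<zeta>[symmetric] ze using m by (simp add: W_def)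
    show "W k (j + 1) * W k j = 1 + W (k + 1) (j + 1) * W (k - 1) j" if "2 \<le> k" "k \<le> m"
      using that by (rule W_step)
  qed (rule m nzs)+
  have X0: "X i 0 = var i" if "i \<le> n" for i
    using X that by (simp add: frieze_sequences_def Dtilde_def)
  have W0: "W k 0 = strip_var n k" if "k \<le> n" for k
    using that n by (simp add: W_def strip_var_def X0)
  have C: "(s.p + s.q + s.p * s.q * s.\<Sigma>)\<^sup>2 / (s.p * s.q) - 2 = trace_ratfun n"
  proof -
    have "s.\<Sigma> = (\<Sum>k = 1..n - 2. 1 / (strip_var n k * strip_var n (k + 1)))"
      unfolding s.\<Sigma>_def m_def[symmetric] by (rule sum.cong) (use m W0 in auto)
    moreover have "s.p = strip_var n 1" "s.q = strip_var n (n - 1)"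
      unfolding s.p_def s.q_def using W0[of 1] W0[of "m + 1"] m by auto
    ultimately show ?thesis by (simp add: trace_ratfun_def Let_def)
  qed
  have ry: "y (j + int m) + y (j - int m) = trace_ratfun n * y j" for j
    using s.y_recurrence C by simp
  have re: "\<eta> (j + int m) + \<eta> (j - int m) = trace_ratfun n * \<eta> j" for j
    using s.eta_recurrence C by simp
  have rz: "z (j + int m) + z (j - int m) = trace_ratfun n * z j" for j
    using arg_cong[OF ry[of j], of "\<lambda>t. \<kappa> * t"] unfolding z by (simp add: algebra_simps)
  have rze: "\<zeta> (j + int m) + \<zeta> (j - int m) = trace_ratfun n * \<zeta> j" for j
    using arg_cong[OF re[of j], of "\<lambda>t. \<mu> * t"] unfolding \<zeta> by (simp add: algebra_simps)
  \<comment> \<open>Since m is even, j, j + m and j - m have the same parity, and the alternating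
    sequences refer to the same vertex at all three times.\<close>
  have "X i (j + int m) + X i (j - int m) = trace_ratfun n * X i j"
    using i ry[of j] re[of j] rz[of j] rze[of j] m
    by (cases "even j") (auto simp: y_def z_def \<eta>_def \<zeta>_def)
  moreover have e: "j - int n + 2 = j - int m" "j + int n - 2 = j + int m" using m by auto
  ultimately show ?thesis unfolding e by (simp add: add.commute)
qed

section \<open>The trace as a sum over dimension vectors\<close>

lemma var_nz [simp]: "var i \<noteq> 0"
  using pos_rat_nz pos_rat_var .

text \<open>The exponent of \<open>x\<^sub>i\<close> in the summand of \<open>CC\<close> for a submodule of dimension \<open>e\<close> in a module of
  dimension \<open>d\<close>.\<close>

definition cc_exponent :: "nat \<Rightarrow> (nat \<Rightarrow> int) \<Rightarrow> (nat \<Rightarrow> int) \<Rightarrow> nat \<Rightarrow> int" where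
  "cc_exponent n d e i = - euler_form (Dtilde n) e (simple_root i)
     - euler_form (Dtilde n) (simple_root i) (\<lambda>v. d v - e v)"

definition cc_monom :: "nat \<Rightarrow> (nat \<Rightarrow> int) \<Rightarrow> (nat \<Rightarrow> int) \<Rightarrow> ratfun" where
  "cc_monom n d e = (\<Prod>i\<in>{0..n}. var i powi cc_exponent n d e i)"

lemma verts_Dtilde: "verts (Dtilde n) = {0..n}"
  by (simp add: Dtilde_def)

text \<open>The contributions of e i from the two Euler forms cancel; what remains is the dimension
  d i and the neighbours of i.\<close>

lemma cc_exponent_eq:
  assumes n: "n \<ge> 4" and i: "i \<le> n"
  shows "cc_exponent n d e i = - d i + (\<Sum>l | (i, l) \<in> arrows (Dtilde n). e l)
    + (\<Sum>s | (s, i) \<in> arrows (Dtilde n). d s - e s)"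
proof -
  let ?A = "arrows (Dtilde n)"
  have out: "{l. (i, l) \<in> ?A} = {l \<in> {0..n}. (i, l) \<in> ?A}" and "in": "{s. (s, i) \<in> ?A} = {s \<in> {0..n}. (s, i) \<in> ?A}"
    using Dtilde_arrow_cases[OF n] i by fastforce+
  have "euler_form (Dtilde n) e (simple_root i) =
      (\<Sum>l\<in>{0..n}. \<Sum>k\<in>{0..n}. if k = i then e l * ((if l = i then 1 else 0) - (if (i, l) \<in> ?A then 1 else 0)) else 0)"
    unfolding euler_form_def verts_Dtilde simple_root_def by (intro sum.cong) auto
  also have "\<dots> = (\<Sum>l\<in>{0..n}. (if l = i then e l else 0) - (if (i, l) \<in> ?A then e l else 0))"
    using i by (intro sum.cong) auto
  also have "\<dots> = e i - (\<Sum>l | (i, l) \<in> ?A. e l)"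
    using i unfolding out sum.inter_filter[OF finite_atLeastAtMost] sum_subtractf by simp
  finally have 1: "euler_form (Dtilde n) e (simple_root i) = e i - (\<Sum>l | (i, l) \<in> ?A. e l)" .
  define f where "f v = d v - e v" for v
  have "euler_form (Dtilde n) (simple_root i) f =
      (\<Sum>l\<in>{0..n}. if l = i then (\<Sum>k\<in>{0..n}. f k * ((if k = i then 1 else 0) - (if (k, i) \<in> ?A then 1 else 0))) else 0)"
    unfolding euler_form_def verts_Dtilde simple_root_def by (intro sum.cong) (auto intro: sum.cong)
  also have "\<dots> = (\<Sum>k\<in>{0..n}. (if k = i then f k else 0) - (if (k, i) \<in> ?A then f k else 0))"
    using i by (auto intro!: sum.cong)
  also have "\<dots> = f i - (\<Sum>s | (s, i) \<in> ?A. f s)"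
    using i unfolding "in" sum.inter_filter[OF finite_atLeastAtMost] sum_subtractf by simp
  finally have 2: "euler_form (Dtilde n) (simple_root i) f = f i - (\<Sum>s | (s, i) \<in> ?A. f s)" .
  have f: "(\<lambda>v. d v - e v) = f" by (simp add: f_def fun_eq_iff)
  show ?thesis using 1 2 unfolding cc_exponent_def f by (simp add: f_def)
qed

lemma cc_monom_cong:
  assumes "n \<ge> 4" "\<And>v. v \<le> n \<Longrightarrow> d v = d' v" "\<And>v. v \<le> n \<Longrightarrow> e v = e' v"
  shows "cc_monom n d e = cc_monom n d' e'"
  unfolding cc_monom_def
proof (rule prod.cong)
  fix i assume i: "i \<in> {0..n}"
  have "(\<Sum>l | (i, l) \<in> arrows (Dtilde n). e l) = (\<Sum>l | (i, l) \<in> arrows (Dtilde n). e' l)"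
    by (rule sum.cong) (use assms i Dtilde_arrow_cases[OF assms(1)] in fastforce)+
  moreover have "(\<Sum>s | (s, i) \<in> arrows (Dtilde n). d s - e s) = (\<Sum>s | (s, i) \<in> arrows (Dtilde n). d' s - e' s)"
    by (rule sum.cong) (use assms i Dtilde_arrow_cases[OF assms(1)] in fastforce)+
  ultimately have "cc_exponent n d e i = cc_exponent n d' e' i"
    using i assms by (simp add: cc_exponent_eq)
  then show "var i powi cc_exponent n d e i = var i powi cc_exponent n d' e' i" by simp
qed simp

text \<open>The exponents are linear in the pair (d, e). This allows \<delta> to be split into two
  strings whose contributions are summed independently.\<close>

lemma cc_monom_add:
  assumes "n \<ge> 4"
  shows "cc_monom n (\<lambda>v. d v + d' v) (\<lambda>v. e v + e' v) = cc_monom n d e * cc_monom n d' e'"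
  unfolding cc_monom_def prod.distrib[symmetric]
proof (rule prod.cong)
  fix i assume i: "i \<in> {0..n}"
  have "cc_exponent n (\<lambda>v. d v + d' v) (\<lambda>v. e v + e' v) i = cc_exponent n d e i + cc_exponent n d' e' i"
    using i assms by (simp add: cc_exponent_eq sum.distrib sum_subtractf)
  then show "var i powi cc_exponent n (\<lambda>v. d v + d' v) (\<lambda>v. e v + e' v) i =
      var i powi cc_exponent n d e i * var i powi cc_exponent n d' e' i"
    by (simp add: power_int_add)
qed simp

text \<open>The dimension vectors of the submodules of a string module along the path \<open>s, 2, \<dots>, n - 2, t\<close>.\<close>

definition pos :: "nat \<Rightarrow> nat \<Rightarrow> nat" where
  "pos n v = max 1 (min (n - 1) v)"

definition tail :: "nat \<Rightarrow> nat \<Rightarrow> nat \<Rightarrow> nat \<Rightarrow> nat \<Rightarrow> nat" where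
  "tail n s t a v = (if (v = s \<or> v = t \<or> 2 \<le> v \<and> v \<le> n - 2) \<and> a \<le> pos n v then 1 else 0)"

text \<open>The maps of the string lead from s towards t, so a submodule is an end segment;
  \<open>a\<close> is its first position, with a = 1 for the whole string and a = n for the zero
  module. On the inner vertices the exponents cancel except at the positions a - 1 and a on the two
  sides of the cut, where they are - 1. At the forks the factor var s * var t completes the
  exponents to those of full fork products.\<close>

lemma cc_monom_tail:
  fixes s s' t t' :: nat
  assumes n: "n \<ge> 4" and st: "s = 0 \<and> s' = 1 \<or> s = 1 \<and> s' = 0" "t = n \<and> t' = n - 1 \<or> t = n - 1 \<and> t' = n"
    and a: "1 \<le> a" "a \<le> n"
  shows "var s * var t * cc_monom n (\<lambda>v. int (tail n s t 1 v)) (\<lambda>v. int (tail n s t a v)) =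
    (if a = 1 then strip_var n (n - 1) else if a = n then strip_var n 1
     else strip_var n 1 * strip_var n (n - 1) / (strip_var n (a - 1) * strip_var n a))"
proof -
  let ?A = "arrows (Dtilde n)"
  define ex where "ex = cc_exponent n (\<lambda>v. int (tail n s t 1 v)) (\<lambda>v. int (tail n s t a v))"
  have ex: "ex i = - int (tail n s t 1 i) + (\<Sum>l | (i, l) \<in> ?A. int (tail n s t a l))
      + (\<Sum>l | (l, i) \<in> ?A. int (tail n s t 1 l) - int (tail n s t a l))" if "i \<le> n" for i
    unfolding ex_def using cc_exponent_eq[OF n that] .
  have n': "n - 2 \<noteq> n - 1" "n - 2 \<noteq> n" "n - 1 \<noteq> n" "n - 2 > 1" "n - Suc 0 \<noteq> n" "n - 2 \<noteq> n - Suc 0" using n by auto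
  have ends: "s \<le> n" "s' \<le> n" "t \<le> n" "t' \<le> n" "s < t" "s' < t'" "s \<noteq> s'" "t \<noteq> t'" "s \<noteq> t'" "s' \<noteq> t"
    using st n by auto
  have tail_s: "tail n s t b s = (if b \<le> 1 then 1 else 0)" "tail n s t b s' = 0" for b
    using st n by (auto simp: tail_def pos_def)
  have tail_t: "tail n s t b t = (if b \<le> n - 1 then 1 else 0)" "tail n s t b t' = 0" for b
    using st n by (auto simp: tail_def pos_def)
  have tail_k: "tail n s t b k = (if b \<le> k then 1 else 0)" if "2 \<le> k" "k \<le> n - 2" for b k
    using that n by (auto simp: tail_def pos_def)
  have out_s: "{l. (s, l) \<in> ?A} = {}" "{l. (s', l) \<in> ?A} = {}" "{l. (l, s) \<in> ?A} = {2}" "{l. (l, s') \<in> ?A} = {2}"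
    using st(1) Dtilde_out(1,2)[OF n] Dtilde_in(1,2)[OF n] by (elim disjE conjE; simp)+
  have out_t: "{l. (t, l) \<in> ?A} = {n - 2}" "{l. (t', l) \<in> ?A} = {n - 2}" "{l. (l, t) \<in> ?A} = {}" "{l. (l, t') \<in> ?A} = {}"
    using st(2) Dtilde_out(3,4)[OF n] Dtilde_in(3,4)[OF n] by (elim disjE conjE; simp only:)+
  have ex_s: "ex s = (if a > 2 then 0 else - 1)" "ex s' = (if a > 2 then 1 else 0)"
    using n a by (simp_all add: ex ends out_s tail_s tail_k)
  have ex_t: "ex t = (if a \<le> n - 2 then 0 else - 1)" "ex t' = (if a \<le> n - 2 then 1 else 0)"
    using n a by (simp_all add: ex ends out_t tail_t tail_k)
  have ex_k: "ex k = (if k = a - 1 \<or> k = a then - 1 else 0)" if k: "2 \<le> k" "k \<le> n - 2" for k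
  proof -
    have o: "(\<Sum>l | (k, l) \<in> ?A. int (tail n s t a l)) = (if a \<le> k - 1 then 1 else 0)"
    proof (cases "k = 2")
      case True
      have "{l. (k, l) \<in> ?A} = {s, s'}" using Dtilde_out(5)[OF n] st(1) unfolding True by (elim disjE) auto
      then show ?thesis using True ends(7) by (simp add: tail_s)
    next
      case False
      then show ?thesis using k Dtilde_out(6)[OF n, of k] by (simp add: tail_k)
    qed
    have i: "(\<Sum>l | (l, k) \<in> ?A. int (tail n s t 1 l) - int (tail n s t a l)) = (if a > k + 1 then 1 else 0)"
    proof (cases "k = n - 2")
      case True
      have e: "{l. (l, k) \<in> ?A} = {t, t'}" using Dtilde_in(5)[OF n] st(2) unfolding True by (elim disjE) auto
      have "a > k + 1 \<longleftrightarrow> \<not> a \<le> n - 1" "1 \<le> n - 1" using True n by linarith+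
      then show ?thesis unfolding e using ends(8) by (simp add: tail_t)
    next
      case False
      then have k3: "k \<le> n - 3" "k + 1 \<le> n - 2" using k by linarith+
      have e: "{l. (l, k) \<in> ?A} = {k + 1}" using Dtilde_in(6)[OF n k(1) k3(1)] .
      show ?thesis unfolding e using k tail_k[of "k + 1"] k3(2) by auto
    qed
    have "ex k = - int (tail n s t 1 k) + (if a \<le> k - 1 then 1 else 0) + (if a > k + 1 then 1 else 0)"
      unfolding ex[OF order_trans[OF k(2) diff_le_self]] o i by (rule refl)
    also have "\<dots> = (if k = a - 1 \<or> k = a then - 1 else 0)"
      using k a by (auto simp: tail_k)
    finally show ?thesis .
  qed
  have split: "{0..n} = {s, s', t, t'} \<union> {2..n - 2}" using st n by auto
  have "cc_monom n (\<lambda>v. int (tail n s t 1 v)) (\<lambda>v. int (tail n s t a v)) =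
      (\<Prod>i\<in>{s, s', t, t'}. var i powi ex i) * (\<Prod>i\<in>{2..n - 2}. var i powi ex i)"
    unfolding cc_monom_def ex_def[symmetric] split by (rule prod.union_disjoint) (use st n in auto)
  also have "(\<Prod>i\<in>{2..n - 2}. var i powi ex i) = (\<Prod>i\<in>{2..n - 2}. if i \<in> {a - 1, a} then inverse (var i) else 1)"
    by (rule prod.cong) (auto simp: ex_k)
  also have "\<dots> = (\<Prod>i\<in>{2..n - 2} \<inter> {a - 1, a}. inverse (var i))"
    by (simp add: prod.inter_restrict)
  also have "(\<Prod>i\<in>{s, s', t, t'}. var i powi ex i) =
      (if a > 2 then var s' else inverse (var s)) * (if a \<le> n - 2 then var t' else inverse (var t))"
    using ends by (simp add: ex_s ex_t power_int_minus)
  finally have mon: "cc_monom n (\<lambda>v. int (tail n s t 1 v)) (\<lambda>v. int (tail n s t a v)) =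
      (if a > 2 then var s' else inverse (var s)) * (if a \<le> n - 2 then var t' else inverse (var t)) *
      (\<Prod>i\<in>{2..n - 2} \<inter> {a - 1, a}. inverse (var i))" .
  have w1: "strip_var n 1 = var s * var s'" using st by (auto simp: strip_var_def)
  have wn: "strip_var n (n - 1) = var t * var t'" using st n by (auto simp: strip_var_def)
  have wk: "strip_var n k = var k" if "2 \<le> k" "k \<le> n - 2" for k using that by (auto simp: strip_var_def)
  have n2: "Suc 0 \<le> n - 2" "2 \<le> n - 2" "\<not> n \<le> n - 2" "n \<noteq> Suc 0" "n \<noteq> 2" "n > 2"
    using n by linarith+
  consider "a = 1" | "a = n" | "a = 2" | "a = n - 1" "a > 2" | "3 \<le> a" "a \<le> n - 2" using a by linarith
  then show ?thesis
  proof cases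
    case 1
    then have "{2..n - 2} \<inter> {a - 1, a} = {}" by auto
    then show ?thesis unfolding mon using 1 n2 wn by simp
  next
    case 2
    then have "{2..n - 2} \<inter> {a - 1, a} = {}" using n by auto
    then show ?thesis unfolding mon using 2 n2 w1 by simp
  next
    case 3
    then have "{2..n - 2} \<inter> {a - 1, a} = {2}" using n by auto
    then show ?thesis unfolding mon using 3 n2 w1 wn wk[of 2] by (simp add: field_simps)
  next
    case 4
    then have "{2..n - 2} \<inter> {a - 1, a} = {n - 2}" using n by auto
    moreover have "a - 1 = n - 2" "\<not> a \<le> n - 2" "a \<noteq> 1" "a \<noteq> n" using 4 n by linarith+
    moreover have "strip_var n a = strip_var n (n - 1)" using 4 by simp
    ultimately show ?thesis unfolding mon using 4(2) n2 w1 wn wk[of "n - 2"] by (simp add: field_simps)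
  next
    case 5
    then have "{2..n - 2} \<inter> {a - 1, a} = {a - 1, a}" using n by auto
    moreover have "a - 1 \<noteq> a" "a \<noteq> 1" "a \<noteq> n" "a > 2" using 5 n by linarith+
    moreover have "strip_var n (a - 1) = var (a - 1)" by (rule wk) (use 5 in linarith)+
    moreover have "strip_var n a = var a" by (rule wk) (use 5 in linarith)+
    ultimately show ?thesis unfolding mon using 5(2) w1 wn by (simp add: field_simps)
  qed
qed

definition strip_sum :: "nat \<Rightarrow> ratfun" where
  "strip_sum n = strip_var n 1 + strip_var n (n - 1) + strip_var n 1 * strip_var n (n - 1) *
     (\<Sum>k = 1..n - 2. 1 / (strip_var n k * strip_var n (k + 1)))"

text \<open>The normalised sum over all cuts is the same for every choice of one vertex in each
  fork. Two complementary strings therefore produce a square.\<close>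

lemma sum_cc_monom_tail:
  fixes s s' t t' :: nat
  assumes n: "n \<ge> 4" and st: "s = 0 \<and> s' = 1 \<or> s = 1 \<and> s' = 0" "t = n \<and> t' = n - 1 \<or> t = n - 1 \<and> t' = n"
  shows "var s * var t * (\<Sum>a = 1..n. cc_monom n (\<lambda>v. int (tail n s t 1 v)) (\<lambda>v. int (tail n s t a v))) = strip_sum n"
proof -
  define f where "f a = (if a = 1 then strip_var n (n - 1) else if a = n then strip_var n 1
     else strip_var n 1 * strip_var n (n - 1) / (strip_var n (a - 1) * strip_var n a))" for a
  have L: "var s * var t * (\<Sum>a = 1..n. cc_monom n (\<lambda>v. int (tail n s t 1 v)) (\<lambda>v. int (tail n s t a v))) = (\<Sum>a = 1..n. f a)"
    unfolding sum_distrib_left f_def by (rule sum.cong[OF refl], rule cc_monom_tail[OF n st]) auto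
  have I: "{1..n} = insert 1 (insert n {2..n - 1})" using n by auto
  have R: "(\<Sum>a = 1..n. f a) = f 1 + (f n + (\<Sum>a = 2..n - 1. f a))" unfolding I using n by simp
  have M: "(\<Sum>a = 2..n - 1. f a) = strip_var n 1 * strip_var n (n - 1) * (\<Sum>k = 1..n - 2. 1 / (strip_var n k * strip_var n (k + 1)))"
    unfolding sum_distrib_left by (rule sum.reindex_bij_witness[of _ "\<lambda>k. k + 1" "\<lambda>k. k - 1"]) (use n in \<open>auto simp: f_def\<close>)
  show ?thesis
    unfolding L R M strip_sum_def using n by (simp add: f_def)
qed

text \<open>Dimension vectors of pairs of submodules of two complementary strings, which together
  have dimension \<delta>. The restriction places them in the index set of the sum in
  \<open>CC\<close>.\<close>

definition tails :: "nat \<Rightarrow> nat \<times> nat \<Rightarrow> nat \<Rightarrow> nat" where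
  "tails n = (\<lambda>(a, b). restrict (\<lambda>v. tail n 0 n a v + tail n 1 (n - 1) b v) {0..n})"

lemma tail_le: "tail n s t a v \<le> tail n s t 1 v"
  by (simp add: tail_def pos_def)

lemma delta_eq_tails:
  assumes "n \<ge> 4" "v \<le> n"
  shows "delta n v = tail n 0 n 1 v + tail n 1 (n - 1) 1 v"
proof -
  have n: "n - 2 \<noteq> n - 1" "n - 1 \<noteq> n" "n - 2 \<noteq> n" "0 \<noteq> n - 1" "1 \<noteq> n - 1" "0 \<noteq> n" "1 \<noteq> n" "\<not> n - 1 \<le> n - 2" "\<not> n \<le> n - 2"
    using assms by linarith+
  have p: "1 \<le> pos n v" by (simp add: pos_def)
  consider "v \<in> {0, 1, n - 1, n}" | "2 \<le> v" "v \<le> n - 2" using assms by fastforce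
  then show ?thesis
  proof cases
    case 1
    then show ?thesis unfolding tail_def delta_def using p n by auto
  next
    case 2
    then have "v \<notin> {0, 1, n - 1, n}" using n by auto
    then show ?thesis using 2 p assms by (simp add: tail_def delta_def)
  qed
qed

lemma tails_in:
  assumes "n \<ge> 4"
  shows "tails n x \<in> (\<Pi>\<^sub>E v\<in>{0..n}. {0..delta n v})"
proof -
  obtain a b where x: "x = (a, b)" by fastforce
  show ?thesis
  proof (intro PiE_I)
    fix v assume "v \<in> {0..n}"
    then show "tails n x v \<in> {0..delta n v}"
      using add_mono[OF tail_le[of n 0 n a v] tail_le[of n 1 "n - 1" b v]] delta_eq_tails[OF assms, of v]
      unfolding x by (simp add: tails_def)
  qed (simp add: x tails_def)
qed

text \<open>Summed over all pairs of cuts, the monomials give the product of the two string sums,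
  which is \<open>strip_sum\<close> squared over p q, that is, the trace plus 2. Where one string is
  taken whole and the other one not at all, the monomial is 1; lowering the multiplicities of these
  two vectors by one removes the 2.\<close>

lemma trace_ratfun_eq_sum:
  assumes n: "n \<ge> 4"
  shows "(\<Sum>e \<in> (\<Pi>\<^sub>E v\<in>{0..n}. {0..delta n v}).
      of_int (int (card {x \<in> {1..n} \<times> {1..n}. tails n x = e}) - (if e \<in> {tails n (1, n), tails n (n, 1)} then 1 else 0)) *
      cc_monom n (\<lambda>v. int (delta n v)) (\<lambda>v. int (e v))) = trace_ratfun n"
proof -
  let ?E = "\<Pi>\<^sub>E v\<in>{0..n}. {0..delta n v}" and ?S = "{1..n} \<times> {1..n}"
  define M where "M e = cc_monom n (\<lambda>v. int (delta n v)) (\<lambda>v. int (e v))" for e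
  define m1 where "m1 a = cc_monom n (\<lambda>v. int (tail n 0 n 1 v)) (\<lambda>v. int (tail n 0 n a v))" for a
  define m2 where "m2 b = cc_monom n (\<lambda>v. int (tail n 1 (n - 1) 1 v)) (\<lambda>v. int (tail n 1 (n - 1) b v))" for b
  have fin: "finite ?E" by (intro finite_PiE) auto
  have M: "M (tails n (a, b)) = m1 a * m2 b" for a b
    unfolding M_def m1_def m2_def cc_monom_add[OF n, symmetric]
    by (rule cc_monom_cong[OF n]) (simp_all add: delta_eq_tails[OF n] tails_def)
  have "(\<Sum>e\<in>?E. of_int (int (card {x \<in> ?S. tails n x = e})) * M e) =
      (\<Sum>e\<in>?E. \<Sum>x\<in>{x \<in> ?S. tails n x = e}. M (tails n x))"
    by (rule sum.cong) simp_all
  also have "\<dots> = (\<Sum>x\<in>?S. M (tails n x))"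
    by (rule sum.group) (use fin tails_in[OF n] in auto)
  also have "\<dots> = (\<Sum>a = 1..n. m1 a) * (\<Sum>b = 1..n. m2 b)"
    unfolding sum_product sum.cartesian_product by (rule sum.cong) (auto simp: M)
  finally have sum: "(\<Sum>e\<in>?E. of_int (int (card {x \<in> ?S. tails n x = e})) * M e) =
      (\<Sum>a = 1..n. m1 a) * (\<Sum>b = 1..n. m2 b)" .
  have p: "strip_var n 1 = var 0 * var 1" and q: "strip_var n (n - 1) = var n * var (n - 1)"
    using n by (auto simp: strip_var_def)
  have s1: "var 0 * var n * (\<Sum>a = 1..n. m1 a) = strip_sum n"
    unfolding m1_def by (rule sum_cc_monom_tail[OF n]) auto
  have s2: "var 1 * var (n - 1) * (\<Sum>a = 1..n. m2 a) = strip_sum n"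
    unfolding m2_def by (rule sum_cc_monom_tail[OF n]) auto
  have "(strip_sum n)\<^sup>2 = (var 0 * var n * (\<Sum>a = 1..n. m1 a)) * (var 1 * var (n - 1) * (\<Sum>b = 1..n. m2 b))"
    unfolding s1 s2 by (simp add: power2_eq_square)
  then have S: "(\<Sum>a = 1..n. m1 a) * (\<Sum>b = 1..n. m2 b) = (strip_sum n)\<^sup>2 / (strip_var n 1 * strip_var n (n - 1))"
    unfolding p q by (simp add: field_simps)
  have full: "var 0 * var n * m1 1 = strip_var n (n - 1)" "var 1 * var (n - 1) * m2 1 = strip_var n (n - 1)"
    unfolding m1_def m2_def using n by (subst cc_monom_tail[OF n]; auto)+
  have empty: "var 0 * var n * m1 n = strip_var n 1" "var 1 * var (n - 1) * m2 n = strip_var n 1"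
    unfolding m1_def m2_def using n by (subst cc_monom_tail[OF n]; auto)+
  have cancel: "u = v / (x * y)" if "x * y * u = v" "x \<noteq> 0" "y \<noteq> 0" for u v x y :: ratfun
    using that by auto
  note vals = full[unfolded p q, THEN cancel, OF var_nz var_nz] empty[unfolded p q, THEN cancel, OF var_nz var_nz]
  have "m1 1 * m2 n = 1" "m1 n * m2 1 = 1" unfolding vals by simp_all
  then have special: "M (tails n (1, n)) = 1" "M (tails n (n, 1)) = 1" unfolding M by simp_all
  have "tails n (1, n) 0 \<noteq> tails n (n, 1) 0" using n by (simp add: tails_def tail_def pos_def)
  then have neq: "tails n (1, n) \<noteq> tails n (n, 1)" by metis
  have "(\<Sum>e\<in>?E. (if e \<in> {tails n (1, n), tails n (n, 1)} then 1 else 0) * M e) =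
      (\<Sum>e\<in>{tails n (1, n), tails n (n, 1)}. M e)"
    by (rule sum.mono_neutral_cong_right) (use fin tails_in[OF n] in auto)
  also have "\<dots> = 2" using neq special by simp
  finally have two: "(\<Sum>e\<in>?E. (if e \<in> {tails n (1, n), tails n (n, 1)} then 1 else 0) * M e) = 2" .
  have "(\<Sum>e\<in>?E. of_int (int (card {x \<in> ?S. tails n x = e}) - (if e \<in> {tails n (1, n), tails n (n, 1)} then 1 else 0)) * M e) =
     (\<Sum>e\<in>?E. of_int (int (card {x \<in> ?S. tails n x = e})) * M e) -
     (\<Sum>e\<in>?E. (if e \<in> {tails n (1, n), tails n (n, 1)} then 1 else 0) * M e)"
    unfolding sum_subtractf[symmetric] by (rule sum.cong) (auto simp: algebra_simps)
  also have "\<dots> = trace_ratfun n"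
    unfolding two sum S by (simp add: trace_ratfun_def strip_sum_def Let_def)
  finally show ?thesis by (simp add: M_def)
qed

section \<open>Euler characteristics of points and spheres\<close>

text \<open>Taking all coefficients equal to 1 gives a relation on any finite subset, so only the
  empty set is independent.\<close>

lemma free_rank_trivial:
  fixes G :: "('a, 'b) monoid_scheme"
  assumes "comm_group G" "trivial_group G"
  shows "free_rank G = 0"
proof -
  interpret comm_group G by fact
  have c: "carrier G = {\<one>\<^bsub>G\<^esub>}" using assms(2) by (simp add: trivial_group_def)
  define R where "R = {card S | S. finite S \<and> S \<subseteq> carrier G \<and>
     (\<forall>c :: 'a \<Rightarrow> int. finprod G (\<lambda>s. s [^]\<^bsub>G\<^esub> c s) S = \<one>\<^bsub>G\<^esub> \<longrightarrow> (\<forall>s\<in>S. c s = 0))}"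
  have "x = 0" if x_in: "x \<in> R" for x
  proof -
    from x_in[unfolded R_def mem_Collect_eq] obtain S where x: "x = card S" and S: "S \<subseteq> carrier G"
      and ind: "\<forall>c :: 'a \<Rightarrow> int. finprod G (\<lambda>s. s [^]\<^bsub>G\<^esub> c s) S = \<one>\<^bsub>G\<^esub> \<longrightarrow> (\<forall>s\<in>S. c s = 0)"
      by (elim exE conjE)
    have "finprod G (\<lambda>s. s [^]\<^bsub>G\<^esub> (1::int)) S = \<one>\<^bsub>G\<^esub>"
      by (rule finprod_one_eqI) (use S c in auto)
    then have "\<forall>s\<in>S. (1::int) = 0" using ind[rule_format, of "\<lambda>_. 1"] by blast
    then show ?thesis by (simp add: x)
  qed
  moreover have "0 \<in> R" unfolding R_def by (rule CollectI, rule exI[of _ "{}"]) simp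
  ultimately have "R = {0}" by blast
  then show ?thesis by (simp add: free_rank_def R_def)
qed

lemma free_rank_integer:
  fixes G :: "('a, 'b) monoid_scheme"
  assumes "comm_group G" "G \<cong> integer_group"
  shows "free_rank G = 1"
proof -
  interpret comm_group G by fact
  obtain f where f: "f \<in> iso G integer_group" using assms(2) by (auto simp: is_iso_def)
  then have bij: "bij_betw f (carrier G) UNIV" by (simp add: iso_def)
  interpret h: group_hom G integer_group f
    using f by (simp add: group_hom_def group_hom_axioms_def iso_def)
  have f_pow: "f (x [^]\<^bsub>G\<^esub> (k::int)) = k * f x" if "x \<in> carrier G" for x k
    using h.hom_int_pow[OF that] by simp
  have sum: "f (finprod G (\<lambda>s. s [^]\<^bsub>G\<^esub> (c s :: int)) S) = (\<Sum>s\<in>S. c s * f s)"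
    if "finite S" "S \<subseteq> carrier G" for c S
    using that
  proof (induction S)
    case (insert s S)
    then have "finprod G (\<lambda>s. s [^]\<^bsub>G\<^esub> c s) S \<in> carrier G" by (intro finprod_closed) auto
    then show ?case using insert by (subst finprod_insert) (auto simp: f_pow)
  qed (simp add: h.hom_one[simplified])
  have one: "finprod G (\<lambda>s. s [^]\<^bsub>G\<^esub> (c s :: int)) S = \<one>\<^bsub>G\<^esub> \<longleftrightarrow> (\<Sum>s\<in>S. c s * f s) = 0"
    if S: "finite S" "S \<subseteq> carrier G" for c S
  proof -
    have "finprod G (\<lambda>s. s [^]\<^bsub>G\<^esub> (c s :: int)) S \<in> carrier G" using S by (intro finprod_closed) auto
    then have "finprod G (\<lambda>s. s [^]\<^bsub>G\<^esub> (c s :: int)) S = \<one>\<^bsub>G\<^esub> \<longleftrightarrow>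
        f (finprod G (\<lambda>s. s [^]\<^bsub>G\<^esub> (c s :: int)) S) = f \<one>\<^bsub>G\<^esub>"
      using inj_on_eq_iff[OF bij_betw_imp_inj_on[OF bij]] one_closed by blast
    then show ?thesis unfolding sum[OF S] h.hom_one one_integer_group .
  qed
  define R where "R = {card S | S. finite S \<and> S \<subseteq> carrier G \<and>
     (\<forall>c :: 'a \<Rightarrow> int. finprod G (\<lambda>s. s [^]\<^bsub>G\<^esub> c s) S = \<one>\<^bsub>G\<^esub> \<longrightarrow> (\<forall>s\<in>S. c s = 0))}"
  have le: "card S \<le> 1" if S: "finite S" "S \<subseteq> carrier G"
    and ind: "\<forall>c :: 'a \<Rightarrow> int. finprod G (\<lambda>s. s [^]\<^bsub>G\<^esub> c s) S = \<one>\<^bsub>G\<^esub> \<longrightarrow> (\<forall>s\<in>S. c s = 0)" for S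
  proof (rule ccontr)
    assume "\<not> card S \<le> 1"
    then obtain s t where st: "s \<in> S" "t \<in> S" "s \<noteq> t" using card_le_Suc0_iff_eq[OF S(1)] by auto
    \<comment> \<open>Two integers f s and f t always satisfy f t * f s - f s * f t = 0. If both
      coefficients of this relation vanish, then f s = f t and the elements coincide.\<close>
    define c where "c x = (if x = s then f t else if x = t then - f s else 0)" for x
    have "(\<Sum>x\<in>S. c x * f x) = (\<Sum>x\<in>{s, t}. c x * f x)"
      by (rule sum.mono_neutral_right) (use S st in \<open>auto simp: c_def\<close>)
    also have "\<dots> = 0" using st by (simp add: c_def)
    finally have "\<forall>x\<in>S. c x = 0" by (rule ind[THEN spec, THEN mp, OF iffD2[OF one[OF S]]])
    then have "c t = 0" "c s = 0" using st by blast+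
    then have "f s = f t" using st by (simp add: c_def)
    then have "s = t"
      by (rule inj_onD[OF bij_betw_imp_inj_on[OF bij]]) (use st S in blast)+
    then show False using st by blast
  qed
  obtain g where g: "g \<in> carrier G" "f g = 1" using bij unfolding bij_betw_def by (metis UNIV_I imageE)
  have "1 \<in> R" unfolding R_def
  proof (rule CollectI, rule exI[of _ "{g}"], intro conjI allI impI)
    fix c :: "'a \<Rightarrow> int" assume "finprod G (\<lambda>s. s [^]\<^bsub>G\<^esub> c s) {g} = \<one>\<^bsub>G\<^esub>"
    then show "\<forall>s\<in>{g}. c s = 0" using one[of "{g}" c] g by simp
  qed (use g in auto)
  moreover have "x \<le> 1" if "x \<in> R" for x
  proof -
    from that[unfolded R_def mem_Collect_eq] obtain S where "x = card S" "finite S" "S \<subseteq> carrier G"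
      "\<forall>c :: 'a \<Rightarrow> int. finprod G (\<lambda>s. s [^]\<^bsub>G\<^esub> c s) S = \<one>\<^bsub>G\<^esub> \<longrightarrow> (\<forall>s\<in>S. c s = 0)"
      by (elim exE conjE)
    then show ?thesis using le by simp
  qed
  ultimately have "Sup R = 1" by (intro cSup_eq_maximum)
  then show ?thesis by (simp add: free_rank_def R_def)
qed

lemma free_rank_homology_trivial:
  "trivial_group (homology_group p X) \<Longrightarrow> free_rank (homology_group p X) = 0"
  using free_rank_trivial abelian_homology_group by blast

lemma free_rank_homology_integer:
  "homology_group p X \<cong> integer_group \<Longrightarrow> free_rank (homology_group p X) = 1"
  using free_rank_integer abelian_homology_group by blast

lemma euler_characteristic_empty:
  assumes "topspace X = {}"
  shows "euler_characteristic X = 0"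
  using free_rank_homology_trivial[OF trivial_homology_group_empty[OF assms]]
  by (simp add: euler_characteristic_def)

lemma euler_characteristic_point:
  assumes "topspace X = {a}"
  shows "euler_characteristic X = 1"
proof -
  have "free_rank (homology_group (int p) X) = (if p = 0 then 1 else 0)" for p
    using free_rank_homology_trivial[OF homology_dimension_axiom[OF assms]]
      free_rank_homology_integer[OF homology_coefficients[OF assms]] by simp
  then show ?thesis by (simp add: euler_characteristic_def)
qed

text \<open>The two-sphere is taken inside \<open>complex \<times> real\<close>, where the Hopf map
  below has its values. Comparison with \<open>nsphere 2\<close> leaves homology of rank 1 in
  degrees 0 and 2 only.\<close>

lemma euler_characteristic_sphere:
  assumes X: "X homeomorphic_space top_of_set (sphere 0 1 :: (complex \<times> real) set)"
  shows "euler_characteristic X = 2"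
proof -
  have "card (Basis :: (complex \<times> real) set) = 3" by simp
  then obtain f and g :: "complex \<times> real \<Rightarrow> nat \<Rightarrow> real"
    where "homeomorphic_maps (nsphere (3 - 1)) (top_of_set (sphere 0 1 \<inter> span Basis)) f g"
    using homeomorphic_maps_nsphere_euclidean_sphere[OF independent_Basis
        orthogonal_Basis _ _ norm_Basis, where 'n = "complex \<times> real"]
    by (metis numeral_3_eq_3 nat.distinct(1))
  then have "nsphere 2 homeomorphic_space top_of_set (sphere 0 1 :: (complex \<times> real) set)"
    by (auto simp: homeomorphic_space_def numeral_eq_Suc)
  then have N: "X homeomorphic_space nsphere 2"
    using X homeomorphic_space_sym homeomorphic_space_trans by blast
  have pc: "path_connected (sphere 0 1 :: (complex \<times> real) set)"
    by (rule path_connected_sphere) simp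
  have "path_connected_space X"
    using homeomorphic_path_connected_space[OF X] pc[folded path_connectedin_euclidean]
    unfolding path_connectedin_def by blast
  moreover have "topspace X \<noteq> {}"
  proof
    assume "topspace X = {}"
    then have "topspace (top_of_set (sphere 0 1 :: (complex \<times> real) set)) = {}"
      using homeomorphic_empty_space[OF X] by simp
    moreover have "(0, 1) \<in> (sphere 0 1 :: (complex \<times> real) set)" by (simp add: norm_Pair)
    ultimately show False by simp
  qed
  ultimately have H0: "homology_group 0 X \<cong> integer_group"
    by (rule isomorphic_integer_zeroth_homology_group)
  have iso: "homology_group p X \<cong> homology_group p (nsphere 2)" for p
    using homeomorphic_space_imp_isomorphic_homology_groups[OF N] .
  have H2: "homology_group 2 X \<cong> integer_group"
    using iso[of 2] reduced_homology_group_nsphere(1)[of 2] un_reduced_homology_group[of 2 "nsphere 2"]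
    by (metis iso_trans of_nat_numeral zero_neq_numeral)
  have H: "trivial_group (homology_group (int p) X)" if "p \<noteq> 0" "p \<noteq> 2" for p
  proof -
    have "trivial_group (homology_group (int p) (nsphere 2))"
      using reduced_homology_group_nsphere(2)[of "int p" 2] un_reduced_homology_group[of "int p" "nsphere 2"] that by simp
    then show ?thesis using isomorphic_group_triviality[OF iso] by simp
  qed
  have "free_rank (homology_group (int p) X) = (if p = 0 \<or> p = 2 then 1 else 0)" for p
    using free_rank_homology_trivial[OF H] free_rank_homology_integer[OF H0] free_rank_homology_integer[OF H2]
    by auto
  then have "{p. free_rank (homology_group (int p) X) \<noteq> 0} = {0, 2}"
    "\<And>p. p \<in> {0, 2} \<Longrightarrow> free_rank (homology_group (int p) X) = 1" by auto
  then show ?thesis by (simp add: euler_characteristic_def)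
qed

section \<open>Embeddings into the complex numbers\<close>

definition polys_over :: "'k::field set \<Rightarrow> 'k poly set" where
  "polys_over K = {p. \<forall>i. coeff p i \<in> K}"

lemma countable_polys_over:
  assumes "countable K"
  shows "countable (polys_over K)"
proof -
  have "polys_over K \<subseteq> Poly ` lists K"
  proof
    fix p assume p: "p \<in> polys_over K"
    then have "coeffs p \<in> lists K"
      by (cases "p = 0") (auto simp: polys_over_def coeffs_def in_lists_conv_set)
    then show "p \<in> Poly ` lists K" by (rule image_eqI[rotated]) simp
  qed
  then show ?thesis by (rule countable_subset) (intro countable_image countable_lists assms)
qed

locale embedded_field =
  fixes K :: "'k::field set" and \<sigma> :: "'k \<Rightarrow> complex"
  assumes emb: "complex_embedding K \<sigma>"
begin

lemma one_in: "1 \<in> K" and diff_in: "a \<in> K \<Longrightarrow> b \<in> K \<Longrightarrow> a - b \<in> K"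
  and mult_in: "a \<in> K \<Longrightarrow> b \<in> K \<Longrightarrow> a * b \<in> K" and inverse_in: "a \<in> K \<Longrightarrow> inverse a \<in> K"
  and sigma_1 [simp]: "\<sigma> 1 = 1" and sigma_add: "a \<in> K \<Longrightarrow> b \<in> K \<Longrightarrow> \<sigma> (a + b) = \<sigma> a + \<sigma> b"
  and sigma_mult: "a \<in> K \<Longrightarrow> b \<in> K \<Longrightarrow> \<sigma> (a * b) = \<sigma> a * \<sigma> b"
  using emb by (simp_all add: complex_embedding_def)

lemma zero_in: "0 \<in> K" using diff_in[OF one_in one_in] by simp

lemma uminus_in: "a \<in> K \<Longrightarrow> - a \<in> K" using diff_in[OF zero_in] by simp

lemma add_in: "a \<in> K \<Longrightarrow> b \<in> K \<Longrightarrow> a + b \<in> K" using diff_in[of a "- b"] uminus_in by simp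

lemma sigma_0 [simp]: "\<sigma> 0 = 0" using sigma_add[OF zero_in zero_in] by simp

lemma sigma_minus: "a \<in> K \<Longrightarrow> \<sigma> (- a) = - \<sigma> a"
  using sigma_add[of a "- a"] uminus_in by (simp add: eq_neg_iff_add_eq_0 add.commute)

lemma sigma_diff: "a \<in> K \<Longrightarrow> b \<in> K \<Longrightarrow> \<sigma> (a - b) = \<sigma> a - \<sigma> b"
  using sigma_add[of a "- b"] sigma_minus uminus_in by simp

lemma sigma_nz: "a \<in> K \<Longrightarrow> a \<noteq> 0 \<Longrightarrow> \<sigma> a \<noteq> 0"
  using sigma_mult[of a "inverse a"] inverse_in by auto

lemma sum_in: "(\<And>x. x \<in> A \<Longrightarrow> f x \<in> K) \<Longrightarrow> sum f A \<in> K"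
  by (induction A rule: infinite_finite_induct) (auto intro: zero_in add_in)

lemma sigma_sum: "(\<And>x. x \<in> A \<Longrightarrow> f x \<in> K) \<Longrightarrow> \<sigma> (sum f A) = (\<Sum>x\<in>A. \<sigma> (f x))"
  by (induction A rule: infinite_finite_induct) (simp_all add: sigma_add sum_in)

abbreviation "P \<equiv> polys_over K"
abbreviation "mp \<equiv> map_poly \<sigma>"

lemma poly_add_in: "p \<in> P \<Longrightarrow> q \<in> P \<Longrightarrow> p + q \<in> P"
  and poly_diff_in: "p \<in> P \<Longrightarrow> q \<in> P \<Longrightarrow> p - q \<in> P"
  and poly_mult_in: "p \<in> P \<Longrightarrow> q \<in> P \<Longrightarrow> p * q \<in> P"
  by (auto simp: polys_over_def coeff_mult intro: add_in diff_in mult_in sum_in)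

lemma poly_const_in: "a \<in> K \<Longrightarrow> [:a:] \<in> P" and poly_monom_in: "a \<in> K \<Longrightarrow> monom a i \<in> P"
  by (auto simp: polys_over_def coeff_pCons zero_in split: nat.split)

lemma poly_0_in: "0 \<in> P" by (simp add: polys_over_def zero_in)

lemma coeff_mp: "coeff (mp p) i = \<sigma> (coeff p i)" by (simp add: coeff_map_poly)

lemma mp_diff: "p \<in> P \<Longrightarrow> q \<in> P \<Longrightarrow> mp (p - q) = mp p - mp q"
  by (rule poly_eqI) (simp add: coeff_mp sigma_diff polys_over_def)

lemma mp_add: "p \<in> P \<Longrightarrow> q \<in> P \<Longrightarrow> mp (p + q) = mp p + mp q"
  by (rule poly_eqI) (simp add: coeff_mp sigma_add polys_over_def)

lemma mp_mult: "p \<in> P \<Longrightarrow> q \<in> P \<Longrightarrow> mp (p * q) = mp p * mp q"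
  by (rule poly_eqI) (simp add: coeff_mp coeff_mult sigma_sum sigma_mult mult_in polys_over_def)

lemma coeff_mp_nz: "p \<in> P \<Longrightarrow> coeff p i \<noteq> 0 \<Longrightarrow> coeff (mp p) i \<noteq> 0"
  by (simp add: coeff_mp polys_over_def sigma_nz)

lemma mp_nz: "p \<in> P \<Longrightarrow> p \<noteq> 0 \<Longrightarrow> mp p \<noteq> 0"
  using coeff_mp_nz[of p "degree p"] by auto

lemma degree_mp: "p \<in> P \<Longrightarrow> degree (mp p) = degree p"
  using coeff_mp_nz[of p "degree p"] map_poly_degree_leq[of \<sigma> p]
  by (cases "p = 0") (auto intro!: antisym le_degree)

text \<open>The usual division algorithm, carried out so that quotient and remainder keep their
  coefficients in K, where \<sigma> respects sums and products.\<close>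

lemma division:
  assumes m: "m \<in> P" "m \<noteq> 0"
  shows "p \<in> P \<Longrightarrow> \<exists>q r. q \<in> P \<and> r \<in> P \<and> p = m * q + r \<and> (r = 0 \<or> degree r < degree m)"
proof (induction "degree p" arbitrary: p rule: less_induct)
  case less
  show ?case
  proof (cases "p = 0 \<or> degree p < degree m")
    case True
    then show ?thesis using less.prems poly_0_in by (intro exI[of _ 0] exI[of _ p]) auto
  next
    case False
    define s where "s = monom (lead_coeff p * inverse (lead_coeff m)) (degree p - degree m)"
    have s: "s \<in> P" unfolding s_def
      using m less.prems by (intro poly_monom_in mult_in inverse_in) (auto simp: polys_over_def)
    define p' where "p' = p - m * s"
    have p': "p' \<in> P" unfolding p'_def by (intro poly_diff_in poly_mult_in less.prems m s)
    have "degree s \<le> degree p - degree m" by (simp add: s_def degree_monom_le)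
    then have "degree (m * s) \<le> degree p" using degree_mult_le[of m s] False by linarith
    moreover have "coeff (m * s) (degree p) = lead_coeff p"
      using False m by (simp add: s_def mult.commute[of m] coeff_monom_mult)
    ultimately have "p' = 0 \<or> degree p' < degree p"
      unfolding p'_def by (intro eq_zero_or_degree_less) (auto intro: degree_diff_le)
    then obtain q r where "q \<in> P" "r \<in> P" "p' = m * q + r" "r = 0 \<or> degree r < degree m"
      using less.hyps[OF _ p'] poly_0_in by (metis add.right_neutral mult_zero_right)
    then show ?thesis using s by (intro exI[of _ "q + s"] exI[of _ r])
        (auto simp: p'_def algebra_simps intro: poly_add_in)
  qed
qed

text \<open>If no nonzero polynomial over K vanishes at a, then b has to avoid the roots of
  countably many nonzero polynomials, and some real number does. Otherwise b is a root of the image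
  of a polynomial m of least degree vanishing at a.\<close>

lemma ex_matching_element:
  assumes "countable K"
  shows "\<exists>b. \<forall>p\<in>P. poly p a = 0 \<longleftrightarrow> poly (mp p) b = 0"
proof (cases "\<exists>p\<in>P. p \<noteq> 0 \<and> poly p a = 0")
  case False
  define B where "B = (\<Union>p\<in>P - {0}. {b. poly (mp p) b = 0})"
  have "countable B" unfolding B_def
    using countable_polys_over[OF assms] mp_nz
    by (intro countable_UN) (auto intro!: countable_finite poly_roots_finite)
  then have "countable {r::real. complex_of_real r \<in> B}"
    by (intro countable_image_inj_on[of complex_of_real, OF _ inj_onI])
      (auto intro: countable_subset[of _ B])
  then obtain r where r: "complex_of_real r \<notin> B"
    using uncountable_UNIV_real by (metis (mono_tags, lifting) UNIV_eq_I mem_Collect_eq)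
  show ?thesis
  proof (intro exI[of _ "complex_of_real r"] ballI)
    fix p assume "p \<in> P"
    then show "poly p a = 0 \<longleftrightarrow> poly (mp p) (complex_of_real r) = 0"
      using r False by (cases "p = 0") (auto simp: B_def)
  qed
next
  case True
  then obtain m where m: "m \<in> P" "m \<noteq> 0" "poly m a = 0"
    and min: "\<And>p. p \<in> P \<Longrightarrow> p \<noteq> 0 \<Longrightarrow> poly p a = 0 \<Longrightarrow> degree m \<le> degree p"
    using ex_has_least_nat[of "\<lambda>p. p \<in> P \<and> p \<noteq> 0 \<and> poly p a = 0" _ degree] by blast
  have "degree m \<noteq> 0"
    using m by (metis degree_eq_zeroE mult_zero_right pCons_0_0 poly_0 poly_pCons add.right_neutral)
  then have "degree (mp m) > 0" using m degree_mp by simp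
  then obtain b where b: "poly (mp m) b = 0" using alg_closed_imp_poly_has_root by blast
  \<comment> \<open>Divide m by p. A nonzero remainder does not vanish at b by induction, so neither
    does p. If p divides m, minimality of m forces the cofactor to have full degree, and p is a
    nonzero constant.\<close>
  have nz: "p \<in> P \<Longrightarrow> p \<noteq> 0 \<Longrightarrow> degree p < degree m \<Longrightarrow> poly (mp p) b \<noteq> 0" for p
  proof (induction "degree p" arbitrary: p rule: less_induct)
    case less
    obtain q r where qr: "q \<in> P" "r \<in> P" "m = p * q + r" "r = 0 \<or> degree r < degree p"
      using division[OF less.prems(1,2) m(1)] by blast
    have e: "poly (mp p) b * poly (mp q) b + poly (mp r) b = 0"
      using b qr less.prems by (simp add: mp_add mp_mult poly_mult_in)
    show ?case
    proof (cases "r = 0")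
      case False
      then have "poly (mp r) b \<noteq> 0" using qr less by auto
      then show ?thesis using e by auto
    next
      case True
      then have pq: "m = p * q" using qr by simp
      have "q \<noteq> 0" using pq m by auto
      have deg: "degree m = degree p + degree q" unfolding pq
        using \<open>q \<noteq> 0\<close> less.prems by (simp add: degree_mult_eq)
      have "poly p a \<noteq> 0" using min[of p] less.prems by auto
      then have "poly q a = 0" using m(3) pq by simp
      then have "degree p = 0" using min[of q] qr(1) \<open>q \<noteq> 0\<close> deg by auto
      then obtain c where c: "p = [:c:]" by (meson degree_eq_zeroE)
      then show ?thesis using less.prems coeff_mp_nz[of p 0] by (simp add: map_poly_pCons)
    qed
  qed
  show ?thesis
  proof (intro exI[of _ b] ballI)
    fix p assume p: "p \<in> P"
    obtain q r where qr: "q \<in> P" "r \<in> P" "p = m * q + r" "r = 0 \<or> degree r < degree m"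
      using division[OF m(1,2) p] by blast
    have 1: "poly p a = poly r a" using qr m by simp
    have 2: "poly (mp p) b = poly (mp r) b" using qr m b by (simp add: mp_add mp_mult poly_mult_in)
    show "poly p a = 0 \<longleftrightarrow> poly (mp p) b = 0"
      unfolding 1 2 using qr nz[of r] min[of r] by (cases "r = 0") auto
  qed
qed

text \<open>The extended field consists of the quotients p(a) / q(a), and such a quotient is sent to
  the quotient of the image polynomials at the matching element b. That polynomials vanish at a and
  at b simultaneously makes this well defined and keeps denominators nonzero. Countability is
  preserved, so the step can be iterated.\<close>

lemma adjoin_element:
  assumes "countable K"
  shows "\<exists>K' \<sigma>'. complex_embedding K' \<sigma>' \<and> countable K' \<and> insert a K \<subseteq> K'"
proof -
  obtain b where b: "\<And>p. p \<in> P \<Longrightarrow> poly p a = 0 \<longleftrightarrow> poly (mp p) b = 0"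
    using ex_matching_element[OF assms] by blast
  define D where "D = {(p, q). p \<in> P \<and> q \<in> P \<and> poly q a \<noteq> 0}"
  define f where "f = (\<lambda>(p, q). poly p a / poly q a)"
  define g where "g = (\<lambda>(p, q). poly (mp p) b / poly (mp q) b)"
  have welldef: "g x = g y" if "x \<in> D" "y \<in> D" "f x = f y" for x y
  proof -
    obtain p q r s where xy: "x = (p, q)" "y = (r, s)" by fastforce
    have in_P: "p \<in> P" "q \<in> P" "r \<in> P" "s \<in> P" and nz: "poly q a \<noteq> 0" "poly s a \<noteq> 0"
      using that by (auto simp: D_def xy)
    have nz': "poly (mp q) b \<noteq> 0" "poly (mp s) b \<noteq> 0" using b in_P nz by auto
    have "poly (p * s - r * q) a = 0" using that(3) nz by (simp add: f_def xy frac_eq_eq)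
    then have "poly (mp (p * s - r * q)) b = 0"
      using b in_P by (metis poly_diff_in poly_mult_in)
    then show ?thesis
      using nz' in_P by (simp add: g_def xy frac_eq_eq mp_diff mp_mult poly_mult_in)
  qed
  define \<sigma>' where "\<sigma>' t = g (SOME x. x \<in> D \<and> f x = t)" for t
  have val: "\<sigma>' (f x) = g x" if "x \<in> D" for x
    unfolding \<sigma>'_def using someI[of "\<lambda>y. y \<in> D \<and> f y = f x" x] that by (intro welldef) auto
  have one: "(1, 1) \<in> D" "f (1, 1) = 1" "g (1, 1) = 1"
    using poly_const_in[OF one_in] by (auto simp: D_def f_def g_def one_pCons map_poly_pCons)
  have ops: "\<exists>z\<in>D. f z = f x - f y" "\<exists>z\<in>D. f z = f x * f y \<and> g z = g x * g y"
    "\<exists>z\<in>D. f z = f x + f y \<and> g z = g x + g y" "\<exists>z\<in>D. f z = inverse (f x)"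
    if D: "x \<in> D" "y \<in> D" for x y
  proof -
    obtain p q r s where xy: "x = (p, q)" "y = (r, s)" by fastforce
    have in_P: "p \<in> P" "q \<in> P" "r \<in> P" "s \<in> P" and nz: "poly q a \<noteq> 0" "poly s a \<noteq> 0"
      using D by (auto simp: D_def xy)
    have nz': "poly (mp q) b \<noteq> 0" "poly (mp s) b \<noteq> 0" using b in_P nz by auto
    note closed = in_P poly_diff_in poly_add_in poly_mult_in
    show "\<exists>z\<in>D. f z = f x - f y"
      by (rule bexI[of _ "(p * s - r * q, q * s)"])
        (use nz in \<open>auto simp: D_def f_def xy field_simps intro!: closed\<close>)
    show "\<exists>z\<in>D. f z = f x * f y \<and> g z = g x * g y"
      by (rule bexI[of _ "(p * r, q * s)"])
        (use nz in_P in \<open>auto simp: D_def f_def g_def xy mp_mult intro!: closed\<close>)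
    show "\<exists>z\<in>D. f z = f x + f y \<and> g z = g x + g y"
      by (rule bexI[of _ "(p * s + r * q, q * s)"])
        (use nz nz' in_P in \<open>auto simp: D_def f_def g_def xy mp_mult mp_add poly_mult_in field_simps intro!: closed\<close>)
    show "\<exists>z\<in>D. f z = inverse (f x)"
    proof (cases "poly p a = 0")
      case True
      \<comment> \<open>Here f x = 0, whose inverse is 0 by convention, so x itself represents the
        inverse.\<close>
      then show ?thesis using D by (intro bexI[of _ x]) (auto simp: f_def xy)
    next
      case False
      then show ?thesis using in_P by (intro bexI[of _ "(q, p)"]) (auto simp: D_def f_def xy)
    qed
  qed
  have "complex_embedding (f ` D) \<sigma>'"
    unfolding complex_embedding_def
  proof (intro conjI ballI)
    show "1 \<in> f ` D" using one by force
    show "\<sigma>' 1 = 1" using val one by metis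
    fix u v assume "u \<in> f ` D" "v \<in> f ` D"
    then obtain x y where xy: "x \<in> D" "y \<in> D" "u = f x" "v = f y" by blast
    show "u - v \<in> f ` D" "u * v \<in> f ` D" using ops(1,2)[OF xy(1,2)] xy by (metis imageI)+
    show "inverse u \<in> f ` D" using ops(4)[OF xy(1,2)] xy by (metis imageI)
    show "\<sigma>' (u + v) = \<sigma>' u + \<sigma>' v" "\<sigma>' (u * v) = \<sigma>' u * \<sigma>' v"
      using ops(2,3)[OF xy(1,2)] val xy by metis+
  qed
  moreover have "countable (f ` D)"
    using countable_polys_over[OF assms]
    by (intro countable_image countable_subset[of D "P \<times> P"]) (auto simp: D_def)
  moreover have "x \<in> f ` D" if "x \<in> insert a K" for x
  proof -
    have "([:0, 1:], 1) \<in> D" "f ([:0, 1:], 1) = a"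
      using one by (auto simp: D_def f_def polys_over_def coeff_pCons zero_in one_in split: nat.split)
    moreover have "([:x:], 1) \<in> D" "f ([:x:], 1) = x" if "x \<in> K"
      using one poly_const_in[OF that] by (auto simp: D_def f_def)
    ultimately show ?thesis using that by (metis image_eqI insertE)
  qed
  ultimately show ?thesis by blast
qed

end

text \<open>\<open>chi_Gr\<close> chooses among the Euler characteristics over all fields of
  definition embedded into the complex numbers, so its value can be determined only once such an
  embedding is known to exist. The matrix entries, finite in number, are adjoined one by one to the
  rationals.\<close>

lemma ex_complex_embedding:
  fixes A :: "'k::field_char_0 set"
  assumes "finite A"
  shows "\<exists>K \<sigma>. complex_embedding K \<sigma> \<and> A \<subseteq> K"
proof -
  have "\<exists>K \<sigma>. complex_embedding K \<sigma> \<and> countable K \<and> A \<subseteq> K"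
    using assms
  proof (induction A)
    case empty
    define \<sigma> where "\<sigma> x = (of_rat (SOME r. x = of_rat r) :: complex)" for x :: 'k
    have \<sigma>: "\<sigma> (of_rat r) = of_rat r" for r
      unfolding \<sigma>_def by (rule someI2[of _ r]) auto
    have "complex_embedding \<rat> \<sigma>"
      unfolding complex_embedding_def
    proof (intro conjI ballI)
      show "\<sigma> 1 = 1" using \<sigma>[of 1] by simp
      fix a b :: 'k assume "a \<in> \<rat>" "b \<in> \<rat>"
      then obtain r s where ab: "a = of_rat r" "b = of_rat s" by (elim Rats_cases)
      show "\<sigma> (a + b) = \<sigma> a + \<sigma> b" "\<sigma> (a * b) = \<sigma> a * \<sigma> b"
        unfolding ab of_rat_add[symmetric] of_rat_mult[symmetric] \<sigma> by (rule refl)+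
    qed auto
    moreover have "countable (\<rat> :: 'k set)" by (simp add: Rats_def)
    ultimately show ?case by blast
  next
    case (insert a A)
    then obtain K \<sigma> where K: "complex_embedding K \<sigma>" "countable K" "A \<subseteq> K" by blast
    interpret embedded_field K \<sigma> by unfold_locales (rule K)
    show ?case using adjoin_element[OF K(2), of a] K(3) by blast
  qed
  then show ?thesis by blast
qed

section \<open>Generic representations\<close>

text \<open>Vectors of length two and \<open>2 \<times> 2\<close> matrices are given by their coordinate functions.\<close>

definition par :: "(nat \<Rightarrow> 'k::field) \<Rightarrow> (nat \<Rightarrow> 'k) \<Rightarrow> bool" where
  "par x y \<longleftrightarrow> x 0 * y 1 = x 1 * y 0"

definition nz2 :: "(nat \<Rightarrow> 'k::field) \<Rightarrow> bool" where
  "nz2 x \<longleftrightarrow> x 0 \<noteq> 0 \<or> x 1 \<noteq> 0"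

definition mul2 :: "(nat \<Rightarrow> nat \<Rightarrow> 'k::field) \<Rightarrow> (nat \<Rightarrow> 'k) \<Rightarrow> nat \<Rightarrow> 'k" where
  "mul2 A x r = A r 0 * x 0 + A r 1 * x 1"

definition det2 :: "(nat \<Rightarrow> nat \<Rightarrow> 'k::field) \<Rightarrow> 'k" where
  "det2 A = A 0 0 * A 1 1 - A 0 1 * A 1 0"

text \<open>Membership in a subspace of dimension \<open>e\<close> of a two-dimensional space, where \<open>w\<close> spans the
  subspace if \<open>e = 1\<close>.\<close>

definition lin2 :: "nat \<Rightarrow> (nat \<Rightarrow> 'k::field) \<Rightarrow> (nat \<Rightarrow> 'k) \<Rightarrow> bool" where
  "lin2 e w x \<longleftrightarrow> (e = 0 \<longrightarrow> x 0 = 0 \<and> x 1 = 0) \<and> (e = 1 \<longrightarrow> par x w)"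

lemma par_sym: "par x y \<Longrightarrow> par y x"
  by (simp add: par_def mult.commute)

lemma par_scale:
  assumes "par x y" "nz2 y"
  obtains c where "x 0 = c * y 0" "x 1 = c * y 1"
proof (cases "y 0 = 0")
  case True
  then show ?thesis using assms that[of "x 1 / y 1"] by (auto simp: par_def nz2_def)
next
  case False
  then show ?thesis using assms that[of "x 0 / y 0"] by (auto simp: par_def nz2_def field_simps)
qed

lemma par_trans:
  assumes "par x y" "par y z" "nz2 y"
  shows "par x z"
proof -
  obtain c where "x 0 = c * y 0" "x 1 = c * y 1" by (rule par_scale[OF assms(1,3)])
  then show ?thesis using assms(2) by (simp add: par_def mult.assoc)
qed

lemma par_mul2: "par x y \<Longrightarrow> par (mul2 A x) (mul2 A y)"
proof -
  assume "par x y"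
  then have e: "x 0 * y 1 = x 1 * y 0" by (simp add: par_def)
  have "mul2 A x 0 * mul2 A y 1 - mul2 A x 1 * mul2 A y 0 = (x 0 * y 1 - x 1 * y 0) * det2 A"
    by (simp add: mul2_def det2_def algebra_simps)
  then show ?thesis using e by (simp add: par_def)
qed

lemma par_mul2_iff:
  assumes "det2 A \<noteq> 0"
  shows "par (mul2 A x) (mul2 A y) \<longleftrightarrow> par x y"
proof -
  have "mul2 A x 0 * mul2 A y 1 - mul2 A x 1 * mul2 A y 0 = (x 0 * y 1 - x 1 * y 0) * det2 A"
    by (simp add: mul2_def det2_def algebra_simps)
  then show ?thesis using assms by (auto simp: par_def)
qed

lemma nz2_mul2:
  assumes "det2 A \<noteq> 0" "nz2 x"
  shows "nz2 (mul2 A x)"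
proof (rule ccontr)
  assume "\<not> nz2 (mul2 A x)"
  then have z: "mul2 A x 0 = 0" "mul2 A x 1 = 0" by (simp_all add: nz2_def)
  have "det2 A * x 0 = A 1 1 * mul2 A x 0 - A 0 1 * mul2 A x 1"
    "det2 A * x 1 = A 0 0 * mul2 A x 1 - A 1 0 * mul2 A x 0"
    by (simp_all add: mul2_def det2_def algebra_simps)
  then show False using assms z by (simp add: nz2_def)
qed

lemma mul2_surj:
  fixes y :: "nat \<Rightarrow> 'k::field"
  assumes "det2 A \<noteq> 0"
  obtains x where "mul2 A x 0 = y 0" "mul2 A x 1 = y 1"
proof
  define x where "x r = (if r = 0 then A 1 1 * y 0 - A 0 1 * y 1 else A 0 0 * y 1 - A 1 0 * y 0) / det2 A" for r :: nat
  have "mul2 A x 0 = det2 A * y 0 / det2 A" "mul2 A x 1 = det2 A * y 1 / det2 A"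
    by (simp_all add: x_def mul2_def det2_def diff_divide_distrib[symmetric] add_divide_distrib[symmetric] algebra_simps)
  then show "mul2 A x 0 = y 0" "mul2 A x 1 = y 1" using assms by simp_all
qed

lemma lin2_cong: "x 0 = y 0 \<Longrightarrow> x 1 = y 1 \<Longrightarrow> lin2 e w x \<longleftrightarrow> lin2 e w y"
  by (simp add: lin2_def par_def)

lemma lin2_step:
  assumes det: "det2 A \<noteq> 0" and w: "e = 1 \<Longrightarrow> nz2 w" "e' = 1 \<Longrightarrow> nz2 w'" and e: "e \<le> 2" "e' \<le> 2"
  shows "(\<forall>x. lin2 e w x \<longrightarrow> lin2 e' w' (mul2 A x)) \<longleftrightarrow> e \<le> e' \<and> (e = 1 \<and> e' = 1 \<longrightarrow> par (mul2 A w) w')"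
    (is "?L \<longleftrightarrow> ?R")
proof
  assume L: ?L
  have 1: "lin2 e' w' (mul2 A w)" if "e \<ge> 1" using L that e by (auto simp: lin2_def par_def)
  show ?R
  proof (intro conjI impI)
    assume "e = 1 \<and> e' = 1"
    then show "par (mul2 A w) w'" using 1 by (simp add: lin2_def)
  next
    show "e \<le> e'"
    proof (rule ccontr)
      assume "\<not> e \<le> e'"
      then consider "e = 1" "e' = 0" | "e = 2" "e' \<le> 1" using e by linarith
      then show False
      proof cases
        case 1
        then show False using \<open>e \<ge> 1 \<Longrightarrow> lin2 e' w' (mul2 A w)\<close> nz2_mul2[OF det w(1)] by (simp add: lin2_def nz2_def)
      next
        case 2
        have "lin2 e' w' (mul2 A (\<lambda>r. if r = 0 then 1 else 0))" "lin2 e' w' (mul2 A (\<lambda>r. if r = 0 then 0 else 1))"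
          using L 2 by (simp_all add: lin2_def)
        then have "lin2 e' w' (\<lambda>r. A r 0)" "lin2 e' w' (\<lambda>r. A r 1)"
          by (simp_all add: mul2_def lin2_def par_def)
        \<comment> \<open>Both columns of A lie in a subspace of dimension at most 1. If that
          subspace is 0, any nonzero vector can serve in place of w'; in either case the columns are
          parallel, against the invertibility of A.\<close>
        then have l: "lin2 1 w'' (\<lambda>r. A r 0)" "lin2 1 w'' (\<lambda>r. A r 1)" "nz2 w''"
          if "w'' = (if e' = 0 then (\<lambda>_. 1) else w')" for w''
          using that 2 w(2) by (auto simp: lin2_def par_def nz2_def split: if_splits)
        obtain w'' where w'': "w'' = (if e' = 0 then (\<lambda>_. 1) else w')" by blast
        have "par (\<lambda>r. A r 0) (\<lambda>r. A r 1)"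
          using par_trans[OF _ par_sym] l[OF w''] by (auto simp: lin2_def)
        then show False using det by (simp add: par_def det2_def mult.commute)
      qed
    qed
  qed
next
  assume R: ?R
  show ?L
  proof (intro allI impI)
    fix x assume x: "lin2 e w x"
    show "lin2 e' w' (mul2 A x)"
    proof (cases "e = 0")
      case True
      then show ?thesis using x by (auto simp: lin2_def mul2_def par_def)
    next
      case False
      show ?thesis
      proof (cases "e' = 1")
        case True
        then have "e = 1" using R False by simp
        then have "par (mul2 A x) (mul2 A w)" using x by (simp add: lin2_def par_mul2)
        then show ?thesis
          using R True \<open>e = 1\<close> nz2_mul2[OF det w(1)] par_trans by (fastforce simp: lin2_def)
      next
        case False
        then show ?thesis using R \<open>e \<noteq> 0\<close> by (simp add: lin2_def)
      qed
    qed
  qed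
qed

lemma nz2_functionals:
  fixes f g z :: "nat \<Rightarrow> 'k::field"
  assumes "f 0 * g 1 - f 1 * g 0 \<noteq> 0" and "f 0 * z 0 + f 1 * z 1 = 0" "g 0 * z 0 + g 1 * z 1 = 0"
  shows "\<not> nz2 z"
proof -
  have "(f 0 * g 1 - f 1 * g 0) * z 0 = g 1 * (f 0 * z 0 + f 1 * z 1) - f 1 * (g 0 * z 0 + g 1 * z 1)"
    "(f 0 * g 1 - f 1 * g 0) * z 1 = f 0 * (g 0 * z 0 + g 1 * z 1) - g 0 * (f 0 * z 0 + f 1 * z 1)"
    by (simp_all add: algebra_simps)
  then have "(f 0 * g 1 - f 1 * g 0) * z 0 = 0" "(f 0 * g 1 - f 1 * g 0) * z 1 = 0"
    unfolding assms(2,3) by simp_all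
  then show ?thesis using assms(1) by (simp add: nz2_def)
qed

text \<open>The image in \<open>M\<^bsub>i+2\<^esub>\<close> of the vector \<open>z\<close> of \<open>M\<^sub>2\<close>, for modules with \<open>dim M\<^sub>k = 2\<close> for
  \<open>2 \<le> k \<le> n - 2\<close>.\<close>

fun chain :: "'k::field qmod \<Rightarrow> (nat \<Rightarrow> 'k) \<Rightarrow> nat \<Rightarrow> nat \<Rightarrow> 'k" where
  "chain M z 0 = z"
| "chain M z (Suc i) = mul2 (\<lambda>r c. act M (i + 3, i + 2) $$ (r, c)) (chain M z i)"

text \<open>The functional on \<open>M\<^sub>2\<close> whose kernel is the line attached to an extending vertex: the image of
  \<open>M\<^sub>u\<close> for \<open>u \<in> {0, 1}\<close> and the kernel of the map to \<open>M\<^sub>u\<close> for \<open>u \<in> {n - 1, n}\<close>.\<close>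

definition end_fun :: "nat \<Rightarrow> 'k::field qmod \<Rightarrow> nat \<Rightarrow> nat \<Rightarrow> 'k" where
  "end_fun n M u c = (if u \<le> 1 then (if c = 0 then - act M (2, u) $$ (1, 0) else act M (2, u) $$ (0, 0))
     else (let z = chain M (\<lambda>r. if r = c then 1 else 0) (n - 4) in
       act M (u, n - 2) $$ (0, 0) * z 0 + act M (u, n - 2) $$ (0, 1) * z 1))"

text \<open>The maps between the planes are invertible, so all conditions can be transported to M at
  vertex 2, where the four extending vertices mark lines. The nonvanishing of the determinant for
  every pair says at once that each functional is nonzero and that no two of the lines
  coincide.\<close>

definition generic_module :: "nat \<Rightarrow> 'k::field qmod \<Rightarrow> bool" where
  "generic_module n M \<longleftrightarrow> n \<ge> 4 \<and> is_qmod (Dtilde n) M \<and> (\<forall>v\<le>n. dimv M v = delta n v) \<and>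
     (\<forall>k. 2 \<le> k \<and> k \<le> n - 3 \<longrightarrow> det2 (\<lambda>r c. act M (k + 1, k) $$ (r, c)) \<noteq> 0) \<and>
     (\<forall>u\<in>{0, 1, n - 1, n}. \<forall>v\<in>{0, 1, n - 1, n}. u \<noteq> v \<longrightarrow>
        end_fun n M u 0 * end_fun n M v 1 - end_fun n M u 1 * end_fun n M v 0 \<noteq> 0)"

lemma chain_linear:
  "chain M (\<lambda>r. a * x r + b * y r) i r = a * chain M x i r + b * chain M y i r"
  by (induction i arbitrary: r) (simp_all add: mul2_def algebra_simps)

lemma chain_cong: "z 0 = z' 0 \<Longrightarrow> z 1 = z' 1 \<Longrightarrow> r \<le> 1 \<Longrightarrow> chain M z i r = chain M z' i r"
  by (induction i arbitrary: r) (auto simp: mul2_def le_Suc_eq)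

lemma chain_basis:
  assumes "r \<le> 1"
  shows "chain M z i r = z 0 * chain M (\<lambda>r. if r = 0 then 1 else 0) i r + z 1 * chain M (\<lambda>r. if r = 1 then 1 else 0) i r"
  unfolding chain_linear[symmetric] by (rule chain_cong) (use assms in simp_all)

lemma end_fun_right:
  assumes "u > 1"
  shows "end_fun n M u 0 * z 0 + end_fun n M u 1 * z 1 =
    act M (u, n - 2) $$ (0, 0) * chain M z (n - 4) 0 + act M (u, n - 2) $$ (0, 1) * chain M z (n - 4) 1"
  using assms chain_basis[of 0 M z "n - 4"] chain_basis[of 1 M z "n - 4"]
  by (simp add: end_fun_def Let_def algebra_simps)

lemma end_fun_left:
  assumes "u \<le> 1"
  shows "end_fun n M u 0 * z 0 + end_fun n M u 1 * z 1 = 0 \<longleftrightarrow> par (\<lambda>r. act M (2, u) $$ (r, 0)) z"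
  using assms by (auto simp: end_fun_def par_def algebra_simps)

locale generic_rep =
  fixes n :: nat and M :: "'k::field qmod"
  assumes generic: "generic_module n M"
begin

abbreviation "Q \<equiv> Dtilde n"

lemma n: "n \<ge> 4" and qmod: "is_qmod Q M" and dims: "v \<le> n \<Longrightarrow> dimv M v = delta n v"
  and det: "2 \<le> k \<Longrightarrow> k \<le> n - 3 \<Longrightarrow> det2 (\<lambda>r c. act M (k + 1, k) $$ (r, c)) \<noteq> 0"
  and ends: "u \<in> {0, 1, n - 1, n} \<Longrightarrow> v \<in> {0, 1, n - 1, n} \<Longrightarrow> u \<noteq> v \<Longrightarrow>
        end_fun n M u 0 * end_fun n M v 1 - end_fun n M u 1 * end_fun n M v 0 \<noteq> 0"
  using generic unfolding generic_module_def by blast+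

lemma delta_mid: "2 \<le> v \<Longrightarrow> v \<le> n - 2 \<Longrightarrow> delta n v = 2"
  using n by (auto simp: delta_def)

lemma delta_end: "v \<in> {0, 1, n - 1, n} \<Longrightarrow> delta n v = 1"
  by (simp add: delta_def)

lemma vert_cases: "v \<le> n \<Longrightarrow> v \<in> {0, 1, n - 1, n} \<or> 2 \<le> v \<and> v \<le> n - 2"
  by auto

lemma nz2_end_fun: "u \<in> {0, 1, n - 1, n} \<Longrightarrow> nz2 (end_fun n M u)"
  using ends[of u 0] ends[of u 1] by (cases "u = 0") (auto simp: nz2_def)

lemma nz2_chain: "nz2 z \<Longrightarrow> i \<le> n - 4 \<Longrightarrow> nz2 (chain M z i)"
proof (induction i)
  case (Suc i)
  then show ?case using nz2_mul2[OF det[of "i + 2"]] n by (simp add: numeral_eq_Suc)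
qed simp

lemma par_chain_iff: "i \<le> n - 4 \<Longrightarrow> par (chain M z i) (chain M z' i) \<longleftrightarrow> par z z'"
proof (induction i)
  case (Suc i)
  then show ?case using par_mul2_iff[OF det[of "i + 2"]] n by (simp add: numeral_eq_Suc)
qed simp

lemma chain_surj:
  fixes y :: "nat \<Rightarrow> 'k"
  assumes "i \<le> n - 4"
  shows "\<exists>z. chain M z i 0 = y 0 \<and> chain M z i 1 = y 1"
  using assms
proof (induction i arbitrary: y)
  case 0
  show ?case by (rule exI[of _ y]) simp
next
  case (Suc i)
  then have "det2 (\<lambda>r c. act M (i + 3, i + 2) $$ (r, c)) \<noteq> 0" using det[of "i + 2"] n by (simp add: numeral_eq_Suc)
  then obtain x where x: "mul2 (\<lambda>r c. act M (i + 3, i + 2) $$ (r, c)) x 0 = y 0"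
    "mul2 (\<lambda>r c. act M (i + 3, i + 2) $$ (r, c)) x 1 = y 1" by (rule mul2_surj)
  obtain z where "chain M z i 0 = x 0" "chain M z i 1 = x 1" using Suc by auto
  then show ?case using x by (intro exI[of _ z]) (simp add: mul2_def)
qed

section \<open>Families of subspaces described by dimensions and directions\<close>

definition sub_vecs :: "(nat \<Rightarrow> nat) \<Rightarrow> (nat \<Rightarrow> nat \<Rightarrow> 'k) \<Rightarrow> nat \<Rightarrow> 'k vec set" where
  "sub_vecs e w v = (if v \<le> n then {y \<in> carrier_vec (delta n v).
     if 2 \<le> v \<and> v \<le> n - 2 then lin2 (e v) (w v) (\<lambda>r. y $ r) else e v = 0 \<longrightarrow> y $ 0 = 0} else {})"

text \<open>A standard frame: the direction w v for a line in a plane, the unit columns for a whole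
  plane, and the entry 1 at an extending vertex. It shows that every family
  \<open>sub_vecs e w\<close> is spanned by a frame.\<close>

definition sub_frame :: "(nat \<Rightarrow> nat) \<Rightarrow> (nat \<Rightarrow> nat \<Rightarrow> 'k) \<Rightarrow> nat \<times> nat \<times> nat \<Rightarrow> 'k" where
  "sub_frame e w = restrict (\<lambda>(v, r, c). if 2 \<le> v \<and> v \<le> n - 2 then if e v = 1 then w v r else if r = c then 1 else 0
     else 1) (frame_index Q M e)"

lemma frame_mult:
  assumes "x \<in> carrier_vec (e v)" "r < dimv M v"
  shows "(frame_mat M e F v *\<^sub>v x) $ r = (\<Sum>c<e v. F (v, r, c) * x $ c)"
  using assms by (simp add: frame_mat_def scalar_prod_def lessThan_atLeast0)

lemma mem_frame_span:
  assumes "v \<le> n"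
  shows "y \<in> frame_span Q M e F v \<longleftrightarrow>
    y \<in> carrier_vec (delta n v) \<and> (\<exists>x::nat \<Rightarrow> 'k. \<forall>r<delta n v. y $ r = (\<Sum>c<e v. F (v, r, c) * x c))"
proof
  assume "y \<in> frame_span Q M e F v"
  then obtain x where x: "x \<in> carrier_vec (e v)" "y = frame_mat M e F v *\<^sub>v x"
    using assms by (auto simp: frame_span_def verts_Dtilde)
  have "y \<in> carrier_vec (delta n v)"
    unfolding x(2) by (rule carrier_vecI) (use assms in \<open>simp add: frame_mat_def dims\<close>)
  moreover have "y $ r = (\<Sum>c<e v. F (v, r, c) * x $ c)" if "r < delta n v" for r
    unfolding x(2) by (rule frame_mult) (use x assms that dims in auto)
  ultimately show "y \<in> carrier_vec (delta n v) \<and> (\<exists>x::nat \<Rightarrow> 'k. \<forall>r<delta n v. y $ r = (\<Sum>c<e v. F (v, r, c) * x c))"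
    by (intro conjI exI[of _ "\<lambda>c. x $ c"] allI impI)
next
  assume "y \<in> carrier_vec (delta n v) \<and> (\<exists>x::nat \<Rightarrow> 'k. \<forall>r<delta n v. y $ r = (\<Sum>c<e v. F (v, r, c) * x c))"
  then have y: "y \<in> carrier_vec (delta n v)"
    and "\<exists>x::nat \<Rightarrow> 'k. \<forall>r<delta n v. y $ r = (\<Sum>c<e v. F (v, r, c) * x c)" by (rule conjunct1, rule conjunct2)
  from this(2) obtain x :: "nat \<Rightarrow> 'k" where x: "\<forall>r<delta n v. y $ r = (\<Sum>c<e v. F (v, r, c) * x c)" ..
  have "y = frame_mat M e F v *\<^sub>v vec (e v) x"
  proof (rule eq_vecI)
    fix r assume "r < dim_vec (frame_mat M e F v *\<^sub>v vec (e v) x)"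
    then have r: "r < dimv M v" by (simp add: frame_mat_def)
    show "y $ r = (frame_mat M e F v *\<^sub>v vec (e v) x) $ r"
      using r assms by (subst frame_mult) (auto simp: x dims)
  qed (use y assms in \<open>simp add: frame_mat_def dims\<close>)
  then have "y \<in> (\<lambda>x. frame_mat M e F v *\<^sub>v x) ` carrier_vec (e v)" by (rule image_eqI) simp
  then show "y \<in> frame_span Q M e F v"
    using assms by (simp add: frame_span_def verts_Dtilde)
qed

lemma frame_inj_iff:
  assumes v: "v \<le> n"
  shows "inj_on (\<lambda>x. frame_mat M e F v *\<^sub>v x) (carrier_vec (e v)) \<longleftrightarrow>
    (\<forall>x::nat \<Rightarrow> 'k. (\<forall>r<delta n v. (\<Sum>c<e v. F (v, r, c) * x c) = 0) \<longrightarrow> (\<forall>c<e v. x c = 0))"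
proof
  assume inj: "inj_on (\<lambda>x. frame_mat M e F v *\<^sub>v x) (carrier_vec (e v))"
  show "\<forall>x::nat \<Rightarrow> 'k. (\<forall>r<delta n v. (\<Sum>c<e v. F (v, r, c) * x c) = 0) \<longrightarrow> (\<forall>c<e v. x c = 0)"
  proof (intro allI impI)
    fix x :: "nat \<Rightarrow> 'k" and c
    assume x: "\<forall>r<delta n v. (\<Sum>c<e v. F (v, r, c) * x c) = 0" and c: "c < e v"
    have "frame_mat M e F v *\<^sub>v vec (e v) x = frame_mat M e F v *\<^sub>v 0\<^sub>v (e v)"
    proof (rule eq_vecI)
      fix r assume "r < dim_vec (frame_mat M e F v *\<^sub>v 0\<^sub>v (e v))"
      then have "r < dimv M v" by (simp add: frame_mat_def)
      then show "(frame_mat M e F v *\<^sub>v vec (e v) x) $ r = (frame_mat M e F v *\<^sub>v 0\<^sub>v (e v)) $ r"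
        using x v by (subst (1 2) frame_mult) (auto simp: dims)
    qed simp
    then have "vec (e v) x = 0\<^sub>v (e v)" using inj by (auto dest: inj_onD)
    then show "x c = 0" using c by (metis index_vec index_zero_vec(1))
  qed
next
  assume h: "\<forall>x::nat \<Rightarrow> 'k. (\<forall>r<delta n v. (\<Sum>c<e v. F (v, r, c) * x c) = 0) \<longrightarrow> (\<forall>c<e v. x c = 0)"
  show "inj_on (\<lambda>x. frame_mat M e F v *\<^sub>v x) (carrier_vec (e v))"
  proof (rule inj_onI)
    fix x y :: "'k vec" assume xy: "x \<in> carrier_vec (e v)" "y \<in> carrier_vec (e v)"
      and eq: "frame_mat M e F v *\<^sub>v x = frame_mat M e F v *\<^sub>v y"
    have "(\<Sum>c<e v. F (v, r, c) * (x $ c - y $ c)) = 0" if "r < delta n v" for r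
      using arg_cong[OF eq, of "\<lambda>u. vec_index u r"] that v xy
      by (simp add: frame_mult dims right_diff_distrib sum_subtractf)
    then have "\<forall>c<e v. x $ c - y $ c = 0" using h[rule_format, of "\<lambda>c. x $ c - y $ c"] by blast
    then show "x = y" using xy by (intro eq_vecI) auto
  qed
qed

end

context generic_rep begin

lemma sum_less_1_2: "(\<Sum>c<(1::nat). f c) = f 0" "(\<Sum>c<(2::nat). f c) = f 0 + f 1"
  by (simp_all add: lessThan_Suc numeral_2_eq_2 add.commute)

lemma all_less_2: "(\<forall>r<(2::nat). R r) \<longleftrightarrow> R 0 \<and> R 1"
  by (auto simp: less_2_cases_iff)

text \<open>An injective frame spans 0, a line or the whole space at v. Only a line in a plane
  depends on the frame, and it does so through the first column, whence the directions F (v, r,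
  0).\<close>

lemma span_of_inj:
  assumes v: "v \<le> n" and e: "e v \<le> delta n v"
    and inj: "inj_on (\<lambda>x. frame_mat M e F v *\<^sub>v x) (carrier_vec (e v))"
  shows "frame_span Q M e F v = sub_vecs e (\<lambda>v r. F (v, r, 0)) v"
    and "2 \<le> v \<Longrightarrow> v \<le> n - 2 \<Longrightarrow> e v = 1 \<Longrightarrow> nz2 (\<lambda>r. F (v, r, 0))"
proof -
  let ?w = "\<lambda>r. F (v, r, 0)"
  have ker: "\<forall>c<e v. x c = 0" if "\<forall>r<delta n v. (\<Sum>c<e v. F (v, r, c) * x c) = 0" for x :: "nat \<Rightarrow> 'k"
    using inj that unfolding frame_inj_iff[OF v] by simp
  have nz: "nz2 ?w" if mid: "2 \<le> v" "v \<le> n - 2" "e v = 1"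
  proof (rule ccontr)
    assume "\<not> nz2 ?w"
    then have "\<forall>c<e v. (1::'k) = 0"
      using ker[of "\<lambda>_. 1"] mid by (simp add: delta_mid sum_less_1_2 nz2_def all_less_2)
    then show False using mid(3) by (auto dest: spec[of _ 0])
  qed
  then show "2 \<le> v \<Longrightarrow> v \<le> n - 2 \<Longrightarrow> e v = 1 \<Longrightarrow> nz2 ?w" .
  have iff: "(\<exists>x::nat \<Rightarrow> 'k. \<forall>r<delta n v. y $ r = (\<Sum>c<e v. F (v, r, c) * x c)) \<longleftrightarrow>
      (if 2 \<le> v \<and> v \<le> n - 2 then lin2 (e v) ?w (\<lambda>r. y $ r) else e v = 0 \<longrightarrow> y $ 0 = 0)" for y :: "'k vec"
  proof (cases "2 \<le> v \<and> v \<le> n - 2")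
    case True
    then have d: "delta n v = 2" by (simp add: delta_mid)
    consider "e v = 0" | "e v = 1" | "e v = 2" using e d by linarith
    then show ?thesis
    proof cases
      case 1
      then show ?thesis using True by (simp add: d all_less_2 lin2_def)
    next
      case 2
      have "(\<exists>x::nat \<Rightarrow> 'k. y $ 0 = ?w 0 * x 0 \<and> y $ 1 = ?w 1 * x 0) \<longleftrightarrow> par (\<lambda>r. y $ r) ?w"
      proof
        assume pw: "par (\<lambda>r. y $ r) ?w"
        have "nz2 ?w" using nz True 2 by simp
        from pw this obtain c where "y $ 0 = c * ?w 0" "y $ 1 = c * ?w 1" by (rule par_scale)
        then show "\<exists>x::nat \<Rightarrow> 'k. y $ 0 = ?w 0 * x 0 \<and> y $ 1 = ?w 1 * x 0"
          by (intro exI[of _ "\<lambda>_. c"]) (simp add: mult.commute)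
      next
        assume "\<exists>x::nat \<Rightarrow> 'k. y $ 0 = ?w 0 * x 0 \<and> y $ 1 = ?w 1 * x 0"
        then obtain x :: "nat \<Rightarrow> 'k" where "y $ 0 = ?w 0 * x 0" "y $ 1 = ?w 1 * x 0" by (elim exE conjE)
        then show "par (\<lambda>r. y $ r) ?w" by (simp add: par_def)
      qed
      then show ?thesis using True 2 by (simp add: d all_less_2 lin2_def sum_less_1_2)
    next
      case 3
      define A where "A r c = F (v, r, c)" for r c
      have ker2: "x 0 = 0 \<and> x 1 = 0" if "mul2 A x 0 = 0" "mul2 A x 1 = 0" for x
        using ker[of x] that 3 by (simp add: d all_less_2 sum_less_1_2 mul2_def A_def)
      have "det2 A \<noteq> 0"
      proof
        assume det: "det2 A = 0"
        \<comment> \<open>If the determinant vanishes, (A 0 1, - A 0 0) and (A 1 1, - A 1 0) are in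
          the kernel. Injectivity then makes every entry 0, and the vector (1, 1) contradicts
          it.\<close>
        have "A 0 1 = 0 \<and> - A 0 0 = 0"
          using ker2[of "\<lambda>r. if r = 0 then A 0 1 else - A 0 0"] det
          by (simp add: mul2_def det2_def algebra_simps)
        moreover have "A 1 1 = 0 \<and> - A 1 0 = 0"
          using ker2[of "\<lambda>r. if r = 0 then A 1 1 else - A 1 0"] det
          by (simp add: mul2_def det2_def algebra_simps)
        ultimately show False using ker2[of "\<lambda>_. 1"] by (simp add: mul2_def)
      qed
      then obtain x where "mul2 A x 0 = y $ 0" "mul2 A x 1 = y $ 1" by (rule mul2_surj)
      then have "\<forall>r<delta n v. y $ r = (\<Sum>c<e v. F (v, r, c) * x c)"
        using 3 by (simp add: d all_less_2 sum_less_1_2 mul2_def A_def)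
      then show ?thesis using 3 True by (auto simp: lin2_def)
    qed
  next
    case False
    then have d: "delta n v = 1" using vert_cases[OF v] delta_end by blast
    consider "e v = 0" | "e v = 1" using e d by linarith
    then show ?thesis
    proof cases
      case 1
      then show ?thesis unfolding if_not_P[OF False] by (simp add: d)
    next
      case 2
      then have "F (v, 0, 0) \<noteq> 0" using ker[of "\<lambda>_. 1"] by (auto simp: d sum_less_1_2)
      then have "\<forall>r<delta n v. y $ r = (\<Sum>c<e v. F (v, r, c) * (\<lambda>_. y $ 0 / F (v, 0, 0)) c)"
        using 2 by (simp add: d sum_less_1_2)
      then have "\<exists>x::nat \<Rightarrow> 'k. \<forall>r<delta n v. y $ r = (\<Sum>c<e v. F (v, r, c) * x c)"
        by (rule exI[where x = "\<lambda>_. y $ 0 / F (v, 0, 0)"])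
      then show ?thesis unfolding if_not_P[OF False] using 2 by simp
    qed
  qed
  show "frame_span Q M e F v = sub_vecs e (\<lambda>v r. F (v, r, 0)) v"
    by (rule Set.set_eqI) (unfold mem_frame_span[OF v] iff, simp add: sub_vecs_def v)
qed

lemma arrows_ball: "(\<forall>(i, l)\<in>arrows Q. R i l) \<longleftrightarrow>
    (\<forall>k. 2 \<le> k \<and> k \<le> n - 3 \<longrightarrow> R (k + 1) k) \<and> (\<forall>t\<in>{0, 1}. R 2 t) \<and> (\<forall>b\<in>{n - 1, n}. R b (n - 2))"
  unfolding Dtilde_def by auto

text \<open>The submodule condition arrow by arrow: inequalities of dimensions, plus incidences that
  enter where a line meets another line or an end. Directions enter only at vertices with e v =
  1.\<close>

definition valid_sub :: "(nat \<Rightarrow> nat) \<Rightarrow> (nat \<Rightarrow> nat \<Rightarrow> 'k) \<Rightarrow> bool" where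
  "valid_sub e w \<longleftrightarrow>
    (\<forall>k. 2 \<le> k \<and> k \<le> n - 3 \<longrightarrow> e k \<le> e (k + 1) \<and>
      (e k = 1 \<and> e (k + 1) = 1 \<longrightarrow> par (mul2 (\<lambda>r c. act M (k + 1, k) $$ (r, c)) (w k)) (w (k + 1)))) \<and>
    (\<forall>t\<in>{0, 1}. e t = 1 \<longrightarrow> e 2 \<ge> 1 \<and> (e 2 = 1 \<longrightarrow> par (\<lambda>r. act M (2, t) $$ (r, 0)) (w 2))) \<and>
    (\<forall>b\<in>{n - 1, n}. e b = 0 \<longrightarrow> e (n - 2) \<le> 1 \<and> (e (n - 2) = 1 \<longrightarrow>
      act M (b, n - 2) $$ (0, 0) * w (n - 2) 0 + act M (b, n - 2) $$ (0, 1) * w (n - 2) 1 = 0))"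

lemma act_carrier:
  assumes "(i, l) \<in> arrows Q"
  shows "act M (i, l) \<in> carrier_mat (delta n i) (delta n l)"
proof -
  have "i \<le> n" "l \<le> n" using Dtilde_arrow_cases[OF n assms] by auto
  then show ?thesis using qmod assms dims by (auto simp: is_qmod_def)
qed

lemma arrow_in: "2 \<le> k \<Longrightarrow> k \<le> n - 3 \<Longrightarrow> (k + 1, k) \<in> arrows Q" "t \<in> {0, 1} \<Longrightarrow> (2, t) \<in> arrows Q"
  "b \<in> {n - 1, n} \<Longrightarrow> (b, n - 2) \<in> arrows Q"
  by (auto simp: Dtilde_def)

lemma left_nz: "t \<in> {0, 1} \<Longrightarrow> nz2 (\<lambda>r. act M (2, t) $$ (r, 0))"
  using nz2_end_fun[of t] by (auto simp: nz2_def end_fun_def)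

lemma right_nz:
  assumes "b \<in> {n - 1, n}"
  shows "act M (b, n - 2) $$ (0, 0) \<noteq> 0 \<or> act M (b, n - 2) $$ (0, 1) \<noteq> 0"
proof -
  have "\<not> b \<le> 1" "b \<in> {0, 1, n - 1, n}" using assms n by auto
  then show ?thesis using nz2_end_fun[of b] by (auto simp: nz2_def end_fun_def Let_def)
qed

lemma act_mult:
  assumes "(i, l) \<in> arrows Q" "x \<in> carrier_vec (delta n l)" "r < delta n i"
  shows "(act M (i, l) *\<^sub>v x) $ r = (\<Sum>c<delta n l. act M (i, l) $$ (r, c) * x $ c)"
  using act_carrier[OF assms(1)] assms(2,3) by (simp add: scalar_prod_def lessThan_atLeast0)

lemma lin2_functional:
  fixes f :: "nat \<Rightarrow> 'k"
  assumes e: "e \<le> 2" and w: "e = 1 \<Longrightarrow> nz2 w" and f: "nz2 f"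
  shows "(\<forall>x. lin2 e w x \<longrightarrow> f 0 * x 0 + f 1 * x 1 = 0) \<longleftrightarrow> e \<le> 1 \<and> (e = 1 \<longrightarrow> f 0 * w 0 + f 1 * w 1 = 0)"
proof
  assume L: "\<forall>x. lin2 e w x \<longrightarrow> f 0 * x 0 + f 1 * x 1 = 0"
  have "e \<noteq> 2"
  proof
    assume "e = 2"
    then have "f 0 * x 0 + f 1 * x 1 = 0" for x :: "nat \<Rightarrow> 'k" using L by (simp add: lin2_def)
    from this[of "\<lambda>r. if r = 0 then 1 else 0"] this[of "\<lambda>r. if r = 0 then 0 else 1"]
    show False using f by (simp add: nz2_def)
  qed
  moreover have "f 0 * w 0 + f 1 * w 1 = 0" if "e = 1"
    using L that by (simp add: lin2_def par_def)
  ultimately show "e \<le> 1 \<and> (e = 1 \<longrightarrow> f 0 * w 0 + f 1 * w 1 = 0)" using e by linarith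
next
  assume R: "e \<le> 1 \<and> (e = 1 \<longrightarrow> f 0 * w 0 + f 1 * w 1 = 0)"
  show "\<forall>x. lin2 e w x \<longrightarrow> f 0 * x 0 + f 1 * x 1 = 0"
  proof (intro allI impI)
    fix x assume x: "lin2 e w x"
    show "f 0 * x 0 + f 1 * x 1 = 0"
    proof (cases "e = 0")
      case True
      then show ?thesis using x by (simp add: lin2_def)
    next
      case False
      then have "e = 1" using R by simp
      then have "par x w" using x by (simp add: lin2_def)
      then obtain c where c: "x 0 = c * w 0" "x 1 = c * w 1" using par_scale w[OF \<open>e = 1\<close>] by metis
      have "f 0 * x 0 + f 1 * x 1 = c * (f 0 * w 0 + f 1 * w 1)" unfolding c by (simp add: algebra_simps)
      then show ?thesis using R \<open>e = 1\<close> by simp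
    qed
  qed
qed

lemma mem_sub_vecs_mid: "2 \<le> v \<Longrightarrow> v \<le> n - 2 \<Longrightarrow>
    x \<in> sub_vecs e w v \<longleftrightarrow> x \<in> carrier_vec 2 \<and> lin2 (e v) (w v) (\<lambda>r. x $ r)"
  using diff_le_self[of n 2] by (simp add: sub_vecs_def delta_mid del: diff_le_self)

lemma mem_sub_vecs_end: "v \<in> {0, 1, n - 1, n} \<Longrightarrow>
    x \<in> sub_vecs e w v \<longleftrightarrow> x \<in> carrier_vec 1 \<and> (e v = 0 \<longrightarrow> x $ 0 = 0)"
proof -
  assume v: "v \<in> {0, 1, n - 1, n}"
  then have a: "v \<le> n" and b: "\<not> (2 \<le> v \<and> v \<le> n - 2)" using n by auto
  show ?thesis unfolding sub_vecs_def if_P[OF a] if_not_P[OF b] delta_end[OF v] by simp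
qed

lemma vec_coords: "(\<forall>x\<in>carrier_vec 2. R (\<lambda>r. x $ r)) \<longleftrightarrow> (\<forall>x :: nat \<Rightarrow> 'k. R x)"
  if R: "\<And>x y. x 0 = y 0 \<Longrightarrow> x 1 = y 1 \<Longrightarrow> R x = R y"
proof
  assume L: "\<forall>x\<in>carrier_vec 2. R (\<lambda>r. x $ r)"
  show "\<forall>x. R x"
  proof
    fix x :: "nat \<Rightarrow> 'k"
    have "R (\<lambda>r. vec 2 x $ r)" using L by simp
    then show "R x" using R[of "\<lambda>r. vec 2 x $ r" x] by simp
  qed
qed simp

lemma sub_vecs_subspace:
  assumes v: "v \<le> n"
  shows "sub_vecs e w v \<subseteq> carrier_vec (dimv M v) \<and> 0\<^sub>v (dimv M v) \<in> sub_vecs e w v \<and>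
        (\<forall>x\<in>sub_vecs e w v. \<forall>y\<in>sub_vecs e w v. x + y \<in> sub_vecs e w v) \<and>
        (\<forall>c. \<forall>x\<in>sub_vecs e w v. c \<cdot>\<^sub>v x \<in> sub_vecs e w v)"
proof (cases "2 \<le> v \<and> v \<le> n - 2")
  case True
  then have d: "dimv M v = 2" using dims[OF v] delta_mid by simp
  show ?thesis using True
    by (auto simp: d mem_sub_vecs_mid lin2_def par_def distrib_left distrib_right mult.assoc)
next
  case False
  then have e: "v \<in> {0, 1, n - 1, n}" using vert_cases[OF v] by blast
  then have d: "dimv M v = 1" using dims[OF v] delta_end by simp
  show ?thesis
    unfolding d by (auto simp: mem_sub_vecs_end[OF e])
qed

lemma submodule_sub_vecs:
  assumes e: "\<And>v. v \<le> n \<Longrightarrow> e v \<le> delta n v"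
    and w: "\<And>v. 2 \<le> v \<Longrightarrow> v \<le> n - 2 \<Longrightarrow> e v = 1 \<Longrightarrow> nz2 (w v)"
  shows "submodule Q M (sub_vecs e w) \<longleftrightarrow> valid_sub e w"
proof -
  have e2: "e v \<le> 2" if "2 \<le> v" "v \<le> n - 2" for v using e[of v] that delta_mid[of v] by simp
  have mid: "(\<forall>x\<in>sub_vecs e w k. act M (k + 1, k) *\<^sub>v x \<in> sub_vecs e w (k + 1)) \<longleftrightarrow>
      e k \<le> e (k + 1) \<and> (e k = 1 \<and> e (k + 1) = 1 \<longrightarrow> par (mul2 (\<lambda>r c. act M (k + 1, k) $$ (r, c)) (w k)) (w (k + 1)))"
    if k: "2 \<le> k" "k \<le> n - 3" for k
  proof -
    let ?A = "\<lambda>r c. act M (k + 1, k) $$ (r, c)"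
    have k': "2 \<le> k + 1" "k + 1 \<le> n - 2" "k \<le> n - 2" using k n by linarith+
    have d: "delta n k = 2" "delta n (k + 1) = 2" using k k' delta_mid by auto
    have "act M (k + 1, k) *\<^sub>v x \<in> sub_vecs e w (k + 1) \<longleftrightarrow> lin2 (e (k + 1)) (w (k + 1)) (mul2 ?A (\<lambda>r. x $ r))"
      if x: "x \<in> carrier_vec 2" for x
    proof -
      have "(act M (k + 1, k) *\<^sub>v x) $ r = mul2 ?A (\<lambda>r. x $ r) r" if "r < 2" for r
        using act_mult[OF arrow_in(1)[OF k], of x r] x that unfolding d by (simp add: sum_less_1_2 mul2_def)
      then have "lin2 (e (k + 1)) (w (k + 1)) (\<lambda>r. (act M (k + 1, k) *\<^sub>v x) $ r) \<longleftrightarrow>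
          lin2 (e (k + 1)) (w (k + 1)) (mul2 ?A (\<lambda>r. x $ r))" by (intro lin2_cong) simp_all
      moreover have "act M (k + 1, k) *\<^sub>v x \<in> carrier_vec 2"
        using act_carrier[OF arrow_in(1)[OF k]] x unfolding d by (rule mult_mat_vec_carrier)
      ultimately show ?thesis unfolding mem_sub_vecs_mid[OF k'(1,2)] by blast
    qed
    then have "(\<forall>x\<in>sub_vecs e w k. act M (k + 1, k) *\<^sub>v x \<in> sub_vecs e w (k + 1)) \<longleftrightarrow>
        (\<forall>x\<in>carrier_vec 2. lin2 (e k) (w k) (\<lambda>r. x $ r) \<longrightarrow> lin2 (e (k + 1)) (w (k + 1)) (mul2 ?A (\<lambda>r. x $ r)))"
      using k(1) k'(3) by (auto simp: mem_sub_vecs_mid)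
    also have "\<dots> \<longleftrightarrow> (\<forall>x. lin2 (e k) (w k) x \<longrightarrow> lin2 (e (k + 1)) (w (k + 1)) (mul2 ?A x))"
      by (rule vec_coords) (simp add: lin2_def par_def mul2_def)
    also have "\<dots> \<longleftrightarrow> e k \<le> e (k + 1) \<and> (e k = 1 \<and> e (k + 1) = 1 \<longrightarrow> par (mul2 ?A (w k)) (w (k + 1)))"
      by (rule lin2_step[OF det[OF k]]) (use w e2 k k' in auto)
    finally show ?thesis .
  qed
  have n2: "2 \<le> n - 2" "n - 2 \<le> n" "(2::nat) \<le> n" using n by auto
  have left: "(\<forall>x\<in>sub_vecs e w t. act M (2, t) *\<^sub>v x \<in> sub_vecs e w 2) \<longleftrightarrow>
      (e t = 1 \<longrightarrow> e 2 \<ge> 1 \<and> (e 2 = 1 \<longrightarrow> par (\<lambda>r. act M (2, t) $$ (r, 0)) (w 2)))" if t: "t \<in> {0, 1}" for t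
  proof -
    let ?a = "\<lambda>r. act M (2, t) $$ (r, 0)"
    have t': "t \<in> {0, 1, n - 1, n}" "t \<le> n" using t n by auto
    have d: "delta n 2 = 2" "delta n t = 1" using delta_mid[of 2] n2 delta_end[OF t'(1)] by auto
    have et: "e t \<le> 1" using e[OF t'(2)] d by simp
    have a: "act M (2, t) *\<^sub>v x \<in> sub_vecs e w 2 \<longleftrightarrow> lin2 (e 2) (w 2) (\<lambda>r. x $ 0 * ?a r)"
      if x: "x \<in> carrier_vec 1" for x
    proof -
      have "(act M (2, t) *\<^sub>v x) $ r = x $ 0 * ?a r" if "r < 2" for r
        using act_mult[OF arrow_in(2)[OF t], of x r] x that unfolding d by (simp add: sum_less_1_2 mult.commute)
      then show ?thesis
        using act_carrier[OF arrow_in(2)[OF t]] x n2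
        by (subst mem_sub_vecs_mid) (auto simp: d lin2_cong[of "\<lambda>r. (act M (2, t) *\<^sub>v x) $ r" "\<lambda>r. x $ 0 * ?a r"])
    qed
    have lin: "lin2 (e 2) (w 2) ?a \<longleftrightarrow> e 2 \<ge> 1 \<and> (e 2 = 1 \<longrightarrow> par ?a (w 2))"
      using left_nz[OF t] by (cases "e 2 = 0") (auto simp: lin2_def nz2_def)
    show ?thesis
    proof
      assume L: "\<forall>x\<in>sub_vecs e w t. act M (2, t) *\<^sub>v x \<in> sub_vecs e w 2"
      show "e t = 1 \<longrightarrow> e 2 \<ge> 1 \<and> (e 2 = 1 \<longrightarrow> par ?a (w 2))"
      proof
        assume "e t = 1"
        then have "vec 1 (\<lambda>_. 1) \<in> sub_vecs e w t" by (simp add: mem_sub_vecs_end[OF t'(1)])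
        then have "act M (2, t) *\<^sub>v vec 1 (\<lambda>_. 1) \<in> sub_vecs e w 2" by (rule bspec[OF L])
        then have "lin2 (e 2) (w 2) (\<lambda>r. vec 1 (\<lambda>_. 1) $ 0 * ?a r)" by (rule iffD1[OF a, rotated]) simp
        then show "e 2 \<ge> 1 \<and> (e 2 = 1 \<longrightarrow> par ?a (w 2))" using lin by simp
      qed
    next
      assume R: "e t = 1 \<longrightarrow> e 2 \<ge> 1 \<and> (e 2 = 1 \<longrightarrow> par ?a (w 2))"
      show "\<forall>x\<in>sub_vecs e w t. act M (2, t) *\<^sub>v x \<in> sub_vecs e w 2"
      proof
        fix x assume "x \<in> sub_vecs e w t"
        then have x: "x \<in> carrier_vec 1" "e t = 0 \<longrightarrow> x $ 0 = 0" by (simp_all add: mem_sub_vecs_end[OF t'(1)])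
        have "lin2 (e 2) (w 2) (\<lambda>r. x $ 0 * ?a r)"
        proof (cases "e t = 0")
          case True
          then show ?thesis using x by (simp add: lin2_def par_def)
        next
          case False
          then have "lin2 (e 2) (w 2) ?a" using R et lin by simp
          then show ?thesis by (auto simp: lin2_def par_def mult.assoc)
        qed
        then show "act M (2, t) *\<^sub>v x \<in> sub_vecs e w 2" using a[OF x(1)] by simp
      qed
    qed
  qed
  have right: "(\<forall>x\<in>sub_vecs e w (n - 2). act M (b, n - 2) *\<^sub>v x \<in> sub_vecs e w b) \<longleftrightarrow>
      (e b = 0 \<longrightarrow> e (n - 2) \<le> 1 \<and> (e (n - 2) = 1 \<longrightarrow>
      act M (b, n - 2) $$ (0, 0) * w (n - 2) 0 + act M (b, n - 2) $$ (0, 1) * w (n - 2) 1 = 0))"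
    if b: "b \<in> {n - 1, n}" for b
  proof -
    let ?f = "\<lambda>c. act M (b, n - 2) $$ (0, c)"
    have b': "b \<in> {0, 1, n - 1, n}" "b \<le> n" using b n by auto
    have d: "delta n (n - 2) = 2" "delta n b = 1" using delta_mid[of "n - 2"] n2 delta_end[OF b'(1)] by auto
    have f: "act M (b, n - 2) *\<^sub>v x \<in> sub_vecs e w b \<longleftrightarrow> (e b = 0 \<longrightarrow> ?f 0 * x $ 0 + ?f 1 * x $ 1 = 0)"
      if x: "x \<in> carrier_vec 2" for x
      using act_mult[OF arrow_in(3)[OF b], of x 0] act_carrier[OF arrow_in(3)[OF b]] x unfolding d
      by (subst mem_sub_vecs_end[OF b'(1)]) (auto simp: sum_less_1_2)
    have "(\<forall>x\<in>sub_vecs e w (n - 2). act M (b, n - 2) *\<^sub>v x \<in> sub_vecs e w b) \<longleftrightarrow>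
        (\<forall>x\<in>carrier_vec 2. lin2 (e (n - 2)) (w (n - 2)) (\<lambda>r. x $ r) \<longrightarrow> e b = 0 \<longrightarrow> ?f 0 * x $ 0 + ?f 1 * x $ 1 = 0)"
      using f n2 by (auto simp: mem_sub_vecs_mid)
    also have "\<dots> \<longleftrightarrow> (\<forall>x. lin2 (e (n - 2)) (w (n - 2)) x \<longrightarrow> e b = 0 \<longrightarrow> ?f 0 * x 0 + ?f 1 * x 1 = 0)"
      by (rule vec_coords) (simp add: lin2_def par_def)
    also have "\<dots> \<longleftrightarrow> (e b = 0 \<longrightarrow> (\<forall>x. lin2 (e (n - 2)) (w (n - 2)) x \<longrightarrow> ?f 0 * x 0 + ?f 1 * x 1 = 0))"
      by auto
    also have "(\<forall>x. lin2 (e (n - 2)) (w (n - 2)) x \<longrightarrow> ?f 0 * x 0 + ?f 1 * x 1 = 0) \<longleftrightarrow>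
        e (n - 2) \<le> 1 \<and> (e (n - 2) = 1 \<longrightarrow> ?f 0 * w (n - 2) 0 + ?f 1 * w (n - 2) 1 = 0)"
      by (rule lin2_functional) (use e2[of "n - 2"] w[of "n - 2"] n2 right_nz[OF b] in \<open>auto simp: nz2_def\<close>)
    finally show ?thesis .
  qed
  have "submodule Q M (sub_vecs e w) \<longleftrightarrow> (\<forall>(i, l)\<in>arrows Q. \<forall>x\<in>sub_vecs e w l. act M (i, l) *\<^sub>v x \<in> sub_vecs e w i)"
    using sub_vecs_subspace unfolding submodule_def verts_Dtilde by simp
  then show ?thesis
    unfolding arrows_ball valid_sub_def using mid left right by simp
qed

end

context generic_rep begin

definition nz_on :: "(nat \<Rightarrow> nat) \<Rightarrow> (nat \<Rightarrow> nat \<Rightarrow> 'k) \<Rightarrow> bool" where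
  "nz_on e w \<longleftrightarrow> (\<forall>v. 2 \<le> v \<and> v \<le> n - 2 \<and> e v = 1 \<longrightarrow> nz2 (w v))"

lemma sub_frame_apply:
  assumes "v \<le> n" "r < delta n v" "c < e v"
  shows "sub_frame e w (v, r, c) =
    (if 2 \<le> v \<and> v \<le> n - 2 then if e v = 1 then w v r else if r = c then 1 else 0 else 1)"
  using assms by (simp add: sub_frame_def frame_index_def verts_Dtilde dims)

lemma sub_frame_inj:
  assumes v: "v \<le> n" and e: "e v \<le> delta n v" and w: "nz_on e w"
  shows "inj_on (\<lambda>x. frame_mat M e (sub_frame e w) v *\<^sub>v x) (carrier_vec (e v))"
  unfolding frame_inj_iff[OF v]
proof (intro allI impI)
  fix x :: "nat \<Rightarrow> 'k" and c
  assume x: "\<forall>r<delta n v. (\<Sum>c<e v. sub_frame e w (v, r, c) * x c) = 0" and c: "c < e v"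
  show "x c = 0"
  proof (cases "2 \<le> v \<and> v \<le> n - 2")
    case True
    then have d: "delta n v = 2" by (simp add: delta_mid)
    consider "e v = 1" | "e v = 2" using e d c by linarith
    then show ?thesis
    proof cases
      case 1
      then have "w v 0 * x 0 = 0" "w v 1 * x 0 = 0"
        using x[rule_format, of 0] x[rule_format, of 1] True v d by (simp_all add: sub_frame_apply sum_less_1_2)
      moreover have "nz2 (w v)" using w True 1 by (simp add: nz_on_def)
      ultimately show ?thesis using c 1 by (auto simp: nz2_def)
    next
      case 2
      then have "x 0 = 0" "x 1 = 0"
        using x[rule_format, of 0] x[rule_format, of 1] True v d by (simp_all add: sub_frame_apply sum_less_1_2)
      then show ?thesis using c 2 by (auto simp: less_2_cases_iff)
    qed
  next
    case False
    then have d: "delta n v = 1" using vert_cases[OF v] delta_end by blast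
    then have e1: "e v = 1" "c = 0" using e c by linarith+
    have "sub_frame e w (v, 0, 0) = 1"
      using sub_frame_apply[of v 0 0 e w] v d e1 unfolding if_not_P[OF False] by simp
    then show ?thesis using x[rule_format, of 0] d e1 by (simp add: sum_less_1_2)
  qed
qed

lemma sub_vecs_cong:
  assumes "\<And>v. 2 \<le> v \<Longrightarrow> v \<le> n - 2 \<Longrightarrow> e v = 1 \<Longrightarrow> w v 0 = w' v 0 \<and> w v 1 = w' v 1"
  shows "sub_vecs e w = sub_vecs e w'"
proof
  fix v
  have "lin2 (e v) (w v) x \<longleftrightarrow> lin2 (e v) (w' v) x" if "2 \<le> v \<and> v \<le> n - 2" for x
    using assms[of v] that by (auto simp: lin2_def par_def)
  then show "sub_vecs e w v = sub_vecs e w' v" unfolding sub_vecs_def by (auto split: if_splits)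
qed

lemma sub_vecs_par:
  assumes "\<And>v. 2 \<le> v \<Longrightarrow> v \<le> n - 2 \<Longrightarrow> e v = 1 \<Longrightarrow> par (w v) (w' v)" "nz_on e w" "nz_on e w'"
  shows "sub_vecs e w = sub_vecs e w'"
proof
  fix v
  have "lin2 (e v) (w v) x \<longleftrightarrow> lin2 (e v) (w' v) x" if mid: "2 \<le> v \<and> v \<le> n - 2" for x
  proof (cases "e v = 1")
    case True
    have p: "par (w v) (w' v)" and nz: "nz2 (w v)" "nz2 (w' v)"
      using assms mid True by (auto simp: nz_on_def)
    show ?thesis using True par_trans[OF _ p nz(1)] par_trans[OF _ par_sym[OF p] nz(2)] by (auto simp: lin2_def)
  qed (simp add: lin2_def)
  then show "sub_vecs e w v = sub_vecs e w' v" unfolding sub_vecs_def by (auto split: if_splits)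
qed

lemma frame_span_sub_frame:
  assumes e: "\<forall>v\<le>n. e v \<le> delta n v" and w: "nz_on e w"
  shows "frame_span Q M e (sub_frame e w) = sub_vecs e w"
proof
  fix v
  show "frame_span Q M e (sub_frame e w) v = sub_vecs e w v"
  proof (cases "v \<le> n")
    case True
    have "frame_span Q M e (sub_frame e w) v = sub_vecs e (\<lambda>v r. sub_frame e w (v, r, 0)) v"
      by (rule span_of_inj[OF True e[rule_format, OF True] sub_frame_inj[OF True e[rule_format, OF True] w]])
    also have "sub_vecs e (\<lambda>v r. sub_frame e w (v, r, 0)) = sub_vecs e w"
    proof (rule sub_vecs_cong)
      fix v assume v: "2 \<le> v" "v \<le> n - 2" "e v = 1"
      then have "v \<le> n" by simp
      then show "sub_frame e w (v, 0, 0) = w v 0 \<and> sub_frame e w (v, 1, 0) = w v 1"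
        using v delta_mid[OF v(1,2)] by (simp add: sub_frame_apply)
    qed
    finally show ?thesis .
  next
    case False
    then show ?thesis by (simp add: frame_span_def sub_vecs_def verts_Dtilde)
  qed
qed

lemma submodule_iff_valid:
  assumes "\<forall>v\<le>n. e v \<le> delta n v" "nz_on e w"
  shows "submodule Q M (sub_vecs e w) \<longleftrightarrow> valid_sub e w"
  by (rule submodule_sub_vecs) (use assms in \<open>simp_all add: nz_on_def\<close>)

lemma sub_frame_in_frames:
  assumes e: "\<forall>v\<le>n. e v \<le> delta n v" and w: "nz_on e w" "valid_sub e w"
  shows "sub_frame e w \<in> submodule_frames Q M e"
proof -
  have "submodule Q M (sub_vecs e w)"
    using submodule_iff_valid[OF e w(1)] w(2) by blast
  moreover have "sub_frame e w \<in> frame_index Q M e \<rightarrow>\<^sub>E UNIV" unfolding sub_frame_def by simp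
  moreover have "inj_on (\<lambda>x. frame_mat M e (sub_frame e w) v *\<^sub>v x) (carrier_vec (e v))" if "v \<in> {0..n}" for v
    using sub_frame_inj[OF _ _ w(1), of v] e that by simp
  ultimately show ?thesis
    unfolding submodule_frames_def mem_Collect_eq frame_span_sub_frame[OF e w(1)] verts_Dtilde
    by blast
qed

lemma frame_span_submodule_frame:
  assumes e: "\<forall>v\<le>n. e v \<le> delta n v" and F: "F \<in> submodule_frames Q M e"
  shows "nz_on e (\<lambda>v r. F (v, r, 0))" "valid_sub e (\<lambda>v r. F (v, r, 0))"
    "frame_span Q M e F = sub_vecs e (\<lambda>v r. F (v, r, 0))"
proof -
  have inj: "inj_on (\<lambda>x. frame_mat M e F v *\<^sub>v x) (carrier_vec (e v))" if "v \<le> n" for v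
    using F that by (simp add: submodule_frames_def verts_Dtilde)
  show nz: "nz_on e (\<lambda>v r. F (v, r, 0))"
    unfolding nz_on_def
  proof (intro allI impI)
    fix v assume v: "2 \<le> v \<and> v \<le> n - 2 \<and> e v = 1"
    then have "v \<le> n - 2" by blast
    then have "v \<le> n" by linarith
    then show "nz2 (\<lambda>r. F (v, r, 0))" using span_of_inj(2)[of v e F] e inj v by blast
  qed
  show eq: "frame_span Q M e F = sub_vecs e (\<lambda>v r. F (v, r, 0))"
  proof
    fix v
    show "frame_span Q M e F v = sub_vecs e (\<lambda>v r. F (v, r, 0)) v"
    proof (cases "v \<le> n")
      case True
      then show ?thesis using e inj by (intro span_of_inj(1)) simp_all
    next
      case False
      then show ?thesis by (simp add: frame_span_def sub_vecs_def verts_Dtilde)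
    qed
  qed
  have "submodule Q M (frame_span Q M e F)" using F by (simp add: submodule_frames_def)
  then show "valid_sub e (\<lambda>v r. F (v, r, 0))"
    unfolding eq using submodule_iff_valid[OF e nz] by blast
qed

section \<open>Quiver Grassmannians as sets of lines in the plane at vertex 2\<close>

definition line :: "(nat \<Rightarrow> 'k) \<Rightarrow> nat \<Rightarrow> nat \<Rightarrow> 'k" where
  "line z v = chain M z (v - 2)"

lemma nz_on_line: "nz2 z \<Longrightarrow> nz_on e (line z)"
  unfolding nz_on_def line_def by (intro allI impI nz2_chain) (assumption, linarith)

definition mono_dim :: "(nat \<Rightarrow> nat) \<Rightarrow> bool" where
  "mono_dim e \<longleftrightarrow> (\<forall>k. 2 \<le> k \<and> k \<le> n - 3 \<longrightarrow> e k \<le> e (k + 1)) \<and>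
    (\<forall>t\<in>{0, 1}. e t = 1 \<longrightarrow> e 2 \<ge> 1) \<and> (\<forall>b\<in>{n - 1, n}. e b = 0 \<longrightarrow> e (n - 2) \<le> 1)"

text \<open>The extending vertices that restrict the position of the line, once the inequalities in
  \<open>mono_dim\<close> hold. On the left the line has to contain the image of M at t, on the
  right it has to lie in the kernel of the map to M at b; transported to vertex 2, both are the
  vanishing of one functional \<open>end_fun\<close>.\<close>

definition active :: "(nat \<Rightarrow> nat) \<Rightarrow> nat set" where
  "active e = {t \<in> {0, 1}. e t = 1 \<and> e 2 = 1} \<union> {b \<in> {n - 1, n}. e b = 0 \<and> e (n - 2) = 1}"

definition on_lines :: "nat set \<Rightarrow> (nat \<Rightarrow> 'k) \<Rightarrow> bool" where
  "on_lines A z \<longleftrightarrow> nz2 z \<and> (\<forall>u\<in>A. end_fun n M u 0 * z 0 + end_fun n M u 1 * z 1 = 0)"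

lemma valid_line_iff:
  assumes z: "nz2 z"
  shows "valid_sub e (line z) \<longleftrightarrow> mono_dim e \<and> on_lines (active e) z"
proof -
  have chain: "par (mul2 (\<lambda>r c. act M (k + 1, k) $$ (r, c)) (line z k)) (line z (k + 1))"
    if k: "2 \<le> k" for k
  proof -
    obtain i where "k = i + 2" using k by (metis add.commute le_Suc_ex)
    then show ?thesis by (simp add: line_def par_def numeral_eq_Suc mult.commute)
  qed
  define E where "E u = (end_fun n M u 0 * z 0 + end_fun n M u 1 * z 1 = 0)" for u
  have left: "par (\<lambda>r. act M (2, t) $$ (r, 0)) (line z 2) \<longleftrightarrow> E t" if "t \<in> {0, 1}" for t
    unfolding E_def using end_fun_left[of t n M z] that by (auto simp: line_def)
  have right: "act M (b, n - 2) $$ (0, 0) * line z (n - 2) 0 + act M (b, n - 2) $$ (0, 1) * line z (n - 2) 1 = 0 \<longleftrightarrow> E b"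
    if "b \<in> {n - 1, n}" for b
  proof -
    have "b > 1" "n - 2 - 2 = n - 4" using that n by auto
    then show ?thesis unfolding E_def using end_fun_right[of b n M z] by (simp add: line_def)
  qed
  have 1: "(\<forall>k. 2 \<le> k \<and> k \<le> n - 3 \<longrightarrow> e k \<le> e (k + 1) \<and>
      (e k = 1 \<and> e (k + 1) = 1 \<longrightarrow> par (mul2 (\<lambda>r c. act M (k + 1, k) $$ (r, c)) (line z k)) (line z (k + 1)))) \<longleftrightarrow>
      (\<forall>k. 2 \<le> k \<and> k \<le> n - 3 \<longrightarrow> e k \<le> e (k + 1))"
    using chain by simp
  have 2: "(\<forall>t\<in>{0, 1}. e t = 1 \<longrightarrow> e 2 \<ge> 1 \<and> (e 2 = 1 \<longrightarrow> par (\<lambda>r. act M (2, t) $$ (r, 0)) (line z 2))) \<longleftrightarrow>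
      (\<forall>t\<in>{0, 1}. e t = 1 \<longrightarrow> e 2 \<ge> 1 \<and> (e 2 = 1 \<longrightarrow> E t))"
    using left by simp
  have 3: "(\<forall>b\<in>{n - 1, n}. e b = 0 \<longrightarrow> e (n - 2) \<le> 1 \<and> (e (n - 2) = 1 \<longrightarrow>
      act M (b, n - 2) $$ (0, 0) * line z (n - 2) 0 + act M (b, n - 2) $$ (0, 1) * line z (n - 2) 1 = 0)) \<longleftrightarrow>
      (\<forall>b\<in>{n - 1, n}. e b = 0 \<longrightarrow> e (n - 2) \<le> 1 \<and> (e (n - 2) = 1 \<longrightarrow> E b))"
    by (rule ball_cong[OF refl]) (simp only: right)
  have 4: "on_lines (active e) z \<longleftrightarrow> (\<forall>t\<in>{0, 1}. e t = 1 \<longrightarrow> e 2 = 1 \<longrightarrow> E t) \<and>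
      (\<forall>b\<in>{n - 1, n}. e b = 0 \<longrightarrow> e (n - 2) = 1 \<longrightarrow> E b)"
    unfolding on_lines_def active_def E_def[symmetric] using z by blast
  show ?thesis
    unfolding valid_sub_def mono_dim_def 1 2 3 4 by blast
qed

text \<open>Dimensions do not decrease along the path, so the vertices carrying a line form an
  interval. The direction at its first vertex k is pulled back to vertex 2 through the invertible
  maps, and validity forces the later directions to be images of it.\<close>

lemma ex_line:
  assumes e: "\<forall>v\<le>n. e v \<le> delta n v" and nz: "nz_on e w" and valid: "valid_sub e w"
  shows "\<exists>z. nz2 z \<and> sub_vecs e w = sub_vecs e (line z)"
proof (cases "\<exists>v. 2 \<le> v \<and> v \<le> n - 2 \<and> e v = 1")
  case False
  \<comment> \<open>No vertex of the path carries a line, so an arbitrary nonzero vector gives the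
    same subspaces.\<close>
  have "nz2 (\<lambda>_. 1 :: 'k)" by (simp add: nz2_def)
  moreover have "sub_vecs e w = sub_vecs e (line (\<lambda>_. 1))" by (rule sub_vecs_cong) (use False in auto)
  ultimately show ?thesis by (intro exI conjI)
next
  case True
  define k where "k = (LEAST v. 2 \<le> v \<and> v \<le> n - 2 \<and> e v = 1)"
  have k: "2 \<le> k \<and> k \<le> n - 2 \<and> e k = 1" unfolding k_def using True by (rule LeastI_ex)
  have le: "k \<le> v" if "2 \<le> v \<and> v \<le> n - 2 \<and> e v = 1" for v unfolding k_def using that by (rule Least_le)
  have "k - 2 \<le> n - 4" using k by linarith
  from chain_surj[OF this, of "w k"] obtain z where "chain M z (k - 2) 0 = w k 0 \<and> chain M z (k - 2) 1 = w k 1" ..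
  then have z: "line z k 0 = w k 0" "line z k 1 = w k 1" by (simp_all add: line_def)
  have "nz2 (w k)" using nz k by (simp add: nz_on_def)
  then have nzk: "nz2 (line z k)" using z by (simp add: nz2_def)
  have nzz: "nz2 z"
  proof (rule ccontr)
    assume "\<not> nz2 z"
    then have "z 0 = 0" "z 1 = 0" by (simp_all add: nz2_def)
    then have "line z k 0 = 0" "line z k 1 = 0"
      using chain_basis[of 0 M z "k - 2"] chain_basis[of 1 M z "k - 2"] by (simp_all add: line_def)
    then show False using nzk by (simp add: nz2_def)
  qed
  have mono: "e v \<le> e (v + 1)" if "2 \<le> v" "v \<le> n - 3" for v
    using valid that by (simp add: valid_sub_def)
  have ek: "u \<le> n - 2 \<longrightarrow> e k \<le> e u" if "k \<le> u" for u
    using that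
  proof (induction u rule: dec_induct)
    case (step u)
    show ?case
    proof
      assume u: "Suc u \<le> n - 2"
      then have "2 \<le> u" "u \<le> n - 3" "u \<le> n - 2" using step k by linarith+
      then show "e k \<le> e (Suc u)" using step mono[of u] by simp
    qed
  qed simp
  have "v \<le> n - 2 \<longrightarrow> e v = 1 \<longrightarrow> (par (w v) (line z v))" if "k \<le> v" for v
    using that
  proof (induction v rule: dec_induct)
    case base
    then show ?case using z by (simp add: par_def mult.commute)
  next
    case (step v)
    show ?case
    proof (intro impI)
      assume v: "Suc v \<le> n - 2" "e (Suc v) = 1"
      have v2: "2 \<le> v" "v \<le> n - 3" "v \<le> n - 2" using step k v by linarith+
      have "e k \<le> e v" using ek step(1) v2 by simp
      then have ev: "e v = 1" using k mono[OF v2(1,2)] v by simp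
      let ?A = "\<lambda>r c. act M (v + 1, v) $$ (r, c)"
      have "par (w v) (line z v)" using step v2 ev by simp
      then have 1: "par (mul2 ?A (w v)) (mul2 ?A (line z v))" by (rule par_mul2)
      have 2: "par (mul2 ?A (w v)) (w (v + 1))" using valid v2 ev v by (simp add: valid_sub_def)
      obtain i where "v = i + 2" using v2(1) by (metis add.commute le_Suc_ex)
      then have 3: "line z (v + 1) = mul2 ?A (line z v)"
        by (simp add: line_def numeral_eq_Suc)
      have "nz2 (w v)" using nz v2 ev by (simp add: nz_on_def)
      then have "nz2 (mul2 ?A (w v))" using nz2_mul2[OF det[OF v2(1,2)]] by simp
      then show "par (w (Suc v)) (line z (Suc v))"
        using par_trans[OF par_sym[OF 2] 1] 3 by simp
    qed
  qed
  then have "sub_vecs e w = sub_vecs e (line z)"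
    by (intro sub_vecs_par nz nz_on_line nzz) (use le in simp)
  then show ?thesis using nzz by (intro exI conjI)
qed

lemma Gr_eq_lines:
  assumes e: "\<forall>v\<le>n. e v \<le> delta n v"
  shows "Gr Q M e = {U. mono_dim e \<and> (\<exists>z. on_lines (active e) z \<and> U = sub_vecs e (line z))}"
proof (intro Set.set_eqI iffI)
  fix U assume "U \<in> Gr Q M e"
  then obtain F where F: "F \<in> submodule_frames Q M e" "U = frame_span Q M e F" by (auto simp: Gr_def)
  note f = frame_span_submodule_frame[OF e F(1)]
  obtain z where z: "nz2 z" "sub_vecs e (\<lambda>v r. F (v, r, 0)) = sub_vecs e (line z)"
    using ex_line[OF e f(1,2)] by blast
  have "submodule Q M (sub_vecs e (line z))"
    using submodule_iff_valid[OF e f(1)] f(2) unfolding z(2) by blast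
  then have "valid_sub e (line z)"
    using submodule_iff_valid[OF e nz_on_line[OF z(1)]] by blast
  then show "U \<in> {U. mono_dim e \<and> (\<exists>z. on_lines (active e) z \<and> U = sub_vecs e (line z))}"
    using valid_line_iff[OF z(1)] F(2) f(3) z(2) by auto
next
  fix U assume "U \<in> {U. mono_dim e \<and> (\<exists>z. on_lines (active e) z \<and> U = sub_vecs e (line z))}"
  then obtain z where z: "mono_dim e" "on_lines (active e) z" "U = sub_vecs e (line z)" by blast
  then have nz: "nz2 z" by (simp add: on_lines_def)
  have "sub_frame e (line z) \<in> submodule_frames Q M e"
    using sub_frame_in_frames[OF e nz_on_line[OF nz]] valid_line_iff[OF nz] z by simp
  then show "U \<in> Gr Q M e"
    unfolding Gr_def z(3) frame_span_sub_frame[OF e nz_on_line[OF nz], symmetric] by (rule imageI)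
qed

lemma sub_vecs_line_eq_iff:
  assumes v: "2 \<le> v" "v \<le> n - 2" "e v = 1" and z: "nz2 z" "nz2 z'"
  shows "sub_vecs e (line z) = sub_vecs e (line z') \<longleftrightarrow> par z z'"
proof
  assume eq: "sub_vecs e (line z) = sub_vecs e (line z')"
  have i: "v - 2 \<le> n - 4" using v by linarith
  have "vec 2 (line z v) \<in> sub_vecs e (line z) v"
    unfolding mem_sub_vecs_mid[OF v(1,2)] using v(3) by (simp add: lin2_def par_def mult.commute)
  then have "vec 2 (line z v) \<in> sub_vecs e (line z') v" unfolding eq .
  then have "par (line z v) (line z' v)"
    unfolding mem_sub_vecs_mid[OF v(1,2)] using v(3) by (simp add: lin2_def par_def)
  then show "par z z'" using par_chain_iff[OF i] by (simp add: line_def)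
next
  assume "par z z'"
  then show "sub_vecs e (line z) = sub_vecs e (line z')"
    using par_chain_iff by (intro sub_vecs_par nz_on_line z) (simp add: line_def)
qed

lemma Gr_no_line:
  assumes e: "\<forall>v\<le>n. e v \<le> delta n v" and no: "\<And>v. 2 \<le> v \<Longrightarrow> v \<le> n - 2 \<Longrightarrow> e v \<noteq> 1"
    and mono: "mono_dim e"
  shows "\<exists>U. Gr Q M e = {U}"
proof -
  have "active e = {}" using no[of 2] no[of "n - 2"] n by (auto simp: active_def)
  then have "on_lines (active e) (\<lambda>_. 1)" by (simp add: on_lines_def nz2_def)
  moreover have "sub_vecs e (line z) = sub_vecs e (line z')" for z z'
    by (rule sub_vecs_cong) (use no in blast)
  ultimately have "{U. mono_dim e \<and> (\<exists>z. on_lines (active e) z \<and> U = sub_vecs e (line z))} =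
      {sub_vecs e (line (\<lambda>_. 1))}"
    using mono by blast
  then show ?thesis unfolding Gr_eq_lines[OF e] by (intro exI[of _ "sub_vecs e (line (\<lambda>_. 1))"])
qed

lemma active_ends: "active e \<subseteq> {0, 1, n - 1, n}"
  by (auto simp: active_def)

lemma Gr_one_active:
  assumes e: "\<forall>v\<le>n. e v \<le> delta n v" and v: "2 \<le> v" "v \<le> n - 2" "e v = 1"
    and mono: "mono_dim e" and A: "active e = {u}"
  shows "\<exists>U. Gr Q M e = {U}"
proof -
  let ?f = "end_fun n M u"
  have nzf: "nz2 ?f" using nz2_end_fun active_ends[of e] A by blast
  \<comment> \<open>The kernel of the functional (f 0, f 1) is spanned by (f 1, - f 0).\<close>
  define z where "z r = (if r = 0 then ?f 1 else - ?f 0)" for r :: nat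
  have z: "on_lines (active e) z" using nzf by (auto simp: on_lines_def A z_def nz2_def)
  have uniq: "sub_vecs e (line z') = sub_vecs e (line z)" if z': "on_lines (active e) z'" for z'
  proof -
    have "?f 0 * z' 0 + ?f 1 * z' 1 = 0" using z' by (simp add: on_lines_def A)
    then have "- (z' 0 * ?f 0) = z' 1 * ?f 1" by (simp add: neg_eq_iff_add_eq_0 mult.commute)
    then have "par z' z" by (simp add: par_def z_def eq_neg_iff_add_eq_0 neg_eq_iff_add_eq_0 add.commute)
    then show ?thesis using sub_vecs_line_eq_iff[where v = v and e = e, OF v] z z' by (simp add: on_lines_def)
  qed
  have "Gr Q M e = {sub_vecs e (line z)}"
    unfolding Gr_eq_lines[OF e]
  proof (intro equalityI subsetI)
    fix U assume "U \<in> {U. mono_dim e \<and> (\<exists>z. on_lines (active e) z \<and> U = sub_vecs e (line z))}"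
    then obtain z' where "on_lines (active e) z'" "U = sub_vecs e (line z')" by (elim CollectE conjE exE)
    then show "U \<in> {sub_vecs e (line z)}" using uniq by simp
  next
    fix U assume "U \<in> {sub_vecs e (line z)}"
    then show "U \<in> {U. mono_dim e \<and> (\<exists>z. on_lines (active e) z \<and> U = sub_vecs e (line z))}"
      using mono z by blast
  qed
  then show ?thesis by (intro exI[of _ "sub_vecs e (line z)"])
qed

lemma Gr_two_active:
  assumes e: "\<forall>v\<le>n. e v \<le> delta n v" and A: "u \<in> active e" "u' \<in> active e" "u \<noteq> u'"
  shows "Gr Q M e = {}"
proof -
  have "\<not> on_lines (active e) z" for z
  proof
    assume z: "on_lines (active e) z"
    have "\<not> nz2 z"
    proof (rule nz2_functionals)
      show "end_fun n M u 0 * end_fun n M u' 1 - end_fun n M u 1 * end_fun n M u' 0 \<noteq> 0"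
        using ends[of u u'] A active_ends[of e] by blast
    qed (use z A in \<open>auto simp: on_lines_def\<close>)
    then show False using z by (simp add: on_lines_def)
  qed
  then show ?thesis unfolding Gr_eq_lines[OF e] by blast
qed

end

section \<open>The analytic topology of quiver Grassmannians and the projective line\<close>

definition frame_space :: "quiver \<Rightarrow> complex qmod \<Rightarrow> (nat \<Rightarrow> nat) \<Rightarrow> (nat \<times> nat \<times> nat \<Rightarrow> complex) topology" where
  "frame_space Q M e = subtopology (product_topology (\<lambda>_. euclidean) (frame_index Q M e)) (submodule_frames Q M e)"

lemma topspace_frame_space: "topspace (frame_space Q M e) = submodule_frames Q M e"
  by (auto simp: frame_space_def submodule_frames_def)

text \<open>\<open>topology\<close> yields the intended open sets only for a predicate that
  satisfies the axioms. These are inherited from the space of frames, as preimages commute with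
  intersections and unions.\<close>

lemma openin_Gr_topology:
  "openin (Gr_topology Q M e) U \<longleftrightarrow>
    U \<subseteq> Gr Q M e \<and> openin (frame_space Q M e) {F \<in> submodule_frames Q M e. frame_span Q M e F \<in> U}"
proof -
  let ?pre = "\<lambda>U. {F \<in> submodule_frames Q M e. frame_span Q M e F \<in> U}"
  have "istopology (\<lambda>U. U \<subseteq> Gr Q M e \<and> openin (frame_space Q M e) (?pre U))"
    unfolding istopology_def
  proof (intro conjI allI impI)
    fix S T assume S: "S \<subseteq> Gr Q M e \<and> openin (frame_space Q M e) (?pre S)"
      and T: "T \<subseteq> Gr Q M e \<and> openin (frame_space Q M e) (?pre T)"
    have "?pre (S \<inter> T) = ?pre S \<inter> ?pre T" by auto
    then show "openin (frame_space Q M e) (?pre (S \<inter> T))" using S T by (simp add: openin_Int)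
    show "S \<inter> T \<subseteq> Gr Q M e" using S by auto
  next
    fix K assume K: "\<forall>S\<in>K. S \<subseteq> Gr Q M e \<and> openin (frame_space Q M e) (?pre S)"
    have "?pre (\<Union>K) = \<Union> (?pre ` K)" by auto
    moreover have "openin (frame_space Q M e) (\<Union> (?pre ` K))" using K by (intro openin_Union) auto
    ultimately show "openin (frame_space Q M e) (?pre (\<Union>K))" by simp
    show "\<Union>K \<subseteq> Gr Q M e" using K by auto
  qed
  then show ?thesis unfolding Gr_topology_def frame_space_def by (simp only: topology_inverse')
qed

lemma topspace_Gr_topology: "topspace (Gr_topology Q M e) = Gr Q M e"
proof (rule antisym)
  show "topspace (Gr_topology Q M e) \<subseteq> Gr Q M e"
  proof -
    have "openin (Gr_topology Q M e) (topspace (Gr_topology Q M e))" by simp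
    then show ?thesis unfolding openin_Gr_topology by (rule conjunct1)
  qed
  have "{F \<in> submodule_frames Q M e. frame_span Q M e F \<in> Gr Q M e} = topspace (frame_space Q M e)"
    by (auto simp: Gr_def topspace_frame_space)
  then have "openin (Gr_topology Q M e) (Gr Q M e)"
    by (simp add: openin_Gr_topology)
  then show "Gr Q M e \<subseteq> topspace (Gr_topology Q M e)" by (rule openin_subset)
qed

lemma quotient_map_frame_span: "quotient_map (frame_space Q M e) (Gr_topology Q M e) (frame_span Q M e)"
  unfolding quotient_map_def topspace_frame_space topspace_Gr_topology
  by (auto simp: Gr_def openin_Gr_topology)

text \<open>The Hopf map. It is constant on complex lines through the origin and so identifies the
  projective line with the unit sphere of \<open>complex \<times> real\<close>. Division by the
  squared norm extends it to all nonzero vectors, so that the columns of frames need no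
  normalisation.\<close>

definition hopf :: "complex \<times> complex \<Rightarrow> complex \<times> real" where
  "hopf = (\<lambda>(x, y). (2 * x * cnj y / of_real ((norm x)\<^sup>2 + (norm y)\<^sup>2),
     ((norm x)\<^sup>2 - (norm y)\<^sup>2) / ((norm x)\<^sup>2 + (norm y)\<^sup>2)))"

lemma sum_norm_pos: "(x, y) \<noteq> (0, 0) \<Longrightarrow> (norm (x::complex))\<^sup>2 + (norm (y::complex))\<^sup>2 > 0"
  by (auto simp: add_pos_nonneg add_nonneg_pos)

lemma hopf_in_sphere:
  assumes "(x, y) \<noteq> (0, 0)"
  shows "hopf (x, y) \<in> sphere 0 1"
proof -
  define a b where "a = (norm x)\<^sup>2" and "b = (norm y)\<^sup>2"
  have ab: "a + b > 0" using sum_norm_pos[OF assms] by (simp add: a_def b_def)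
  define c r where "c = 2 * x * cnj y / of_real (a + b)" and "r = (a - b) / (a + b)"
  have N: "norm (complex_of_real (a + b)) = a + b" using ab by (simp only: norm_of_real)
  have "norm c = 2 * norm x * norm y / (a + b)"
    unfolding c_def norm_divide norm_mult N complex_mod_cnj by simp
  then have c: "(norm c)\<^sup>2 = 4 * a * b / (a + b)\<^sup>2"
    by (simp add: power_divide power_mult_distrib a_def b_def)
  have "hopf (x, y) = (c, r)" by (simp add: hopf_def a_def b_def c_def r_def)
  then have "(norm (hopf (x, y)))\<^sup>2 = (norm c)\<^sup>2 + r\<^sup>2" by (simp add: norm_Pair)
  also have "\<dots> = 4 * a * b / (a + b)\<^sup>2 + ((a - b) / (a + b))\<^sup>2" unfolding c r_def by (rule refl)
  also have "\<dots> = (4 * a * b + (a - b)\<^sup>2) / (a + b)\<^sup>2" by (simp add: power_divide add_divide_distrib)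
  also have "4 * a * b + (a - b)\<^sup>2 = (a + b)\<^sup>2" by (simp add: power2_eq_square algebra_simps)
  finally have "(norm (hopf (x, y)))\<^sup>2 = 1" using ab by simp
  then have "norm (hopf (x, y)) = 1" using norm_ge_zero power2_eq_1_iff by (metis abs_norm_cancel abs_1 power2_eq_iff one_power2 neg_equal_iff_equal abs_minus_cancel)
  then show ?thesis by simp
qed

text \<open>With a, b, a', b' the squared norms, equality of the real components amounts to b (a' +
  b') = b' (a + b). If b = 0 then y and y' both vanish; otherwise equality of the complex
  components, multiplied by y y', gives x y' = y x'. For the converse the proportion of the squared
  norms is read off from the norms of both sides.\<close>

lemma hopf_eq_iff:
  assumes "(x, y) \<noteq> (0, 0)" "(x', y') \<noteq> (0, 0)"
  shows "hopf (x, y) = hopf (x', y') \<longleftrightarrow> x * y' = y * x'"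
proof -
  define a b a' b' where "a = (norm x)\<^sup>2" and "b = (norm y)\<^sup>2" and "a' = (norm x')\<^sup>2" and "b' = (norm y')\<^sup>2"
  have ab: "a + b > 0" "a' + b' > 0" using sum_norm_pos[OF assms(1)] sum_norm_pos[OF assms(2)]
    by (simp_all add: a_def b_def a'_def b'_def)
  have h: "hopf (x, y) = (2 * x * cnj y / of_real (a + b), (a - b) / (a + b))"
    "hopf (x', y') = (2 * x' * cnj y' / of_real (a' + b'), (a' - b') / (a' + b'))"
    by (simp_all add: hopf_def a_def b_def a'_def b'_def)
  have y: "y * cnj y = of_real b" "y' * cnj y' = of_real b'" "x * cnj x = of_real a" "x' * cnj x' = of_real a'"
    by (simp_all only: a_def b_def a'_def b'_def complex_norm_square)
  have ne: "of_real (a + b) \<noteq> (0 :: complex)" "of_real (a' + b') \<noteq> (0 :: complex)"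
    using ab by (metis of_real_eq_0_iff less_irrefl)+
  have A: "hopf (x, y) = hopf (x', y') \<longleftrightarrow>
      x * cnj y * of_real (a' + b') = x' * cnj y' * of_real (a + b) \<and> b * (a' + b') = b' * (a + b)"
  proof -
    have "2 * x * cnj y / of_real (a + b) = 2 * x' * cnj y' / of_real (a' + b') \<longleftrightarrow>
        x * cnj y * of_real (a' + b') = x' * cnj y' * of_real (a + b)"
      using ne by (simp add: frac_eq_eq mult.assoc)
    moreover have "(a - b) / (a + b) = (a' - b') / (a' + b') \<longleftrightarrow> b * (a' + b') = b' * (a + b)"
    proof -
      have "(a - b) / (a + b) = (a' - b') / (a' + b') \<longleftrightarrow> (a - b) * (a' + b') = (a' - b') * (a + b)"
        using ab by (intro frac_eq_eq) auto
      also have "\<dots> \<longleftrightarrow> b * (a' + b') = b' * (a + b)" by (auto simp: algebra_simps)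
      finally show ?thesis .
    qed
    ultimately show ?thesis unfolding h by simp
  qed
  show ?thesis
  proof
    assume "hopf (x, y) = hopf (x', y')"
    then have 1: "x * cnj y * of_real (a' + b') = x' * cnj y' * of_real (a + b)" and 2: "b * (a' + b') = b' * (a + b)"
      using A by simp_all
    show "x * y' = y * x'"
    proof (cases "b = 0")
      case True
      then have "b' = 0" using 2 ab by simp
      then show ?thesis using True by (simp add: b_def b'_def)
    next
      case False
      have "x * y' * (y * cnj y) * of_real (a' + b') = (x * cnj y * of_real (a' + b')) * y' * y" by (simp add: algebra_simps)
      also have "\<dots> = y * x' * (y' * cnj y') * of_real (a + b)" unfolding 1 by (simp add: algebra_simps)
      finally have "x * y' * of_real (b * (a' + b')) = y * x' * of_real (b' * (a + b))"
        unfolding y by (simp only: of_real_mult mult.assoc)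
      moreover have "of_real (b' * (a + b)) \<noteq> (0 :: complex)" using False ab 2 by (metis mult_eq_0_iff of_real_eq_0_iff less_irrefl)
      ultimately show ?thesis unfolding 2 by (simp only: mult_cancel_right) simp
    qed
  next
    assume e: "x * y' = y * x'"
    have n: "a * b' = b * a'"
      using arg_cong[OF e, of norm] by (simp add: a_def b_def a'_def b'_def norm_mult flip: power_mult_distrib)
    have "x * cnj y * of_real (a' + b') = x * cnj y * (x' * cnj x' + y' * cnj y')"
      unfolding y by simp
    also have "\<dots> = x' * cnj (y * x') * x + (x * y') * cnj y * cnj y'"
      by (simp add: algebra_simps)
    also have "x' * cnj (y * x') * x = x' * cnj y' * (x * cnj x)"
      unfolding e[symmetric] by (simp add: algebra_simps)
    also have "(x * y') * cnj y * cnj y' = x' * cnj y' * (y * cnj y)"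
      unfolding e by (simp add: algebra_simps)
    also have "x' * cnj y' * (x * cnj x) + x' * cnj y' * (y * cnj y) = x' * cnj y' * (x * cnj x + y * cnj y)"
      by (simp only: distrib_left)
    finally have "x * cnj y * of_real (a' + b') = x' * cnj y' * of_real (a + b)"
      unfolding y by simp
    moreover have "b * (a' + b') = b' * (a + b)" using n by (simp add: algebra_simps)
    ultimately show "hopf (x, y) = hopf (x', y')" using A by simp
  qed
qed

lemma hopf_surj:
  assumes "p \<in> sphere 0 1"
  shows "\<exists>x y. (x, y) \<noteq> (0, 0) \<and> hopf (x, y) = p"
proof -
  obtain w t where p: "p = (w, t)" by fastforce
  have 1: "(norm w)\<^sup>2 + t\<^sup>2 = 1" using assms by (simp add: p norm_Pair)
  show ?thesis
  proof (cases "t = 1")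
    case True
    then have "w = 0" using 1 by simp
    then have "hopf (1, 0) = p" using True p by (simp add: hopf_def)
    then show ?thesis by (intro exI[of _ 1] exI[of _ 0]) simp
  next
    case False
    have "t\<^sup>2 \<le> 1" using 1 by (smt (verit) zero_le_power2)
    then have "\<bar>t\<bar> \<le> 1" by (simp add: abs_square_le_1)
    then have t: "t < 1" using False by linarith
    have e: "(norm w)\<^sup>2 + (1 - t)\<^sup>2 = 2 * (1 - t)" "(norm w)\<^sup>2 - (1 - t)\<^sup>2 = t * (2 * (1 - t))"
      using 1 by (simp_all add: power2_eq_square algebra_simps)
    have nn: "norm (complex_of_real (1 - t)) = 1 - t" using t by (simp only: norm_of_real)
    \<comment> \<open>The preimage of (w, t) is the line through (w, 1 - t), as in stereographic
      projection from the pole t = 1, which is the point treated separately.\<close>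
    have "hopf (w, of_real (1 - t)) = (2 * w * of_real (1 - t) / of_real (2 * (1 - t)), t * (2 * (1 - t)) / (2 * (1 - t)))"
      unfolding hopf_def prod.case nn e complex_cnj_complex_of_real by (rule refl)
    also have "t * (2 * (1 - t)) / (2 * (1 - t)) = t" using t by simp
    also have "2 * w * of_real (1 - t) / of_real (2 * (1 - t)) = w"
    proof -
      define u where "u = complex_of_real (1 - t)"
      have "u \<noteq> 0" unfolding u_def using t by (metis of_real_eq_0_iff diff_gt_0_iff_gt less_irrefl)
      moreover have "complex_of_real (2 * (1 - t)) = 2 * u" unfolding u_def by (simp only: of_real_mult of_real_numeral)
      ultimately show ?thesis unfolding u_def[symmetric] by simp
    qed
    finally have "hopf (w, of_real (1 - t)) = p" by (simp add: p)
    moreover have "complex_of_real (1 - t) \<noteq> 0" using t by (metis of_real_eq_0_iff diff_gt_0_iff_gt less_irrefl)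
    ultimately show ?thesis by (intro exI[of _ w] exI[of _ "of_real (1 - t)"]) simp
  qed
qed

lemma continuous_on_hopf: "continuous_on {p. p \<noteq> (0, 0)} hopf"
proof -
  have "fst p \<noteq> 0 \<or> snd p \<noteq> 0 \<Longrightarrow> (norm (fst p))\<^sup>2 + (norm (snd p))\<^sup>2 \<noteq> 0" for p :: "complex \<times> complex"
    using sum_norm_pos[of "fst p" "snd p"] by (metis less_irrefl prod.inject)
  then have nz: "p \<in> {p. p \<noteq> (0, 0)} \<Longrightarrow> (norm (fst p))\<^sup>2 + (norm (snd p))\<^sup>2 \<noteq> 0" for p :: "complex \<times> complex"
    by (auto simp: prod_eq_iff)
  have "continuous_on {p. p \<noteq> (0, 0)} (\<lambda>p. (2 * fst p * cnj (snd p) / of_real ((norm (fst p))\<^sup>2 + (norm (snd p))\<^sup>2),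
     ((norm (fst p))\<^sup>2 - (norm (snd p))\<^sup>2) / ((norm (fst p))\<^sup>2 + (norm (snd p))\<^sup>2)))"
    by (intro continuous_intros ballI) (use nz in \<open>auto simp flip: of_real_add of_real_power\<close>)
  then show ?thesis by (simp add: hopf_def case_prod_unfold)
qed

locale generic_complex = generic_rep n M for n :: nat and M :: "complex qmod"
begin

lemma continuous_sub_frame:
  assumes v: "v \<le> n" "2 \<le> v" "v \<le> n - 2" "e v = 1"
  shows "continuous_map (top_of_set (sphere 0 1)) (product_topology (\<lambda>_. euclidean) (frame_index Q M e))
    (\<lambda>p. sub_frame e (line (\<lambda>r. if r = 0 then fst p else snd p)))"
  unfolding continuous_map_componentwise
proof (intro conjI ballI)
  show "(\<lambda>p. sub_frame e (line (\<lambda>r. if r = 0 then fst p else snd p))) ` topspace (top_of_set (sphere 0 1))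
      \<subseteq> extensional (frame_index Q M e)"
    by (auto simp: sub_frame_def)
  fix i assume i: "i \<in> frame_index Q M e"
  obtain u r c where irc: "i = (u, r, c)" using prod_cases3 by blast
  show "continuous_map (top_of_set (sphere 0 1)) euclidean
      (\<lambda>p. sub_frame e (line (\<lambda>r. if r = 0 then fst p else snd p)) i)"
  proof (cases "2 \<le> u \<and> u \<le> n - 2 \<and> e u = 1")
    case False
    then have "(\<lambda>p. sub_frame e (line (\<lambda>r. if r = 0 then fst p else snd p)) i) =
      (\<lambda>p. if 2 \<le> u \<and> u \<le> n - 2 then if r = c then 1 else 0 else 1)"
      using i by (auto simp: sub_frame_def irc)
    then show ?thesis by simp
  next
    case True
    have "r < delta n u" using i True by (auto simp: irc frame_index_def verts_Dtilde dims)
    then have r: "r \<le> 1" using True delta_mid by simp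
    have "sub_frame e (line (\<lambda>r. if r = 0 then fst p else snd p)) i =
      fst p * chain M (\<lambda>r. if r = 0 then 1 else 0) (u - 2) r + snd p * chain M (\<lambda>r. if r = 1 then 1 else 0) (u - 2) r" for p
      using i True chain_basis[OF r, of M "\<lambda>r. if r = 0 then fst p else snd p" "u - 2"]
      by (simp add: sub_frame_def irc line_def)
    then show ?thesis by (simp add: continuous_intros)
  qed
qed

text \<open>The Hopf map of the first column at v is continuous on frames and takes equal values
  exactly on frames with equal span. It therefore descends to a continuous bijection from the
  Grassmannian, which carries the quotient topology, to the sphere. The Grassmannian is compact as
  the image of the unit vectors z of the plane at vertex 2, and a continuous bijection from a
  compact space to a Hausdorff space is a homeomorphism.\<close>

lemma Gr_sphere:
  assumes e: "\<forall>v\<le>n. e v \<le> delta n v" and v: "2 \<le> v" "v \<le> n - 2" "e v = 1"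
    and mono: "mono_dim e" and A: "active e = {}"
  shows "Gr_topology Q M e homeomorphic_space top_of_set (sphere 0 1 :: (complex \<times> real) set)"
proof -
  let ?X = "frame_space Q M e" and ?Y = "Gr_topology Q M e" and ?q = "frame_span Q M e"
  let ?S = "top_of_set (sphere 0 1 :: (complex \<times> real) set)"
  have vn: "v \<le> n" using v by simp
  define vec_of where "vec_of p = (\<lambda>r::nat. if r = 0 then fst p else snd p)" for p :: "complex \<times> complex"
  define col where "col F = (F (v, 0, 0), F (v, 1, 0))" for F :: "nat \<times> nat \<times> nat \<Rightarrow> complex"
  have idx: "(v, 0, 0) \<in> frame_index Q M e" "(v, 1, 0) \<in> frame_index Q M e"
    using v vn delta_mid[OF v(1,2)] by (simp_all add: frame_index_def verts_Dtilde dims)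
  have lines: "on_lines (active e) z \<longleftrightarrow> nz2 z" for z by (simp add: on_lines_def A)
  have frames: "\<exists>z. nz2 z \<and> ?q F = sub_vecs e (line z) \<and> par (\<lambda>r. F (v, r, 0)) (line z v) \<and> col F \<noteq> (0, 0)"
    if F: "F \<in> submodule_frames Q M e" for F
  proof -
    note f = frame_span_submodule_frame[OF e F]
    obtain z where z: "nz2 z" "sub_vecs e (\<lambda>v r. F (v, r, 0)) = sub_vecs e (line z)"
      using ex_line[OF e f(1,2)] by (elim exE conjE)
    have "vec 2 (\<lambda>r. F (v, r, 0)) \<in> sub_vecs e (\<lambda>v r. F (v, r, 0)) v"
      unfolding mem_sub_vecs_mid[OF v(1,2)] using v(3) by (simp add: lin2_def par_def mult.commute)
    then have "par (\<lambda>r. F (v, r, 0)) (line z v)"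
      unfolding z(2) mem_sub_vecs_mid[OF v(1,2)] using v(3) by (simp add: lin2_def par_def)
    moreover have "nz2 (\<lambda>r. F (v, r, 0))" using f(1) v by (simp add: nz_on_def)
    ultimately show ?thesis using z f(3) by (intro exI[of _ z]) (auto simp: nz2_def col_def)
  qed
  define h where "h F = hopf (col F)" for F
  have h_eq: "h F = h F' \<longleftrightarrow> ?q F = ?q F'" if F: "F \<in> submodule_frames Q M e" and F': "F' \<in> submodule_frames Q M e" for F F'
  proof -
    obtain z where z: "nz2 z" "?q F = sub_vecs e (line z)" "par (\<lambda>r. F (v, r, 0)) (line z v)" "col F \<noteq> (0, 0)"
      using frames[OF F] by (elim exE conjE)
    obtain z' where z': "nz2 z'" "?q F' = sub_vecs e (line z')" "par (\<lambda>r. F' (v, r, 0)) (line z' v)" "col F' \<noteq> (0, 0)"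
      using frames[OF F'] by (elim exE conjE)
    have i: "v - 2 \<le> n - 4" using v by linarith
    have nzF: "nz2 (\<lambda>r. F (v, r, 0))" "nz2 (\<lambda>r. F' (v, r, 0))" "nz2 (line z v)" "nz2 (line z' v)"
      using z z' nz2_chain[OF _ i] by (auto simp: nz2_def col_def line_def)
    have "h F = h F' \<longleftrightarrow> par (\<lambda>r. F (v, r, 0)) (\<lambda>r. F' (v, r, 0))"
      using z(4) z'(4) unfolding h_def col_def by (subst hopf_eq_iff) (simp_all add: par_def)
    also have "\<dots> \<longleftrightarrow> par (line z v) (line z' v)"
    proof
      assume "par (\<lambda>r. F (v, r, 0)) (\<lambda>r. F' (v, r, 0))"
      from par_trans[OF this z'(3) nzF(2)] show "par (line z v) (line z' v)"
        by (rule par_trans[OF par_sym[OF z(3)] _ nzF(1)])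
    next
      assume "par (line z v) (line z' v)"
      from par_trans[OF this par_sym[OF z'(3)] nzF(4)] show "par (\<lambda>r. F (v, r, 0)) (\<lambda>r. F' (v, r, 0))"
        by (rule par_trans[OF z(3) _ nzF(3)])
    qed
    also have "\<dots> \<longleftrightarrow> par z z'" unfolding line_def by (rule par_chain_iff[OF i])
    also have "\<dots> \<longleftrightarrow> ?q F = ?q F'" unfolding z(2) z'(2)
      by (rule sub_vecs_line_eq_iff[where v = v and e = e, OF v z(1) z'(1), symmetric])
    finally show ?thesis .
  qed
  have in_X: "sub_frame e (line z) \<in> submodule_frames Q M e" if "nz2 z" for z
    using sub_frame_in_frames[OF e nz_on_line[OF that]] valid_line_iff[OF that] mono that lines by simp
  have cont_h: "continuous_map ?X ?S h"
  proof -
    have c: "continuous_map ?X euclidean (\<lambda>F. F i)" if "i \<in> frame_index Q M e" for i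
      unfolding frame_space_def
      by (intro continuous_map_from_subtopology continuous_map_product_projection that)
    have "continuous_map ?X (prod_topology euclidean euclidean) col"
      unfolding col_def by (intro continuous_map_pairedI c idx)
    then have "continuous_map ?X euclidean col" by (simp add: euclidean_product_topology)
    moreover have "col ` topspace ?X \<subseteq> {p. p \<noteq> (0, 0)}"
    proof
      fix p assume "p \<in> col ` topspace ?X"
      then obtain F where F: "F \<in> submodule_frames Q M e" "p = col F" unfolding topspace_frame_space by (elim imageE)
      obtain z where "col F \<noteq> (0, 0)" using frames[OF F(1)] by (elim exE conjE)
      then show "p \<in> {p. p \<noteq> (0, 0)}" using F by simp
    qed
    ultimately have 1: "continuous_map ?X (top_of_set {p. p \<noteq> (0, 0)}) col"
      unfolding continuous_map_in_subtopology by auto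
    have "continuous_map (top_of_set {p. p \<noteq> (0, 0)}) ?S hopf"
      using continuous_on_hopf hopf_in_sphere by (auto simp: continuous_map_in_subtopology simp del: mem_sphere mem_sphere_0)
    then have "continuous_map ?X ?S (hopf \<circ> col)" by (rule continuous_map_compose[OF 1])
    moreover have "h = hopf \<circ> col" by (rule ext) (simp add: h_def)
    ultimately show ?thesis by simp
  qed
  define g where "g U = h (SOME F. F \<in> submodule_frames Q M e \<and> ?q F = U)" for U
  have gq: "g (?q F) = h F" if F: "F \<in> submodule_frames Q M e" for F
  proof -
    let ?F' = "SOME F'. F' \<in> submodule_frames Q M e \<and> ?q F' = ?q F"
    have F': "?F' \<in> submodule_frames Q M e \<and> ?q ?F' = ?q F"
      by (rule someI[where x = F]) (simp add: F)
    have "h ?F' = h F" using h_eq[of ?F' F] F F' by blast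
    then show ?thesis by (simp only: g_def)
  qed
  have cont_g: "continuous_map ?Y ?S g"
  proof (rule continuous_compose_quotient_map[OF quotient_map_frame_span])
    show "continuous_map ?X ?S (g \<circ> ?q)"
      by (rule continuous_map_eq[OF cont_h]) (simp add: topspace_frame_space gq)
  qed
  have top: "topspace ?Y = ?q ` submodule_frames Q M e" by (simp add: topspace_Gr_topology Gr_def)
  have inj: "inj_on g (topspace ?Y)"
    unfolding top
  proof (rule inj_onI)
    fix U U' assume "U \<in> ?q ` submodule_frames Q M e" "U' \<in> ?q ` submodule_frames Q M e" and eq: "g U = g U'"
    then obtain F F' where F: "F \<in> submodule_frames Q M e" "U = ?q F" "F' \<in> submodule_frames Q M e" "U' = ?q F'"
      by (elim imageE)
    then show "U = U'" using eq h_eq[OF F(1,3)] gq by simp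
  qed
  have surj: "g ` topspace ?Y = topspace ?S"
  proof
    show "g ` topspace ?Y \<subseteq> topspace ?S" using cont_g by (rule continuous_map_image_subset_topspace)
    show "topspace ?S \<subseteq> g ` topspace ?Y"
    proof
      fix p assume "p \<in> topspace ?S"
      then have "p \<in> sphere 0 1" by simp
      from hopf_surj[OF this] obtain x y where xy: "(x, y) \<noteq> (0, 0)" "hopf (x, y) = p" by (elim exE conjE)
      have i: "v - 2 \<le> n - 4" using v by linarith
      from chain_surj[OF i, of "\<lambda>r. if r = 0 then x else y"]
      obtain z where z: "chain M z (v - 2) 0 = x \<and> chain M z (v - 2) 1 = y" by auto
      have "nz2 z"
      proof (rule ccontr)
        assume "\<not> nz2 z"
        then have "z 0 = 0" "z 1 = 0" by (simp_all add: nz2_def)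
        then have "chain M z (v - 2) 0 = 0" "chain M z (v - 2) 1 = 0"
          using chain_basis[of 0 M z "v - 2"] chain_basis[of 1 M z "v - 2"] by simp_all
        then show False using xy z by simp
      qed
      note F = in_X[OF this]
      have "col (sub_frame e (line z)) = (x, y)"
        using z v vn delta_mid[OF v(1,2)] by (simp add: col_def sub_frame_apply line_def)
      then have "g (?q (sub_frame e (line z))) = p" using gq[OF F] xy by (simp add: h_def)
      then show "p \<in> g ` topspace ?Y" using F unfolding top by (metis imageI)
    qed
  qed
  have comp: "compact_space ?Y"
  proof -
    let ?j = "\<lambda>p. sub_frame e (line (vec_of p))"
    have nz: "nz2 (vec_of p)" if "p \<in> sphere 0 1" for p
      using that by (cases p) (auto simp: nz2_def vec_of_def norm_Pair)
    have "continuous_map (top_of_set (sphere 0 1)) (product_topology (\<lambda>_. euclidean) (frame_index Q M e)) ?j"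
      unfolding vec_of_def by (rule continuous_sub_frame[where v = v and e = e, OF vn v])
    moreover have "?j ` topspace (top_of_set (sphere 0 1)) \<subseteq> submodule_frames Q M e"
      by (rule image_subsetI, rule in_X, rule nz) simp
    ultimately have "continuous_map (top_of_set (sphere 0 1)) ?X ?j"
      unfolding frame_space_def continuous_map_in_subtopology by auto
    then have "continuous_map (top_of_set (sphere 0 1)) ?Y (?q \<circ> ?j)"
      by (rule continuous_map_compose[OF _ quotient_imp_continuous_map[OF quotient_map_frame_span]])
    moreover have "compactin (top_of_set (sphere 0 1 :: (complex \<times> complex) set)) (sphere 0 1)"
      by (simp add: compactin_subtopology)
    ultimately have "compactin ?Y ((?q \<circ> ?j) ` sphere 0 1)" by (rule image_compactin[rotated])
    moreover have "(?q \<circ> ?j) ` sphere 0 1 = topspace ?Y"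
    proof
      show "(?q \<circ> ?j) ` sphere 0 1 \<subseteq> topspace ?Y" using in_X[OF nz] unfolding top by auto
      show "topspace ?Y \<subseteq> (?q \<circ> ?j) ` sphere 0 1"
      proof
        fix U assume "U \<in> topspace ?Y"
        then obtain F where F: "F \<in> submodule_frames Q M e" "U = ?q F" unfolding top by (elim imageE)
        obtain z where z: "nz2 z" "?q F = sub_vecs e (line z)" using frames[OF F(1)] by (elim exE conjE)
        define N where "N = norm (z 0, z 1)"
        have N: "N > 0" using z(1) by (auto simp: N_def nz2_def prod_eq_iff)
        define p where "p = (z 0 / of_real N, z 1 / of_real N)"
        have "norm p = norm ((1 / N) *\<^sub>R (z 0, z 1))" by (simp add: p_def scaleR_conv_of_real divide_inverse mult.commute)
        also have "\<dots> = 1" using N unfolding norm_scaleR N_def[symmetric] by simp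
        finally have p: "p \<in> sphere 0 1" by simp
        have "par (vec_of p) z" by (simp add: par_def vec_of_def p_def mult.commute)
        then have "sub_vecs e (line (vec_of p)) = sub_vecs e (line z)"
          using sub_vecs_line_eq_iff[where v = v and e = e, OF v nz[OF p] z(1)] by blast
        then have "(?q \<circ> ?j) p = U"
          using frame_span_sub_frame[OF e nz_on_line[OF nz[OF p]]] z(2) F(2) by simp
        then show "U \<in> (?q \<circ> ?j) ` sphere 0 1" using p by blast
      qed
    qed
    ultimately show ?thesis by (simp add: compact_space_def)
  qed
  have "Hausdorff_space ?S" by (simp add: Hausdorff_space_subtopology)
  then have "homeomorphic_map ?Y ?S g" using continuous_imp_homeomorphic_map[OF cont_g comp _ surj inj] by blast
  then show ?thesis by (rule homeomorphic_map_imp_homeomorphic_space)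
qed

end

section \<open>Counting pairs of cuts with a given dimension vector\<close>

lemma threshold:
  fixes f :: "nat \<Rightarrow> nat"
  assumes n: "n \<ge> 4" and step: "\<forall>k. 2 \<le> k \<and> k \<le> n - 3 \<longrightarrow> f k \<le> f (k + 1)"
  shows "\<exists>K. 2 \<le> K \<and> K \<le> n - 1 \<and> (\<forall>k. 2 \<le> k \<and> k \<le> n - 2 \<longrightarrow> (c \<le> f k \<longleftrightarrow> K \<le> k))"
proof (cases "\<exists>k. 2 \<le> k \<and> k \<le> n - 2 \<and> c \<le> f k")
  case False
  then show ?thesis using n by (intro exI[of _ "n - 1"]) auto
next
  case True
  define K where "K = (LEAST k. 2 \<le> k \<and> k \<le> n - 2 \<and> c \<le> f k)"
  have K: "2 \<le> K \<and> K \<le> n - 2 \<and> c \<le> f K" unfolding K_def using True by (rule LeastI_ex)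
  have le: "K \<le> k" if "2 \<le> k \<and> k \<le> n - 2 \<and> c \<le> f k" for k unfolding K_def using that by (rule Least_le)
  have up: "k \<le> n - 2 \<longrightarrow> c \<le> f k" if "K \<le> k" for k
    using that
  proof (induction k rule: dec_induct)
    case base
    then show ?case using K by simp
  next
    case (step k)
    show ?case
    proof
      assume "Suc k \<le> n - 2"
      then have "2 \<le> k" "k \<le> n - 3" "k \<le> n - 2" using step(1) K by linarith+
      then show "c \<le> f (Suc k)" using step assms(2)[rule_format, of k] by simp
    qed
  qed
  have "K \<le> n - 1" using K by linarith
  then show ?thesis using K le up by (intro exI[of _ K]) blast
qed

text \<open>A sum of two unit steps determines the unordered pair of their positions: it leaves 0 at
  the smaller one and reaches 2 at the larger one. The position n - 1 lies just beyond the range and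
  stands for a step that does not occur in it.\<close>

lemma two_thresholds:
  fixes x y K L n :: nat
  assumes "2 \<le> x" "x \<le> n - 1" "2 \<le> y" "y \<le> n - 1" "2 \<le> K" "K \<le> L" "L \<le> n - 1"
  shows "(\<forall>k. 2 \<le> k \<and> k \<le> n - 2 \<longrightarrow>
      (if x \<le> k then 1 else 0) + (if y \<le> k then 1 else 0) = (if K \<le> k then 1 else 0) + (if L \<le> k then (1::nat) else 0)) \<longleftrightarrow>
    x = K \<and> y = L \<or> x = L \<and> y = K"
    (is "?P \<longleftrightarrow> ?R")
proof
  assume P: ?P
  have I: "(if x \<le> k then 1 else 0) + (if y \<le> k then 1 else 0) = (if K \<le> k then 1 else 0) + (if L \<le> k then (1::nat) else 0)"
    if "2 \<le> k" "k < n - 1" for k using P[rule_format, of k] that by linarith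
  have "min x y = K"
  proof (rule ccontr)
    assume "min x y \<noteq> K"
    then consider "min x y < K" | "K < min x y" by linarith
    then show False
    proof cases
      case 1
      then have "2 \<le> min x y" "min x y < n - 1" "\<not> K \<le> min x y" "\<not> L \<le> min x y" using assms by linarith+
      then show False using I[of "min x y"] by (cases "x \<le> y") simp_all
    next
      case 2
      then have "K < n - 1" "\<not> x \<le> K" "\<not> y \<le> K" using assms by linarith+
      then show False using I[of K] assms by simp
    qed
  qed
  moreover have "max x y = L"
  proof (rule ccontr)
    assume "max x y \<noteq> L"
    then consider "max x y < L" | "L < max x y" by linarith
    then show False
    proof cases
      case 1
      then have "2 \<le> max x y" "max x y < n - 1" "\<not> L \<le> max x y" using assms by linarith+
      then show False using I[of "max x y"] by (simp split: if_splits)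
    next
      case 2
      then have "2 \<le> L" "L < n - 1" "\<not> (x \<le> L \<and> y \<le> L)" using assms by linarith+
      then show False using I[of L] assms by (auto split: if_splits)
    qed
  qed
  ultimately show ?R by (auto simp: min_def max_def split: if_splits)
qed auto

text \<open>The part of a cut that is visible on the vertices 2 to n - 2. The cuts 1 and 2 differ
  only at the left fork, and the cuts n - 1 and n only at the right fork.\<close>

definition clamp :: "nat \<Rightarrow> nat \<Rightarrow> nat" where
  "clamp n a = max 2 (min (n - 1) a)"

lemma clamp_le_iff: "2 \<le> k \<Longrightarrow> k \<le> n - 2 \<Longrightarrow> n \<ge> 4 \<Longrightarrow> clamp n a \<le> k \<longleftrightarrow> a \<le> k"
  by (auto simp: clamp_def min_def max_def)

lemma clamp_bounds: "n \<ge> 4 \<Longrightarrow> 2 \<le> clamp n a \<and> clamp n a \<le> n - 1"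
  by (auto simp: clamp_def)

text \<open>Recovers the cut from its visible step K and two flags: p says that the left end belongs
  to the submodule, q that the right end does not. A flag that is set fixes both the cut and the
  visible step; otherwise the cut is K.\<close>

lemma clamp_eq_iff:
  assumes "n \<ge> 4" "1 \<le> a" "a \<le> n" "2 \<le> K" "K \<le> n - 1"
  shows "clamp n a = K \<and> (a \<le> 1 \<longleftrightarrow> p) \<and> (a \<le> n - 1 \<longleftrightarrow> \<not> q) \<longleftrightarrow>
    (p \<longrightarrow> K = 2) \<and> (q \<longrightarrow> K = n - 1) \<and> a = (if p then 1 else if q then n else K)"
proof -
  consider "a = 1" | "a = n" "a > 1" | "2 \<le> a" "a \<le> n - 1" using assms by linarith
  then show ?thesis
  proof cases
    case 1
    then have "clamp n a = 2" "a \<le> 1" "a \<le> n - 1" "n \<noteq> 1" "K \<noteq> 1" "n - 1 \<noteq> 2" using assms by (auto simp: clamp_def)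
    then show ?thesis using 1 by (cases p; cases q) auto
  next
    case 2
    then have "clamp n a = n - 1" "\<not> a \<le> 1" "\<not> a \<le> n - 1" "K \<noteq> n" "n - 1 \<noteq> 2" using assms by (auto simp: clamp_def)
    then show ?thesis using 2 by auto
  next
    case 3
    then have "clamp n a = a" "\<not> a \<le> 1" "a \<noteq> n" "a \<noteq> 1" using assms by (auto simp: clamp_def)
    then show ?thesis using 3 by auto
  qed
qed

lemma tails_apply:
  assumes n: "n \<ge> 4"
  shows "tails n (a, b) 0 = (if a \<le> 1 then 1 else 0)" "tails n (a, b) (Suc 0) = (if b \<le> 1 then 1 else 0)"
    "tails n (a, b) n = (if a \<le> n - 1 then 1 else 0)" "tails n (a, b) (n - 1) = (if b \<le> n - 1 then 1 else 0)"
    "2 \<le> k \<Longrightarrow> k \<le> n - 2 \<Longrightarrow> tails n (a, b) k = (if a \<le> k then 1 else 0) + (if b \<le> k then 1 else 0)"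
proof -
  obtain m where m: "n = Suc (Suc (Suc (Suc m)))" using n le_Suc_ex[of 4 n] by (auto simp: numeral_eq_Suc)
  show "tails n (a, b) 0 = (if a \<le> 1 then 1 else 0)" "tails n (a, b) (Suc 0) = (if b \<le> 1 then 1 else 0)"
    "tails n (a, b) n = (if a \<le> n - 1 then 1 else 0)" "tails n (a, b) (n - 1) = (if b \<le> n - 1 then 1 else 0)"
    unfolding m by (simp_all add: tails_def tail_def pos_def)
  show "tails n (a, b) k = (if a \<le> k then 1 else 0) + (if b \<le> k then 1 else 0)" if k: "2 \<le> k" "k \<le> n - 2"
  proof -
    have "pos n k = k" "k \<le> n" "k \<noteq> 0" "k \<noteq> 1" "k \<noteq> n" "k \<noteq> n - 1" using k n by (auto simp: pos_def)
    then show ?thesis using k by (simp add: tails_def tail_def)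
  qed
qed

lemma tails_eq_iff:
  assumes n: "n \<ge> 4" and e: "e \<in> (\<Pi>\<^sub>E v\<in>{0..n}. {0..delta n v})"
  shows "tails n (a, b) = e \<longleftrightarrow> (a \<le> 1 \<longleftrightarrow> e 0 = 1) \<and> (b \<le> 1 \<longleftrightarrow> e (Suc 0) = 1) \<and>
    (a \<le> n - 1 \<longleftrightarrow> \<not> e n = 0) \<and> (b \<le> n - 1 \<longleftrightarrow> \<not> e (n - 1) = 0) \<and>
    (\<forall>k. 2 \<le> k \<and> k \<le> n - 2 \<longrightarrow> (if a \<le> k then 1 else 0) + (if b \<le> k then 1 else 0) = e k)"
    (is "_ \<longleftrightarrow> ?R")
proof -
  have le: "e v \<le> delta n v" if "v \<le> n" for v using e that by (auto simp: PiE_iff)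
  have ends: "e 0 \<le> 1" "e (Suc 0) \<le> 1" "e n \<le> 1" "e (n - 1) \<le> 1"
    using le[of 0] le[of "Suc 0"] le[of n] le[of "n - 1"] n by (simp_all add: delta_def)
  have "tails n (a, b) = e \<longleftrightarrow> (\<forall>v\<in>{0..n}. tails n (a, b) v = e v)"
    using PiE_ext[OF tails_in[OF n] e] by auto
  also have "\<dots> \<longleftrightarrow> tails n (a, b) 0 = e 0 \<and> tails n (a, b) (Suc 0) = e (Suc 0) \<and> tails n (a, b) n = e n \<and>
      tails n (a, b) (n - 1) = e (n - 1) \<and> (\<forall>k. 2 \<le> k \<and> k \<le> n - 2 \<longrightarrow> tails n (a, b) k = e k)"
    (is "?A \<longleftrightarrow> ?B")
  proof
    assume A: ?A
    show ?B
    proof (intro conjI allI impI)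
      fix k assume "2 \<le> k \<and> k \<le> n - 2"
      then have "k \<le> n" by linarith
      then show "tails n (a, b) k = e k" using A by simp
    qed (use A n in simp_all)
  next
    assume B: ?B
    show ?A
    proof
      fix v assume "v \<in> {0..n}"
      then consider "v = 0" | "v = Suc 0" | "v = n" | "v = n - 1" | "2 \<le> v \<and> v \<le> n - 2" by force
      then show "tails n (a, b) v = e v" using B by cases simp_all
    qed
  qed
  also have "\<dots> \<longleftrightarrow> ?R"
  proof -
    have "(if a \<le> 1 then 1 else 0) = e 0 \<longleftrightarrow> (a \<le> 1 \<longleftrightarrow> e 0 = 1)"
      "(if b \<le> 1 then 1 else 0) = e (Suc 0) \<longleftrightarrow> (b \<le> 1 \<longleftrightarrow> e (Suc 0) = 1)"
      "(if a \<le> n - 1 then 1 else 0) = e n \<longleftrightarrow> (a \<le> n - 1 \<longleftrightarrow> \<not> e n = 0)"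
      "(if b \<le> n - 1 then 1 else 0) = e (n - 1) \<longleftrightarrow> (b \<le> n - 1 \<longleftrightarrow> \<not> e (n - 1) = 0)"
      using ends by (simp_all only: split: if_splits) linarith+
    moreover have "(\<forall>k. 2 \<le> k \<and> k \<le> n - 2 \<longrightarrow> tails n (a, b) k = e k) \<longleftrightarrow>
        (\<forall>k. 2 \<le> k \<and> k \<le> n - 2 \<longrightarrow> (if a \<le> k then 1 else 0) + (if b \<le> k then 1 else 0) = e k)"
      using tails_apply(5)[OF n, of _ a b] by metis
    ultimately show ?thesis unfolding tails_apply(1-4)[OF n] by argo
  qed
  finally show ?thesis .
qed

context generic_rep
begin

lemma mono_dim_tails: "mono_dim (tails n x)"
proof -
  obtain a b where x: "x = (a, b)" by fastforce
  have n2: "n - 2 \<ge> 2" "n - 2 \<le> n - 2" "(2::nat) \<le> 2" using n by linarith+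
  show ?thesis
    unfolding mono_dim_def x
  proof (intro conjI allI impI ballI)
    fix k assume k: "2 \<le> k \<and> k \<le> n - 3"
    then have "2 \<le> k + 1" "k + 1 \<le> n - 2" "k \<le> n - 2" using n by linarith+
    then show "tails n (a, b) k \<le> tails n (a, b) (k + 1)" using k by (simp add: tails_apply(5)[OF n] del: Suc_eq_plus1 add_Suc_right)
  next
    fix t :: nat assume t: "t \<in> {0, 1}" "tails n (a, b) t = 1"
    then have "a \<le> 1 \<or> b \<le> 1" using tails_apply(1,2)[OF n, of a b] by (auto split: if_splits)
    then show "1 \<le> tails n (a, b) 2" using n2 by (auto simp: tails_apply(5)[OF n])
  next
    fix t assume t: "t \<in> {n - 1, n}" "tails n (a, b) t = 0"
    then have "\<not> a \<le> n - 1 \<or> \<not> b \<le> n - 1" using tails_apply(3,4)[OF n, of a b] by (auto split: if_splits)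
    then have "\<not> a \<le> n - 2 \<or> \<not> b \<le> n - 2" by linarith
    then show "tails n (a, b) (n - 2) \<le> 1" using n2 by (auto simp: tails_apply(5)[OF n])
  qed
qed

end

text \<open>The sixteen patterns of constraints at the four ends. The corrected number r of pairs of
  cuts is 2, 1 or 0 according to whether no end, one end or several ends are active, which are the
  Euler characteristics of a projective line, a point and the empty set. The correction concerns the
  patterns {a, c} and {b, d}, where two ends are active and yet one pair of cuts exists.\<close>

lemma flags_cases:
  fixes a b c d :: nat and p0 p1 q1 qn :: bool
  assumes "a \<noteq> b" "a \<noteq> c" "a \<noteq> d" "b \<noteq> c" "b \<noteq> d" "c \<noteq> d"
  defines "A \<equiv> (if p0 then {a} else {}) \<union> (if p1 then {b} else {}) \<union> (if q1 then {c} else {}) \<union> (if qn then {d} else {})"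
    and "r \<equiv> (if \<not> p1 \<and> \<not> qn then 1 else 0) + (if \<not> p0 \<and> \<not> q1 then 1 else 0) -
        (if p0 \<and> \<not> p1 \<and> \<not> qn \<and> q1 \<or> \<not> p0 \<and> p1 \<and> qn \<and> \<not> q1 then 1 else (0::int))"
  shows "(A = {} \<and> r = 2) \<or> (\<exists>u. A = {u} \<and> r = 1) \<or> (\<exists>u\<in>A. \<exists>u'\<in>A. u \<noteq> u' \<and> r = 0)"
  unfolding A_def r_def using assms(1-6) by (cases p0; cases p1; cases q1; cases qn; simp; blast)

context generic_complex
begin

text \<open>On the path e is the sum of two steps K \<le> L, and a pair of cuts over e distributes
  these steps to the two strings in one of two orders. For K < L each active end rules out one of
  the orders, while on the Grassmannian it puts one condition on the line. For K = L there is no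
  line and both orders give the same pair.\<close>

lemma euler_Gr:
  assumes eE: "e \<in> (\<Pi>\<^sub>E v\<in>{0..n}. {0..delta n v})"
  shows "euler_characteristic (Gr_topology Q M e) =
    int (card {x \<in> {1..n} \<times> {1..n}. tails n x = e}) - (if e \<in> {tails n (1, n), tails n (n, 1)} then 1 else 0)"
proof (cases "mono_dim e")
  case False
  have e: "\<forall>v\<le>n. e v \<le> delta n v" using PiE_mem[OF eE] by simp
  have "Gr Q M e = {}" unfolding Gr_eq_lines[OF e] using False by simp
  then have "euler_characteristic (Gr_topology Q M e) = 0"
    by (intro euler_characteristic_empty) (simp add: topspace_Gr_topology)
  moreover have ne: "tails n x \<noteq> e" for x using mono_dim_tails[of x] False by metis
  moreover have "e \<notin> {tails n (1, n), tails n (n, 1)}" using ne[of "(1, n)"] ne[of "(n, 1)"] by (metis empty_iff insert_iff)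
  ultimately show ?thesis by simp
next
  case True
  have e: "\<forall>v\<le>n. e v \<le> delta n v" using PiE_mem[OF eE] by simp
  have n2: "2 \<le> n - 2" "n - 2 \<le> n - 2" "(2::nat) \<le> 2" "n - 1 \<noteq> n" "n - 1 \<noteq> 0" "n - 1 \<noteq> Suc 0" "n \<noteq> 0" "n \<noteq> Suc 0" "n - 2 < n - 1"
    "n - Suc 0 \<noteq> n" "n - Suc 0 \<noteq> 0" "n - Suc 0 \<noteq> Suc 0"
    using n by linarith+
  have mid2: "e k \<le> 2" if "2 \<le> k" "k \<le> n - 2" for k
  proof -
    have "k \<le> n" using that by linarith
    then show ?thesis using e delta_mid[OF that] by metis
  qed
  have ends: "e 0 \<le> 1" "e (Suc 0) \<le> 1" "e n \<le> 1" "e (n - 1) \<le> 1"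
    using e[rule_format, of 0] e[rule_format, of "Suc 0"] e[rule_format, of n] e[rule_format, of "n - 1"] n by (simp_all add: delta_def)
  have step: "\<forall>k. 2 \<le> k \<and> k \<le> n - 3 \<longrightarrow> e k \<le> e (k + 1)" using True by (simp add: mono_dim_def)
  from threshold[OF n step, of 1] obtain K where
    "2 \<le> K \<and> K \<le> n - 1 \<and> (\<forall>k. 2 \<le> k \<and> k \<le> n - 2 \<longrightarrow> (1 \<le> e k \<longleftrightarrow> K \<le> k))" ..
  then have K: "2 \<le> K" "K \<le> n - 1" "\<And>k. 2 \<le> k \<Longrightarrow> k \<le> n - 2 \<Longrightarrow> 1 \<le> e k \<longleftrightarrow> K \<le> k" by simp_all
  from threshold[OF n step, of 2] obtain L where
    "2 \<le> L \<and> L \<le> n - 1 \<and> (\<forall>k. 2 \<le> k \<and> k \<le> n - 2 \<longrightarrow> (2 \<le> e k \<longleftrightarrow> L \<le> k))" ..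
  then have L: "2 \<le> L" "L \<le> n - 1" "\<And>k. 2 \<le> k \<Longrightarrow> k \<le> n - 2 \<Longrightarrow> 2 \<le> e k \<longleftrightarrow> L \<le> k" by simp_all
  have KL: "K \<le> L"
  proof (rule ccontr)
    assume "\<not> K \<le> L"
    then have "L \<le> n - 2" using K by linarith
    then have "2 \<le> e L" using L(3)[OF L(1)] by blast
    then have "1 \<le> e L" by linarith
    then have "K \<le> L" using K(3)[OF L(1) \<open>L \<le> n - 2\<close>] by blast
    then show False using \<open>\<not> K \<le> L\<close> by simp
  qed
  have ek: "e k = (if K \<le> k then 1 else 0) + (if L \<le> k then 1 else 0)" if "2 \<le> k" "k \<le> n - 2" for k
    using K(3)[OF that] L(3)[OF that] mid2[OF that] KL by auto
  \<comment> \<open>On the left the flags record that an end belongs to the submodule, on the right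
    that it is missing; these are the situations in which an end can constrain the line.\<close>
  define p0 p1 q1 qn where "p0 \<longleftrightarrow> e 0 = 1" and "p1 \<longleftrightarrow> e (Suc 0) = 1" and "q1 \<longleftrightarrow> e (n - 1) = 0" and "qn \<longleftrightarrow> e n = 0"
  have left: "p0 \<or> p1 \<Longrightarrow> K = 2"
  proof -
    assume "p0 \<or> p1"
    then have "1 \<le> e 2" using True by (auto simp: mono_dim_def p0_def p1_def)
    then show "K = 2" using K(3)[of 2] K(1) n2 by simp
  qed
  have right: "q1 \<or> qn \<Longrightarrow> L = n - 1"
  proof -
    assume "q1 \<or> qn"
    then have "e (n - 2) \<le> 1" using True by (auto simp: mono_dim_def q1_def qn_def)
    then show "L = n - 1" using L(3)[of "n - 2"] L(2) n2 by auto
  qed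
  \<comment> \<open>These are the cuts on the first and the second string whose visible step is k,
    given the flags of the ends of that string; \<open>okA\<close> and \<open>okB\<close> say that
    the flags admit this step.\<close>
  define \<alpha> \<beta> where "\<alpha> k = (if p0 then 1 else if qn then n else k)" and "\<beta> k = (if p1 then 1 else if q1 then n else k)" for k
  define okA okB where "okA k \<longleftrightarrow> (p0 \<longrightarrow> k = 2) \<and> (qn \<longrightarrow> k = n - 1)"
    and "okB k \<longleftrightarrow> (p1 \<longrightarrow> k = 2) \<and> (q1 \<longrightarrow> k = n - 1)" for k
  have fiber: "tails n (a, b) = e \<longleftrightarrow>
      (okA K \<and> okB L \<and> a = \<alpha> K \<and> b = \<beta> L) \<or> (okA L \<and> okB K \<and> a = \<alpha> L \<and> b = \<beta> K)"
    if ab: "1 \<le> a" "a \<le> n" "1 \<le> b" "b \<le> n" for a b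
  proof -
    note cb = clamp_bounds[OF n, of a] clamp_bounds[OF n, of b]
    have A: "okA k \<and> a = \<alpha> k \<longleftrightarrow> clamp n a = k \<and> (a \<le> 1 \<longleftrightarrow> p0) \<and> (a \<le> n - 1 \<longleftrightarrow> \<not> qn)" if "2 \<le> k" "k \<le> n - 1" for k
      using clamp_eq_iff[OF n ab(1,2) that, of p0 qn] by (simp add: okA_def \<alpha>_def)
    have B: "okB k \<and> b = \<beta> k \<longleftrightarrow> clamp n b = k \<and> (b \<le> 1 \<longleftrightarrow> p1) \<and> (b \<le> n - 1 \<longleftrightarrow> \<not> q1)" if "2 \<le> k" "k \<le> n - 1" for k
      using clamp_eq_iff[OF n ab(3,4) that, of p1 q1] by (simp add: okB_def \<beta>_def)
    have "(\<forall>k. 2 \<le> k \<and> k \<le> n - 2 \<longrightarrow> (if a \<le> k then 1 else 0) + (if b \<le> k then 1 else 0) = e k) \<longleftrightarrow>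
        (\<forall>k. 2 \<le> k \<and> k \<le> n - 2 \<longrightarrow> (if clamp n a \<le> k then 1 else 0) + (if clamp n b \<le> k then 1 else 0) =
           (if K \<le> k then 1 else 0) + (if L \<le> k then (1::nat) else 0))"
      using ek clamp_le_iff[OF _ _ n] by simp
    also have "\<dots> \<longleftrightarrow> clamp n a = K \<and> clamp n b = L \<or> clamp n a = L \<and> clamp n b = K"
      by (rule two_thresholds) (use cb K L KL in auto)
    finally have C: "(\<forall>k. 2 \<le> k \<and> k \<le> n - 2 \<longrightarrow> (if a \<le> k then 1 else 0) + (if b \<le> k then 1 else 0) = e k) \<longleftrightarrow>
        clamp n a = K \<and> clamp n b = L \<or> clamp n a = L \<and> clamp n b = K" .
    show ?thesis
      unfolding tails_eq_iff[OF n eE] C p0_def[symmetric] p1_def[symmetric] q1_def[symmetric] qn_def[symmetric]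
      using A[OF K(1,2)] A[OF L(1,2)] B[OF K(1,2)] B[OF L(1,2)] by metis
  qed
  have rng: "1 \<le> \<alpha> k \<and> \<alpha> k \<le> n" "1 \<le> \<beta> k \<and> \<beta> k \<le> n" if "2 \<le> k" "k \<le> n - 1" for k
    using that n by (auto simp: \<alpha>_def \<beta>_def)
  define S where "S = {x \<in> {1..n} \<times> {1..n}. tails n x = e}"
  have S: "S = (if okA K \<and> okB L then {(\<alpha> K, \<beta> L)} else {}) \<union> (if okA L \<and> okB K then {(\<alpha> L, \<beta> K)} else {})"
  proof (rule Set.set_eqI)
    fix x :: "nat \<times> nat"
    obtain a b where x: "x = (a, b)" by fastforce
    show "x \<in> S \<longleftrightarrow> x \<in> (if okA K \<and> okB L then {(\<alpha> K, \<beta> L)} else {}) \<union> (if okA L \<and> okB K then {(\<alpha> L, \<beta> K)} else {})"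
      unfolding S_def x using fiber[of a b] rng[OF K(1,2)] rng[OF L(1,2)] by auto
  qed
  have special: "e = tails n (1, n) \<longleftrightarrow> p0 \<and> \<not> p1 \<and> \<not> qn \<and> q1 \<and> K < L" "e = tails n (n, 1) \<longleftrightarrow> \<not> p0 \<and> p1 \<and> qn \<and> \<not> q1 \<and> K < L"
  proof -
    have \<alpha>: "1 = \<alpha> k \<longleftrightarrow> p0" "n = \<alpha> k \<longleftrightarrow> \<not> p0 \<and> qn" and \<beta>: "1 = \<beta> k \<longleftrightarrow> p1" "n = \<beta> k \<longleftrightarrow> \<not> p1 \<and> q1"
      if "2 \<le> k" "k \<le> n - 1" for k
    proof -
      have "1 \<noteq> k" "n \<noteq> k" "1 \<noteq> n" "n \<noteq> 1" using that n by linarith+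
      then show "1 = \<alpha> k \<longleftrightarrow> p0" "n = \<alpha> k \<longleftrightarrow> \<not> p0 \<and> qn" "1 = \<beta> k \<longleftrightarrow> p1" "n = \<beta> k \<longleftrightarrow> \<not> p1 \<and> q1"
        by (simp_all add: \<alpha>_def \<beta>_def)
    qed
    have n1: "1 \<le> (1::nat)" "1 \<le> n" "n \<le> n" using n by linarith+
    have ne: "\<not> (K = 2 \<and> K = n - 1)" "\<not> (L = 2 \<and> L = n - 1)" "K < L \<longleftrightarrow> K \<noteq> L" using n KL by linarith+
    have "tails n (1, n) = e \<longleftrightarrow> p0 \<and> \<not> p1 \<and> \<not> qn \<and> q1 \<and> K < L"
      unfolding fiber[OF n1(1,2,2,3)] \<alpha>[OF K(1,2)] \<alpha>[OF L(1,2)] \<beta>[OF K(1,2)] \<beta>[OF L(1,2)] okA_def okB_def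
      using left right ne by metis
    moreover have "tails n (n, 1) = e \<longleftrightarrow> \<not> p0 \<and> p1 \<and> qn \<and> \<not> q1 \<and> K < L"
      unfolding fiber[OF n1(2,3,1,2)] \<alpha>[OF K(1,2)] \<alpha>[OF L(1,2)] \<beta>[OF K(1,2)] \<beta>[OF L(1,2)] okA_def okB_def
      using left right ne by metis
    ultimately show "e = tails n (1, n) \<longleftrightarrow> p0 \<and> \<not> p1 \<and> \<not> qn \<and> q1 \<and> K < L"
      "e = tails n (n, 1) \<longleftrightarrow> \<not> p0 \<and> p1 \<and> qn \<and> \<not> q1 \<and> K < L" by metis+
  qed
  show ?thesis
  proof (cases "K = L")
    case eq: True
    \<comment> \<open>Both steps coincide, so e jumps from 0 to 2 and no line has to be
      chosen.\<close>
    have "e k \<noteq> 1" if "2 \<le> k" "k \<le> n - 2" for k using ek[OF that] eq by simp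
    from Gr_no_line[OF e this True] obtain U where "Gr Q M e = {U}" by blast
    then have chi: "euler_characteristic (Gr_topology Q M e) = 1"
      by (intro euler_characteristic_point) (simp add: topspace_Gr_topology)
    have "okA K" "okB K" using left right eq by (auto simp: okA_def okB_def)
    then have "card S = 1" unfolding S using eq by simp
    moreover have "e \<notin> {tails n (1, n), tails n (n, 1)}" using special eq by simp
    ultimately show ?thesis unfolding S_def[symmetric] chi by simp
  next
    case False
    then have lt: "K < L" using KL by simp
    then have K2: "K \<le> n - 2" using L by linarith
    have eK: "e K = 1" using ek[OF K(1) K2] lt by simp
    have e2: "e 2 = 1" if "p0 \<or> p1" using left[OF that] eK by simp
    have en2: "e (n - 2) = 1" if "q1 \<or> qn"
      using right[OF that] ek[OF n2(1,2)] K2 n by auto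
    have act: "active e = (if p0 then {0} else {}) \<union> (if p1 then {Suc 0} else {}) \<union> (if q1 then {n - 1} else {}) \<union> (if qn then {n} else {})"
    proof (rule Set.set_eqI)
      fix x
      have "x \<in> active e \<longleftrightarrow> (x = 0 \<and> p0 \<and> e 2 = 1) \<or> (x = Suc 0 \<and> p1 \<and> e 2 = 1) \<or>
          (x = n - 1 \<and> q1 \<and> e (n - 2) = 1) \<or> (x = n \<and> qn \<and> e (n - 2) = 1)"
        unfolding active_def p0_def p1_def q1_def qn_def One_nat_def
        by (simp only: Un_iff mem_Collect_eq insert_iff empty_iff) metis
      also have "\<dots> \<longleftrightarrow> (x = 0 \<and> p0) \<or> (x = Suc 0 \<and> p1) \<or> (x = n - 1 \<and> q1) \<or> (x = n \<and> qn)"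
        using e2 en2 by blast
      finally show "x \<in> active e \<longleftrightarrow> x \<in> (if p0 then {0} else {}) \<union> (if p1 then {Suc 0} else {}) \<union>
          (if q1 then {n - 1} else {}) \<union> (if qn then {n} else {})" by simp
    qed
    have card: "int (card S) = (if \<not> p1 \<and> \<not> qn then 1 else 0) + (if \<not> p0 \<and> \<not> q1 then 1 else 0)"
    proof -
      have A: "okA K \<and> okB L \<longleftrightarrow> \<not> p1 \<and> \<not> qn" "okA L \<and> okB K \<longleftrightarrow> \<not> p0 \<and> \<not> q1"
        using left right lt L K by (auto simp: okA_def okB_def)
      have "(\<alpha> K, \<beta> L) \<noteq> (\<alpha> L, \<beta> K)" if "\<not> p1 \<and> \<not> qn" "\<not> p0 \<and> \<not> q1"
        using that lt by (simp add: \<alpha>_def)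
      then show ?thesis unfolding S A by auto
    qed
    have "euler_characteristic (Gr_topology Q M e) =
        (if \<not> p1 \<and> \<not> qn then 1 else 0) + (if \<not> p0 \<and> \<not> q1 then 1 else 0) -
        (if p0 \<and> \<not> p1 \<and> \<not> qn \<and> q1 \<or> \<not> p0 \<and> p1 \<and> qn \<and> \<not> q1 then 1 else 0)"
      (is "_ = ?rhs")
    proof -
      have "(0::nat) \<noteq> Suc 0" "0 \<noteq> n - 1" "0 \<noteq> n" "Suc 0 \<noteq> n - 1" "Suc 0 \<noteq> n" "n - 1 \<noteq> n" using n by linarith+
      then have "(active e = {} \<and> ?rhs = 2) \<or> (\<exists>u. active e = {u} \<and> ?rhs = 1) \<or>
          (\<exists>u\<in>active e. \<exists>u'\<in>active e. u \<noteq> u' \<and> ?rhs = 0)"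
        unfolding act by (rule flags_cases)
      then consider "active e = {}" "?rhs = 2" | u where "active e = {u}" "?rhs = 1"
        | u u' where "u \<in> active e" "u' \<in> active e" "u \<noteq> u'" "?rhs = 0"
        by (elim disjE exE bexE conjE)
      then show ?thesis
      proof cases
        case 1
        have "euler_characteristic (Gr_topology Q M e) = 2"
          by (rule euler_characteristic_sphere, rule Gr_sphere[where v = K and e = e, OF e K(1) K2 eK True 1(1)])
        then show ?thesis using 1(2) by simp
      next
        case (2 u)
        from Gr_one_active[where v = K and e = e, OF e K(1) K2 eK True 2(1)] obtain U where "Gr Q M e = {U}" by (elim exE)
        then have "euler_characteristic (Gr_topology Q M e) = 1"
          by (intro euler_characteristic_point) (simp add: topspace_Gr_topology)
        then show ?thesis using 2(2) by simp
      next
        case (3 u u')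
        have "euler_characteristic (Gr_topology Q M e) = 0"
          using Gr_two_active[OF e 3(1,2,3)] by (intro euler_characteristic_empty) (simp add: topspace_Gr_topology)
        then show ?thesis using 3(4) by simp
      qed
    qed
    then show ?thesis unfolding S_def[symmetric] card using special lt by simp
  qed
qed

end

section \<open>Change of the ground field and the Laurent polynomial of a generic module\<close>

lemma act_map_qmod:
  assumes "is_qmod Q M" "(i, l) \<in> arrows Q" "r < dimv M i" "c < dimv M l"
  shows "act (map_qmod \<sigma> M) (i, l) $$ (r, c) = \<sigma> (act M (i, l) $$ (r, c))"
  using assms by (auto simp: is_qmod_def map_qmod_def)

text \<open>Genericity is the nonvanishing of certain polynomials in the matrix entries. The
  embedding commutes with these polynomials, and it sends nonzero elements of K to nonzero
  numbers.\<close>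

lemma (in generic_rep) generic_map_qmod:
  assumes emb: "complex_embedding K \<sigma>" and K: "\<forall>a\<in>arrows Q. elements_mat (act M a) \<subseteq> K"
  shows "generic_module n (map_qmod \<sigma> M)"
proof -
  interpret embedded_field K \<sigma> by unfold_locales (rule emb)
  let ?N = "map_qmod \<sigma> M"
  have entry: "act M (i, l) $$ (r, c) \<in> K \<and> act ?N (i, l) $$ (r, c) = \<sigma> (act M (i, l) $$ (r, c))"
    if "(i, l) \<in> arrows Q" "r < delta n i" "c < delta n l" for i l r c
  proof -
    have "i \<le> n" "l \<le> n" using Dtilde_arrow_cases[OF n that(1)] by auto
    then have d: "r < dimv M i" "c < dimv M l" using that dims by auto
    have "act M (i, l) $$ (r, c) \<in> elements_mat (act M (i, l))"
      using act_carrier[OF that(1)] that by (intro elements_matI) auto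
    then show ?thesis using K that(1) act_map_qmod[OF qmod that(1) d] by blast
  qed
  have mid: "act M (k + 1, k) $$ (r, c) \<in> K \<and> act ?N (k + 1, k) $$ (r, c) = \<sigma> (act M (k + 1, k) $$ (r, c))"
    if "2 \<le> k" "k \<le> n - 3" "r \<le> 1" "c \<le> 1" for k r c
  proof -
    have "2 \<le> k + 1" "k + 1 \<le> n - 2" "k \<le> n - 2" using that n by linarith+
    then show ?thesis using entry[OF arrow_in(1)[OF that(1,2)], of r c] that delta_mid[of k] delta_mid[of "k + 1"] by simp
  qed
  have left: "act M (2, t) $$ (r, 0) \<in> K \<and> act ?N (2, t) $$ (r, 0) = \<sigma> (act M (2, t) $$ (r, 0))" if "t \<le> 1" "r \<le> 1" for t r
  proof -
    have "t \<in> {0, 1}" using that by auto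
    then show ?thesis using entry[OF arrow_in(2)[of t], of r 0] that delta_mid[of 2] delta_end[of t] n by auto
  qed
  have right: "act M (b, n - 2) $$ (0, c) \<in> K \<and> act ?N (b, n - 2) $$ (0, c) = \<sigma> (act M (b, n - 2) $$ (0, c))"
    if "b \<in> {n - 1, n}" "c \<le> 1" for b c
    using entry[OF arrow_in(3)[OF that(1)], of 0 c] that delta_mid[of "n - 2"] delta_end[of b] n by auto
  have chain: "\<forall>r\<le>1. chain M z i r \<in> K \<and> chain ?N (\<lambda>r. \<sigma> (z r)) i r = \<sigma> (chain M z i r)"
    if "i \<le> n - 4" and z: "\<forall>r\<le>1. z r \<in> K" for i z
    using that(1)
  proof (induction i)
    case 0
    then show ?case using z by simp
  next
    case (Suc i)
    then have IH: "\<forall>r\<le>1. chain M z i r \<in> K \<and> chain ?N (\<lambda>r. \<sigma> (z r)) i r = \<sigma> (chain M z i r)" by simp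
    have ik: "2 \<le> i + 2" "i + 2 \<le> n - 3" using Suc.prems n by linarith+
    have m: "act M (i + 3, i + 2) $$ (r, c) \<in> K \<and> act ?N (i + 3, i + 2) $$ (r, c) = \<sigma> (act M (i + 3, i + 2) $$ (r, c))"
      if "r \<le> 1" "c \<le> 1" for r c
      using mid[OF ik that] by (simp add: numeral_3_eq_3)
    show ?case
      using IH m by (simp add: mul2_def mult_in add_in sigma_add sigma_mult)
  qed
  have ef: "end_fun n M u c \<in> K \<and> end_fun n ?N u c = \<sigma> (end_fun n M u c)"
    if u: "u \<in> {0, 1, n - 1, n}" and c: "c \<le> 1" for u c
  proof (cases "u \<le> 1")
    case True
    then show ?thesis using left[of u 0] left[of u 1] by (simp add: end_fun_def uminus_in sigma_minus)
  next
    case False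
    then have b: "u \<in> {n - 1, n}" using u by auto
    define z :: "nat \<Rightarrow> 'k" where "z r = (if r = c then 1 else 0)" for r
    have "(\<lambda>r. \<sigma> (z r)) = (\<lambda>r. if r = c then 1 else 0)" by (auto simp: z_def)
    moreover have "\<forall>r\<le>1. z r \<in> K" by (simp add: z_def one_in zero_in)
    ultimately have "\<forall>r\<le>1. chain M z (n - 4) r \<in> K \<and> chain ?N (\<lambda>r. if r = c then 1 else 0) (n - 4) r = \<sigma> (chain M z (n - 4) r)"
      using chain[of "n - 4" z] by simp
    then show ?thesis
      using right[OF b, of 0] right[OF b, of 1] False
      by (simp add: end_fun_def Let_def z_def[abs_def, symmetric] mult_in add_in sigma_add sigma_mult)
  qed
  show ?thesis
    unfolding generic_module_def
  proof (intro conjI allI impI ballI)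
    show "n \<ge> 4" by (rule n)
    show "is_qmod Q ?N" using qmod by (auto simp: is_qmod_def map_qmod_def)
    show "dimv ?N v = delta n v" if "v \<le> n" for v using dims[OF that] by (simp add: map_qmod_def)
  next
    fix k assume k: "2 \<le> k \<and> k \<le> n - 3"
    have k': "2 \<le> k" "k \<le> n - 3" using k by blast+
    let ?d = "det2 (\<lambda>r c. act M (k + 1, k) $$ (r, c))"
    have "?d \<in> K" "det2 (\<lambda>r c. act ?N (k + 1, k) $$ (r, c)) = \<sigma> ?d"
      using mid[OF k', of 0 0] mid[OF k', of 0 1] mid[OF k', of 1 0] mid[OF k', of 1 1]
      unfolding det2_def by (simp_all add: mult_in diff_in sigma_diff sigma_mult)
    then show "det2 (\<lambda>r c. act ?N (k + 1, k) $$ (r, c)) \<noteq> 0" using sigma_nz det[OF k'] by simp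
  next
    fix u v assume uv: "u \<in> {0, 1, n - 1, n}" "v \<in> {0, 1, n - 1, n}" "u \<noteq> v"
    let ?d = "end_fun n M u 0 * end_fun n M v 1 - end_fun n M u 1 * end_fun n M v 0"
    have "?d \<in> K" "end_fun n ?N u 0 * end_fun n ?N v 1 - end_fun n ?N u 1 * end_fun n ?N v 0 = \<sigma> ?d"
      using ef[OF uv(1), of 0] ef[OF uv(1), of 1] ef[OF uv(2), of 0] ef[OF uv(2), of 1]
      by (simp_all add: mult_in diff_in sigma_diff sigma_mult)
    then show "end_fun n ?N u 0 * end_fun n ?N v 1 - end_fun n ?N u 1 * end_fun n ?N v 0 \<noteq> 0"
      using sigma_nz ends[OF uv] by simp
  qed
qed

text \<open>Every admissible embedding turns the module into a generic complex one, whose Euler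
  characteristics depend on n and e only. All candidates for the choice in \<open>chi_Gr\<close>
  therefore agree, and at least one exists.\<close>

lemma CC_generic:
  fixes M :: "'k::field_char_0 qmod"
  assumes "generic_module n M"
  shows "CC (Dtilde n) M = trace_ratfun n"
proof -
  interpret generic_rep n M by unfold_locales (rule assms)
  have fin: "finite (\<Union>a\<in>arrows Q. elements_mat (act M a))"
  proof -
    have "arrows Q \<subseteq> {0..n} \<times> {0..n}" using Dtilde_arrow_cases[OF n] by fastforce
    then have "finite (arrows Q)" by (rule finite_subset) simp
    moreover have "finite (elements_mat A)" for A :: "'k mat" unfolding elements_mat_def by simp
    ultimately show ?thesis by (rule finite_UN_I)
  qed
  have chi: "chi_Gr Q M e = int (card {x \<in> {1..n} \<times> {1..n}. tails n x = e}) -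
      (if e \<in> {tails n (1, n), tails n (n, 1)} then 1 else 0)" (is "_ = ?c")
    if e: "e \<in> (\<Pi>\<^sub>E v\<in>{0..n}. {0..delta n v})" for e
  proof -
    obtain K \<sigma> where K: "complex_embedding K \<sigma>" "(\<Union>a\<in>arrows Q. elements_mat (act M a)) \<subseteq> K"
      using ex_complex_embedding[OF fin] by (elim exE conjE)
    have val: "euler_characteristic (Gr_topology Q (map_qmod \<sigma> M) e) = ?c"
      if "complex_embedding K \<sigma>" "\<forall>a\<in>arrows Q. elements_mat (act M a) \<subseteq> K" for K \<sigma>
    proof -
      interpret N: generic_complex n "map_qmod \<sigma> M"
        by unfold_locales (rule generic_map_qmod[OF that])
      show ?thesis by (rule N.euler_Gr[OF e])
    qed
    show ?thesis
      unfolding chi_Gr_def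
    proof (rule some_equality)
      show "\<exists>K \<sigma>. complex_embedding K \<sigma> \<and> (\<forall>a\<in>arrows Q. elements_mat (act M a) \<subseteq> K) \<and>
          ?c = euler_characteristic (Gr_topology Q (map_qmod \<sigma> M) e)"
      proof (intro exI[of _ K] exI[of _ \<sigma>] conjI)
        show "complex_embedding K \<sigma>" by (rule K(1))
        show K': "\<forall>a\<in>arrows Q. elements_mat (act M a) \<subseteq> K" using K(2) by blast
        show "?c = euler_characteristic (Gr_topology Q (map_qmod \<sigma> M) e)" by (rule val[OF K(1) K', symmetric])
      qed
    next
      fix c assume "\<exists>K \<sigma>. complex_embedding K \<sigma> \<and> (\<forall>a\<in>arrows Q. elements_mat (act M a) \<subseteq> K) \<and>
          c = euler_characteristic (Gr_topology Q (map_qmod \<sigma> M) e)"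
      then show "c = ?c" using val by (elim exE conjE) simp
    qed
  qed
  have "CC Q M = (\<Sum>e \<in> (\<Pi>\<^sub>E v\<in>{0..n}. {0..delta n v}). of_int (chi_Gr Q M e) *
      cc_monom n (\<lambda>v. int (delta n v)) (\<lambda>v. int (e v)))"
    unfolding CC_def verts_Dtilde
  proof (rule sum.cong)
    show "(\<Pi>\<^sub>E v\<in>{0..n}. {0..dimv M v}) = (\<Pi>\<^sub>E v\<in>{0..n}. {0..delta n v})"
      by (rule PiE_cong) (simp add: dims)
    fix e
    have "(\<Prod>i\<in>{0..n}. var i powi (- euler_form Q (\<lambda>v. int (e v)) (simple_root i)
         - euler_form Q (simple_root i) (\<lambda>v. int (dimv M v) - int (e v)))) =
        cc_monom n (\<lambda>v. int (dimv M v)) (\<lambda>v. int (e v))"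
      unfolding cc_monom_def cc_exponent_def by (rule refl)
    also have "\<dots> = cc_monom n (\<lambda>v. int (delta n v)) (\<lambda>v. int (e v))"
      by (rule cc_monom_cong[OF n]) (simp_all add: dims)
    finally show "of_int (chi_Gr Q M e) * (\<Prod>i\<in>{0..n}. var i powi (- euler_form Q (\<lambda>v. int (e v)) (simple_root i)
         - euler_form Q (simple_root i) (\<lambda>v. int (dimv M v) - int (e v)))) =
       of_int (chi_Gr Q M e) * cc_monom n (\<lambda>v. int (delta n v)) (\<lambda>v. int (e v))" by simp
  qed
  also have "\<dots> = trace_ratfun n"
    unfolding trace_ratfun_eq_sum[OF n, symmetric] by (rule sum.cong) (simp_all only: chi)
  finally show ?thesis .
qed

section \<open>Extensions and almost split sequences\<close>

lemma mult_assoc_dim: "dim_col A = dim_row B \<Longrightarrow> dim_col B = dim_row C \<Longrightarrow> A * B * C = A * (B * (C :: 'a::semiring_0 mat))"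
  by (rule assoc_mult_mat[of A "dim_row A" "dim_row B" B "dim_row C" C "dim_col C"]) auto

lemma mult_add_dim: "dim_col A = dim_row B \<Longrightarrow> dim_row B = dim_row C \<Longrightarrow> dim_col B = dim_col C \<Longrightarrow>
    A * (B + C) = A * B + A * (C :: 'a::semiring_0 mat)"
  by (rule mult_add_distrib_mat[of A "dim_row A" "dim_row B" B "dim_col B" C]) auto

lemma add_mult_dim: "dim_row A = dim_row B \<Longrightarrow> dim_col A = dim_col B \<Longrightarrow> dim_col A = dim_row C \<Longrightarrow>
    (A + B) * C = A * C + B * (C :: 'a::semiring_0 mat)"
  by (rule add_mult_distrib_mat[of A "dim_row A" "dim_row C" B C "dim_col C"]) auto

lemma zero_add_dim: "dim_row A = r \<Longrightarrow> dim_col A = c \<Longrightarrow> 0\<^sub>m r c + A = (A :: 'a::semiring_0 mat)"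
  by (rule left_add_zero_mat[of A r c]) auto

lemma add_zero_dim: "dim_row A = r \<Longrightarrow> dim_col A = c \<Longrightarrow> A + 0\<^sub>m r c = (A :: 'a::semiring_0 mat)"
  by (rule right_add_zero_mat[of A r c]) auto

lemma zero_mult_dim: "dim_row A = c \<Longrightarrow> 0\<^sub>m r c * A = 0\<^sub>m r (dim_col (A :: 'a::semiring_0 mat))"
  by (rule left_mult_zero_mat[of A c "dim_col A"]) auto

lemma mult_zero_dim: "dim_col A = r \<Longrightarrow> A * 0\<^sub>m r c = 0\<^sub>m (dim_row (A :: 'a::semiring_0 mat)) c"
  by (rule right_mult_zero_mat[of A "dim_row A" r]) auto

lemma one_mult_dim: "dim_row A = r \<Longrightarrow> 1\<^sub>m r * A = (A :: 'a::semiring_1 mat)"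
  by (rule left_mult_one_mat[of A r "dim_col A"]) auto

lemma mult_one_dim: "dim_col A = c \<Longrightarrow> A * 1\<^sub>m c = (A :: 'a::semiring_1 mat)"
  by (rule right_mult_one_mat[of A "dim_row A" c]) auto

definition inl_mat :: "nat \<Rightarrow> nat \<Rightarrow> 'k::field mat" where
  "inl_mat a b = mat (a + b) a (\<lambda>(r, c). if r = c then 1 else 0)"

definition inr_mat :: "nat \<Rightarrow> nat \<Rightarrow> 'k::field mat" where
  "inr_mat a b = mat (a + b) b (\<lambda>(r, c). if r = a + c then 1 else 0)"

definition prl_mat :: "nat \<Rightarrow> nat \<Rightarrow> 'k::field mat" where
  "prl_mat a b = mat a (a + b) (\<lambda>(r, c). if c = r then 1 else 0)"

definition prr_mat :: "nat \<Rightarrow> nat \<Rightarrow> 'k::field mat" where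
  "prr_mat a b = mat b (a + b) (\<lambda>(r, c). if c = a + r then 1 else 0)"

lemma dim_inj_proj [simp]:
  "dim_row (inl_mat a b) = a + b" "dim_col (inl_mat a b) = a"
  "dim_row (inr_mat a b) = a + b" "dim_col (inr_mat a b) = b"
  "dim_row (prl_mat a b) = a" "dim_col (prl_mat a b) = a + b"
  "dim_row (prr_mat a b) = b" "dim_col (prr_mat a b) = a + b"
  by (simp_all add: inl_mat_def inr_mat_def prl_mat_def prr_mat_def)

lemma proj_inj:
  "prl_mat a b * inl_mat a b = (1\<^sub>m a :: 'k::field mat)" "prr_mat a b * inr_mat a b = (1\<^sub>m b :: 'k mat)"
  "prl_mat a b * inr_mat a b = (0\<^sub>m a b :: 'k mat)" "prr_mat a b * inl_mat a b = (0\<^sub>m b a :: 'k mat)"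
  by (rule eq_matI; simp add: inl_mat_def inr_mat_def prl_mat_def prr_mat_def scalar_prod_def if_distrib[of "\<lambda>x. x * _"] cong: if_cong)+

lemma proj_inj_mult:
  "dim_row X = a \<Longrightarrow> prl_mat a b * (inl_mat a b * X) = (X :: 'k::field mat)"
  "dim_row X = b \<Longrightarrow> prr_mat a b * (inr_mat a b * X) = X"
  "dim_row X = b \<Longrightarrow> prl_mat a b * (inr_mat a b * X) = 0\<^sub>m a (dim_col X)"
  "dim_row X = a \<Longrightarrow> prr_mat a b * (inl_mat a b * X) = 0\<^sub>m b (dim_col X)"
  by (simp_all add: proj_inj one_mult_dim zero_mult_dim flip: mult_assoc_dim)

text \<open>The extension of M by L with block matrices: \<open>act L\<close> and
  \<open>act M\<close> on the diagonal and \<theta> in the upper right corner. A quiver without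
  relations imposes no condition on \<theta>. In terms of inclusions and projections, block products
  reduce to matrix identities.\<close>

definition ext_mod :: "'k::field qmod \<Rightarrow> 'k qmod \<Rightarrow> (nat \<times> nat \<Rightarrow> 'k mat) \<Rightarrow> 'k qmod" where
  "ext_mod L M \<theta> = \<lparr> dimv = (\<lambda>v. dimv L v + dimv M v),
     act = (\<lambda>(i, l). inl_mat (dimv L i) (dimv M i) * (act L (i, l) * prl_mat (dimv L l) (dimv M l))
       + (inl_mat (dimv L i) (dimv M i) * (\<theta> (i, l) * prr_mat (dimv L l) (dimv M l))
       + inr_mat (dimv L i) (dimv M i) * (act M (i, l) * prr_mat (dimv L l) (dimv M l)))) \<rparr>"

locale module_ext =
  fixes Q :: quiver and L M :: "'k::field qmod" and \<theta> :: "nat \<times> nat \<Rightarrow> 'k mat"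
  assumes arrows: "(i, l) \<in> arrows Q \<Longrightarrow> i \<in> verts Q \<and> l \<in> verts Q"
    and L: "is_qmod Q L" and M: "is_qmod Q M"
    and theta: "(i, l) \<in> arrows Q \<Longrightarrow> \<theta> (i, l) \<in> carrier_mat (dimv L i) (dimv M l)"
begin

abbreviation "Y \<equiv> ext_mod L M \<theta>"
abbreviation "\<iota> v \<equiv> (inl_mat (dimv L v) (dimv M v) :: 'k mat)"
abbreviation "\<kappa> v \<equiv> (inr_mat (dimv L v) (dimv M v) :: 'k mat)"
abbreviation "\<rho> v \<equiv> (prl_mat (dimv L v) (dimv M v) :: 'k mat)"
abbreviation "\<pi> v \<equiv> (prr_mat (dimv L v) (dimv M v) :: 'k mat)"

lemma dims:
  assumes "(i, l) \<in> arrows Q"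
  shows "dim_row (act L (i, l)) = dimv L i" "dim_col (act L (i, l)) = dimv L l"
    "dim_row (act M (i, l)) = dimv M i" "dim_col (act M (i, l)) = dimv M l"
    "dim_row (\<theta> (i, l)) = dimv L i" "dim_col (\<theta> (i, l)) = dimv M l"
    "dim_row (act Y (i, l)) = dimv L i + dimv M i" "dim_col (act Y (i, l)) = dimv L l + dimv M l"
  using L M theta[OF assms] assms by (auto simp: is_qmod_def ext_mod_def)

lemma dimv_Y: "dimv Y v = dimv L v + dimv M v"
  by (simp add: ext_mod_def)

lemma is_qmod_Y: "is_qmod Q Y"
  unfolding is_qmod_def by (intro ballI) (auto simp: dimv_Y dims intro!: carrier_matI)

lemma act_Y:
  assumes a: "(i, l) \<in> arrows Q"
  shows "\<pi> i * act Y (i, l) = act M (i, l) * \<pi> l"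
    "\<rho> i * act Y (i, l) = act L (i, l) * \<rho> l + \<theta> (i, l) * \<pi> l"
    "act Y (i, l) * \<iota> l = \<iota> i * act L (i, l)"
    "act Y (i, l) * \<kappa> l = \<iota> i * \<theta> (i, l) + \<kappa> i * act M (i, l)"
  using dims[OF a]
  by (simp_all add: ext_mod_def mult_add_dim add_mult_dim mult_assoc_dim proj_inj proj_inj_mult
      zero_add_dim add_zero_dim mult_zero_dim mult_one_dim)

lemma \<pi>_hom: "\<pi> \<in> qhom Q Y M" and \<iota>_hom: "\<iota> \<in> qhom Q L Y"
  by (auto simp: qhom_def dimv_Y act_Y intro!: carrier_matI)

text \<open>The L-component of a section of the projection to M. Since the M-component is the
  identity, compatibility with the action becomes the coboundary equation.\<close>

lemma split_epi_coboundary: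
  assumes "split_epi Q Y M \<pi>"
  shows "\<exists>s. (\<forall>v\<in>verts Q. s v \<in> carrier_mat (dimv L v) (dimv M v)) \<and>
    (\<forall>(i, l)\<in>arrows Q. s i * act M (i, l) = act L (i, l) * s l + \<theta> (i, l))"
proof -
  obtain s where s: "s \<in> qhom Q M Y" "\<forall>v\<in>verts Q. \<pi> v * s v = 1\<^sub>m (dimv M v)"
    using assms by (auto simp: split_epi_def)
  have c: "dim_row (s v) = dimv L v + dimv M v" "dim_col (s v) = dimv M v" if "v \<in> verts Q" for v
    using s(1) that by (auto simp: qhom_def dimv_Y)
  show ?thesis
  proof (intro exI[of _ "\<lambda>v. \<rho> v * s v"] conjI ballI)
    fix v assume "v \<in> verts Q"
    then show "\<rho> v * s v \<in> carrier_mat (dimv L v) (dimv M v)" by (intro carrier_matI) (simp_all add: c)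
  next
    fix a assume "a \<in> arrows Q"
    then obtain i l where a: "a = (i, l)" "(i, l) \<in> arrows Q" by (cases a) auto
    have v: "i \<in> verts Q" "l \<in> verts Q" using arrows[OF a(2)] by auto
    have "\<rho> i * s i * act M (i, l) = \<rho> i * (s i * act M (i, l))"
      by (rule mult_assoc_dim) (simp_all add: c v dims[OF a(2)])
    also have "s i * act M (i, l) = act Y (i, l) * s l" using s(1) a by (auto simp: qhom_def)
    also have "\<rho> i * (act Y (i, l) * s l) = \<rho> i * act Y (i, l) * s l"
      by (rule mult_assoc_dim[symmetric]) (simp_all add: c v dims[OF a(2)])
    also have "\<dots> = act L (i, l) * (\<rho> l * s l) + \<theta> (i, l) * (\<pi> l * s l)"
      unfolding act_Y[OF a(2)] by (simp add: add_mult_dim mult_assoc_dim c v dims[OF a(2)])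
    also have "\<theta> (i, l) * (\<pi> l * s l) = \<theta> (i, l)"
      using s(2) v by (simp add: mult_one_dim dims[OF a(2)])
    finally show "case a of (i, l) \<Rightarrow> \<rho> i * s i * act M (i, l) = act L (i, l) * (\<rho> l * s l) + \<theta> (i, l)"
      by (simp add: a)
  qed
qed

text \<open>Dually, the restriction to the summand M of a retraction onto L. Here \<theta> appears
  on the other side of the equation, that is, with the opposite sign.\<close>

lemma split_mono_coboundary:
  assumes "split_mono Q L Y \<iota>"
  shows "\<exists>s. (\<forall>v\<in>verts Q. s v \<in> carrier_mat (dimv L v) (dimv M v)) \<and>
    (\<forall>(i, l)\<in>arrows Q. act L (i, l) * s l = \<theta> (i, l) + s i * act M (i, l))"
proof -
  obtain s where s: "s \<in> qhom Q Y L" "\<forall>v\<in>verts Q. s v * \<iota> v = 1\<^sub>m (dimv L v)"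
    using assms by (auto simp: split_mono_def)
  have c: "dim_col (s v) = dimv L v + dimv M v" "dim_row (s v) = dimv L v" if "v \<in> verts Q" for v
    using s(1) that by (auto simp: qhom_def dimv_Y)
  show ?thesis
  proof (intro exI[of _ "\<lambda>v. s v * \<kappa> v"] conjI ballI)
    fix v assume "v \<in> verts Q"
    then show "s v * \<kappa> v \<in> carrier_mat (dimv L v) (dimv M v)" by (intro carrier_matI) (simp_all add: c)
  next
    fix a assume "a \<in> arrows Q"
    then obtain i l where a: "a = (i, l)" "(i, l) \<in> arrows Q" by (cases a) auto
    have v: "i \<in> verts Q" "l \<in> verts Q" using arrows[OF a(2)] by auto
    have "act L (i, l) * (s l * \<kappa> l) = act L (i, l) * s l * \<kappa> l"
      by (rule mult_assoc_dim[symmetric]) (simp_all add: c v dims[OF a(2)])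
    also have "act L (i, l) * s l = s i * act Y (i, l)" using s(1) a by (auto simp: qhom_def)
    also have "s i * act Y (i, l) * \<kappa> l = s i * (act Y (i, l) * \<kappa> l)"
      by (rule mult_assoc_dim) (simp_all add: c v dims[OF a(2)])
    also have "\<dots> = s i * (\<iota> i * \<theta> (i, l)) + s i * (\<kappa> i * act M (i, l))"
      unfolding act_Y[OF a(2)] by (simp add: mult_add_dim c v dims[OF a(2)])
    also have "s i * (\<iota> i * \<theta> (i, l)) = s i * \<iota> i * \<theta> (i, l)"
      by (rule mult_assoc_dim[symmetric]) (simp_all add: c v dims[OF a(2)])
    also have "\<dots> = \<theta> (i, l)"
      using s(2) v by (simp add: one_mult_dim dims[OF a(2)])
    also have "s i * (\<kappa> i * act M (i, l)) = s i * \<kappa> i * act M (i, l)"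
      by (rule mult_assoc_dim[symmetric]) (simp_all add: c v dims[OF a(2)])
    finally show "case a of (i, l) \<Rightarrow> act L (i, l) * (s l * \<kappa> l) = \<theta> (i, l) + s i * \<kappa> i * act M (i, l)"
      by (simp add: a)
  qed
qed

lemma \<pi>_epi: "qepi Q Y M \<pi>"
  unfolding qepi_def
proof (intro ballI)
  fix v
  show "(\<lambda>x. \<pi> v *\<^sub>v x) ` carrier_vec (dimv Y v) = carrier_vec (dimv M v)"
  proof (intro equalityI subsetI)
    fix y assume "y \<in> (\<lambda>x. \<pi> v *\<^sub>v x) ` carrier_vec (dimv Y v)"
    then show "y \<in> carrier_vec (dimv M v)" by (auto intro!: carrier_vecI)
  next
    fix y :: "'k vec" assume y: "y \<in> carrier_vec (dimv M v)"
    have "\<pi> v *\<^sub>v (\<kappa> v *\<^sub>v y) = (\<pi> v * \<kappa> v) *\<^sub>v y"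
      by (rule assoc_mult_mat_vec[symmetric, of _ "dimv M v" "dimv L v + dimv M v" _ "dimv M v"])
        (use y in \<open>auto intro!: carrier_matI\<close>)
    also have "\<dots> = y" using y by (simp add: proj_inj)
    finally have "y = \<pi> v *\<^sub>v (\<kappa> v *\<^sub>v y)" by simp
    moreover have "\<kappa> v *\<^sub>v y \<in> carrier_vec (dimv Y v)" by (auto simp: dimv_Y intro!: carrier_vecI)
    ultimately show "y \<in> (\<lambda>x. \<pi> v *\<^sub>v x) ` carrier_vec (dimv Y v)" by (rule image_eqI)
  qed
qed

lemma \<iota>_mono: "qmono Q L \<iota>"
  unfolding qmono_def
proof (intro ballI inj_onI)
  fix v and x y :: "'k vec"
  assume xy: "x \<in> carrier_vec (dimv L v)" "y \<in> carrier_vec (dimv L v)" and eq: "\<iota> v *\<^sub>v x = \<iota> v *\<^sub>v y"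
  have "\<rho> v *\<^sub>v (\<iota> v *\<^sub>v z) = z" if z: "z \<in> carrier_vec (dimv L v)" for z
  proof -
    have "\<rho> v *\<^sub>v (\<iota> v *\<^sub>v z) = (\<rho> v * \<iota> v) *\<^sub>v z"
      by (rule assoc_mult_mat_vec[symmetric, of _ "dimv L v" "dimv L v + dimv M v" _ "dimv L v"])
        (use z in \<open>auto intro!: carrier_matI\<close>)
    then show ?thesis using z by (simp add: proj_inj)
  qed
  then show "x = y" using xy eq by metis
qed

end

lemma ex_vec_mat:
  assumes "\<And>c. c < k \<Longrightarrow> \<exists>x\<in>carrier_vec m. A *\<^sub>v x = col (B :: 'k::field mat) c" "dim_col B = k"
    and A: "A \<in> carrier_mat (dim_row B) m"
  shows "\<exists>G\<in>carrier_mat m k. A * G = B"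
proof -
  define x where "x c = (SOME x. x \<in> carrier_vec m \<and> A *\<^sub>v x = col B c)" for c
  have x: "x c \<in> carrier_vec m \<and> A *\<^sub>v x c = col B c" if c: "c < k" for c
    unfolding x_def by (rule someI_ex) (use assms(1)[OF c] in blast)
  define G where "G = mat m k (\<lambda>(r, c). x c $ r)"
  have col: "col G c = x c" if "c < k" for c
    using x[OF that] that by (intro eq_vecI) (auto simp: G_def)
  have G: "G \<in> carrier_mat m k" by (simp add: G_def)
  have "A * G = B"
  proof (rule eq_matI)
    fix r c assume rc: "r < dim_row B" "c < dim_col B"
    have "(A * G) $$ (r, c) = row A r \<bullet> x c" using rc assms(2) A G by (simp add: col)
    also have "\<dots> = (A *\<^sub>v x c) $ r" using rc A by simp
    also have "\<dots> = B $$ (r, c)" using x[of c] rc assms(2) by simp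
    finally show "(A * G) $$ (r, c) = B $$ (r, c)" .
  qed (use A G assms(2) in auto)
  then show ?thesis using G by blast
qed

lemma inj_mat_cancel:
  assumes "inj_on (\<lambda>x. A *\<^sub>v x) (carrier_vec m)" "A \<in> carrier_mat k m" "B \<in> carrier_mat m p" "C \<in> carrier_mat m p"
    "A * B = A * (C :: 'k::field mat)"
  shows "B = C"
proof (rule mat_col_eqI)
  fix c assume c: "c < dim_col C"
  have p: "c < p" using c assms by simp
  have "A *\<^sub>v col B c = col (A * B) c" "A *\<^sub>v col C c = col (A * C) c"
    by (rule col_mult2[OF assms(2,3) p, symmetric], rule col_mult2[OF assms(2,4) p, symmetric])
  then have "A *\<^sub>v col B c = A *\<^sub>v col C c" using assms(5) by simp
  then show "col B c = col C c" by (rule inj_onD[OF assms(1)]) (use assms c in auto)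
qed (use assms in auto)

lemma factor_mono:
  assumes se: "short_exact Q N f E g M" and v: "v \<in> verts Q"
    and A: "A \<in> carrier_mat (dimv E v) k" and zero: "g v * A = 0\<^sub>m (dimv M v) k"
  shows "\<exists>G\<in>carrier_mat (dimv N v) k. f v * G = (A :: 'k::field mat)"
proof (rule ex_vec_mat)
  have f: "f v \<in> carrier_mat (dimv E v) (dimv N v)" and g: "g v \<in> carrier_mat (dimv M v) (dimv E v)"
    using se v by (auto simp: short_exact_def qhom_def)
  show "dim_col A = k" "f v \<in> carrier_mat (dim_row A) (dimv N v)" using A f by auto
  fix c assume c: "c < k"
  have "g v *\<^sub>v col A c = col (g v * A) c" using g A c by (simp add: col_mult2)
  also have "\<dots> = 0\<^sub>v (dimv M v)" unfolding zero using c by simp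
  finally have "col A c \<in> {y \<in> carrier_vec (dimv E v). g v *\<^sub>v y = 0\<^sub>v (dimv M v)}" using A c by auto
  also have "\<dots> = (\<lambda>x. f v *\<^sub>v x) ` carrier_vec (dimv N v)" using se v by (simp add: short_exact_def)
  finally show "\<exists>x\<in>carrier_vec (dimv N v). f v *\<^sub>v x = col A c" by auto
qed

lemma section_epi:
  assumes "qepi Q E M g" "g \<in> qhom Q E M" and v: "v \<in> verts Q"
  shows "\<exists>r\<in>carrier_mat (dimv E v) (dimv M v). g v * r = (1\<^sub>m (dimv M v) :: 'k::field mat)"
proof (rule ex_vec_mat)
  have "g v \<in> carrier_mat (dimv M v) (dimv E v)" using assms(2) v unfolding qhom_def by blast
  then show "g v \<in> carrier_mat (dim_row (1\<^sub>m (dimv M v) :: 'k mat)) (dimv E v)" by simp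
  fix c assume c: "c < dimv M v"
  have "col (1\<^sub>m (dimv M v) :: 'k mat) c \<in> carrier_vec (dimv M v)" by (rule carrier_vecI) simp
  also have "carrier_vec (dimv M v) = (\<lambda>x. g v *\<^sub>v x) ` carrier_vec (dimv E v)"
    using assms(1) v unfolding qepi_def by blast
  finally show "\<exists>x\<in>carrier_vec (dimv E v). g v *\<^sub>v x = col (1\<^sub>m (dimv M v)) c" unfolding image_iff by metis
qed simp

text \<open>For a linear section r of g, the map 1 - r g takes values in the kernel of g and hence
  factors through f. So A annihilates it, which gives A = (A r) g.\<close>

lemma factor_epi:
  assumes se: "short_exact Q N f E g M" and v: "v \<in> verts Q"
    and A: "A \<in> carrier_mat k (dimv E v)" and zero: "A * f v = 0\<^sub>m k (dimv N v)"
  shows "\<exists>G\<in>carrier_mat k (dimv M v). G * g v = (A :: 'k::field mat)"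
proof -
  have f: "f v \<in> carrier_mat (dimv E v) (dimv N v)" and g: "g v \<in> carrier_mat (dimv M v) (dimv E v)"
    using se v by (auto simp: short_exact_def qhom_def)
  obtain r where r: "r \<in> carrier_mat (dimv E v) (dimv M v)" "g v * r = 1\<^sub>m (dimv M v)"
    using section_epi[of Q E M g v] se v by (auto simp: short_exact_def)
  let ?D = "1\<^sub>m (dimv E v) - r * g v"
  have D: "?D \<in> carrier_mat (dimv E v) (dimv E v)" using r g by auto
  have "g v * ?D = g v * 1\<^sub>m (dimv E v) - g v * (r * g v)"
    by (rule mult_minus_distrib_mat[OF g]) (use r g in auto)
  also have "g v * (r * g v) = g v * r * g v" using assoc_mult_mat[OF g r(1) g] by simp
  also have "g v * 1\<^sub>m (dimv E v) - g v * r * g v = 0\<^sub>m (dimv M v) (dimv E v)"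
    unfolding r(2) using g by simp
  finally obtain H where H: "H \<in> carrier_mat (dimv N v) (dimv E v)" "f v * H = ?D"
    using factor_mono[OF se v D] by blast
  have "A * ?D = A * 1\<^sub>m (dimv E v) - A * (r * g v)"
    by (rule mult_minus_distrib_mat[OF A]) (use r g in auto)
  moreover have "A * ?D = A * f v * H" using assoc_mult_mat[OF A f H(1)] H(2) by simp
  moreover have "A * f v * H = 0\<^sub>m k (dimv E v)" unfolding zero using H(1) by simp
  ultimately have z: "A - A * (r * g v) = 0\<^sub>m k (dimv E v)" using A by simp
  have "A = A * (r * g v)"
  proof (rule eq_matI)
    fix i j assume "i < dim_row (A * (r * g v))" "j < dim_col (A * (r * g v))"
    then have ij: "i < k" "j < dimv E v" using A g by auto
    have "(A - A * (r * g v)) $$ (i, j) = 0" unfolding z using ij by simp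
    then show "A $$ (i, j) = (A * (r * g v)) $$ (i, j)" using ij A r g by simp
  qed (use A g in auto)
  also have "\<dots> = A * r * g v" using assoc_mult_mat[OF A r(1) g] by simp
  finally have "A * r * g v = A" by simp
  moreover have "A * r \<in> carrier_mat k (dimv M v)" using A r by auto
  ultimately show ?thesis by blast
qed

definition hom_zero :: "quiver \<Rightarrow> 'k::field qmod \<Rightarrow> 'k qmod \<Rightarrow> bool" where
  "hom_zero Q L M \<longleftrightarrow> (\<forall>h\<in>qhom Q L M. \<forall>v\<in>verts Q. h v = 0\<^sub>m (dimv M v) (dimv L v))"

context module_ext
begin

lemma coboundary_if_projective:
  assumes "projective Q M"
  shows "\<exists>s. (\<forall>v\<in>verts Q. s v \<in> carrier_mat (dimv L v) (dimv M v)) \<and>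
    (\<forall>(i, l)\<in>arrows Q. s i * act M (i, l) = act L (i, l) * s l + \<theta> (i, l))"
proof (rule split_epi_coboundary)
  have id: "(\<lambda>v. 1\<^sub>m (dimv M v)) \<in> qhom Q M M" using dims by (auto simp: qhom_def one_mult_dim mult_one_dim)
  obtain s where "s \<in> qhom Q M Y" "\<forall>v\<in>verts Q. \<pi> v * s v = 1\<^sub>m (dimv M v)"
    using assms[unfolded projective_def, THEN conjunct2, rule_format, OF conjI[OF is_qmod_Y M] \<pi>_hom \<pi>_epi id]
    by (elim bexE)
  then show "split_epi Q Y M \<pi>" unfolding split_epi_def by (intro bexI)
qed

lemma coboundary_if_injective:
  assumes "injective Q L"
  shows "\<exists>s. (\<forall>v\<in>verts Q. s v \<in> carrier_mat (dimv L v) (dimv M v)) \<and>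
    (\<forall>(i, l)\<in>arrows Q. act L (i, l) * s l = \<theta> (i, l) + s i * act M (i, l))"
proof (rule split_mono_coboundary)
  have id: "(\<lambda>v. 1\<^sub>m (dimv L v)) \<in> qhom Q L L" using dims by (auto simp: qhom_def one_mult_dim mult_one_dim)
  obtain s where "s \<in> qhom Q Y L" "\<forall>v\<in>verts Q. s v * \<iota> v = 1\<^sub>m (dimv L v)"
    using assms[unfolded injective_def, THEN conjunct2, rule_format, OF conjI[OF L is_qmod_Y] \<iota>_hom \<iota>_mono id]
    by (elim bexE)
  then show "split_mono Q L Y \<iota>" unfolding split_mono_def by (intro bexI)
qed

text \<open>If the projection from the extension to \<open>M\<close> does not split, it factors through the almost split
  sequence, which produces a homomorphism from \<open>L\<close> to the translate of \<open>M\<close>.\<close>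

lemma coboundary_if_AR_right:
  assumes AR: "AR_translate Q M N" and zero: "hom_zero Q L N"
  shows "\<exists>s. (\<forall>v\<in>verts Q. s v \<in> carrier_mat (dimv L v) (dimv M v)) \<and>
    (\<forall>(i, l)\<in>arrows Q. s i * act M (i, l) = act L (i, l) * s l + \<theta> (i, l))"
proof (rule split_epi_coboundary, rule ccontr)
  assume ns: "\<not> split_epi Q Y M \<pi>"
  obtain E f g where E: "is_qmod Q E" and se: "short_exact Q N f E g M" and ras: "right_almost_split Q E M g"
    using AR unfolding AR_translate_def by (elim conjE exE)
  obtain h where h: "h \<in> qhom Q Y E" "\<forall>v\<in>verts Q. g v * h v = \<pi> v"
    using ras[unfolded right_almost_split_def, THEN conjunct2, rule_format, OF is_qmod_Y \<pi>_hom ns] by (elim bexE)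
  have f: "f v \<in> carrier_mat (dimv E v) (dimv N v)" and g: "g v \<in> carrier_mat (dimv M v) (dimv E v)"
    and hv: "h v \<in> carrier_mat (dimv E v) (dimv L v + dimv M v)" if "v \<in> verts Q" for v
    using se h(1) that by (auto simp: short_exact_def qhom_def dimv_Y)
  have fhom: "f i * act N (i, l) = act E (i, l) * f l" if "(i, l) \<in> arrows Q" for i l
    using se that by (auto simp: short_exact_def qhom_def)
  have hhom: "h i * act Y (i, l) = act E (i, l) * h l" if "(i, l) \<in> arrows Q" for i l
    using h(1) that by (auto simp: qhom_def)
  have N: "is_qmod Q N" using AR by (simp add: AR_translate_def)
  have dE: "act E (i, l) \<in> carrier_mat (dimv E i) (dimv E l)" "act N (i, l) \<in> carrier_mat (dimv N i) (dimv N l)"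
    if "(i, l) \<in> arrows Q" for i l using E N that by (auto simp: is_qmod_def)
  have "\<exists>G\<in>carrier_mat (dimv N v) (dimv L v). f v * G = h v * \<iota> v" if v: "v \<in> verts Q" for v
  proof (rule factor_mono[OF se v])
    show "h v * \<iota> v \<in> carrier_mat (dimv E v) (dimv L v)" using hv[OF v] by (intro carrier_matI) simp_all
    have "g v * (h v * \<iota> v) = g v * h v * \<iota> v"
      by (rule mult_assoc_dim[symmetric]) (use g[OF v] hv[OF v] in simp_all)
    then show "g v * (h v * \<iota> v) = 0\<^sub>m (dimv M v) (dimv L v)" using h(2) v by (simp add: proj_inj)
  qed
  then have "\<forall>v\<in>verts Q. \<exists>G. G \<in> carrier_mat (dimv N v) (dimv L v) \<and> f v * G = h v * \<iota> v" by (simp add: Bex_def)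
  from bchoice[OF this] obtain G where
    G: "\<And>v. v \<in> verts Q \<Longrightarrow> G v \<in> carrier_mat (dimv N v) (dimv L v) \<and> f v * G v = h v * \<iota> v"
    by metis
  have "G i * act L (i, l) = act N (i, l) * G l" if a: "(i, l) \<in> arrows Q" for i l
  proof -
    have v: "i \<in> verts Q" "l \<in> verts Q" using arrows[OF a] by auto
    note c = f[OF v(1)] f[OF v(2)] hv[OF v(1)] hv[OF v(2)] G[OF v(1)] G[OF v(2)] dE[OF a] dims[OF a]
    have "f i * (G i * act L (i, l)) = f i * G i * act L (i, l)"
      by (rule mult_assoc_dim[symmetric]) (use c in auto)
    also have "\<dots> = h i * \<iota> i * act L (i, l)" using G[OF v(1)] by simp
    also have "\<dots> = h i * (\<iota> i * act L (i, l))" by (rule mult_assoc_dim) (use c in auto)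
    also have "\<dots> = h i * act Y (i, l) * \<iota> l"
      unfolding act_Y(3)[OF a, symmetric] by (rule mult_assoc_dim[symmetric]) (use c in auto)
    also have "\<dots> = act E (i, l) * (h l * \<iota> l)" unfolding hhom[OF a] by (rule mult_assoc_dim) (use c in auto)
    also have "\<dots> = act E (i, l) * (f l * G l)" using G[OF v(2)] by simp
    also have "\<dots> = act E (i, l) * f l * G l" by (rule mult_assoc_dim[symmetric]) (use c in auto)
    also have "\<dots> = f i * (act N (i, l) * G l)" unfolding fhom[OF a, symmetric] by (rule mult_assoc_dim) (use c in auto)
    finally have eq: "f i * (G i * act L (i, l)) = f i * (act N (i, l) * G l)" .
    have "inj_on (\<lambda>x. f i *\<^sub>v x) (carrier_vec (dimv N i))" using se v by (simp add: short_exact_def qmono_def)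
    then show ?thesis
      by (rule inj_mat_cancel[OF _ f[OF v(1)] _ _ eq]) (use c in \<open>auto intro!: carrier_matI\<close>)
  qed
  then have "G \<in> qhom Q L N" using G by (auto simp: qhom_def)
  then have "G v = 0\<^sub>m (dimv N v) (dimv L v)" if "v \<in> verts Q" for v using zero that by (simp add: hom_zero_def)
  then have hi: "h v * \<iota> v = 0\<^sub>m (dimv E v) (dimv L v)" if "v \<in> verts Q" for v
    using G[OF that] f[OF that] that by simp
  \<comment> \<open>The inclusion \<kappa> of the summand M does not commute with the action, the
    error being \<iota> \<theta>; as h vanishes on L, the composite does commute.\<close>
  have "(\<lambda>v. h v * \<kappa> v) \<in> qhom Q M E"
    unfolding qhom_def
  proof (rule CollectI, intro conjI ballI)
    fix v assume "v \<in> verts Q"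
    then show "h v * \<kappa> v \<in> carrier_mat (dimv E v) (dimv M v)" using hv[of v] by (intro carrier_matI) simp_all
  next
    fix x assume "x \<in> arrows Q"
    then obtain i l where x: "x = (i, l)" and a: "(i, l) \<in> arrows Q" by (cases x) auto
    have v: "i \<in> verts Q" "l \<in> verts Q" using arrows[OF a] by auto
    note c = hv[OF v(1)] hv[OF v(2)] dE[OF a] dims[OF a]
    have "act E (i, l) * (h l * \<kappa> l) = act E (i, l) * h l * \<kappa> l" by (rule mult_assoc_dim[symmetric]) (use c in auto)
    also have "\<dots> = h i * (act Y (i, l) * \<kappa> l)" unfolding hhom[OF a, symmetric] by (rule mult_assoc_dim) (use c in auto)
    also have "\<dots> = h i * (\<iota> i * \<theta> (i, l)) + h i * (\<kappa> i * act M (i, l))"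
      unfolding act_Y(4)[OF a] by (rule mult_add_dim) (use c in auto)
    also have "h i * (\<iota> i * \<theta> (i, l)) = h i * \<iota> i * \<theta> (i, l)" by (rule mult_assoc_dim[symmetric]) (use c in auto)
    also have "\<dots> = 0\<^sub>m (dimv E i) (dimv M l)" unfolding hi[OF v(1)] using c by (simp add: zero_mult_dim)
    also have "h i * (\<kappa> i * act M (i, l)) = h i * \<kappa> i * act M (i, l)" by (rule mult_assoc_dim[symmetric]) (use c in auto)
    also have "0\<^sub>m (dimv E i) (dimv M l) + h i * \<kappa> i * act M (i, l) = h i * \<kappa> i * act M (i, l)"
      by (rule zero_add_dim) (use c in auto)
    finally show "case x of (i, l) \<Rightarrow> h i * \<kappa> i * act M (i, l) = act E (i, l) * (h l * \<kappa> l)" by (simp add: x)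
  qed
  moreover have "g v * (h v * \<kappa> v) = 1\<^sub>m (dimv M v)" if v: "v \<in> verts Q" for v
  proof -
    have "g v * (h v * \<kappa> v) = g v * h v * \<kappa> v"
      by (rule mult_assoc_dim[symmetric]) (use g[OF v] hv[OF v] in auto)
    then show ?thesis using h(2) v by (simp add: proj_inj)
  qed
  ultimately have "split_epi Q E M g" unfolding split_epi_def by (intro bexI[of _ "\<lambda>v. h v * \<kappa> v"]) auto
  then show False using ras by (simp add: right_almost_split_def)
qed

text \<open>If the inclusion of L into the extension is not split, it extends to the middle term E
  of the almost split sequence starting in L. Composed with the projection to M, this extension
  factors through N and hence vanishes. So it takes values in L and is a retraction for f, which is
  impossible.\<close>

lemma coboundary_if_AR_left:
  assumes AR: "AR_translate Q N L" and zero: "hom_zero Q N M"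
  shows "\<exists>s. (\<forall>v\<in>verts Q. s v \<in> carrier_mat (dimv L v) (dimv M v)) \<and>
    (\<forall>(i, l)\<in>arrows Q. act L (i, l) * s l = \<theta> (i, l) + s i * act M (i, l))"
proof (rule split_mono_coboundary, rule ccontr)
  assume ns: "\<not> split_mono Q L Y \<iota>"
  obtain E f g where E: "is_qmod Q E" and se: "short_exact Q L f E g N" and las: "left_almost_split Q L E f"
    using AR unfolding AR_translate_def by (elim conjE exE)
  obtain h where h: "h \<in> qhom Q E Y" "\<forall>v\<in>verts Q. h v * f v = \<iota> v"
    using las[unfolded left_almost_split_def, THEN conjunct2, rule_format, OF is_qmod_Y \<iota>_hom ns] by (elim bexE)
  have f: "f v \<in> carrier_mat (dimv E v) (dimv L v)" and g: "g v \<in> carrier_mat (dimv N v) (dimv E v)"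
    and hv: "h v \<in> carrier_mat (dimv L v + dimv M v) (dimv E v)" if "v \<in> verts Q" for v
    using se h(1) that by (auto simp: short_exact_def qhom_def dimv_Y)
  have ghom: "g i * act E (i, l) = act N (i, l) * g l" if "(i, l) \<in> arrows Q" for i l
    using se that by (auto simp: short_exact_def qhom_def)
  have hhom: "h i * act E (i, l) = act Y (i, l) * h l" if "(i, l) \<in> arrows Q" for i l
    using h(1) that by (auto simp: qhom_def)
  have N: "is_qmod Q N" using AR by (simp add: AR_translate_def)
  have dE: "act E (i, l) \<in> carrier_mat (dimv E i) (dimv E l)" "act N (i, l) \<in> carrier_mat (dimv N i) (dimv N l)"
    if "(i, l) \<in> arrows Q" for i l using E N that by (auto simp: is_qmod_def)
  have "\<exists>G\<in>carrier_mat (dimv M v) (dimv N v). G * g v = \<pi> v * h v" if v: "v \<in> verts Q" for v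
  proof (rule factor_epi[OF se v])
    show "\<pi> v * h v \<in> carrier_mat (dimv M v) (dimv E v)" using hv[OF v] by (intro carrier_matI) simp_all
    have "\<pi> v * h v * f v = \<pi> v * (h v * f v)"
      by (rule mult_assoc_dim) (use f[OF v] hv[OF v] in simp_all)
    then show "\<pi> v * h v * f v = 0\<^sub>m (dimv M v) (dimv L v)" using h(2) v by (simp add: proj_inj)
  qed
  then have "\<forall>v\<in>verts Q. \<exists>G. G \<in> carrier_mat (dimv M v) (dimv N v) \<and> G * g v = \<pi> v * h v" by (simp add: Bex_def)
  from bchoice[OF this] obtain G where
    G: "\<And>v. v \<in> verts Q \<Longrightarrow> G v \<in> carrier_mat (dimv M v) (dimv N v) \<and> G v * g v = \<pi> v * h v"
    by metis
  have "G i * act N (i, l) = act M (i, l) * G l" if a: "(i, l) \<in> arrows Q" for i l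
  proof -
    have v: "i \<in> verts Q" "l \<in> verts Q" using arrows[OF a] by auto
    note c = g[OF v(1)] g[OF v(2)] hv[OF v(1)] hv[OF v(2)] G[OF v(1)] G[OF v(2)] dE[OF a] dims[OF a]
    obtain r where r: "r \<in> carrier_mat (dimv E l) (dimv N l)" "g l * r = 1\<^sub>m (dimv N l)"
      using section_epi[of Q E N g l] se v by (auto simp: short_exact_def)
    have "G i * act N (i, l) * g l = G i * (act N (i, l) * g l)" by (rule mult_assoc_dim) (use c in auto)
    also have "\<dots> = G i * g i * act E (i, l)"
      unfolding ghom[OF a, symmetric] by (rule mult_assoc_dim[symmetric]) (use c in auto)
    also have "\<dots> = \<pi> i * h i * act E (i, l)" using G[OF v(1)] by simp
    also have "\<dots> = \<pi> i * (h i * act E (i, l))" by (rule mult_assoc_dim) (use c in auto)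
    also have "\<dots> = \<pi> i * act Y (i, l) * h l"
      unfolding hhom[OF a] by (rule mult_assoc_dim[symmetric]) (use c in auto)
    also have "\<dots> = act M (i, l) * (\<pi> l * h l)" unfolding act_Y(1)[OF a] by (rule mult_assoc_dim) (use c in auto)
    also have "\<dots> = act M (i, l) * (G l * g l)" using G[OF v(2)] by simp
    also have "\<dots> = act M (i, l) * G l * g l" by (rule mult_assoc_dim[symmetric]) (use c in auto)
    finally have eq: "G i * act N (i, l) * g l = act M (i, l) * G l * g l" .
    have "G i * act N (i, l) = G i * act N (i, l) * (g l * r)" unfolding r(2) by (rule mult_one_dim[symmetric]) (use c in auto)
    also have "\<dots> = G i * act N (i, l) * g l * r" by (rule mult_assoc_dim[symmetric]) (use c r in auto)
    also have "\<dots> = act M (i, l) * G l * (g l * r)" unfolding eq by (rule mult_assoc_dim) (use c r in auto)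
    also have "\<dots> = act M (i, l) * G l" unfolding r(2) by (rule mult_one_dim) (use c in auto)
    finally show ?thesis .
  qed
  then have "G \<in> qhom Q N M" using G by (auto simp: qhom_def)
  then have "G v = 0\<^sub>m (dimv M v) (dimv N v)" if "v \<in> verts Q" for v using zero that by (simp add: hom_zero_def)
  then have hi: "\<pi> v * h v = 0\<^sub>m (dimv M v) (dimv E v)" if "v \<in> verts Q" for v
    using G[OF that] g[OF that] that by simp
  have "(\<lambda>v. \<rho> v * h v) \<in> qhom Q E L"
    unfolding qhom_def
  proof (rule CollectI, intro conjI ballI)
    fix v assume "v \<in> verts Q"
    then show "\<rho> v * h v \<in> carrier_mat (dimv L v) (dimv E v)" using hv[of v] by (intro carrier_matI) simp_all
  next
    fix x assume "x \<in> arrows Q"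
    then obtain i l where x: "x = (i, l)" and a: "(i, l) \<in> arrows Q" by (cases x) auto
    have v: "i \<in> verts Q" "l \<in> verts Q" using arrows[OF a] by auto
    note c = hv[OF v(1)] hv[OF v(2)] dE[OF a] dims[OF a]
    have "\<rho> i * h i * act E (i, l) = \<rho> i * (h i * act E (i, l))" by (rule mult_assoc_dim) (use c in auto)
    also have "\<dots> = \<rho> i * act Y (i, l) * h l" unfolding hhom[OF a] by (rule mult_assoc_dim[symmetric]) (use c in auto)
    also have "\<dots> = act L (i, l) * \<rho> l * h l + \<theta> (i, l) * \<pi> l * h l"
      unfolding act_Y(2)[OF a] by (rule add_mult_dim) (use c in auto)
    also have "\<theta> (i, l) * \<pi> l * h l = \<theta> (i, l) * (\<pi> l * h l)" by (rule mult_assoc_dim) (use c in auto)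
    also have "\<dots> = 0\<^sub>m (dimv L i) (dimv E l)" unfolding hi[OF v(2)] using c by (simp add: mult_zero_dim)
    also have "act L (i, l) * \<rho> l * h l = act L (i, l) * (\<rho> l * h l)" by (rule mult_assoc_dim) (use c in auto)
    also have "act L (i, l) * (\<rho> l * h l) + 0\<^sub>m (dimv L i) (dimv E l) = act L (i, l) * (\<rho> l * h l)"
      by (rule add_zero_dim) (use c in auto)
    finally show "case x of (i, l) \<Rightarrow> \<rho> i * h i * act E (i, l) = act L (i, l) * (\<rho> l * h l)" by (simp add: x)
  qed
  moreover have "\<rho> v * h v * f v = 1\<^sub>m (dimv L v)" if v: "v \<in> verts Q" for v
  proof -
    have "\<rho> v * h v * f v = \<rho> v * (h v * f v)"
      by (rule mult_assoc_dim) (use f[OF v] hv[OF v] in auto)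
    then show ?thesis using h(2) v by (simp add: proj_inj)
  qed
  ultimately have "split_mono Q L E f" unfolding split_mono_def by (intro bexI[of _ "\<lambda>v. \<rho> v * h v"]) auto
  then show False using las by (simp add: left_almost_split_def)
qed

end

section \<open>Thin modules at the mouths of the exceptional tubes\<close>

definition thin :: "nat set \<Rightarrow> 'k::field qmod" where
  "thin S = \<lparr> dimv = (\<lambda>v. if v \<in> S then 1 else 0),
     act = (\<lambda>(i, l). mat (if i \<in> S then 1 else 0) (if l \<in> S then 1 else 0) (\<lambda>_. 1)) \<rparr>"

lemma dimv_thin: "dimv (thin S) v = (if v \<in> S then 1 else 0)"
  by (simp add: thin_def)

lemma act_thin: "act (thin S) (i, l) = mat (if i \<in> S then 1 else 0) (if l \<in> S then 1 else 0) (\<lambda>_. 1)"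
  by (simp add: thin_def)

lemma dim_act_thin [simp]:
  "dim_row (act (thin S) (i, l)) = (if i \<in> S then 1 else 0)"
  "dim_col (act (thin S) (i, l)) = (if l \<in> S then 1 else 0)"
  by (simp_all add: act_thin)

lemma is_qmod_thin: "is_qmod Q (thin S)"
  by (auto simp: is_qmod_def act_thin dimv_thin)

lemma mult_act_thin:
  assumes "l \<in> S" "dim_row X = 1" "dim_col X = dimv (thin S :: 'k::field qmod) i"
  shows "(X * act (thin S) (i, l)) $$ (0, 0) = (if i \<in> S then X $$ (0, 0) else (0::'k))"
  using assms by (simp add: act_thin dimv_thin scalar_prod_def)

lemma act_thin_mult:
  assumes "i \<in> S" "dim_row X = dimv (thin S :: 'k::field qmod) l" "dim_col X = 1"
  shows "(act (thin S) (i, l) * X) $$ (0, 0) = (if l \<in> S then X $$ (0, 0) else (0::'k))"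
  using assms by (simp add: act_thin dimv_thin scalar_prod_def)

text \<open>A cochain \<open>U\<close> of scalars \<open>M\<^sub>v \<rightarrow> L\<^sub>v\<close> whose coboundary is the extension of \<open>M = thin S1\<close> by
  \<open>L = thin S2\<close> that is supported on the arrow \<open>a\<close>.\<close>

definition thin_coboundary :: "quiver \<Rightarrow> nat set \<Rightarrow> nat set \<Rightarrow> nat \<times> nat \<Rightarrow> (nat \<Rightarrow> 'k::field) \<Rightarrow> bool" where
  "thin_coboundary Q S1 S2 a U \<longleftrightarrow> (\<forall>v. v \<notin> S1 \<inter> S2 \<longrightarrow> U v = 0) \<and>
     (\<forall>(i, l)\<in>arrows Q. l \<in> S1 \<longrightarrow> i \<in> S2 \<longrightarrow> U i - U l = (if (i, l) = a then 1 else 0))"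

text \<open>The extension of thin S1 by thin S2 supported on the arrow from i to l has a nonzero
  class. For the thin modules at the mouths of the tubes this occurs when thin S2 is the translate
  of thin S1. The type argument records the field over which cochains are taken.\<close>

definition obstructed :: "'k::field itself \<Rightarrow> quiver \<Rightarrow> nat set \<Rightarrow> nat set \<Rightarrow> nat \<Rightarrow> nat \<Rightarrow> bool" where
  "obstructed _ Q S1 S2 i l \<longleftrightarrow> (i, l) \<in> arrows Q \<and> l \<in> S1 \<and> i \<in> S2 \<and>
     \<not> (\<exists>U :: nat \<Rightarrow> 'k. thin_coboundary Q S1 S2 (i, l) U)"

text \<open>Extensions of M by thin S' pull back along h to extensions of thin S. If h l0 had a
  nonzero entry, a suitable \<theta> would pull back to the class of the arrow; but \<theta> is a
  coboundary, and s h would be a cochain that bounds this class.\<close>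

lemma zero_if_coboundaries_right:
  fixes M :: "'k::field qmod"
  assumes arr: "\<forall>(i, l)\<in>arrows Q. i \<in> verts Q \<and> l \<in> verts Q" and M: "is_qmod Q M"
    and h: "h \<in> qhom Q (thin S) M" and ob: "obstructed TYPE('k) Q S S' i0 l0"
    and cob: "\<forall>\<theta>. (\<forall>(i, l)\<in>arrows Q. \<theta> (i, l) \<in> carrier_mat (dimv (thin S' :: 'k qmod) i) (dimv M l)) \<longrightarrow>
      (\<exists>s. (\<forall>v\<in>verts Q. s v \<in> carrier_mat (dimv (thin S' :: 'k qmod) v) (dimv M v)) \<and>
        (\<forall>(i, l)\<in>arrows Q. s i * act M (i, l) = act (thin S') (i, l) * s l + \<theta> (i, l)))"
  shows "h l0 = 0\<^sub>m (dimv M l0) 1"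
proof (rule ccontr)
  have a0: "(i0, l0) \<in> arrows Q" "l0 \<in> S" "i0 \<in> S'" and no: "\<And>U :: nat \<Rightarrow> 'k. \<not> thin_coboundary Q S S' (i0, l0) U"
    using ob by (auto simp: obstructed_def)
  have hc: "dim_row (h v) = dimv M v" "dim_col (h v) = dimv (thin S :: 'k qmod) v" if "v \<in> verts Q" for v
    using h that by (auto simp: qhom_def)
  have l0: "l0 \<in> verts Q" using arr a0 by auto
  assume "h l0 \<noteq> 0\<^sub>m (dimv M l0) 1"
  then obtain r where r: "r < dimv M l0" "h l0 $$ (r, 0) \<noteq> 0"
    using hc[OF l0] a0 by (auto simp: mat_eq_iff dimv_thin)
  \<comment> \<open>The inverse of the chosen entry normalises the product of \<theta> with h to 1
    on the arrow (i0, l0); on every other arrow \<theta> is 0.\<close>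
  define \<theta> :: "nat \<times> nat \<Rightarrow> 'k mat" where "\<theta> = (\<lambda>(i, l). mat (dimv (thin S' :: 'k qmod) i) (dimv M l)
     (\<lambda>(_, c). if (i, l) = (i0, l0) \<and> c = r then inverse (h l0 $$ (r, 0)) else 0))"
  have th: "dim_row (\<theta> (i, l)) = dimv (thin S' :: 'k qmod) i" "dim_col (\<theta> (i, l)) = dimv M l" for i l
    by (simp_all add: \<theta>_def)
  have "\<forall>(i, l)\<in>arrows Q. \<theta> (i, l) \<in> carrier_mat (dimv (thin S' :: 'k qmod) i) (dimv M l)"
    by (simp add: \<theta>_def)
  from cob[THEN spec, THEN mp, OF this] obtain s where
    sc: "\<forall>v\<in>verts Q. s v \<in> carrier_mat (dimv (thin S' :: 'k qmod) v) (dimv M v)"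
    and s: "\<forall>(i, l)\<in>arrows Q. s i * act M (i, l) = act (thin S') (i, l) * s l + \<theta> (i, l)" by (elim exE conjE)
  have sd: "dim_row (s v) = dimv (thin S' :: 'k qmod) v" "dim_col (s v) = dimv M v" if "v \<in> verts Q" for v
    using sc that by auto
  define U where "U v = (if v \<in> S \<inter> S' then (s v * h v) $$ (0, 0) else 0)" for v
  have "thin_coboundary Q S S' (i0, l0) U"
    unfolding thin_coboundary_def
  proof (intro conjI allI impI ballI)
    fix v assume "v \<notin> S \<inter> S'"
    then show "U v = 0" unfolding U_def by (rule if_not_P)
  next
    fix x assume "x \<in> arrows Q"
    then obtain i l where x: "x = (i, l)" and a: "(i, l) \<in> arrows Q" by (cases x) auto
    have v: "i \<in> verts Q" "l \<in> verts Q" using arr a by auto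
    have m: "dim_row (act M (i, l)) = dimv M i" "dim_col (act M (i, l)) = dimv M l"
      using M a by (auto simp: is_qmod_def)
    note d = hc[OF v(1)] hc[OF v(2)] sd[OF v(1)] sd[OF v(2)] th m
    have eq: "s i * act M (i, l) = act (thin S') (i, l) * s l + \<theta> (i, l)" using s a by auto
    have hom: "h i * act (thin S) (i, l) = act M (i, l) * h l" using h a by (auto simp: qhom_def)
    have "U i - U l = (if (i, l) = (i0, l0) then 1 else 0)" if lS: "l \<in> S" and iS: "i \<in> S'"
    proof -
      have "s i * h i * act (thin S) (i, l) = s i * (act M (i, l) * h l)"
        unfolding hom[symmetric] by (rule mult_assoc_dim) (use d in \<open>simp_all add: dimv_thin\<close>)
      also have "\<dots> = s i * act M (i, l) * h l"
        by (rule mult_assoc_dim[symmetric]) (use d in simp_all)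
      also have "\<dots> = act (thin S') (i, l) * s l * h l + \<theta> (i, l) * h l"
        unfolding eq by (rule add_mult_dim) (use d in \<open>simp_all add: dimv_thin\<close>)
      also have "act (thin S') (i, l) * s l * h l = act (thin S') (i, l) * (s l * h l)"
        by (rule mult_assoc_dim) (use d in \<open>simp_all add: dimv_thin\<close>)
      finally have e: "s i * h i * act (thin S) (i, l) = act (thin S') (i, l) * (s l * h l) + \<theta> (i, l) * h l" .
      have f1: "(s i * h i * act (thin S) (i, l)) $$ (0, 0) = U i"
        by (subst mult_act_thin) (use d lS iS in \<open>simp_all add: dimv_thin U_def\<close>)
      have f2: "(act (thin S') (i, l) * (s l * h l)) $$ (0, 0) = U l"
        by (subst act_thin_mult) (use d lS iS in \<open>simp_all add: dimv_thin U_def\<close>)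
      have f3: "(\<theta> (i, l) * h l) $$ (0, 0) = (if (i, l) = (i0, l0) then 1 else 0)"
      proof -
        have "(\<theta> (i, l) * h l) $$ (0, 0) = (\<Sum>c<dimv M l. (if (i, l) = (i0, l0) \<and> c = r then inverse (h l0 $$ (r, 0)) else 0) * h l $$ (c, 0))"
          using d lS iS by (simp add: \<theta>_def scalar_prod_def dimv_thin atLeast0LessThan)
        also have "\<dots> = (\<Sum>c<dimv M l. if c = r then (if (i, l) = (i0, l0) then 1 else 0) else 0)"
          by (rule sum.cong) (use r in auto)
        also have "\<dots> = (if (i, l) = (i0, l0) then 1 else 0)" using r(1) by (subst sum.delta) auto
        finally show ?thesis .
      qed
      have "(act (thin S') (i, l) * (s l * h l) + \<theta> (i, l) * h l) $$ (0, 0) =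
          (act (thin S') (i, l) * (s l * h l)) $$ (0, 0) + (\<theta> (i, l) * h l) $$ (0, 0)"
        by (rule index_add_mat(1)) (use d lS iS in \<open>simp_all add: dimv_thin\<close>)
      then have "U i = U l + (if (i, l) = (i0, l0) then 1 else 0)" unfolding e[symmetric] f1 f2 f3 .
      then show ?thesis by (simp only: add_diff_cancel_left')
    qed
    then show "case x of (i, l) \<Rightarrow> l \<in> S \<longrightarrow> i \<in> S' \<longrightarrow> U i - U l = (if (i, l) = (i0, l0) then 1 else 0)"
      by (simp add: x)
  qed
  then show False using no by blast
qed

text \<open>The dual argument pushes extensions of thin S' by L out along h. The minus sign in
  \<theta> corresponds to its place on the other side of the coboundary equation obtained from
  retractions.\<close>

lemma zero_if_coboundaries_left:
  fixes L :: "'k::field qmod"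
  assumes arr: "\<forall>(i, l)\<in>arrows Q. i \<in> verts Q \<and> l \<in> verts Q" and L: "is_qmod Q L"
    and h: "h \<in> qhom Q L (thin S)" and ob: "obstructed TYPE('k) Q S' S i0 l0"
    and cob: "\<forall>\<theta>. (\<forall>(i, l)\<in>arrows Q. \<theta> (i, l) \<in> carrier_mat (dimv L i) (dimv (thin S' :: 'k qmod) l)) \<longrightarrow>
      (\<exists>s. (\<forall>v\<in>verts Q. s v \<in> carrier_mat (dimv L v) (dimv (thin S' :: 'k qmod) v)) \<and>
        (\<forall>(i, l)\<in>arrows Q. act L (i, l) * s l = \<theta> (i, l) + s i * act (thin S') (i, l)))"
  shows "h i0 = 0\<^sub>m 1 (dimv L i0)"
proof (rule ccontr)
  have a0: "(i0, l0) \<in> arrows Q" "l0 \<in> S'" "i0 \<in> S" and no: "\<And>U :: nat \<Rightarrow> 'k. \<not> thin_coboundary Q S' S (i0, l0) U"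
    using ob by (auto simp: obstructed_def)
  have hc: "dim_col (h v) = dimv L v" "dim_row (h v) = dimv (thin S :: 'k qmod) v" if "v \<in> verts Q" for v
    using h that by (auto simp: qhom_def)
  have i0: "i0 \<in> verts Q" using arr a0 by auto
  assume "h i0 \<noteq> 0\<^sub>m 1 (dimv L i0)"
  then obtain r where r: "r < dimv L i0" "h i0 $$ (0, r) \<noteq> 0"
    using hc[OF i0] a0 by (auto simp: mat_eq_iff dimv_thin)
  define \<theta> :: "nat \<times> nat \<Rightarrow> 'k mat" where "\<theta> = (\<lambda>(i, l). mat (dimv L i) (dimv (thin S' :: 'k qmod) l)
     (\<lambda>(c, _). if (i, l) = (i0, l0) \<and> c = r then - inverse (h i0 $$ (0, r)) else 0))"
  have th: "dim_row (\<theta> (i, l)) = dimv L i" "dim_col (\<theta> (i, l)) = dimv (thin S' :: 'k qmod) l" for i l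
    by (simp_all add: \<theta>_def)
  have "\<forall>(i, l)\<in>arrows Q. \<theta> (i, l) \<in> carrier_mat (dimv L i) (dimv (thin S' :: 'k qmod) l)"
    by (simp add: \<theta>_def)
  from cob[THEN spec, THEN mp, OF this] obtain s where
    sc: "\<forall>v\<in>verts Q. s v \<in> carrier_mat (dimv L v) (dimv (thin S' :: 'k qmod) v)"
    and s: "\<forall>(i, l)\<in>arrows Q. act L (i, l) * s l = \<theta> (i, l) + s i * act (thin S') (i, l)" by (elim exE conjE)
  have sd: "dim_col (s v) = dimv (thin S' :: 'k qmod) v" "dim_row (s v) = dimv L v" if "v \<in> verts Q" for v
    using sc that by auto
  define U where "U v = (if v \<in> S' \<inter> S then (h v * s v) $$ (0, 0) else 0)" for v
  have "thin_coboundary Q S' S (i0, l0) U"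
    unfolding thin_coboundary_def
  proof (intro conjI allI impI ballI)
    fix v assume "v \<notin> S' \<inter> S"
    then show "U v = 0" unfolding U_def by (rule if_not_P)
  next
    fix x assume "x \<in> arrows Q"
    then obtain i l where x: "x = (i, l)" and a: "(i, l) \<in> arrows Q" by (cases x) auto
    have v: "i \<in> verts Q" "l \<in> verts Q" using arr a by auto
    have m: "dim_row (act L (i, l)) = dimv L i" "dim_col (act L (i, l)) = dimv L l"
      using L a by (auto simp: is_qmod_def)
    note d = hc[OF v(1)] hc[OF v(2)] sd[OF v(1)] sd[OF v(2)] th m
    have eq: "act L (i, l) * s l = \<theta> (i, l) + s i * act (thin S') (i, l)" using s a by auto
    have hom: "h i * act L (i, l) = act (thin S) (i, l) * h l" using h a by (auto simp: qhom_def)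
    have "U i - U l = (if (i, l) = (i0, l0) then 1 else 0)" if lS: "l \<in> S'" and iS: "i \<in> S"
    proof -
      have "act (thin S) (i, l) * (h l * s l) = act (thin S) (i, l) * h l * s l"
        by (rule mult_assoc_dim[symmetric]) (use d in \<open>simp_all add: dimv_thin\<close>)
      also have "\<dots> = h i * (act L (i, l) * s l)"
        unfolding hom[symmetric] by (rule mult_assoc_dim) (use d in \<open>simp_all add: dimv_thin\<close>)
      also have "\<dots> = h i * \<theta> (i, l) + h i * (s i * act (thin S') (i, l))"
        unfolding eq by (rule mult_add_dim) (use d in \<open>simp_all add: dimv_thin\<close>)
      also have "h i * (s i * act (thin S') (i, l)) = h i * s i * act (thin S') (i, l)"
        by (rule mult_assoc_dim[symmetric]) (use d in \<open>simp_all add: dimv_thin\<close>)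
      finally have e: "act (thin S) (i, l) * (h l * s l) = h i * \<theta> (i, l) + h i * s i * act (thin S') (i, l)" .
      have f1: "(h i * s i * act (thin S') (i, l)) $$ (0, 0) = U i"
        by (subst mult_act_thin) (use d lS iS in \<open>simp_all add: dimv_thin U_def\<close>)
      have f2: "(act (thin S) (i, l) * (h l * s l)) $$ (0, 0) = U l"
        by (subst act_thin_mult) (use d lS iS in \<open>simp_all add: dimv_thin U_def\<close>)
      have f3: "(h i * \<theta> (i, l)) $$ (0, 0) = (if (i, l) = (i0, l0) then - 1 else 0)"
      proof -
        have "(h i * \<theta> (i, l)) $$ (0, 0) = (\<Sum>c<dimv L i. h i $$ (0, c) * (if (i, l) = (i0, l0) \<and> c = r then - inverse (h i0 $$ (0, r)) else 0))"
          using d lS iS by (simp add: \<theta>_def scalar_prod_def dimv_thin atLeast0LessThan)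
        also have "\<dots> = (\<Sum>c<dimv L i. if c = r then (if (i, l) = (i0, l0) then - 1 else 0) else 0)"
          by (rule sum.cong) (use r in auto)
        also have "\<dots> = (if (i, l) = (i0, l0) then - 1 else 0)" using r(1) by (subst sum.delta) auto
        finally show ?thesis .
      qed
      have "(h i * \<theta> (i, l) + h i * s i * act (thin S') (i, l)) $$ (0, 0) =
          (h i * \<theta> (i, l)) $$ (0, 0) + (h i * s i * act (thin S') (i, l)) $$ (0, 0)"
        by (rule index_add_mat(1)) (use d lS iS in \<open>simp_all add: dimv_thin\<close>)
      then have "U l = (if (i, l) = (i0, l0) then - 1 else 0) + U i" unfolding e[symmetric] f1 f2 f3 .
      then show ?thesis by (cases "(i, l) = (i0, l0)") (simp_all only: if_True if_False, simp_all)
    qed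
    then show "case x of (i, l) \<Rightarrow> l \<in> S' \<longrightarrow> i \<in> S \<longrightarrow> U i - U l = (if (i, l) = (i0, l0) then 1 else 0)"
      by (simp add: x)
  qed
  then show False using no by blast
qed

text \<open>The simple modules at 2, ..., n - 2 and the thin module on all vertices form the mouth
  of the tube of rank n - 2. The four thin modules on paths between the forks form the mouths of two
  tubes of rank 2, complementary paths lying in the same tube. On each mouth the dimension vectors
  add up to \<delta>.\<close>

definition tube :: "nat \<Rightarrow> nat set set" where
  "tube n = {{k} | k. 2 \<le> k \<and> k \<le> n - 2} \<union> {{0..n}} \<union>
     {insert t (insert b {2..n - 2}) | t b. t \<in> {0, 1} \<and> b \<in> {n - 1, n}}"

lemma thin_coboundaryD:
  assumes "thin_coboundary Q S1 S2 a U" "(i, l) \<in> arrows Q" "l \<in> S1" "i \<in> S2"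
  shows "U i - U l = (if (i, l) = a then 1 else 0)"
  using assms unfolding thin_coboundary_def by fastforce

lemma thin_coboundary_outside:
  "thin_coboundary Q S1 S2 a U \<Longrightarrow> v \<notin> S1 \<inter> S2 \<Longrightarrow> U v = 0"
  unfolding thin_coboundary_def by blast

context
  fixes n :: nat
  assumes n: "n \<ge> 4"
begin

lemma Dtilde_arrowI:
  "2 \<le> k \<Longrightarrow> k \<le> n - 3 \<Longrightarrow> (Suc k, k) \<in> arrows (Dtilde n)"
  "t \<in> {0, 1} \<Longrightarrow> (2, t) \<in> arrows (Dtilde n)"
  "b \<in> {n - 1, n} \<Longrightarrow> (b, n - 2) \<in> arrows (Dtilde n)"
  using n by (auto simp: Dtilde_def)

text \<open>The supports are disjoint, so the only cochain is 0 and the class of the arrow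
  survives.\<close>

lemma obstructed_simples:
  assumes k: "2 \<le> k" "k \<le> n - 3"
  shows "obstructed TYPE('k::field) (Dtilde n) {k} {Suc k} (Suc k) k"
  unfolding obstructed_def
proof (intro conjI notI)
  assume "\<exists>U :: nat \<Rightarrow> 'k. thin_coboundary (Dtilde n) {k} {Suc k} (Suc k, k) U"
  then obtain U :: "nat \<Rightarrow> 'k" where U: "thin_coboundary (Dtilde n) {k} {Suc k} (Suc k, k) U" by (elim exE)
  have "U (Suc k) = 0" "U k = 0" by (rule thin_coboundary_outside[OF U]; simp)+
  then show False using thin_coboundaryD[OF U Dtilde_arrowI(1)[OF k]] by simp
qed (use Dtilde_arrowI(1)[OF k] in simp_all)

text \<open>A cochain has a single coefficient, at n - 2, which enters the equations of both arrows
  from the right fork in the same way. Only one of these equations has right hand side 1.\<close>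

lemma obstructed_simple_all:
  assumes b: "b \<in> {n - 1, n}"
  shows "obstructed TYPE('k::field) (Dtilde n) {n - 2} {0..n} b (n - 2)"
  unfolding obstructed_def
proof (intro conjI notI)
  assume "\<exists>U :: nat \<Rightarrow> 'k. thin_coboundary (Dtilde n) {n - 2} {0..n} (b, n - 2) U"
  then obtain U :: "nat \<Rightarrow> 'k" where U: "thin_coboundary (Dtilde n) {n - 2} {0..n} (b, n - 2) U" by (elim exE)
  have nb: "n - 2 \<noteq> n - 1" "n - 2 \<noteq> n" "n - 1 \<noteq> n" using n by linarith+
  have D: "U c - U (n - 2) = (if c = b then 1 else 0)" "U c = 0" if c: "c \<in> {n - 1, n}" for c
    using thin_coboundaryD[OF U Dtilde_arrowI(3)[OF c]] thin_coboundary_outside[OF U, of c] c nb by auto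
  from b consider "b = n - 1" | "b = n" by blast
  then show False using D[of n] D[of "n - 1"] nb by cases simp_all
qed (use Dtilde_arrowI(3)[OF b] b in auto)

lemma obstructed_all_simple:
  assumes t: "t \<in> {0, 1}"
  shows "obstructed TYPE('k::field) (Dtilde n) {0..n} {2} 2 t"
  unfolding obstructed_def
proof (intro conjI notI)
  assume "\<exists>U :: nat \<Rightarrow> 'k. thin_coboundary (Dtilde n) {0..n} {2} (2, t) U"
  then obtain U :: "nat \<Rightarrow> 'k" where U: "thin_coboundary (Dtilde n) {0..n} {2} (2, t) U" by (elim exE)
  have D: "U 2 - U c = (if c = t then 1 else 0)" "U c = 0" if c: "c \<in> {0, 1}" for c
    using thin_coboundaryD[OF U Dtilde_arrowI(2)[OF c]] thin_coboundary_outside[OF U, of c] c n by auto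
  from t consider "t = 0" | "t = 1" by blast
  then show False using D[of 0] D[of 1] by cases simp_all
qed (use Dtilde_arrowI(2)[OF t] t n in auto)

text \<open>On the common part 2, ..., n - 2 of the supports a cochain is constant. The two arrows
  leaving this part, to t and from b', give this constant with opposite signs, so their right hand
  sides would have to add up to 0; but one is 1 and the other is 0.\<close>

lemma obstructed_paths:
  assumes t: "t \<in> {0, 1}" "t' \<in> {0, 1}" "t \<noteq> t'" and b: "b \<in> {n - 1, n}" "b' \<in> {n - 1, n}" "b \<noteq> b'"
    and a: "(i, l) = (2, t) \<or> (i, l) = (b', n - 2)"
  shows "obstructed TYPE('k::field) (Dtilde n) (insert t (insert b {2..n - 2})) (insert t' (insert b' {2..n - 2})) i l"
    (is "obstructed _ _ ?S ?T _ _")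
  unfolding obstructed_def
proof (intro conjI notI)
  assume "\<exists>U :: nat \<Rightarrow> 'k. thin_coboundary (Dtilde n) ?S ?T (i, l) U"
  then obtain U :: "nat \<Rightarrow> 'k" where U: "thin_coboundary (Dtilde n) ?S ?T (i, l) U" by (elim exE)
  have r: "2 \<in> ?S" "2 \<in> ?T" "n - 2 \<in> ?S" "t \<in> ?S" "b' \<in> ?T" using n by auto
  have out: "t \<notin> ?S \<inter> ?T" "b' \<notin> ?S \<inter> ?T" using t b n by auto
  have z: "U t = 0" "U b' = 0" using thin_coboundary_outside[OF U out(1)] thin_coboundary_outside[OF U out(2)] .
  have const: "U k = U 2" if "2 \<le> k" "k \<le> n - 2" for k
    using that
  proof (induction k rule: dec_induct)
    case (step k)
    have kn: "2 \<le> k" "k \<le> n - 3" "k \<le> n - 2" "2 \<le> Suc k" "Suc k \<le> n - 2" "Suc k \<noteq> 2"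
      using step(1) step.prems n by linarith+
    then have k: "k \<in> ?S" "Suc k \<in> ?T" "Suc k \<noteq> b'" using b n by auto
    then have ne: "(Suc k, k) \<noteq> (i, l)" using a kn by auto
    have "U (Suc k) = U k"
      using thin_coboundaryD[OF U Dtilde_arrowI(1)[OF kn(1,2)] k(1,2)] unfolding if_not_P[OF ne] by simp
    then show ?case using step by simp
  qed simp
  have "U 2 = (if (2, t) = (i, l) then 1 else 0)"
    using thin_coboundaryD[OF U Dtilde_arrowI(2)[OF t(1)] r(4,2)] z by simp
  moreover have "- U 2 = (if (b', n - 2) = (i, l) then 1 else 0)"
    using thin_coboundaryD[OF U Dtilde_arrowI(3)[OF b(2)] r(3,5)] z const[of "n - 2"] n by simp
  moreover have "(2, t) \<noteq> (b', n - 2)" using t n by auto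
  ultimately show False using a by (auto split: if_splits)
qed (use Dtilde_arrowI(2)[OF t(1)] Dtilde_arrowI(3)[OF b(2)] a t b n in auto)

end

lemma Dtilde_verts_closed:
  assumes "n \<ge> 4" shows "\<forall>(i, l)\<in>arrows (Dtilde n). i \<in> verts (Dtilde n) \<and> l \<in> verts (Dtilde n)"
  using Dtilde_arrow_cases[OF assms] by (fastforce simp: verts_Dtilde)

lemma tube_subset: "n \<ge> 4 \<Longrightarrow> S \<in> tube n \<Longrightarrow> S \<subseteq> verts (Dtilde n)"
  by (auto simp: tube_def verts_Dtilde)

lemma nat_path_induct:
  fixes P :: "nat \<Rightarrow> bool"
  assumes "P 2" "\<And>k. 2 \<le> k \<Longrightarrow> k \<le> n - 3 \<Longrightarrow> P k \<Longrightarrow> P (Suc k)" "2 \<le> k" "k \<le> n - 2"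
  shows "P k"
  using assms(3,4)
proof (induction k rule: dec_induct)
  case (step k)
  then have "2 \<le> k" "k \<le> n - 3" "k \<le> n - 2" by linarith+
  then show ?case using assms(2) step by blast
qed (rule assms(1))

lemma nat_path_induct_down:
  fixes P :: "nat \<Rightarrow> bool"
  assumes "P (n - 2)" "\<And>k. 2 \<le> k \<Longrightarrow> k \<le> n - 3 \<Longrightarrow> P (Suc k) \<Longrightarrow> P k" "2 \<le> k" "k \<le> n - 2"
  shows "P k"
  using assms(4,3)
proof (induction k rule: inc_induct)
  case (step k)
  then have "2 \<le> k" "k \<le> n - 3" "2 \<le> Suc k" by linarith+
  then show ?case using assms(2) step by blast
qed (rule assms(1))

lemma hom_from_thin_zero:
  assumes M: "is_qmod Q M" and h: "h \<in> qhom Q (thin S) M" and a: "(i, l) \<in> arrows Q" "i \<in> S" "l \<in> S"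
    and v: "i \<in> verts Q" and z: "h l = 0\<^sub>m (dimv M l) 1"
  shows "h i = 0\<^sub>m (dimv M i) 1"
proof -
  have c: "dim_col (h i) = 1" using h v a by (auto simp: qhom_def dimv_thin)
  have "act (thin S) (i, l) = (1\<^sub>m 1 :: 'a::field mat)" using a by (auto simp: act_thin intro!: eq_matI)
  moreover have "h i * act (thin S) (i, l) = act M (i, l) * h l" using h a by (auto simp: qhom_def)
  moreover have "act M (i, l) \<in> carrier_mat (dimv M i) (dimv M l)" using M a by (auto simp: is_qmod_def)
  ultimately show ?thesis using z c mult_one_dim[of "h i" 1] mult_zero_dim[of "act M (i, l)" "dimv M l" 1] by auto
qed

lemma hom_to_thin_zero:
  assumes M: "is_qmod Q M" and h: "h \<in> qhom Q M (thin S)" and a: "(i, l) \<in> arrows Q" "i \<in> S" "l \<in> S"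
    and v: "l \<in> verts Q" and z: "h i = 0\<^sub>m 1 (dimv M i)"
  shows "h l = 0\<^sub>m 1 (dimv M l)"
proof -
  have c: "dim_row (h l) = 1" using h v a by (auto simp: qhom_def dimv_thin)
  have "act (thin S) (i, l) = (1\<^sub>m 1 :: 'a::field mat)" using a by (auto simp: act_thin intro!: eq_matI)
  moreover have "h i * act M (i, l) = act (thin S) (i, l) * h l" using h a by (auto simp: qhom_def)
  moreover have "act M (i, l) \<in> carrier_mat (dimv M i) (dimv M l)" using M a by (auto simp: is_qmod_def)
  ultimately show ?thesis using z c one_mult_dim[of "h l" 1] zero_mult_dim[of "act M (i, l)" "dimv M i" 1] by auto
qed

lemma zero_outside:
  assumes "v \<in> verts Q" "v \<notin> S"
  shows "h \<in> qhom Q (thin S) (M :: 'k::field qmod) \<Longrightarrow> h v = 0\<^sub>m (dimv M v) (dimv (thin S :: 'k qmod) v)"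
    and "h \<in> qhom Q M (thin S) \<Longrightarrow> h v = 0\<^sub>m (dimv (thin S :: 'k qmod) v) (dimv M v)"
  using assms by (auto simp: qhom_def dimv_thin mat_eq_iff)

lemma one_mat_zero: "1\<^sub>m d = (0\<^sub>m d d :: 'k::field mat) \<Longrightarrow> d = 0"
proof (rule ccontr)
  assume "1\<^sub>m d = (0\<^sub>m d d :: 'k mat)" "d \<noteq> 0"
  then have "(1\<^sub>m d :: 'k mat) $$ (0, 0) = 0" by simp
  then show False using \<open>d \<noteq> 0\<close> by simp
qed

context
  fixes n :: nat
  assumes n: "n \<ge> 4"
begin

abbreviation (input) "D \<equiv> Dtilde n"

text \<open>The action of a thin module is invertible inside its support, so the vanishing of h
  spreads from l to i along each arrow from i to l. It suffices to start at the lowest vertices of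
  S, where the arrows leading to the next thin module of the tube are obstructed.\<close>

lemma tube_obstruct_right:
  assumes S: "S \<in> tube n" and M: "is_qmod D M" and h: "h \<in> qhom D (thin S) (M :: 'k::field qmod)"
    and z: "\<forall>S'\<in>tube n. \<forall>i l. obstructed TYPE('k) D S S' i l \<longrightarrow> h l = 0\<^sub>m (dimv M l) 1"
    and v: "v \<in> verts D"
  shows "h v = 0\<^sub>m (dimv M v) (dimv (thin S :: 'k qmod) v)"
proof (cases "v \<in> S")
  case False
  then show ?thesis using zero_outside(1)[OF v] h by blast
next
  case vS: True
  have z': "h l = 0\<^sub>m (dimv M l) 1" if "obstructed TYPE('k) D S S' i l" "S' \<in> tube n" for S' i l
    using z that by blast
  have spread: "h i = 0\<^sub>m (dimv M i) 1" if "(i, l) \<in> arrows D" "i \<in> S" "l \<in> S" "h l = 0\<^sub>m (dimv M l) 1" for i l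
    using hom_from_thin_zero[OF M h that(1-3) _ that(4)] Dtilde_verts_closed[OF n] that by auto
  from S consider k where "S = {k}" "2 \<le> k" "k \<le> n - 2" | "S = {0..n}"
    | t b where "S = insert t (insert b {2..n - 2})" "t \<in> {0, 1}" "b \<in> {n - 1, n}"
    unfolding tube_def by auto
  then have "h v = 0\<^sub>m (dimv M v) 1"
  proof cases
    case (1 k)
    show ?thesis
    proof (cases "k = n - 2")
      case True
      \<comment> \<open>The cycle of the large tube closes here: after the simple modules at 2, ...,
        n - 2 comes the thin module on all vertices.\<close>
      have "{0..n} \<in> tube n" by (simp add: tube_def)
      then show ?thesis using z'[OF obstructed_simple_all[OF n, of n, folded True 1(1)]] vS 1 True by auto
    next
      case False
      then have k: "2 \<le> k" "k \<le> n - 3" "2 \<le> Suc k" "Suc k \<le> n - 2" using 1 by linarith+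
      then have "{Suc k} \<in> tube n" unfolding tube_def by blast
      then show ?thesis using z'[OF obstructed_simples[OF n k(1,2), folded 1(1)]] vS 1 by auto
    qed
  next
    case 2
    have "{2} \<in> tube n" using n by (auto simp: tube_def)
    then have z0: "h t = 0\<^sub>m (dimv M t) 1" if "t \<in> {0, 1}" for t
      using z'[OF obstructed_all_simple[OF n that, folded 2]] by blast
    have z2: "h 2 = 0\<^sub>m (dimv M 2) 1" by (rule spread[OF Dtilde_arrowI(2)[OF n, of 0]]) (use 2 n z0[of 0] in auto)
    have zk: "h k = 0\<^sub>m (dimv M k) 1" if "2 \<le> k" "k \<le> n - 2" for k
    proof (rule nat_path_induct[where P = "\<lambda>k. h k = 0\<^sub>m (dimv M k) 1", OF z2 _ that])
      fix k assume k: "2 \<le> k" "k \<le> n - 3" "h k = 0\<^sub>m (dimv M k) 1"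
      have "k \<in> S" "Suc k \<in> S" using k 2 by auto
      then show "h (Suc k) = 0\<^sub>m (dimv M (Suc k)) 1" by (rule spread[OF Dtilde_arrowI(1)[OF n k(1,2)] _ _ k(3), rotated])
    qed
    have zb: "h b = 0\<^sub>m (dimv M b) 1" if "b \<in> {n - 1, n}" for b
      by (rule spread[OF Dtilde_arrowI(3)[OF n that]]) (use 2 n that zk[of "n - 2"] in auto)
    have "v \<in> {0, 1} \<or> v \<in> {n - 1, n} \<or> (2 \<le> v \<and> v \<le> n - 2)" using vS 2 by auto
    then show ?thesis using z0 zk zb by blast
  next
    case (3 t b)
    define t' b' where "t' = 1 - t" and "b' = (if b = n then n - 1 else n)"
    have tb: "t' \<in> {0, 1}" "t \<noteq> t'" "b' \<in> {n - 1, n}" "b \<noteq> b'" using 3 n by (auto simp: t'_def b'_def)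
    have "insert t' (insert b' {2..n - 2}) \<in> tube n" unfolding tube_def using tb by blast
    then have zt: "h t = 0\<^sub>m (dimv M t) 1"
      using z'[OF obstructed_paths[OF n 3(2) tb(1,2) 3(3) tb(3,4), of 2 t, folded 3(1)]] by blast
    have z2: "h 2 = 0\<^sub>m (dimv M 2) 1" by (rule spread[OF Dtilde_arrowI(2)[OF n 3(2)]]) (use 3 n zt in auto)
    have zk: "h k = 0\<^sub>m (dimv M k) 1" if "2 \<le> k" "k \<le> n - 2" for k
    proof (rule nat_path_induct[where P = "\<lambda>k. h k = 0\<^sub>m (dimv M k) 1", OF z2 _ that])
      fix k assume k: "2 \<le> k" "k \<le> n - 3" "h k = 0\<^sub>m (dimv M k) 1"
      have "k \<in> S" "Suc k \<in> S" using k 3 by auto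
      then show "h (Suc k) = 0\<^sub>m (dimv M (Suc k)) 1" by (rule spread[OF Dtilde_arrowI(1)[OF n k(1,2)] _ _ k(3), rotated])
    qed
    have zb: "h b = 0\<^sub>m (dimv M b) 1"
      by (rule spread[OF Dtilde_arrowI(3)[OF n 3(3)]]) (use 3 n zk[of "n - 2"] in auto)
    have "v = t \<or> v = b \<or> (2 \<le> v \<and> v \<le> n - 2)" using vS 3 by auto
    then show ?thesis using zt zk zb by blast
  qed
  then show ?thesis using vS by (simp add: dimv_thin)
qed

text \<open>For maps into thin S the vanishing spreads the other way, from i to l. The start is at
  the highest vertices of S, and the obstruction comes from the preceding thin module of the
  tube.\<close>

lemma tube_obstruct_left:
  assumes S: "S \<in> tube n" and M: "is_qmod D M" and h: "h \<in> qhom D (M :: 'k::field qmod) (thin S)"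
    and z: "\<forall>S'\<in>tube n. \<forall>i l. obstructed TYPE('k) D S' S i l \<longrightarrow> h i = 0\<^sub>m 1 (dimv M i)"
    and v: "v \<in> verts D"
  shows "h v = 0\<^sub>m (dimv (thin S :: 'k qmod) v) (dimv M v)"
proof (cases "v \<in> S")
  case False
  then show ?thesis using zero_outside(2)[OF v] h by blast
next
  case vS: True
  have z': "h i = 0\<^sub>m 1 (dimv M i)" if "obstructed TYPE('k) D S' S i l" "S' \<in> tube n" for S' i l
    using z that by blast
  have spread: "h l = 0\<^sub>m 1 (dimv M l)" if "(i, l) \<in> arrows D" "i \<in> S" "l \<in> S" "h i = 0\<^sub>m 1 (dimv M i)" for i l
    using hom_to_thin_zero[OF M h that(1-3) _ that(4)] Dtilde_verts_closed[OF n] that by auto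
  from S consider k where "S = {k}" "2 \<le> k" "k \<le> n - 2" | "S = {0..n}"
    | t b where "S = insert t (insert b {2..n - 2})" "t \<in> {0, 1}" "b \<in> {n - 1, n}"
    unfolding tube_def by auto
  then have "h v = 0\<^sub>m 1 (dimv M v)"
  proof cases
    case (1 k)
    show ?thesis
    proof (cases "k = 2")
      case True
      have "{0..n} \<in> tube n" by (simp add: tube_def)
      then show ?thesis using z'[OF obstructed_all_simple[OF n, of 0, folded True, folded 1(1)]] vS 1 True by auto
    next
      case False
      then obtain j where j: "k = Suc j" "2 \<le> j" "j \<le> n - 3" "j \<le> n - 2" using 1 by (cases k) auto
      then have "{j} \<in> tube n" unfolding tube_def by blast
      then show ?thesis using z'[OF obstructed_simples[OF n j(2,3), folded j(1), folded 1(1)]] vS 1 by auto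
    qed
  next
    case 2
    have "{n - 2} \<in> tube n" using n by (auto simp: tube_def)
    then have zb: "h b = 0\<^sub>m 1 (dimv M b)" if "b \<in> {n - 1, n}" for b
      using z'[OF obstructed_simple_all[OF n that, folded 2]] by blast
    have z2: "h (n - 2) = 0\<^sub>m 1 (dimv M (n - 2))" by (rule spread[OF Dtilde_arrowI(3)[OF n, of n]]) (use 2 n zb[of n] in auto)
    have zk: "h k = 0\<^sub>m 1 (dimv M k)" if "2 \<le> k" "k \<le> n - 2" for k
    proof (rule nat_path_induct_down[where P = "\<lambda>k. h k = 0\<^sub>m 1 (dimv M k)", OF z2 _ that])
      fix k assume k: "2 \<le> k" "k \<le> n - 3" "h (Suc k) = 0\<^sub>m 1 (dimv M (Suc k))"
      have "Suc k \<in> S" "k \<in> S" using k 2 by auto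
      then show "h k = 0\<^sub>m 1 (dimv M k)" by (rule spread[OF Dtilde_arrowI(1)[OF n k(1,2)] _ _ k(3)])
    qed
    have z0: "h t = 0\<^sub>m 1 (dimv M t)" if "t \<in> {0, 1}" for t
      by (rule spread[OF Dtilde_arrowI(2)[OF n that]]) (use 2 n that zk[of 2] in auto)
    have "v \<in> {0, 1} \<or> v \<in> {n - 1, n} \<or> (2 \<le> v \<and> v \<le> n - 2)" using vS 2 by auto
    then show ?thesis using z0 zk zb by blast
  next
    case (3 t b)
    define t' b' where "t' = 1 - t" and "b' = (if b = n then n - 1 else n)"
    have tb: "t' \<in> {0, 1}" "t' \<noteq> t" "b' \<in> {n - 1, n}" "b' \<noteq> b" using 3 n by (auto simp: t'_def b'_def)
    have "insert t' (insert b' {2..n - 2}) \<in> tube n" unfolding tube_def using tb by blast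
    then have zb: "h b = 0\<^sub>m 1 (dimv M b)"
      using z'[OF obstructed_paths[OF n tb(1) 3(2) tb(2,3) 3(3) tb(4), of b "n - 2", folded 3(1)]] by blast
    have z2: "h (n - 2) = 0\<^sub>m 1 (dimv M (n - 2))" by (rule spread[OF Dtilde_arrowI(3)[OF n 3(3)]]) (use 3 n zb in auto)
    have zk: "h k = 0\<^sub>m 1 (dimv M k)" if "2 \<le> k" "k \<le> n - 2" for k
    proof (rule nat_path_induct_down[where P = "\<lambda>k. h k = 0\<^sub>m 1 (dimv M k)", OF z2 _ that])
      fix k assume k: "2 \<le> k" "k \<le> n - 3" "h (Suc k) = 0\<^sub>m 1 (dimv M (Suc k))"
      have "Suc k \<in> S" "k \<in> S" using k 3 by auto
      then show "h k = 0\<^sub>m 1 (dimv M k)" by (rule spread[OF Dtilde_arrowI(1)[OF n k(1,2)] _ _ k(3)])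
    qed
    have zt: "h t = 0\<^sub>m 1 (dimv M t)"
      by (rule spread[OF Dtilde_arrowI(2)[OF n 3(2)]]) (use 3 n zk[of 2] in auto)
    have "v = t \<or> v = b \<or> (2 \<le> v \<and> v \<le> n - 2)" using vS 3 by auto
    then show ?thesis using zt zk zb by blast
  qed
  then show ?thesis using vS by (simp add: dimv_thin)
qed

lemma module_ext_Dtilde:
  assumes "is_qmod D L" "is_qmod D M" "\<forall>(i, l)\<in>arrows D. \<theta> (i, l) \<in> carrier_mat (dimv L i) (dimv M l)"
  shows "module_ext D L M \<theta>"
  by unfold_locales (use assms Dtilde_verts_closed[OF n] in auto)

text \<open>A nonzero map from thin S to M would produce a non-split extension of M by a neighbour
  thin S' in the tube. For projective M there is none, and for other M it would give a nonzero map
  from thin S' to the translate of M. As the neighbour changes at each step, the induction covers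
  all members of the tubes together.\<close>

lemma hom_zero_preprojective:
  assumes "preprojective D N" "S \<in> tube n"
  shows "hom_zero D (thin S) (N :: 'k::field qmod)"
  using assms
proof (induction arbitrary: S rule: preprojective.induct)
  case (1 P)
  have P: "is_qmod D P" using 1(2) by (simp add: projective_def)
  show ?case
    unfolding hom_zero_def
  proof (intro ballI)
    fix h v assume h: "h \<in> qhom D (thin S) P" and v: "v \<in> verts D"
    have "h l = 0\<^sub>m (dimv P l) 1" if "S' \<in> tube n" "obstructed TYPE('k) D S S' i l" for S' i l
    proof (rule zero_if_coboundaries_right[OF Dtilde_verts_closed[OF n] P h that(2)], intro allI impI)
      fix \<theta> :: "nat \<times> nat \<Rightarrow> 'k mat" assume "\<forall>(i, l)\<in>arrows D. \<theta> (i, l) \<in> carrier_mat (dimv (thin S' :: 'k qmod) i) (dimv P l)"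
      from module_ext.coboundary_if_projective[OF module_ext_Dtilde[OF is_qmod_thin P this] 1(2)]
      show "\<exists>s. (\<forall>v\<in>verts D. s v \<in> carrier_mat (dimv (thin S' :: 'k qmod) v) (dimv P v)) \<and>
        (\<forall>(i, l)\<in>arrows D. s i * act P (i, l) = act (thin S') (i, l) * s l + \<theta> (i, l))" .
    qed
    then have "\<forall>S'\<in>tube n. \<forall>i l. obstructed TYPE('k) D S S' i l \<longrightarrow> h l = 0\<^sub>m (dimv P l) 1" by blast
    then show "h v = 0\<^sub>m (dimv P v) (dimv (thin S :: 'k qmod) v)"
      by (rule tube_obstruct_right[OF 1(3) P h _ v])
  qed
next
  case (2 N M)
  have P: "is_qmod D M" using 2(2) by (simp add: AR_translate_def)
  show ?case
    unfolding hom_zero_def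
  proof (intro ballI)
    fix h v assume h: "h \<in> qhom D (thin S) M" and v: "v \<in> verts D"
    have "h l = 0\<^sub>m (dimv M l) 1" if "S' \<in> tube n" "obstructed TYPE('k) D S S' i l" for S' i l
    proof (rule zero_if_coboundaries_right[OF Dtilde_verts_closed[OF n] P h that(2)], intro allI impI)
      fix \<theta> :: "nat \<times> nat \<Rightarrow> 'k mat" assume "\<forall>(i, l)\<in>arrows D. \<theta> (i, l) \<in> carrier_mat (dimv (thin S' :: 'k qmod) i) (dimv M l)"
      from module_ext.coboundary_if_AR_right[OF module_ext_Dtilde[OF is_qmod_thin P this] 2(2) 2(3)[OF that(1)]]
      show "\<exists>s. (\<forall>v\<in>verts D. s v \<in> carrier_mat (dimv (thin S' :: 'k qmod) v) (dimv M v)) \<and>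
        (\<forall>(i, l)\<in>arrows D. s i * act M (i, l) = act (thin S') (i, l) * s l + \<theta> (i, l))" .
    qed
    then have "\<forall>S'\<in>tube n. \<forall>i l. obstructed TYPE('k) D S S' i l \<longrightarrow> h l = 0\<^sub>m (dimv M l) 1" by blast
    then show "h v = 0\<^sub>m (dimv M v) (dimv (thin S :: 'k qmod) v)"
      by (rule tube_obstruct_right[OF 2(4) P h _ v])
  qed
qed

lemma hom_zero_preinjective:
  assumes "preinjective D N" "S \<in> tube n"
  shows "hom_zero D (N :: 'k::field qmod) (thin S)"
  using assms
proof (induction arbitrary: S rule: preinjective.induct)
  case (1 P)
  have P: "is_qmod D P" using 1(2) by (simp add: injective_def)
  show ?case
    unfolding hom_zero_def
  proof (intro ballI)
    fix h v assume h: "h \<in> qhom D P (thin S)" and v: "v \<in> verts D"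
    have "h i = 0\<^sub>m 1 (dimv P i)" if "S' \<in> tube n" "obstructed TYPE('k) D S' S i l" for S' i l
    proof (rule zero_if_coboundaries_left[OF Dtilde_verts_closed[OF n] P h that(2)], intro allI impI)
      fix \<theta> :: "nat \<times> nat \<Rightarrow> 'k mat" assume "\<forall>(i, l)\<in>arrows D. \<theta> (i, l) \<in> carrier_mat (dimv P i) (dimv (thin S' :: 'k qmod) l)"
      from module_ext.coboundary_if_injective[OF module_ext_Dtilde[OF P is_qmod_thin this] 1(2)]
      show "\<exists>s. (\<forall>v\<in>verts D. s v \<in> carrier_mat (dimv P v) (dimv (thin S' :: 'k qmod) v)) \<and>
        (\<forall>(i, l)\<in>arrows D. act P (i, l) * s l = \<theta> (i, l) + s i * act (thin S') (i, l))" .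
    qed
    then have "\<forall>S'\<in>tube n. \<forall>i l. obstructed TYPE('k) D S' S i l \<longrightarrow> h i = 0\<^sub>m 1 (dimv P i)" by blast
    then show "h v = 0\<^sub>m (dimv (thin S :: 'k qmod) v) (dimv P v)"
      by (rule tube_obstruct_left[OF 1(3) P h _ v])
  qed
next
  case (2 M N)
  have P: "is_qmod D N" using 2(2) by (simp add: AR_translate_def)
  show ?case
    unfolding hom_zero_def
  proof (intro ballI)
    fix h v assume h: "h \<in> qhom D N (thin S)" and v: "v \<in> verts D"
    have "h i = 0\<^sub>m 1 (dimv N i)" if "S' \<in> tube n" "obstructed TYPE('k) D S' S i l" for S' i l
    proof (rule zero_if_coboundaries_left[OF Dtilde_verts_closed[OF n] P h that(2)], intro allI impI)
      fix \<theta> :: "nat \<times> nat \<Rightarrow> 'k mat" assume "\<forall>(i, l)\<in>arrows D. \<theta> (i, l) \<in> carrier_mat (dimv N i) (dimv (thin S' :: 'k qmod) l)"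
      from module_ext.coboundary_if_AR_left[OF module_ext_Dtilde[OF P is_qmod_thin this] 2(2) 2(3)[OF that(1)]]
      show "\<exists>s. (\<forall>v\<in>verts D. s v \<in> carrier_mat (dimv N v) (dimv (thin S' :: 'k qmod) v)) \<and>
        (\<forall>(i, l)\<in>arrows D. act N (i, l) * s l = \<theta> (i, l) + s i * act (thin S') (i, l))" .
    qed
    then have "\<forall>S'\<in>tube n. \<forall>i l. obstructed TYPE('k) D S' S i l \<longrightarrow> h i = 0\<^sub>m 1 (dimv N i)" by blast
    then show "h v = 0\<^sub>m (dimv (thin S :: 'k qmod) v) (dimv N v)"
      by (rule tube_obstruct_left[OF 2(4) P h _ v])
  qed
qed

text \<open>A summand N comes with maps from and to thin S that compose to the identity of N. One of
  the two vanishes if N is preprojective and the other one if N is preinjective, so N would be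
  0.\<close>

lemma regular_thin:
  assumes S: "S \<in> tube n"
  shows "regular D (thin S :: 'k::field qmod)"
  unfolding regular_def
proof (intro conjI allI impI)
  show "is_qmod D (thin S :: 'k qmod)" by (rule is_qmod_thin)
  fix N L :: "'k qmod"
  assume "indecomposable D N \<and> is_qmod D L \<and> direct_sum D (thin S) N L"
  then have N: "indecomposable D N" and ds: "direct_sum D (thin S) N L" by blast+
  have "\<not> qzero D N" using N unfolding indecomposable_def by (elim conjE)
  then obtain v where v: "v \<in> verts D" "dimv N v \<noteq> 0" unfolding qzero_def by metis
  obtain a p where a: "a \<in> qhom D N (thin S)" and p: "p \<in> qhom D (thin S) N"
    and pa: "\<forall>v\<in>verts D. p v * a v = 1\<^sub>m (dimv N v)"
    using ds unfolding direct_sum_def by (elim bexE) simp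
  have av: "a v \<in> carrier_mat (dimv (thin S :: 'k qmod) v) (dimv N v)"
    and pv: "p v \<in> carrier_mat (dimv N v) (dimv (thin S :: 'k qmod) v)"
    using a p v by (auto simp: qhom_def)
  have e: "p v * a v = 1\<^sub>m (dimv N v)" using pa v(1) by (rule bspec)
  show "\<not> preprojective D N"
  proof
    assume "preprojective D N"
    then have "p v = 0\<^sub>m (dimv N v) (dimv (thin S :: 'k qmod) v)"
      using hom_zero_preprojective[OF _ S, unfolded hom_zero_def, rule_format, OF _ p v(1)] by simp
    then have "1\<^sub>m (dimv N v) = (0\<^sub>m (dimv N v) (dimv N v) :: 'k mat)" using e av by simp
    then show False using one_mat_zero[of "dimv N v"] v(2) by simp
  qed
  show "\<not> preinjective D N"
  proof
    assume "preinjective D N"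
    then have "a v = 0\<^sub>m (dimv (thin S :: 'k qmod) v) (dimv N v)"
      using hom_zero_preinjective[OF _ S, unfolded hom_zero_def, rule_format, OF _ a v(1)] by simp
    then have "1\<^sub>m (dimv N v) = (0\<^sub>m (dimv N v) (dimv N v) :: 'k mat)" using e pv by simp
    then show False using one_mat_zero[of "dimv N v"] v(2) by simp
  qed
qed

end

section \<open>Regular simple modules are generic\<close>

text \<open>A functional that vanishes on the common kernel of the rows is a combination of the
  rows. The induction removes the last row: if y fails to vanish at some x0 in the kernel of the
  other rows, then so does the last row, and subtracting its multiple by the ratio \<nu> of the two
  values reduces to the remaining rows.\<close>

lemma solve_left:
  fixes A :: "nat \<Rightarrow> nat \<Rightarrow> 'k::field"
  assumes "\<forall>x. (\<forall>r<m. (\<Sum>c<k. A r c * x c) = 0) \<longrightarrow> (\<Sum>c<k. y c * x c) = 0"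
  shows "\<exists>z. \<forall>c<k. (\<Sum>r<m. z r * A r c) = y c"
  using assms
proof (induction m arbitrary: y)
  case 0
  then have z: "(\<Sum>c<k. y c * x c) = 0" for x by simp
  have "y c = 0" if c: "c < k" for c
  proof -
    have "0 = (\<Sum>c'<k. y c' * (if c' = c then 1 else 0))" using z by simp
    also have "\<dots> = (\<Sum>c'<k. if c' = c then y c else 0)" by (rule sum.cong) auto
    also have "\<dots> = y c" using c by simp
    finally show ?thesis by simp
  qed
  then show ?case by simp
next
  case (Suc m)
  show ?case
  proof (cases "\<forall>x. (\<forall>r<m. (\<Sum>c<k. A r c * x c) = 0) \<longrightarrow> (\<Sum>c<k. y c * x c) = 0")
    case True
    from Suc.IH[OF True] obtain z where z: "\<forall>c<k. (\<Sum>r<m. z r * A r c) = y c" by (elim exE)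
    have "(\<Sum>r<Suc m. (z(m := 0)) r * A r c) = y c" if "c < k" for c
    proof -
      have "(\<Sum>r<m. (z(m := 0)) r * A r c) = (\<Sum>r<m. z r * A r c)" by (rule sum.cong) auto
      then show ?thesis using z that by simp
    qed
    then show ?thesis by (intro exI[of _ "z(m := 0)"]) simp
  next
    case False
    then obtain x0 where x0: "\<forall>r<m. (\<Sum>c<k. A r c * x0 c) = 0" "(\<Sum>c<k. y c * x0 c) \<noteq> 0" by blast
    define a0 y0 where "a0 = (\<Sum>c<k. A m c * x0 c)" and "y0 = (\<Sum>c<k. y c * x0 c)"
    have a0: "a0 \<noteq> 0"
    proof
      assume "a0 = 0"
      then have "\<forall>r<Suc m. (\<Sum>c<k. A r c * x0 c) = 0" using x0(1) by (auto simp: a0_def less_Suc_eq)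
      then show False using Suc.prems x0(2) by blast
    qed
    define \<nu> where "\<nu> = y0 / a0"
    have "\<forall>x. (\<forall>r<m. (\<Sum>c<k. A r c * x c) = 0) \<longrightarrow> (\<Sum>c<k. (y c - \<nu> * A m c) * x c) = 0"
    proof (intro allI impI)
      fix x assume x: "\<forall>r<m. (\<Sum>c<k. A r c * x c) = 0"
      define \<mu> where "\<mu> = (\<Sum>c<k. A m c * x c) / a0"
      have lin: "(\<Sum>c<k. f c * (x c - \<mu> * x0 c)) = (\<Sum>c<k. f c * x c) - \<mu> * (\<Sum>c<k. f c * x0 c)" for f
        by (simp add: algebra_simps sum_subtractf sum_distrib_left)
      have "\<forall>r<Suc m. (\<Sum>c<k. A r c * (x c - \<mu> * x0 c)) = 0"
        unfolding lin using x x0(1) a0 by (auto simp: less_Suc_eq \<mu>_def a0_def[symmetric])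
      then have "(\<Sum>c<k. y c * (x c - \<mu> * x0 c)) = 0"
        using Suc.prems[THEN spec, of "\<lambda>c. x c - \<mu> * x0 c"] by blast
      then have "(\<Sum>c<k. y c * x c) = \<mu> * y0" unfolding lin y0_def by simp
      moreover have "(\<Sum>c<k. (y c - \<nu> * A m c) * x c) = (\<Sum>c<k. y c * x c) - \<nu> * (\<Sum>c<k. A m c * x c)"
        by (simp add: algebra_simps sum_subtractf sum_distrib_left)
      moreover have "(\<Sum>c<k. A m c * x c) = \<mu> * a0" using a0 by (simp add: \<mu>_def)
      ultimately show "(\<Sum>c<k. (y c - \<nu> * A m c) * x c) = 0" using a0 by (simp add: \<nu>_def)
    qed
    from Suc.IH[OF this] obtain z where z: "\<forall>c<k. (\<Sum>r<m. z r * A r c) = y c - \<nu> * A m c" by (elim exE)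
    have "(\<Sum>r<Suc m. (z(m := \<nu>)) r * A r c) = y c" if "c < k" for c
    proof -
      have "(\<Sum>r<m. (z(m := \<nu>)) r * A r c) = (\<Sum>r<m. z r * A r c)" by (rule sum.cong) auto
      then show ?thesis using z that by simp
    qed
    then show ?thesis by (intro exI[of _ "z(m := \<nu>)"]) simp
  qed
qed

lemma extend_functional:
  fixes G :: "'k::field mat"
  assumes G: "G \<in> carrier_mat m k" and inj: "inj_on (\<lambda>x. G *\<^sub>v x) (carrier_vec k)" and h: "h \<in> carrier_mat 1 k"
  shows "\<exists>h'\<in>carrier_mat 1 m. h' * G = h"
proof -
  have "\<forall>x. (\<forall>r<m. (\<Sum>c<k. G $$ (r, c) * x c) = 0) \<longrightarrow> (\<Sum>c<k. h $$ (0, c) * x c) = 0"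
  proof (intro allI impI)
    fix x assume x: "\<forall>r<m. (\<Sum>c<k. G $$ (r, c) * x c) = 0"
    have "G *\<^sub>v vec k x = 0\<^sub>v m"
    proof (rule eq_vecI)
      fix r assume "r < dim_vec (0\<^sub>v m :: 'k vec)"
      then have r: "r < m" by simp
      have "(G *\<^sub>v vec k x) $ r = (\<Sum>c<k. G $$ (r, c) * x c)"
        using r G by (simp add: scalar_prod_def atLeast0LessThan)
      then show "(G *\<^sub>v vec k x) $ r = 0\<^sub>v m $ r" using x r by simp
    qed (use G in auto)
    also have "\<dots> = G *\<^sub>v 0\<^sub>v k" using G by (intro eq_vecI) (auto simp: scalar_prod_def)
    finally have "vec k x = 0\<^sub>v k" by (rule inj_onD[OF inj]) simp_all
    then have "vec k x $ c = 0" if "c < k" for c using that by simp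
    then show "(\<Sum>c<k. h $$ (0, c) * x c) = 0" by (intro sum.neutral) simp
  qed
  from solve_left[OF this] obtain z where z: "\<forall>c<k. (\<Sum>r<m. z r * G $$ (r, c)) = h $$ (0, c)" by (elim exE)
  have "mat 1 m (\<lambda>(_, r). z r) * G = h"
  proof (rule eq_matI)
    fix i c assume "i < dim_row h" "c < dim_col h"
    then have ic: "i = 0" "c < k" using h by auto
    then show "(mat 1 m (\<lambda>(_, r). z r) * G) $$ (i, c) = h $$ (i, c)"
      using z G by (simp add: scalar_prod_def atLeast0LessThan)
  qed (use G h in auto)
  then show ?thesis by (intro bexI) auto
qed

lemma indecomposable_thin_point:
  assumes w: "w \<in> verts Q"
  shows "indecomposable Q (thin {w} :: 'k::field qmod)"
  unfolding indecomposable_def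
proof (intro conjI allI impI)
  show "is_qmod Q (thin {w} :: 'k qmod)" by (rule is_qmod_thin)
  show "\<not> qzero Q (thin {w} :: 'k qmod)" using w by (auto simp: qzero_def dimv_thin)
  fix N L :: "'k qmod"
  assume "is_qmod Q N \<and> is_qmod Q L \<and> direct_sum Q (thin {w}) N L"
  then have "direct_sum Q (thin {w}) N L" by (elim conjE)
  then obtain a b p q where c: "a \<in> qhom Q N (thin {w})" "b \<in> qhom Q L (thin {w})" "p \<in> qhom Q (thin {w}) N" "q \<in> qhom Q (thin {w}) L"
    and e: "\<forall>v\<in>verts Q. p v * a v = 1\<^sub>m (dimv N v) \<and> q v * b v = 1\<^sub>m (dimv L v) \<and>
        p v * b v = 0\<^sub>m (dimv N v) (dimv L v) \<and> q v * a v = 0\<^sub>m (dimv L v) (dimv N v) \<and>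
        a v * p v + b v * q v = 1\<^sub>m (dimv (thin {w} :: 'k qmod) v)"
    unfolding direct_sum_def by (elim bexE)
  define t where "t v = dimv (thin {w} :: 'k qmod) v" for v
  have cv: "a v \<in> carrier_mat (t v) (dimv N v)" "b v \<in> carrier_mat (t v) (dimv L v)"
    "p v \<in> carrier_mat (dimv N v) (t v)" "q v \<in> carrier_mat (dimv L v) (t v)" if "v \<in> verts Q" for v
    using c that unfolding qhom_def t_def by simp_all
  have out: "dimv N v = 0" "dimv L v = 0" if v: "v \<in> verts Q" "v \<noteq> w" for v
  proof -
    have t0: "t v = 0" using v by (simp add: t_def dimv_thin)
    have "p v * a v = 0\<^sub>m (dimv N v) (dimv N v)" "q v * b v = 0\<^sub>m (dimv L v) (dimv L v)"
      by (rule eq_matI; use cv[OF v(1)] t0 in \<open>simp add: scalar_prod_def\<close>)+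
    then have z: "1\<^sub>m (dimv N v) = (0\<^sub>m (dimv N v) (dimv N v) :: 'k mat)" "1\<^sub>m (dimv L v) = (0\<^sub>m (dimv L v) (dimv L v) :: 'k mat)"
      using e v by simp_all
    show "dimv N v = 0" "dimv L v = 0" by (rule one_mat_zero[OF z(1)], rule one_mat_zero[OF z(2)])
  qed
  have "dimv N w = 0 \<or> dimv L w = 0"
  proof (rule ccontr)
    assume "\<not> (dimv N w = 0 \<or> dimv L w = 0)"
    then have pos: "0 < dimv N w" "0 < dimv L w" by auto
    have t1: "t w = 1" by (simp add: t_def dimv_thin)
    note cw = cv[OF w, unfolded t1]
    have "(p w * a w) $$ (0, 0) = p w $$ (0, 0) * a w $$ (0, 0)" "(q w * b w) $$ (0, 0) = q w $$ (0, 0) * b w $$ (0, 0)"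
      "(p w * b w) $$ (0, 0) = p w $$ (0, 0) * b w $$ (0, 0)"
      using cw pos by (simp_all add: scalar_prod_def)
    moreover have "(p w * a w) $$ (0, 0) = 1" "(q w * b w) $$ (0, 0) = 1" "(p w * b w) $$ (0, 0) = 0"
      using e w pos by simp_all
    ultimately show False by auto
  qed
  then show "qzero Q N \<or> qzero Q L" using out unfolding qzero_def by metis
qed

text \<open>Arrows act against their direction, so no map of a module ends in the space at a sink w.
  Homomorphisms to the simple module at w are therefore arbitrary functionals on that space, and
  these extend along injections.\<close>

lemma injective_thin_sink:
  assumes w: "w \<in> verts Q" and arr: "\<forall>(i, l)\<in>arrows Q. i \<noteq> w \<and> i \<in> verts Q \<and> l \<in> verts Q"
  shows "injective Q (thin {w} :: 'k::field qmod)"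
  unfolding injective_def
proof (intro conjI allI impI ballI)
  show "is_qmod Q (thin {w} :: 'k qmod)" by (rule is_qmod_thin)
  fix X Y :: "'k qmod" and g h
  assume XY: "is_qmod Q X \<and> is_qmod Q Y" and g: "g \<in> qhom Q X Y" "qmono Q X g" and h: "h \<in> qhom Q X (thin {w})"
  have hc: "h v \<in> carrier_mat (dimv (thin {w} :: 'k qmod) v) (dimv X v)" and gc: "g v \<in> carrier_mat (dimv Y v) (dimv X v)"
    if "v \<in> verts Q" for v
    using h g that unfolding qhom_def by simp_all
  have hw: "h w \<in> carrier_mat 1 (dimv X w)" using hc[OF w] by (simp add: dimv_thin)
  have "inj_on (\<lambda>x. g w *\<^sub>v x) (carrier_vec (dimv X w))" using g(2) w unfolding qmono_def by (rule bspec)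
  from extend_functional[OF gc[OF w] this hw] obtain u where u: "u \<in> carrier_mat 1 (dimv Y w)" "u * g w = h w" by (elim bexE)
  define h' where "h' v = (if v = w then u else 0\<^sub>m 0 (dimv Y v))" for v
  have "h' \<in> qhom Q Y (thin {w})"
    unfolding qhom_def
  proof (rule CollectI, intro conjI ballI)
    fix v
    show "h' v \<in> carrier_mat (dimv (thin {w} :: 'k qmod) v) (dimv Y v)" using u by (simp add: h'_def dimv_thin)
  next
    fix x assume "x \<in> arrows Q"
    then obtain i l where x: "x = (i, l)" and a: "(i, l) \<in> arrows Q" by (cases x) auto
    have i: "i \<noteq> w" using arr a by auto
    have d: "dim_col (act Y (i, l)) = dimv Y l" using XY a by (auto simp: is_qmod_def)
    have "h' i * act Y (i, l) = act (thin {w}) (i, l) * h' l"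
      by (rule eq_matI) (use i d u in \<open>auto simp: h'_def\<close>)
    then show "case x of (i, l) \<Rightarrow> h' i * act Y (i, l) = act (thin {w}) (i, l) * h' l" by (simp add: x)
  qed
  moreover have "h' v * g v = h v" if v: "v \<in> verts Q" for v
  proof (cases "v = w")
    case False
    then show ?thesis using hc[OF v] gc[OF v] by (intro eq_matI) (auto simp: h'_def dimv_thin)
  qed (simp add: h'_def u)
  ultimately show "\<exists>h'\<in>qhom Q Y (thin {w}). \<forall>v\<in>verts Q. h' v * g v = h v" by (intro bexI[of _ h'] ballI)
qed

lemma thin_point_summand:
  fixes M :: "'k::field qmod"
  assumes M: "is_qmod Q M" and w: "w \<in> verts Q" "dimv M w = 1"
    and arr: "\<forall>(i, l)\<in>arrows Q. i \<noteq> l"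
    and z: "\<forall>(i, l)\<in>arrows Q. i = w \<or> l = w \<longrightarrow> act M (i, l) = 0\<^sub>m (dimv M i) (dimv M l)"
  shows "\<exists>L. is_qmod Q L \<and> direct_sum Q M (thin {w}) L"
proof -
  define d where "d = (dimv M)(w := 0)"
  define L where "L = \<lparr> dimv = d, act = (\<lambda>(i, l). if i = w \<or> l = w then 0\<^sub>m (d i) (d l) else act M (i, l)) \<rparr>"
  have dL: "dimv L v = (if v = w then 0 else dimv M v)" for v by (simp add: L_def d_def)
  have aL: "act L (i, l) = (if i = w \<or> l = w then 0\<^sub>m (d i) (d l) else act M (i, l))" for i l by (simp add: L_def)
  have dM: "dim_row (act M (i, l)) = dimv M i" "dim_col (act M (i, l)) = dimv M l" if "(i, l) \<in> arrows Q" for i l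
    using M that by (auto simp: is_qmod_def)
  have zM: "act M (i, l) = 0\<^sub>m (dimv M i) (dimv M l)" if "(i, l) \<in> arrows Q" "i = w \<or> l = w" for i l
    using z that by auto
  have ne: "i \<noteq> l" if "(i, l) \<in> arrows Q" for i l using arr that by auto
  define a b p q :: "nat \<Rightarrow> 'k mat" where
    "a v = (if v = w then 1\<^sub>m 1 else 0\<^sub>m (dimv M v) 0)" and "b v = (if v = w then 0\<^sub>m 1 0 else 1\<^sub>m (dimv M v))" and
    "p v = (if v = w then 1\<^sub>m 1 else 0\<^sub>m 0 (dimv M v))" and "q v = (if v = w then 0\<^sub>m 0 1 else 1\<^sub>m (dimv M v))" for v
  note defs = a_def b_def p_def q_def
  have L: "is_qmod Q L"
    unfolding is_qmod_def
  proof (intro ballI)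
    fix x assume "x \<in> arrows Q"
    then obtain i l where x: "x = (i, l)" and ar: "(i, l) \<in> arrows Q" by (cases x) auto
    have "act L (i, l) \<in> carrier_mat (dimv L i) (dimv L l)"
      using dM[OF ar] by (intro carrier_matI) (simp_all add: aL dL d_def)
    then show "case x of (i, l) \<Rightarrow> act L (i, l) \<in> carrier_mat (dimv L i) (dimv L l)" by (simp add: x)
  qed
  have homI: "f \<in> qhom Q A B" if "\<And>v. f v \<in> carrier_mat (dimv B v) (dimv A v)"
    "\<And>i l. (i, l) \<in> arrows Q \<Longrightarrow> f i * act A (i, l) = act B (i, l) * f l" for f and A B :: "'k qmod"
    using that unfolding qhom_def by auto
  have "a \<in> qhom Q (thin {w}) M"
  proof (rule homI)
    show "a v \<in> carrier_mat (dimv M v) (dimv (thin {w} :: 'k qmod) v)" for v using w by (simp add: defs dimv_thin)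
    show "a i * act (thin {w}) (i, l) = act M (i, l) * a l" if "(i, l) \<in> arrows Q" for i l
      using w ne[OF that] dM[OF that] zM[OF that] by (intro eq_matI) (auto simp: defs act_thin scalar_prod_def)
  qed
  moreover have "b \<in> qhom Q L M"
  proof (rule homI)
    show "b v \<in> carrier_mat (dimv M v) (dimv L v)" for v using w by (simp add: defs dL)
    show "b i * act L (i, l) = act M (i, l) * b l" if "(i, l) \<in> arrows Q" for i l
      using w ne[OF that] dM[OF that] zM[OF that]
      by (cases "i = w"; cases "l = w") (simp_all add: defs aL d_def one_mult_dim mult_one_dim zero_mult_dim mult_zero_dim)
  qed
  moreover have "p \<in> qhom Q M (thin {w})"
  proof (rule homI)
    show "p v \<in> carrier_mat (dimv (thin {w} :: 'k qmod) v) (dimv M v)" for v using w by (simp add: defs dimv_thin)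
    show "p i * act M (i, l) = act (thin {w}) (i, l) * p l" if "(i, l) \<in> arrows Q" for i l
      using w ne[OF that] dM[OF that] zM[OF that] by (intro eq_matI) (auto simp: defs act_thin scalar_prod_def)
  qed
  moreover have "q \<in> qhom Q M L"
  proof (rule homI)
    show "q v \<in> carrier_mat (dimv L v) (dimv M v)" for v using w by (simp add: defs dL)
    show "q i * act M (i, l) = act L (i, l) * q l" if "(i, l) \<in> arrows Q" for i l
      using w ne[OF that] dM[OF that] zM[OF that]
      by (cases "i = w"; cases "l = w") (simp_all add: defs aL d_def one_mult_dim mult_one_dim zero_mult_dim mult_zero_dim)
  qed
  moreover have "p v * a v = 1\<^sub>m (dimv (thin {w} :: 'k qmod) v)" "q v * b v = 1\<^sub>m (dimv L v)"
    "p v * b v = 0\<^sub>m (dimv (thin {w} :: 'k qmod) v) (dimv L v)" "q v * a v = 0\<^sub>m (dimv L v) (dimv (thin {w} :: 'k qmod) v)"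
    "a v * p v + b v * q v = 1\<^sub>m (dimv M v)" for v
    by (rule eq_matI; cases "v = w"; use w in \<open>simp add: defs dL dimv_thin scalar_prod_def\<close>)+
  ultimately have "direct_sum Q M (thin {w}) L"
    unfolding direct_sum_def by (intro bexI[of _ a] bexI[of _ b] bexI[of _ p] bexI[of _ q] ballI conjI)
  then show ?thesis using L by blast
qed

lemma ball_pairI: "(\<And>i l. (i, l) \<in> A \<Longrightarrow> R i l) \<Longrightarrow> \<forall>(i, l)\<in>A. R i l"
  by auto

text \<open>If nothing acts at w, the simple module there splits off. It is injective, since 0 and 1
  are sinks, and regularity excludes such a summand.\<close>

lemma not_regular_if_zero_end:
  fixes M :: "'k::field qmod"
  assumes n: "n \<ge> 4" and M: "is_qmod (Dtilde n) M" and w: "w \<in> {0, 1}" "dimv M w = 1"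
    and z: "\<forall>(i, l)\<in>arrows (Dtilde n). i = w \<or> l = w \<longrightarrow> act M (i, l) = 0\<^sub>m (dimv M i) (dimv M l)"
  shows "\<not> regular (Dtilde n) M"
proof
  let ?Q = "Dtilde n"
  assume reg: "regular ?Q M"
  have wv: "w \<in> verts ?Q" using w n by (auto simp: verts_Dtilde)
  have arrow: "l < i" "i \<noteq> w" "i \<in> verts ?Q" "l \<in> verts ?Q" if "(i, l) \<in> arrows ?Q" for i l
    using that w(1) n by (auto simp: Dtilde_def)
  have "\<forall>(i, l)\<in>arrows ?Q. i \<noteq> l" using arrow(1) by auto
  from thin_point_summand[OF M wv w(2) this z] obtain L where L: "is_qmod ?Q L" "direct_sum ?Q M (thin {w}) L" by (elim exE conjE)
  have ind: "indecomposable ?Q (thin {w} :: 'k qmod)" by (rule indecomposable_thin_point[OF wv])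
  have no: "\<not> preinjective ?Q (thin {w} :: 'k qmod)" using reg L ind unfolding regular_def by blast
  have "\<forall>(i, l)\<in>arrows ?Q. i \<noteq> w \<and> i \<in> verts ?Q \<and> l \<in> verts ?Q"
  proof (rule ball_pairI)
    fix i l assume "(i, l) \<in> arrows ?Q"
    from arrow(2,3,4)[OF this] show "i \<noteq> w \<and> i \<in> verts ?Q \<and> l \<in> verts ?Q" by simp
  qed
  then have "injective ?Q (thin {w} :: 'k qmod)" by (rule injective_thin_sink[OF wv])
  then show False using no preinjective.intros(1)[OF ind] by blast
qed

text \<open>The vectors x v are the images of the basis vectors under an embedding of the regular
  module thin S. Regular simplicity would make it surjective, whereas a thin module has dimension at
  most 1 at vertex 2 and M has dimension 2 there.\<close>

lemma no_thin_submodule: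
  fixes M :: "'k::field qmod" and x :: "nat \<Rightarrow> nat \<Rightarrow> 'k"
  assumes n: "n \<ge> 4" and M: "regular_simple (Dtilde n) M" and dim2: "dimv M 2 = 2" and S: "S \<in> tube n"
    and nz: "\<forall>v\<in>S. \<exists>r<dimv M v. x v r \<noteq> 0"
    and x: "\<forall>(i, l)\<in>arrows (Dtilde n). l \<in> S \<longrightarrow> (\<forall>r<dimv M i.
      (\<Sum>c<dimv M l. act M (i, l) $$ (r, c) * x l c) = (if i \<in> S then x i r else 0))"
  shows False
proof -
  let ?Q = "Dtilde n" and ?T = "thin S :: 'k qmod"
  have qM: "is_qmod ?Q M" using M by (simp add: regular_simple_def regular_def)
  define f where "f v = mat (dimv M v) (dimv ?T v) (\<lambda>(r, _). x v r)" for v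
  have fd: "f v \<in> carrier_mat (dimv M v) (dimv ?T v)" for v by (simp add: f_def)
  have f: "f \<in> qhom ?Q ?T M"
    unfolding qhom_def
  proof (rule CollectI, intro conjI ballI)
    show "f v \<in> carrier_mat (dimv M v) (dimv ?T v)" for v by (rule fd)
    fix a assume "a \<in> arrows ?Q"
    then obtain i l where a: "a = (i, l)" and ar: "(i, l) \<in> arrows ?Q" by (cases a) auto
    have dM: "dim_row (act M (i, l)) = dimv M i" "dim_col (act M (i, l)) = dimv M l"
      using qM ar by (auto simp: is_qmod_def)
    have x': "(\<Sum>c<dimv M l. act M (i, l) $$ (r, c) * x l c) = (if i \<in> S then x i r else 0)" if "l \<in> S" "r < dimv M i" for r
      using x ar that by auto
    have "f i * act ?T (i, l) = act M (i, l) * f l"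
    proof (rule eq_matI)
      fix r c assume "r < dim_row (act M (i, l) * f l)" "c < dim_col (act M (i, l) * f l)"
      then have rc: "r < dimv M i" "l \<in> S" "c = 0" using dM by (simp_all add: f_def dimv_thin split: if_splits)
      have "(act M (i, l) * f l) $$ (r, c) = (\<Sum>c<dimv M l. act M (i, l) $$ (r, c) * x l c)"
        using rc dM by (simp add: f_def dimv_thin scalar_prod_def atLeast0LessThan)
      also have "\<dots> = (if i \<in> S then x i r else 0)" by (rule x'[OF rc(2,1)])
      also have "\<dots> = (f i * act ?T (i, l)) $$ (r, c)"
        using rc by (simp add: f_def dimv_thin act_thin scalar_prod_def)
      finally show "(f i * act ?T (i, l)) $$ (r, c) = (act M (i, l) * f l) $$ (r, c)" by simp
    qed (use dM in \<open>simp_all add: f_def dimv_thin\<close>)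
    then show "case a of (i, l) \<Rightarrow> f i * act ?T (i, l) = act M (i, l) * f l" by (simp add: a)
  qed
  have val: "(f v *\<^sub>v y) $ r = (if v \<in> S then x v r * y $ 0 else 0)" if "r < dimv M v" "y \<in> carrier_vec (dimv ?T v)" for v r y
    using that by (simp add: f_def dimv_thin scalar_prod_def)
  have "qmono ?Q ?T f"
    unfolding qmono_def
  proof (intro ballI inj_onI)
    fix v y y' assume y: "y \<in> carrier_vec (dimv ?T v)" "y' \<in> carrier_vec (dimv ?T v)" and eq: "f v *\<^sub>v y = f v *\<^sub>v y'"
    show "y = y'"
    proof (cases "v \<in> S")
      case True
      then obtain r where r: "r < dimv M v" "x v r \<noteq> 0" using nz by blast
      have "(f v *\<^sub>v y) $ r = x v r * y $ 0" "(f v *\<^sub>v y') $ r = x v r * y' $ 0"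
        using val[OF r(1) y(1)] val[OF r(1) y(2)] True by simp_all
      then have "x v r * y $ 0 = x v r * y' $ 0" using eq by metis
      then have "y $ 0 = y' $ 0" using r by simp
      then show ?thesis using y True by (intro eq_vecI) (auto simp: dimv_thin)
    next
      case False
      then show ?thesis using y by (intro eq_vecI) (auto simp: dimv_thin)
    qed
  qed
  moreover have "regular ?Q ?T" by (rule regular_thin[OF n S])
  ultimately have alt: "qzero ?Q ?T \<or> qepi ?Q ?T M f" using M f unfolding regular_simple_def by simp
  have "S \<noteq> {}" using S n by (auto simp: tube_def)
  then have nzT: "\<not> qzero ?Q ?T" using tube_subset[OF n S] by (auto simp: qzero_def dimv_thin)
  have "qepi ?Q ?T M f" using alt nzT by blast
  moreover have "2 \<in> verts ?Q" using n by (simp add: verts_Dtilde)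
  ultimately have epi: "(\<lambda>y. f 2 *\<^sub>v y) ` carrier_vec (dimv ?T 2) = carrier_vec (dimv M 2)" unfolding qepi_def by (rule bspec)
  have "\<exists>y\<in>carrier_vec (dimv ?T 2). f 2 *\<^sub>v y = u" if "u \<in> carrier_vec 2" for u
    using that epi dim2 by (metis imageE)
  then obtain y y' where y: "y \<in> carrier_vec (dimv ?T 2)" "f 2 *\<^sub>v y = unit_vec 2 0"
    and y': "y' \<in> carrier_vec (dimv ?T 2)" "f 2 *\<^sub>v y' = unit_vec 2 1" by (metis unit_vec_carrier)
  have "(f 2 *\<^sub>v y) $ 0 = 1" "(f 2 *\<^sub>v y) $ 1 = 0" "(f 2 *\<^sub>v y') $ 0 = 0" "(f 2 *\<^sub>v y') $ 1 = 1"
    unfolding y(2) y'(2) by simp_all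
  then show False using val[OF _ y(1), of 0] val[OF _ y(1), of 1] val[OF _ y'(1), of 0] val[OF _ y'(1), of 1] dim2
    by (auto split: if_splits)
qed

lemma common_kernel:
  fixes f g :: "nat \<Rightarrow> 'k::field"
  assumes "f 0 * g 1 - f 1 * g 0 = 0"
  shows "\<exists>z. nz2 z \<and> f 0 * z 0 + f 1 * z 1 = 0 \<and> g 0 * z 0 + g 1 * z 1 = 0"
proof (cases "nz2 f")
  case True
  then show ?thesis using assms
    by (intro exI[of _ "\<lambda>r. if r = 0 then - f 1 else f 0"]) (auto simp: nz2_def algebra_simps)
next
  case False
  show ?thesis
  proof (cases "nz2 g")
    case True
    then show ?thesis using False by (intro exI[of _ "\<lambda>r. if r = 0 then - g 1 else g 0"]) (auto simp: nz2_def algebra_simps)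
  next
    case ng: False
    then show ?thesis using False by (intro exI[of _ "\<lambda>_. 1"]) (auto simp: nz2_def)
  qed
qed

text \<open>If the module were not generic, one of the thin modules in the exceptional tubes would be a
  proper regular submodule.\<close>

locale simple_rep =
  fixes n :: nat and M :: "'k::field qmod"
  assumes n: "n \<ge> 4" and M: "regular_simple (Dtilde n) M" and dims: "\<forall>v\<in>verts (Dtilde n). dimv M v = delta n v"
begin

definition B :: "nat \<Rightarrow> nat \<Rightarrow> nat \<Rightarrow> 'k" where "B k = (\<lambda>r c. act M (Suc k, k) $$ (r, c))"
definition a :: "nat \<Rightarrow> nat \<Rightarrow> 'k" where "a t = (\<lambda>r. act M (2, t) $$ (r, 0))"
definition p :: "nat \<Rightarrow> nat \<Rightarrow> 'k" where "p b = (\<lambda>c. act M (b, n - 2) $$ (0, c))"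
definition m :: nat where "m = n - 4"
definition F :: "nat \<Rightarrow> (nat \<Rightarrow> 'k) \<Rightarrow> 'k" where "F b z = p b 0 * chain M z m 0 + p b 1 * chain M z m 1"

abbreviation "Q \<equiv> Dtilde n"

lemma regular_M: "regular Q M" and is_qmod_M: "is_qmod Q M"
  using M by (simp_all add: regular_simple_def regular_def)

lemma dimv_eq: "v \<le> n \<Longrightarrow> dimv M v = delta n v"
  using dims by (simp add: verts_Dtilde)

lemma dimv_mid: "2 \<le> v \<Longrightarrow> v \<le> n - 2 \<Longrightarrow> dimv M v = 2"
  using dimv_eq[of v] n by (auto simp: delta_def)

lemma dimv_end: "v \<in> {0, 1, n - 1, n} \<Longrightarrow> dimv M v = 1"
  using dimv_eq[of v] n by (auto simp: delta_def)

lemma dimv_2: "dimv M 2 = 2" and dimv_n2: "dimv M (n - 2) = 2"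
  using dimv_mid n by simp_all

lemma arrows_iff: "(\<forall>(i, l)\<in>arrows Q. R i l) \<longleftrightarrow>
      (\<forall>k. 2 \<le> k \<and> k \<le> n - 3 \<longrightarrow> R (Suc k) k) \<and> (\<forall>t\<in>{0, 1}. R 2 t) \<and> (\<forall>b\<in>{n - 1, n}. R b (n - 2))"
  unfolding Dtilde_def by auto

lemma mid_bounds:
  assumes "2 \<le> k \<and> k \<le> n - 3"
  shows "2 \<le> k" "Suc k \<le> n - 2" "k \<le> n - 2" "2 \<le> Suc k"
  using assms n by linarith+

lemma sum_upto_2: "(\<Sum>c<2. g c) = g 0 + g 1" "(\<Sum>c<1. g c) = g 0" for g :: "nat \<Rightarrow> 'k"
  by (simp_all add: numeral_2_eq_2)

lemma tube_equations:
  assumes 1: "\<forall>k. 2 \<le> k \<and> k \<le> n - 3 \<longrightarrow> k \<in> S \<longrightarrow> (\<forall>r<2. mul2 (B k) (x k) r = (if Suc k \<in> S then x (Suc k) r else 0))"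
    and 2: "\<forall>t\<in>{0, 1}. t \<in> S \<longrightarrow> (\<forall>r<2. a t r * x t 0 = (if 2 \<in> S then x 2 r else 0))"
    and 3: "\<forall>b\<in>{n - 1, n}. n - 2 \<in> S \<longrightarrow> p b 0 * x (n - 2) 0 + p b 1 * x (n - 2) 1 = (if b \<in> S then x b 0 else 0)"
  shows "\<forall>(i, l)\<in>arrows Q. l \<in> S \<longrightarrow> (\<forall>r<dimv M i.
      (\<Sum>c<dimv M l. act M (i, l) $$ (r, c) * x l c) = (if i \<in> S then x i r else 0))"
  unfolding arrows_iff
proof (intro conjI allI impI ballI)
  fix k r assume k: "2 \<le> k \<and> k \<le> n - 3" and kS: "k \<in> S" and r: "r < dimv M (Suc k)"
  have "dimv M (Suc k) = 2" "dimv M k = 2" using dimv_mid mid_bounds[OF k] by simp_all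
  then show "(\<Sum>c<dimv M k. act M (Suc k, k) $$ (r, c) * x k c) = (if Suc k \<in> S then x (Suc k) r else 0)"
    using 1[rule_format, OF k kS, of r] r by (simp only: sum_upto_2 mul2_def B_def)
next
  fix t r :: nat assume t: "t \<in> {0, 1}" and tS: "t \<in> S" and r: "r < dimv M 2"
  have "t \<in> {0, 1, n - 1, n}" using t by blast
  then have "dimv M t = 1" by (rule dimv_end)
  then show "(\<Sum>c<dimv M t. act M (2, t) $$ (r, c) * x t c) = (if 2 \<in> S then x 2 r else 0)"
    using 2[rule_format, OF t tS, of r] r by (simp only: sum_upto_2 a_def dimv_2)
next
  fix b r assume b: "b \<in> {n - 1, n}" and nS: "n - 2 \<in> S" and r: "r < dimv M b"
  have "b \<in> {0, 1, n - 1, n}" using b by blast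
  then have "dimv M b = 1" by (rule dimv_end)
  then have "r = 0" using r by simp
  then show "(\<Sum>c<dimv M (n - 2). act M (b, n - 2) $$ (r, c) * x (n - 2) c) = (if b \<in> S then x b r else 0)"
    using 3[rule_format, OF b nS] by (simp only: sum_upto_2 p_def dimv_n2)
qed

lemma no_tube_submodule:
  assumes "S \<in> tube n" "\<forall>v\<in>S. \<exists>r<dimv M v. x v r \<noteq> 0"
    "\<forall>k. 2 \<le> k \<and> k \<le> n - 3 \<longrightarrow> k \<in> S \<longrightarrow> (\<forall>r<2. mul2 (B k) (x k) r = (if Suc k \<in> S then x (Suc k) r else 0))"
    "\<forall>t\<in>{0, 1}. t \<in> S \<longrightarrow> (\<forall>r<2. a t r * x t 0 = (if 2 \<in> S then x 2 r else 0))"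
    "\<forall>b\<in>{n - 1, n}. n - 2 \<in> S \<longrightarrow> p b 0 * x (n - 2) 0 + p b 1 * x (n - 2) 1 = (if b \<in> S then x b 0 else 0)"
  shows False
  by (rule no_thin_submodule[OF n M dimv_2 assms(1,2) tube_equations[OF assms(3-5)]])

lemma nz2_coord: "nz2 y \<Longrightarrow> \<exists>r<2. y r \<noteq> 0"
  unfolding nz2_def by (metis one_less_numeral_iff semiring_norm(76) zero_less_numeral)

lemma left_le: "t \<in> {0, 1} \<Longrightarrow> t \<le> (1 :: nat)" and right_ge: "b \<in> {n - 1, n} \<Longrightarrow> n - 1 \<le> b"
  by auto

lemma chain_length: "n - 2 - 2 = m"
  by (simp add: m_def)

text \<open>A kernel vector at k would span a copy of the simple module at k, a member of the large
  tube.\<close>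

lemma mid_map_det:
  assumes k: "2 \<le> k" "k \<le> n - 3"
  shows "det2 (B k) \<noteq> 0"
proof
  assume "det2 (B k) = 0"
  then have "B k 0 0 * B k 1 1 - B k 0 1 * B k 1 0 = 0" by (simp add: det2_def)
  from common_kernel[of "B k 0" "B k 1", OF this] obtain z where
    z: "nz2 z" "B k 0 0 * z 0 + B k 0 1 * z 1 = 0" "B k 1 0 * z 0 + B k 1 1 * z 1 = 0" by (elim exE conjE)
  have ne: "Suc k \<noteq> k" "n - 2 \<noteq> k" "k \<noteq> 0" "k \<noteq> 1" using k n by linarith+
  have mk: "2 \<le> k \<and> k \<le> n - 3" using k by simp
  have S: "{k} \<in> tube n" using mid_bounds[OF mk] unfolding tube_def by blast
  have nz: "\<forall>v\<in>{k}. \<exists>r<dimv M v. z r \<noteq> 0" using nz2_coord[OF z(1)] dimv_mid[OF mid_bounds(1,3)[OF mk]] by simp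
  have 1: "\<forall>j. 2 \<le> j \<and> j \<le> n - 3 \<longrightarrow> j \<in> {k} \<longrightarrow> (\<forall>r<2. mul2 (B j) z r = (if Suc j \<in> {k} then z r else 0))"
    using z(2,3) by (auto simp: less_2_cases_iff mul2_def)
  show False by (rule no_tube_submodule[OF S nz 1]) (use ne in auto)
qed

text \<open>A zero map would leave the simple module at t, which belongs to no tube. The
  contradiction is with regularity instead: this simple module would be an injective
  summand.\<close>

lemma left_map_nz:
  assumes t: "t \<in> {0, 1}"
  shows "nz2 (a t)"
proof (rule ccontr)
  assume "\<not> nz2 (a t)"
  then have z: "a t 0 = 0" "a t 1 = 0" by (simp_all add: nz2_def)
  have c: "act M (2, t) \<in> carrier_mat 2 1"
    using is_qmod_M Dtilde_arrowI(2)[OF n t] dimv_end[of t] dimv_2 t unfolding is_qmod_def by fastforce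
  have "act M (2, t) = 0\<^sub>m 2 1"
    by (rule eq_matI) (use c z in \<open>auto simp: a_def less_2_cases_iff\<close>)
  then have "\<forall>(i, l)\<in>arrows Q. i = t \<or> l = t \<longrightarrow> act M (i, l) = 0\<^sub>m (dimv M i) (dimv M l)"
    unfolding arrows_iff using t dimv_end[of t] dimv_2 n by auto
  then show False using not_regular_if_zero_end[OF n is_qmod_M _ dimv_end, of t] t regular_M by blast
qed

lemma chain_nz:
  assumes z: "nz2 z" and i: "i \<le> m"
  shows "nz2 (chain M z i)"
  using i
proof (induction i)
  case (Suc i)
  have "2 \<le> i + 2" "i + 2 \<le> n - 3" using Suc.prems n unfolding m_def by linarith+
  then have "det2 (B (i + 2)) \<noteq> 0" by (rule mid_map_det)
  moreover have "B (i + 2) = (\<lambda>r c. act M (i + 3, i + 2) $$ (r, c))" by (simp add: B_def numeral_eq_Suc)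
  ultimately show ?case using nz2_mul2[of "B (i + 2)" "chain M z i"] Suc by simp
qed (use z in simp)

lemma chain_Suc:
  assumes k: "2 \<le> k" "k \<le> n - 3"
  shows "mul2 (B k) (chain M z (k - 2)) = chain M z (Suc k - 2)"
proof -
  obtain i where i: "k = i + 2" using k le_Suc_ex[of 2 k] by auto
  show ?thesis unfolding i B_def by (simp add: numeral_eq_Suc)
qed

text \<open>Otherwise the image of z in M at n - 2 is killed by both outgoing maps and spans a
  simple submodule there.\<close>

lemma not_both_right_zero:
  assumes z: "nz2 z"
  shows "F (n - 1) z \<noteq> 0 \<or> F n z \<noteq> 0"
proof (rule ccontr)
  assume "\<not> (F (n - 1) z \<noteq> 0 \<or> F n z \<noteq> 0)"
  then have F: "F b z = 0" if "b \<in> {n - 1, n}" for b using that by auto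
  have ne: "n - 2 \<noteq> n" "n - 2 \<noteq> n - 1" "n - 2 \<noteq> 0" "n - 2 \<noteq> 1" "\<not> (n - 2 \<le> n - 3)" using n by linarith+
  have S: "{n - 2} \<in> tube n" using n unfolding tube_def by auto
  have nz: "\<forall>v\<in>{n - 2}. \<exists>r<dimv M v. chain M z m r \<noteq> 0" using nz2_coord[OF chain_nz[OF z order_refl]] dimv_n2 by simp
  have 3: "\<forall>b\<in>{n - 1, n}. n - 2 \<in> {n - 2} \<longrightarrow> p b 0 * chain M z m 0 + p b 1 * chain M z m 1 =
      (if b \<in> {n - 2} then chain M z m 0 else 0)"
  proof (intro ballI impI)
    fix b assume b: "b \<in> {n - 1, n}"
    then have "b \<notin> {n - 2}" using ne by (elim insertE emptyE) simp_all
    then show "p b 0 * chain M z m 0 + p b 1 * chain M z m 1 = (if b \<in> {n - 2} then chain M z m 0 else 0)"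
      using F[OF b] by (simp add: F_def)
  qed
  show False by (rule no_tube_submodule[OF S nz _ _ 3]) (use ne in auto)
qed

text \<open>If the line coming from t is killed on the way to b, it survives at the other vertex b'
  of the fork, and its images span the thin module on the path from t to b'.\<close>

lemma path_nz:
  assumes t: "t \<in> {0, 1}" and b: "b \<in> {n - 1, n}"
  shows "F b (a t) \<noteq> 0"
proof
  assume Fb: "F b (a t) = 0"
  define b' where "b' = (if b = n then n - 1 else n)"
  have b': "b' \<in> {n - 1, n}" "b' \<noteq> b" "{b, b'} = {n - 1, n}" using b n by (auto simp: b'_def)
  have Fb': "F b' (a t) \<noteq> 0" using not_both_right_zero[OF left_map_nz[OF t]] Fb b b' by auto
  let ?S = "insert t (insert b' {2..n - 2})"
  define x where "x v = (if v = t then (\<lambda>_. 1) else if v = b' then (\<lambda>_. F b' (a t)) else chain M (a t) (v - 2))" for v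
  have S: "?S \<in> tube n" using t b' unfolding tube_def by blast
  have ends: "t \<noteq> b'" "\<not> 2 \<le> t" "\<not> b' \<le> n - 2" "\<not> b \<le> n - 2" "b \<noteq> t"
    using left_le[OF t] right_ge[OF b] right_ge[OF b'(1)] n by linarith+
  have xk: "x k = chain M (a t) (k - 2)" if "2 \<le> k" "k \<le> n - 2" for k
    using that ends by (auto simp: x_def)
  have xe: "x t = (\<lambda>_. 1)" "x b' = (\<lambda>_. F b' (a t))" using ends by (auto simp: x_def)
  have nz: "\<forall>v\<in>?S. \<exists>r<dimv M v. x v r \<noteq> 0"
  proof
    fix v assume "v \<in> ?S"
    then consider "v = t" | "v = b'" | "2 \<le> v" "v \<le> n - 2" by auto
    then show "\<exists>r<dimv M v. x v r \<noteq> 0"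
    proof cases
      case 1
      have "dimv M t = 1" using dimv_end t by blast
      then show ?thesis using 1 xe by auto
    next
      case 2
      have "dimv M b' = 1" using dimv_end b' by blast
      then show ?thesis using 2 xe Fb' by auto
    next
      case 3
      then have "v - 2 \<le> m" by (simp add: m_def)
      then show ?thesis using nz2_coord[OF chain_nz[OF left_map_nz[OF t]]] dimv_mid[OF 3] xk[OF 3] by simp
    qed
  qed
  have 1: "\<forall>k. 2 \<le> k \<and> k \<le> n - 3 \<longrightarrow> k \<in> ?S \<longrightarrow> (\<forall>r<2. mul2 (B k) (x k) r = (if Suc k \<in> ?S then x (Suc k) r else 0))"
  proof (intro allI impI)
    fix k r assume k: "2 \<le> k \<and> k \<le> n - 3"
    note k' = mid_bounds[OF k]
    have "Suc k \<in> ?S" using k' by simp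
    then show "mul2 (B k) (x k) r = (if Suc k \<in> ?S then x (Suc k) r else 0)"
      using chain_Suc[of k "a t"] k xk[OF k'(1,3)] xk[OF k'(4,2)] by simp
  qed
  have 2: "\<forall>s\<in>{0, 1}. s \<in> ?S \<longrightarrow> (\<forall>r<2. a s r * x s 0 = (if 2 \<in> ?S then x 2 r else 0))"
  proof (intro ballI impI allI)
    fix s r assume s: "s \<in> {0, 1}" "s \<in> ?S"
    then have "s = t" using b' n by auto
    moreover have "2 \<in> ?S" "x 2 = a t" using n xk[of 2] by auto
    ultimately show "a s r * x s 0 = (if 2 \<in> ?S then x 2 r else 0)" using xe by simp
  qed
  have 3: "\<forall>c\<in>{n - 1, n}. n - 2 \<in> ?S \<longrightarrow> p c 0 * x (n - 2) 0 + p c 1 * x (n - 2) 1 = (if c \<in> ?S then x c 0 else 0)"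
  proof (intro ballI impI)
    fix c assume "c \<in> {n - 1, n}"
    then have c: "c = b \<or> c = b'" using b' by blast
    have "x (n - 2) = chain M (a t) m" using xk[of "n - 2"] n chain_length by simp
    then have "p c 0 * x (n - 2) 0 + p c 1 * x (n - 2) 1 = F c (a t)" by (simp add: F_def)
    also have "\<dots> = (if c \<in> ?S then x c 0 else 0)" using c Fb xe ends b' by auto
    finally show "p c 0 * x (n - 2) 0 + p c 1 * x (n - 2) 1 = (if c \<in> ?S then x c 0 else 0)" .
  qed
  show False by (rule no_tube_submodule[OF S nz 1 2 3])
qed

text \<open>If both left ends had the same image line, the images of this line would span the thin
  module on all vertices; by \<open>path_nz\<close> it is nonzero at both right ends.\<close>

lemma left_lines_not_par:
  shows "\<not> par (a 0) (a 1)"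
proof
  assume "par (a 0) (a 1)"
  then have par: "par (a 1) (a 0)" by (rule par_sym)
  obtain c where c: "a 1 0 = c * a 0 0" "a 1 1 = c * a 0 1" using par_scale[OF par left_map_nz[of 0]] by auto
  have c0: "c \<noteq> 0" using c left_map_nz[of 1] by (auto simp: nz2_def)
  \<comment> \<open>The generator 1 at vertex 0 goes to a 0. Since a 1 = c a 0, the vector at vertex
    1 with the same image is 1 / c.\<close>
  define x where "x v = (if v = 0 then (\<lambda>_. 1) else if v = 1 then (\<lambda>_. inverse c) else
    if v \<in> {n - 1, n} then (\<lambda>_. F v (a 0)) else chain M (a 0) (v - 2))" for v
  have S: "{0..n} \<in> tube n" by (simp add: tube_def)
  have xk: "x k = chain M (a 0) (k - 2)" if "2 \<le> k" "k \<le> n - 2" for k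
    using that n by (auto simp: x_def)
  have xe: "x 0 = (\<lambda>_. 1)" "x 1 = (\<lambda>_. inverse c)" by (simp_all add: x_def)
  have xb: "x b = (\<lambda>_. F b (a 0))" if "b \<in> {n - 1, n}" for b using that n by (auto simp: x_def)
  have nz: "\<forall>v\<in>{0..n}. \<exists>r<dimv M v. x v r \<noteq> 0"
  proof
    fix v assume "v \<in> {0..n}"
    then consider "v = 0" | "v = 1" | "v \<in> {n - 1, n}" | "2 \<le> v" "v \<le> n - 2" by fastforce
    then show "\<exists>r<dimv M v. x v r \<noteq> 0"
    proof cases
      case 1
      then show ?thesis using xe dimv_end[of 0] by auto
    next
      case 2
      then show ?thesis using xe dimv_end[of 1] c0 by auto
    next
      case 3
      then have "dimv M v = 1" "x v = (\<lambda>_. F v (a 0))" "F v (a 0) \<noteq> 0" using dimv_end xb path_nz[of 0 v] by blast+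
      then show ?thesis by simp
    next
      case 4
      then have "v - 2 \<le> m" by (simp add: m_def)
      then show ?thesis using nz2_coord[OF chain_nz[OF left_map_nz[of 0]]] dimv_mid[OF 4] xk[OF 4] by simp
    qed
  qed
  have 1: "\<forall>k. 2 \<le> k \<and> k \<le> n - 3 \<longrightarrow> k \<in> {0..n} \<longrightarrow> (\<forall>r<2. mul2 (B k) (x k) r = (if Suc k \<in> {0..n} then x (Suc k) r else 0))"
  proof (intro allI impI)
    fix k r assume k: "2 \<le> k \<and> k \<le> n - 3"
    note k' = mid_bounds[OF k]
    have "Suc k \<in> {0..n}" using k' by simp
    then show "mul2 (B k) (x k) r = (if Suc k \<in> {0..n} then x (Suc k) r else 0)"
      using chain_Suc[of k "a 0"] k xk[OF k'(1,3)] xk[OF k'(4,2)] by simp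
  qed
  have 2: "\<forall>s\<in>{0, 1}. s \<in> {0..n} \<longrightarrow> (\<forall>r<2. a s r * x s 0 = (if 2 \<in> {0..n} then x 2 r else 0))"
  proof (intro ballI impI allI)
    fix s r :: nat assume s: "s \<in> {0, 1}" and r: "r < 2"
    have x2: "2 \<in> {0..n}" "x 2 = a 0" using n xk[of 2] by auto
    have "a 1 r * inverse c = a 0 r" using r c c0 by (auto simp: less_2_cases_iff)
    then have "a s r * x s 0 = a 0 r" using s xe by auto
    then show "a s r * x s 0 = (if 2 \<in> {0..n} then x 2 r else 0)" using x2 by simp
  qed
  have 3: "\<forall>b\<in>{n - 1, n}. n - 2 \<in> {0..n} \<longrightarrow> p b 0 * x (n - 2) 0 + p b 1 * x (n - 2) 1 = (if b \<in> {0..n} then x b 0 else 0)"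
  proof (intro ballI impI)
    fix b assume b: "b \<in> {n - 1, n}"
    have "x (n - 2) = chain M (a 0) m" using xk[of "n - 2"] n chain_length by simp
    then have "p b 0 * x (n - 2) 0 + p b 1 * x (n - 2) 1 = F b (a 0)" by (simp add: F_def)
    also have "\<dots> = (if b \<in> {0..n} then x b 0 else 0)" using xb[OF b] b by auto
    finally show "p b 0 * x (n - 2) 0 + p b 1 * x (n - 2) 1 = (if b \<in> {0..n} then x b 0 else 0)" .
  qed
  show False by (rule no_tube_submodule[OF S nz 1 2 3])
qed

lemma end_fun_right_iff:
  assumes "b \<in> {n - 1, n}"
  shows "end_fun n M b 0 * z 0 + end_fun n M b 1 * z 1 = F b z"
proof -
  have "b > 1" using assms n by (elim insertE emptyE) linarith+
  then show ?thesis unfolding F_def p_def m_def by (rule end_fun_right)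
qed

lemma end_fun_left_iff:
  assumes "t \<in> {0, 1}"
  shows "end_fun n M t 0 * z 0 + end_fun n M t 1 * z 1 = 0 \<longleftrightarrow> par (a t) z"
proof -
  have "t \<le> 1" using assms by (elim insertE emptyE) linarith+
  then show ?thesis unfolding a_def by (rule end_fun_left)
qed

text \<open>A common kernel vector would lie on two of the marked lines. The three excluded
  coincidences, of two left ends, of a left and a right end, and of two right ends, cover all
  pairs.\<close>

lemma end_fun_independent:
  assumes uv: "u \<in> {0, 1, n - 1, n}" "v \<in> {0, 1, n - 1, n}" "u < v"
  shows "end_fun n M u 0 * end_fun n M v 1 - end_fun n M u 1 * end_fun n M v 0 \<noteq> 0"
proof
  assume "end_fun n M u 0 * end_fun n M v 1 - end_fun n M u 1 * end_fun n M v 0 = 0"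
  from common_kernel[OF this] obtain z where z: "nz2 z" "end_fun n M u 0 * z 0 + end_fun n M u 1 * z 1 = 0"
    "end_fun n M v 0 * z 0 + end_fun n M v 1 * z 1 = 0" by (elim exE conjE)
  consider "u = 0" "v = 1" | "u \<in> {0, 1}" "v \<in> {n - 1, n}" | "u = n - 1" "v = n" using uv n by force
  then show False
  proof cases
    case 1
    then have "par (a 0) z" "par z (a 1)" using z end_fun_left_iff[of 0 z] end_fun_left_iff[of 1 z] by (simp_all add: par_sym)
    then show False using left_lines_not_par par_trans[OF _ _ z(1)] by blast
  next
    case 2
    then have zz: "par (a u) z" "F v z = 0" using z end_fun_left_iff[of u z] end_fun_right_iff[of v z] by simp_all
    obtain c where c: "a u 0 = c * z 0" "a u 1 = c * z 1" using par_scale[OF zz(1) z(1)] by blast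
    have "chain M (a u) m r = c * chain M z m r" if "r \<le> 1" for r
    proof -
      have "chain M (a u) m r = chain M (\<lambda>r. c * z r + 0 * z r) m r" by (rule chain_cong) (use c that in simp_all)
      then show ?thesis unfolding chain_linear by simp
    qed
    then have "F v (a u) = c * F v z" by (simp add: F_def algebra_simps)
    then show False using path_nz[OF 2] zz by simp
  next
    case 3
    then show False using z not_both_right_zero[OF z(1)] end_fun_right_iff[of "n - 1" z] end_fun_right_iff[of n z] by simp
  qed
qed

lemma generic: "generic_module n M"
  unfolding generic_module_def
proof (intro conjI allI impI ballI)
  show "n \<ge> 4" by (rule n)
  show "is_qmod Q M" by (rule is_qmod_M)
  show "dimv M v = delta n v" if "v \<le> n" for v by (rule dimv_eq[OF that])
  show "det2 (\<lambda>r c. act M (k + 1, k) $$ (r, c)) \<noteq> 0" if "2 \<le> k \<and> k \<le> n - 3" for k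
    using mid_map_det[of k] that by (simp add: B_def)
  fix u v assume uv: "u \<in> {0, 1, n - 1, n}" "v \<in> {0, 1, n - 1, n}" "u \<noteq> v"
  show "end_fun n M u 0 * end_fun n M v 1 - end_fun n M u 1 * end_fun n M v 0 \<noteq> 0"
  proof (cases "u < v")
    case True
    then show ?thesis by (rule end_fun_independent[OF uv(1,2)])
  next
    case False
    then have "v < u" using uv by simp
    then show ?thesis using end_fun_independent[OF uv(2,1)] by (simp add: mult.commute)
  qed
qed

end

theorem theorem6p1:
  fixes n i :: nat and j :: int
    and X :: "nat \<Rightarrow> int \<Rightarrow> ratfun"
    and M :: "'k::{alg_closed_field, field_char_0} qmod"
  assumes "n \<ge> 4" and "even n"
    and "i \<in> {0, 1, n - 1, n}"
    and "frieze_sequences (Dtilde n) X"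
    and "regular_simple (Dtilde n) M"
    and "\<forall>v\<in>verts (Dtilde n). dimv M v = delta n v"
    and "j \<ge> int n - 2"
  shows "CC (Dtilde n) M * X i j = X i (j - int n + 2) + X i (j + int n - 2)"
proof -
  interpret simple_rep n M by unfold_locales (rule assms)+
  show ?thesis
    unfolding CC_generic[OF generic] by (rule frieze_recurrence[OF assms(1,2,4,3)])
qed

end
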